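(* Let $n\ge1$, $m\ge2$, $1<r<\infty$, $r'=r/(r-1)$, $0<p_1,\dots,p_m\le\infty$, $0<p<\infty$, and $1/p_1+\dots+1/p_m=1/p$. Let $1\le l\le m$. Suppose that $\vec{s}=(s_1,\dots,s_m)$ satisfies $s_1,\dots,s_m>n/r$ and $$\sum_{k=1}^l\Big(\frac{s_k}{n}-\frac1{p_k}\Big)\le-\frac1{r'}.$$ Then there exists a bounded function $\sigma$ on $(\mathbb{R}^n)^m$ such that $\mathcal{L}_{\vec{s}}^{r,\Psi^{(m)}}[\sigma]<\infty$, but $$\Vert T_\sigma\Vert_{H^{p_1}\times\cdots\times H^{p_m}\to L^p}=\infty.$$
   Context: Fourier transform: $\widehat{f}(\xi)=\int f(x)e^{-2\pi i\langle x,\xi\rangle}dx$, and $F^\vee(\xi)=\widehat F(-\xi)$. For a bounded function $\sigma$ on $(\mathbb{R}^n)^m$ and Schwartz functions $f_j$ on $\mathbb{R}^n$, $$T_\sigma(f_1,\dots,f_m)(x)=\int_{(\mathbb{R}^n)^m}\sigma(\xi_1,\dots,\xi_m)\prod_{j=1}^m\widehat{f_j}(\xi_j)\,e^{2\pi i\langle x,\xi_1+\dots+\xi_m\rangle}\,d\xi_1\cdots d\xi_m.$$ For $s_i\ge0$ and $0<r<\infty$, the product-type Sobolev norm is $$\Vert F\Vert_{L^r_{\vec{s}}((\mathbb{R}^n)^m)}=\Big\Vert\big((1+4\pi^2|\cdot_1|^2)^{s_1/2}\cdots(1+4\pi^2|\cdot_m|^2)^{s_m/2}\widehat F\,\big)^\vee\Big\Vert_{L^r((\mathbb{R}^n)^m)},$$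 where $\cdot_i$ denotes the $i$th $\mathbb{R}^n$-variable. $\Psi^{(m)}$ is a fixed Schwartz function on $(\mathbb{R}^n)^m$ with $\widehat{\Psi^{(m)}}$ supported in $\{1/2\le|\vec\xi|\le2\}$ and $\sum_{j\in\mathbb{Z}}\widehat{\Psi^{(m)}}(\vec\xi/2^j)=1$ for $\vec\xi\ne0$, and $$\mathcal{L}_{\vec{s}}^{r,\Psi^{(m)}}[\sigma]=\sup_{j\in\mathbb{Z}}\big\Vert\sigma(2^j\cdot_1,\dots,2^j\cdot_m)\widehat{\Psi^{(m)}}\big\Vert_{L^r_{\vec{s}}((\mathbb{R}^n)^m)}.$$ For $0<p\le\infty$, $H^p(\mathbb{R}^n)$ is the real Hardy space, $\Vert f\Vert_{H^p}=\Vert\sup_{j\in\mathbb{Z}}|\phi_j*f|\Vert_{L^p}$, where $\phi$ is a fixed Schwartz function with $\widehat\phi(0)=1$ and $\phi_j=2^{jn}\phi(2^j\cdot)$; $H^p=L^p$ for $1<p\le\infty$. $\Vert T_\sigma\Vert_{H^{p_1}\times\cdots\times H^{p_m}\to L^p}=\infty$ means that there is no finite constant $C$ with $\Vert T_\sigma(f_1,\dots,f_m)\Vert_{L^p}\le C\prod_i\Vert f_i\Vert_{H^{p_i}}$ for all Schwartz functions $f_i\in H^{p_i}(\mathbb{R}^n)$. *)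

theory Defs
  imports "HOL-Analysis.Analysis" "HOL-Probability.Essential_Supremum"
begin

section \<open>Schwartz functions and the Fourier transform\<close>

text \<open>Everything below is stated over an arbitrary Euclidean space. It is used both for
  \<^typ>\<open>real ^ 'n\<close>, which plays the role of $R^n$, and for \<^typ>\<open>(real ^ 'n) ^ 'm\<close>,
  which plays the role of $(R^n)^m$; on the latter the library's norm, inner product and
  \<^const>\<open>lborel\<close> are the usual ones of $R^{mn}$.\<close>

primrec iter_deriv :: "'a::euclidean_space list \<Rightarrow> ('a \<Rightarrow> complex) \<Rightarrow> 'a \<Rightarrow> complex" where
  "iter_deriv [] f = f"
| "iter_deriv (v # vs) f = (\<lambda>x. frechet_derivative (iter_deriv vs f) (at x) v)"

text \<open>Requiring every iterated partial derivative to be differentiable everywhere is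
  the same as requiring \<^term>\<open>f\<close> to be infinitely differentiable.\<close>

definition schwartz :: "('a::euclidean_space \<Rightarrow> complex) \<Rightarrow> bool" where
  "schwartz f \<longleftrightarrow> (\<forall>vs. set vs \<subseteq> Basis \<longrightarrow>
     (\<forall>x. iter_deriv vs f differentiable (at x)) \<and>
     (\<forall>N::nat. bounded (range (\<lambda>x. (1 + norm x) ^ N *\<^sub>R iter_deriv vs f x))))"

definition fourier :: "('a::euclidean_space \<Rightarrow> complex) \<Rightarrow> 'a \<Rightarrow> complex" where
  "fourier f \<xi> = (LINT x|lborel. f x * cis (- 2 * pi * (x \<bullet> \<xi>)))"

definition inv_fourier :: "('a::euclidean_space \<Rightarrow> complex) \<Rightarrow> 'a \<Rightarrow> complex" where
  "inv_fourier F \<xi> = fourier F (- \<xi>)"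

section \<open>Lebesgue and Hardy (quasi-)norms\<close>

definition ennreal_powr :: "ennreal \<Rightarrow> real \<Rightarrow> ennreal" where
  "ennreal_powr x a = (if x = \<infinity> then \<infinity> else ennreal (enn2real x powr a))"

text \<open>Exponents satisfy $0 < p \le \infty$. The integrand is nonnegative and may take the
  value infinity, as the maximal function below does a priori.\<close>

definition Lp_norm_nonneg :: "ennreal \<Rightarrow> ('a::euclidean_space \<Rightarrow> ennreal) \<Rightarrow> ennreal" where
  "Lp_norm_nonneg p g =
     (if p = \<infinity> then esssup lborel g
      else ennreal_powr (\<integral>\<^sup>+ x. ennreal_powr (g x) (enn2real p) \<partial>lborel) (1 / enn2real p))"

definition Lp_norm :: "ennreal \<Rightarrow> ('a::euclidean_space \<Rightarrow> complex) \<Rightarrow> ennreal" where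
  "Lp_norm p f = Lp_norm_nonneg p (\<lambda>x. ennreal (norm (f x)))"

definition dyadic_dilate :: "(real ^ 'n \<Rightarrow> complex) \<Rightarrow> int \<Rightarrow> real ^ 'n \<Rightarrow> complex" where
  "dyadic_dilate \<phi> j x = of_real (2 powi (j * int CARD('n))) * \<phi> (2 powi j *\<^sub>R x)"

definition convolve :: "('a::euclidean_space \<Rightarrow> complex) \<Rightarrow> ('a \<Rightarrow> complex) \<Rightarrow> 'a \<Rightarrow> complex" where
  "convolve g f x = (LINT y|lborel. g (x - y) * f y)"

definition Hp_norm ::
  "(real ^ 'n \<Rightarrow> complex) \<Rightarrow> ennreal \<Rightarrow> (real ^ 'n \<Rightarrow> complex) \<Rightarrow> ennreal" where
  "Hp_norm \<phi> p f =
     Lp_norm_nonneg p (\<lambda>x. SUP j::int. ennreal (norm (convolve (dyadic_dilate \<phi> j) f x)))"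

section \<open>Product-type Sobolev norms\<close>

definition sobolev_weight :: "('m::finite \<Rightarrow> real) \<Rightarrow> (real ^ 'n) ^ 'm \<Rightarrow> real" where
  "sobolev_weight s \<xi> = (\<Prod>i\<in>UNIV. (1 + 4 * pi\<^sup>2 * (norm (\<xi> $ i))\<^sup>2) powr (s i / 2))"

text \<open>For integrable \<^term>\<open>F\<close>, the product of the weight with the Fourier transform of
  \<^term>\<open>F\<close> is a function of at most polynomial growth, in general not integrable, so its
  inverse Fourier transform is a tempered distribution. The following predicate says that this
  distribution is the function \<^term>\<open>G\<close>; the inverse Fourier transform is moved to the test
  function as usual.\<close>

definition sobolev_potential ::
  "('m::finite \<Rightarrow> real) \<Rightarrow> ((real ^ 'n) ^ 'm \<Rightarrow> complex) \<Rightarrow> ((real ^ 'n) ^ 'm \<Rightarrow> complex) \<Rightarrow> bool" where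
  "sobolev_potential s F G \<longleftrightarrow> G \<in> borel_measurable borel \<and>
     (\<forall>\<theta>. schwartz \<theta> \<longrightarrow> integrable lborel (\<lambda>x. G x * \<theta> x) \<and>
        (LINT x|lborel. G x * \<theta> x) =
        (LINT \<xi>|lborel. of_real (sobolev_weight s \<xi>) * fourier F \<xi> * inv_fourier \<theta> \<xi>))"

text \<open>Such a \<^term>\<open>G\<close> is unique up to null sets, so the infimum is the $L^r$ norm of
  \<^term>\<open>G\<close> if \<^term>\<open>G\<close> exists, and infinity if the distribution is not a function.\<close>

definition sobolev_norm ::
  "real \<Rightarrow> ('m::finite \<Rightarrow> real) \<Rightarrow> ((real ^ 'n) ^ 'm \<Rightarrow> complex) \<Rightarrow> ennreal" where
  "sobolev_norm r s F = (INF G\<in>{G. sobolev_potential s F G}. Lp_norm (ennreal r) G)"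

definition littlewood_paley :: "('a::euclidean_space \<Rightarrow> complex) \<Rightarrow> bool" where
  "littlewood_paley \<Psi> \<longleftrightarrow> schwartz \<Psi> \<and>
     (\<forall>\<xi>. fourier \<Psi> \<xi> \<noteq> 0 \<longrightarrow> 1 / 2 \<le> norm \<xi> \<and> norm \<xi> \<le> 2) \<and>
     (\<forall>\<xi>. \<xi> \<noteq> 0 \<longrightarrow> ((\<lambda>j::int. fourier \<Psi> (\<xi> /\<^sub>R 2 powi j)) has_sum 1) UNIV)"

definition hormander_norm ::
  "real \<Rightarrow> ('m::finite \<Rightarrow> real) \<Rightarrow> ((real ^ 'n) ^ 'm \<Rightarrow> complex) \<Rightarrow>
   ((real ^ 'n) ^ 'm \<Rightarrow> complex) \<Rightarrow> ennreal" where
  "hormander_norm r s \<Psi> \<sigma> =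
     (SUP j::int. sobolev_norm r s (\<lambda>\<xi>. \<sigma> (2 powi j *\<^sub>R \<xi>) * fourier \<Psi> \<xi>))"

section \<open>Multilinear multipliers\<close>

definition multiplier_op ::
  "((real ^ 'n) ^ 'm::finite \<Rightarrow> complex) \<Rightarrow> ('m \<Rightarrow> real ^ 'n \<Rightarrow> complex) \<Rightarrow> real ^ 'n \<Rightarrow> complex" where
  "multiplier_op \<sigma> f x =
     (LINT \<xi>|lborel. \<sigma> \<xi> * (\<Prod>j\<in>UNIV. fourier (f j) (\<xi> $ j)) *
        cis (2 * pi * (x \<bullet> (\<Sum>j\<in>UNIV. \<xi> $ j))))"

definition multiplier_bounded ::
  "(real ^ 'n \<Rightarrow> complex) \<Rightarrow> ('m::finite \<Rightarrow> ennreal) \<Rightarrow> ennreal \<Rightarrow>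
   ((real ^ 'n) ^ 'm \<Rightarrow> complex) \<Rightarrow> bool" where
  "multiplier_bounded \<phi> p q \<sigma> \<longleftrightarrow>
     (\<exists>C::real. \<forall>f. (\<forall>i. schwartz (f i) \<and> Hp_norm \<phi> (p i) (f i) < \<infinity>) \<longrightarrow>
        Lp_norm q (multiplier_op \<sigma> f) \<le> ennreal C * (\<Prod>i\<in>UNIV. Hp_norm \<phi> (p i) (f i)))"

end

theory Submission
  imports Defs "HOL-Probability.Probability"
begin

text \<open>Let $J$ be the set of the first $l$ indices, $E = \sum_{j \in J} s_j$ and
  $\beta = \sum_{j \in J} 1/p_j$; the hypotheses give $n/r - E - n \ge -n\beta$ and $\beta > 1$.
  Let $\psi \ge 0$ be a Schwartz function with spectrum close to the origin and let $e$ be a point such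
  that $(e,\dots,e)$ has norm $1$. The multiplier is a smooth cut-off to an annulus times
  \[ \sum_k c_k\, 2^{k(n/r - E)}\, \widehat\psi\bigl(2^k(\textstyle\sum_{j \in J} \xi_j - l e)\bigr),
     \qquad c_k = (k+1)^{-1-\delta},\quad \delta = (\beta - 1)/2. \]
  The $k$-th term lives in a slab of codimension $n$ and width $2^{-k}$, so its $L^r$ norm is of order
  $2^{-kn/r}$, and the derivatives of orders $s_j$ with $j \in J$ cost $2^{kE}$; hence its Sobolev norm is $O(c_k)$.

  It is tested on $f_j = e^{2\pi i\langle x, e\rangle}\psi$ for $j \in J$ and, for $j \notin J$, on sums of
  integer translates of this function over the dyadic shells $2^k$ with $k < N$, with weights $2^{-kn/p_j}$. Then the
  product of the Hardy norms is $O(N^{1/p - \beta})$. All terms of the multiplier contribute with the same phase,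
  and on the $k$-th shell the $k$-th one alone is at least a constant times
  $c_k\, 2^{k(n/r - E - n)} \prod_{j \notin J} 2^{-kn/p_j} \ge N^{-1-\delta}\, 2^{-kn/p}$, so the $L^p$ norm
  of the output is at least a constant times $N^{1/p - 1 - \delta}$. The quotient grows like $N^\delta$.\<close>

section \<open>Lebesgue integrals on Euclidean spaces\<close>

text \<open>The hypothesis allows equality, and then a single scale gives no growth: the powers of
  2^k in input and output cancel exactly. Growth must come from the number N of scales, which enters
  the output with exponent 1/p - 1 - \<delta> but the inputs with 1/p - \<beta>. Here \<beta> > 1
  because E > n/r. The modulation by e places the spectra where the cut-off is 1 and away from the
  origin, which replaces the moment conditions of Hardy spaces with small exponent. Positivity of
  \<psi> excludes cancellation between blocks. The orders s_j may be fractional and r may be close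
  to 1. The weights are therefore controlled by averages of modulations, which are contractions for
  every r \<ge> 1: first Gaussians, then negative powers, then a fractional weight divided by an
  integer power of its rescaled version. What remains is a polynomial weight, for which the product
  rule suffices. All bumps come from \<Psi>: \<psi> is the squared modulus of a rescaled
  n-dimensional slice of it, and the cut-off is a finite sum of dilates of its transform.\<close>

lemma nn_integral_lborel_affine:
  fixes f :: "'a::euclidean_space \<Rightarrow> ennreal"
  assumes f[measurable]: "f \<in> borel_measurable borel" and c: "c \<noteq> 0"
  shows "(\<integral>\<^sup>+x. f x \<partial>lborel) = ennreal (\<bar>c\<bar> ^ DIM('a)) * (\<integral>\<^sup>+x. f (t + c *\<^sub>R x) \<partial>lborel)"
  apply (subst lborel_affine[OF c, of t])
  apply (subst nn_integral_density, simp, simp)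
  apply (subst nn_integral_distr, simp, simp)
  apply (subst nn_integral_cmult[symmetric]; simp)
  done

lemma nn_integral_lborel_translate:
  fixes f :: "'a::euclidean_space \<Rightarrow> ennreal"
  assumes f[measurable]: "f \<in> borel_measurable borel"
  shows "(\<integral>\<^sup>+x. f (t + x) \<partial>lborel) = (\<integral>\<^sup>+x. f x \<partial>lborel)"
  using nn_integral_lborel_affine[OF f, of 1 t] by simp

lemma nn_integral_lborel_reflect:
  fixes f :: "'a::euclidean_space \<Rightarrow> ennreal"
  assumes f[measurable]: "f \<in> borel_measurable borel"
  shows "(\<integral>\<^sup>+x. f (t - x) \<partial>lborel) = (\<integral>\<^sup>+x. f x \<partial>lborel)"
  using nn_integral_lborel_affine[OF f, of "-1" t] by simp

lemma integrable_lborel_affine: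
  fixes f :: "'a::euclidean_space \<Rightarrow> 'b::{banach, second_countable_topology}"
  assumes f: "integrable lborel f" and c: "c \<noteq> 0"
  shows "integrable lborel (\<lambda>x. f (t + c *\<^sub>R x))"
proof -
  have [measurable]: "f \<in> borel_measurable borel" using f by auto
  have "(\<integral>\<^sup>+x. ennreal (norm (f (t + c *\<^sub>R x))) \<partial>lborel) < \<infinity>"
  proof -
    have "ennreal (\<bar>c\<bar> ^ DIM('a)) * (\<integral>\<^sup>+x. ennreal (norm (f (t + c *\<^sub>R x))) \<partial>lborel) < \<infinity>"
      using f nn_integral_lborel_affine[OF _ c, of "\<lambda>x. ennreal (norm (f x))" t]
      by (simp add: integrable_iff_bounded)
    then show ?thesis using c by (auto simp: ennreal_mult_less_top)
  qed
  then show ?thesis by (simp add: integrable_iff_bounded)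
qed

lemma integral_lborel_affine:
  fixes f :: "'a::euclidean_space \<Rightarrow> 'b::{banach, second_countable_topology}"
  assumes c: "c \<noteq> 0" and f[measurable]: "f \<in> borel_measurable borel"
  shows "(LINT x|lborel. f x) = (\<bar>c\<bar> ^ DIM('a)) *\<^sub>R (LINT x|lborel. f (t + c *\<^sub>R x))"
  apply (subst lborel_affine[OF c, of t])
  apply (subst integral_density, simp, simp, simp)
  apply (subst integral_distr, simp, simp)
  apply simp
  done

lemma integral_lborel_translate:
  fixes f :: "'a::euclidean_space \<Rightarrow> 'b::{banach, second_countable_topology}"
  assumes f[measurable]: "f \<in> borel_measurable borel"
  shows "(LINT x|lborel. f (t + x)) = (LINT x|lborel. f x)"
  using integral_lborel_affine[of 1 f t] by simp

lemma integral_lborel_reflect: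
  fixes f :: "'a::euclidean_space \<Rightarrow> 'b::{banach, second_countable_topology}"
  assumes f[measurable]: "f \<in> borel_measurable borel"
  shows "(LINT x|lborel. f (t - x)) = (LINT x|lborel. f x)"
  using integral_lborel_affine[of "-1" f t] by simp

lemma lborel_integral_Basis_prod:
  fixes f :: "'a::euclidean_space \<Rightarrow> real \<Rightarrow> 'c::{real_normed_field,banach,second_countable_topology}"
  assumes f: "\<And>b. b \<in> Basis \<Longrightarrow> integrable lborel (f b)"
  shows "integrable lborel (\<lambda>x::'a. \<Prod>b\<in>Basis. f b (x \<bullet> b))"
    and "(LINT x|lborel. (\<Prod>b\<in>Basis. f b (x \<bullet> b))) = (\<Prod>b\<in>Basis. LINT t|lborel. f b t)"
proof -
  interpret product_sigma_finite "\<lambda>_::'a. lborel :: real measure" ..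
  have [measurable]: "f b \<in> borel_measurable borel" if "b \<in> Basis" for b using f[OF that] by auto
  have eq: "(\<Sum>b\<in>Basis. x b *\<^sub>R b) \<bullet> b = x b" if "b \<in> Basis" for x and b :: 'a
    using that by (simp add: inner_sum_left inner_Basis if_distrib cong: if_cong)
  have pe: "(\<Prod>b\<in>Basis. f b ((\<Sum>b\<in>Basis. x b *\<^sub>R b) \<bullet> b)) = (\<Prod>b\<in>Basis. f b (x b))" for x
    by (intro prod.cong refl) (simp add: eq)
  have m: "(\<lambda>x::'a. \<Prod>b\<in>Basis. f b (x \<bullet> b)) \<in> borel_measurable borel" by measurable
  have mm: "(\<lambda>f. \<Sum>b\<in>Basis. f b *\<^sub>R b) \<in> measurable (\<Pi>\<^sub>M b\<in>Basis. lborel) (borel :: 'a measure)" by measurable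
  show "integrable lborel (\<lambda>x::'a. \<Prod>b\<in>Basis. f b (x \<bullet> b))"
    apply (subst lborel_eq) apply (subst integrable_distr_eq[OF mm m]) unfolding pe
    by (rule product_integrable_prod) (use f in auto)
  show "(LINT x|lborel. (\<Prod>b\<in>Basis. f b (x \<bullet> b))) = (\<Prod>b\<in>Basis. LINT t|lborel. f b t)"
    apply (subst lborel_eq) apply (subst integral_distr[OF mm m]) unfolding pe
    by (rule product_integral_prod) (use f in auto)
qed

text \<open>A measure that gives every box its volume is Lebesgue measure
  (\<open>lborel_eqI\<close>). The basis of the vector type consists of the vectors
  \<open>axis i b\<close>, so the volume of a box is the double product over i and b that
  \<open>emeasure_PiM\<close> yields.\<close>

lemma lborel_vec_eq:
  "(lborel :: ('b::euclidean_space ^ 'm) measure) = distr (Pi\<^sub>M UNIV (\<lambda>_. lborel)) borel (\<lambda>x. \<chi> i. x i)"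
proof (rule lborel_eqI)
  interpret P: product_sigma_finite "\<lambda>_::'m. lborel :: 'b measure" ..
  have m[measurable]: "(\<lambda>x. \<chi> i. x i) \<in> measurable (Pi\<^sub>M UNIV (\<lambda>_. lborel)) (borel :: ('b ^ 'm) measure)"
    by (subst borel_measurable_euclidean_space) (auto simp: Basis_vec_def inner_axis)
  fix l u :: "'b^'m" assume le: "\<And>b. b \<in> Basis \<Longrightarrow> l \<bullet> b \<le> u \<bullet> b"
  have le': "l $ i \<bullet> b \<le> u $ i \<bullet> b" if "b \<in> Basis" for i b
    using le[of "axis i b"] that by (simp add: inner_axis)
  have box: "(\<lambda>x. \<chi> i. x i) -` box l u \<inter> space (Pi\<^sub>M UNIV (\<lambda>_. lborel)) = (\<Pi>\<^sub>E i\<in>UNIV. box (l $ i) (u $ i))"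
    by (auto simp: space_PiM box_def Basis_vec_def inner_axis PiE_def extensional_def)
  have "emeasure (distr (Pi\<^sub>M UNIV (\<lambda>_. lborel)) borel (\<lambda>x. \<chi> i. x i)) (box l u) =
     emeasure (Pi\<^sub>M UNIV (\<lambda>_::'m. lborel)) (\<Pi>\<^sub>E i\<in>UNIV. box (l $ i) (u $ i))"
    by (subst emeasure_distr) (auto simp: box)
  also have "\<dots> = (\<Prod>i\<in>UNIV. emeasure lborel (box (l $ i) (u $ i)))"
    by (rule P.emeasure_PiM) auto
  also have "\<dots> = (\<Prod>i\<in>UNIV. ennreal (\<Prod>b\<in>Basis. (u $ i - l $ i) \<bullet> b))"
    using le' by (intro prod.cong refl) (simp add: emeasure_lborel_box)
  also have "\<dots> = ennreal (\<Prod>i\<in>UNIV. \<Prod>b\<in>Basis. (u $ i - l $ i) \<bullet> b)"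
    using le' by (intro prod_ennreal prod_nonneg) (auto simp: inner_diff_left)
  also have "(\<Prod>i\<in>UNIV. \<Prod>b\<in>Basis. (u $ i - l $ i) \<bullet> b) = (\<Prod>b\<in>Basis. (u - l) \<bullet> b)"
  proof -
    have B: "(Basis :: ('b^'m) set) = (\<lambda>(i,b). axis i b) ` (UNIV \<times> Basis)"
      by (auto simp: Basis_vec_def)
    have inj: "inj_on (\<lambda>(i,b). axis i b :: 'b^'m) (UNIV \<times> Basis)"
      by (auto simp: inj_on_def axis_eq_axis)
    show ?thesis unfolding B
      by (subst prod.reindex[OF inj]) (simp add: prod.cartesian_product inner_axis case_prod_beta)
  qed
  finally show "emeasure (distr (Pi\<^sub>M UNIV (\<lambda>_. lborel)) borel (\<lambda>x. \<chi> i. x i)) (box l u) = (\<Prod>b\<in>Basis. (u - l) \<bullet> b)" .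
qed simp

text \<open>Needed for the tensor product of the m Fourier transforms in
  \<open>multiplier_op\<close>: once a block is expanded, its integral over (R^n)^m splits into m
  integrals over R^n.\<close>

lemma lborel_integral_vec_prod:
  fixes f :: "'m::finite \<Rightarrow> 'b::euclidean_space \<Rightarrow> 'c::{real_normed_field,banach,second_countable_topology}"
  assumes f: "\<And>i. integrable lborel (f i)"
  shows "integrable lborel (\<lambda>x::'b^'m. \<Prod>i\<in>UNIV. f i (x $ i))"
    and "(LINT x|lborel. (\<Prod>i\<in>UNIV. f i ((x::'b^'m) $ i))) = (\<Prod>i\<in>UNIV. LINT t|lborel. f i t)"
proof -
  interpret product_sigma_finite "\<lambda>_::'m. lborel :: 'b measure" ..
  have [measurable]: "f b \<in> borel_measurable borel" for b using f by auto
  have m[measurable]: "(\<lambda>x::'b^'m. x $ i) \<in> borel_measurable borel" for i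
    by (intro borel_measurable_continuous_onI continuous_intros)
  have m: "(\<lambda>x::'b^'m. \<Prod>i\<in>UNIV. f i (x $ i)) \<in> borel_measurable borel" by measurable
  have mm: "(\<lambda>x. \<chi> i. x i) \<in> measurable (Pi\<^sub>M UNIV (\<lambda>_. lborel)) (borel :: ('b ^ 'm) measure)"
    by (subst borel_measurable_euclidean_space) (auto simp: Basis_vec_def inner_axis)
  show "integrable lborel (\<lambda>x::'b^'m. \<Prod>i\<in>UNIV. f i (x $ i))"
    apply (subst lborel_vec_eq) apply (subst integrable_distr_eq[OF mm m]) apply simp
    by (rule product_integrable_prod) (use f in auto)
  show "(LINT x|lborel. (\<Prod>i\<in>UNIV. f i ((x::'b^'m) $ i))) = (\<Prod>i\<in>UNIV. LINT t|lborel. f i t)"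
    apply (subst lborel_vec_eq) apply (subst integral_distr[OF mm m]) apply simp
    by (rule product_integral_prod) (use f in auto)
qed

lemma integrable_cis_mult:
  fixes f :: "'a \<Rightarrow> complex"
  assumes "integrable M f" "g \<in> borel_measurable M"
  shows "integrable M (\<lambda>x. f x * cis (g x))"
proof (rule Bochner_Integration.integrable_bound[OF assms(1)])
  have [measurable]: "f \<in> borel_measurable M" "g \<in> borel_measurable M" using assms by auto
  have "cis \<in> borel_measurable borel" by (intro borel_measurable_continuous_onI continuous_intros)
  note [measurable] = measurable_compose[OF _ this]
  show "(\<lambda>x. f x * cis (g x)) \<in> borel_measurable M" by measurable
qed (simp add: norm_mult)

section \<open>Gaussian integrals with a character\<close>

lemma gaussian_integral_real:
  fixes t \<xi> :: real assumes t: "t > 0"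
  shows "integrable lborel (\<lambda>x::real. complex_of_real (exp (- t * x\<^sup>2)) * cis (x * \<xi>))"
   and "(LINT x|lborel. complex_of_real (exp (- t * x\<^sup>2)) * cis (x * \<xi>)) = of_real (sqrt (pi / t) * exp (- \<xi>\<^sup>2 / (4 * t)))"
proof -
  \<comment> \<open>At this scale the standard normal density at x / c is a constant times exp (-t
    x^2), so the integral is the characteristic function of the normal law at c \<xi>.\<close>
  define c where "c = 1 / sqrt (2 * t)"
  have c: "c \<noteq> 0" "c > 0" "c\<^sup>2 = 1 / (2*t)" using t by (auto simp: c_def power_divide)
  have d: "std_normal_density (x / c) = exp (- t * x\<^sup>2) / sqrt (2*pi)" for x
  proof -
    have "(x / c)\<^sup>2 / 2 = t * x\<^sup>2" using t by (simp add: c_def power_divide power_mult_distrib)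
    then show ?thesis by (simp add: std_normal_density_def)
  qed
  have mc: "cis \<in> borel_measurable borel" by (intro borel_measurable_continuous_onI continuous_intros)
  have int0: "integrable lborel (\<lambda>x. complex_of_real (std_normal_density x) * cis (x * (c*\<xi>)))"
    by (rule integrable_cis_mult) (auto intro!: integrable_of_real)
  have i: "integrable lborel (\<lambda>x. complex_of_real (std_normal_density (0 + (1/c) * x)) * cis ((0 + (1/c)*x) * (c*\<xi>)))"
    by (rule lborel_integrable_real_affine[OF int0]) (use c in auto)
  then have i': "integrable lborel (\<lambda>x. complex_of_real (exp (- t * x\<^sup>2)) / sqrt (2*pi) * cis (x * \<xi>))"
    using c by (simp add: d mult.commute)
  have "integrable lborel (\<lambda>x. sqrt (2*pi) * (complex_of_real (exp (- t * x\<^sup>2)) / sqrt (2*pi) * cis (x * \<xi>)))"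
    by (intro integrable_mult_right i')
  then show "integrable lborel (\<lambda>x::real. complex_of_real (exp (- t * x\<^sup>2)) * cis (x * \<xi>))" by (simp add: field_simps)
  have "char std_normal_distribution (c * \<xi>) = (LINT x|lborel. complex_of_real (std_normal_density x) * cis (x * (c*\<xi>)))"
    unfolding char_def using mc
    by (subst integral_density) (auto simp: scaleR_conv_of_real mult_ac cis_conv_exp)
  also have "\<dots> = (1/c) *\<^sub>R (LINT x|lborel. complex_of_real (std_normal_density (0 + (1/c) * x)) * cis ((0 + (1/c)*x) * (c*\<xi>)))"
    using lborel_integral_real_affine[of "1/c" "\<lambda>x. complex_of_real (std_normal_density x) * cis (x * (c*\<xi>))" 0] c by simp
  also have "\<dots> = (1/c) *\<^sub>R (LINT x|lborel. (complex_of_real (exp (- t * x\<^sup>2)) * cis (x * \<xi>)) / sqrt (2*pi))"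
    using c by (intro arg_cong2[where f=scaleR] refl Bochner_Integration.integral_cong) (simp_all add: d mult.commute)
  also have "\<dots> = (1/c) *\<^sub>R ((LINT x|lborel. complex_of_real (exp (- t * x\<^sup>2)) * cis (x * \<xi>)) / sqrt (2*pi))"
    by simp
  finally have "(LINT x|lborel. complex_of_real (exp (- t * x\<^sup>2)) * cis (x * \<xi>)) = of_real (c * sqrt (2*pi)) * char std_normal_distribution (c * \<xi>)"
    using c by (simp add: scaleR_conv_of_real field_simps)
  also have "\<dots> = of_real (sqrt (pi / t) * exp (- \<xi>\<^sup>2 / (4 * t)))"
  proof -
    have "c * sqrt (2*pi) = sqrt (pi/t)" using t by (simp add: c_def real_sqrt_mult real_sqrt_divide)
    then show ?thesis using c(3) by (simp add: char_std_normal_distribution power_mult_distrib)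
  qed
  finally show "(LINT x|lborel. complex_of_real (exp (- t * x\<^sup>2)) * cis (x * \<xi>)) = of_real (sqrt (pi / t) * exp (- \<xi>\<^sup>2 / (4 * t)))" .
qed

lemma norm_sq_Basis: "(norm (x::'a::euclidean_space))\<^sup>2 = (\<Sum>b\<in>Basis. (x \<bullet> b)\<^sup>2)"
  unfolding power2_norm_eq_inner by (subst euclidean_inner) (simp add: power2_eq_square)

lemma cis_sum: "finite A \<Longrightarrow> cis (\<Sum>a\<in>A. f a) = (\<Prod>a\<in>A. cis (f a))"
  by (induction A rule: finite_induct) (auto simp: cis_mult[symmetric])

lemma gaussian_integral:
  fixes \<xi> :: "'a::euclidean_space" assumes t: "t > 0"
  shows "integrable lborel (\<lambda>x::'a. complex_of_real (exp (- t * (norm x)\<^sup>2)) * cis (x \<bullet> \<xi>))"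
   and "(LINT x|lborel. complex_of_real (exp (- t * (norm x)\<^sup>2)) * cis (x \<bullet> \<xi>)) =
      of_real (sqrt (pi / t) ^ DIM('a) * exp (- (norm \<xi>)\<^sup>2 / (4 * t)))"
proof -
  have eq: "complex_of_real (exp (- t * (norm x)\<^sup>2)) * cis (x \<bullet> \<xi>) =
    (\<Prod>b\<in>Basis. complex_of_real (exp (- t * (x \<bullet> b)\<^sup>2)) * cis ((x \<bullet> b) * (\<xi> \<bullet> b)))" for x :: 'a
    by (simp add: norm_sq_Basis euclidean_inner[of x \<xi>] cis_sum sum_distrib_left exp_sum prod.distrib flip: sum_negf)
  show "integrable lborel (\<lambda>x::'a. complex_of_real (exp (- t * (norm x)\<^sup>2)) * cis (x \<bullet> \<xi>))"
    unfolding eq using gaussian_integral_real(1)[OF t]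
    by (rule lborel_integral_Basis_prod(1))
  have "(LINT x|lborel. complex_of_real (exp (- t * (norm x)\<^sup>2)) * cis (x \<bullet> \<xi>)) =
     (\<Prod>b\<in>Basis. complex_of_real (sqrt (pi / t) * exp (- (\<xi> \<bullet> b)\<^sup>2 / (4 * t))))"
    unfolding eq gaussian_integral_real(2)[OF t, symmetric] using gaussian_integral_real(1)[OF t]
    by (rule lborel_integral_Basis_prod(2))
  also have "\<dots> = of_real (sqrt (pi / t) ^ DIM('a) * exp (- (norm \<xi>)\<^sup>2 / (4 * t)))"
    by (simp add: norm_sq_Basis prod.distrib exp_sum sum_divide_distrib flip: sum_negf)
  finally show "(LINT x|lborel. complex_of_real (exp (- t * (norm x)\<^sup>2)) * cis (x \<bullet> \<xi>)) =
      of_real (sqrt (pi / t) ^ DIM('a) * exp (- (norm \<xi>)\<^sup>2 / (4 * t)))" .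
qed

section \<open>The Fourier transform\<close>

lemma borel_measurable_cis[measurable]: "cis \<in> borel_measurable borel"
  by (intro borel_measurable_continuous_onI continuous_intros)

text \<open>Comparison with a product of one-dimensional functions 1 / (1 + t^2). Each coordinate
  costs one factor (1 + |x|)^2, which explains the exponent 2 DIM.\<close>

lemma integrable_decay: "integrable lborel (\<lambda>x::'a::euclidean_space. 1 / (1 + norm x) ^ (2 * DIM('a)))"
proof (rule Bochner_Integration.integrable_bound)
  have "integrable lborel (\<lambda>t::real. inverse (1 + t\<^sup>2))"
    using integrable_inverse_1_plus_square by (simp add: set_integrable_def einterval_def)
  then show "integrable lborel (\<lambda>x::'a. \<Prod>b\<in>Basis. inverse (1 + (x \<bullet> b)\<^sup>2))"
    by (intro lborel_integral_Basis_prod)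
  show "AE x in lborel. norm (1 / (1 + norm x) ^ (2 * DIM('a))) \<le> norm (\<Prod>b\<in>Basis. inverse (1 + ((x::'a) \<bullet> b)\<^sup>2))"
  proof (intro AE_I2)
    fix x :: 'a
    have "(\<Prod>b\<in>Basis. 1 + (x \<bullet> b)\<^sup>2) \<le> (\<Prod>b\<in>(Basis::'a set). (1 + norm x)\<^sup>2)"
    proof (intro prod_mono conjI)
      fix b :: 'a assume "b \<in> Basis"
      then have "(x \<bullet> b)\<^sup>2 \<le> (norm x)\<^sup>2" by (metis Basis_le_norm abs_le_square_iff abs_norm_cancel)
      moreover have "(1 + norm x)\<^sup>2 = 1 + 2 * norm x + (norm x)\<^sup>2" by (simp add: power2_sum)
      ultimately show "1 + (x \<bullet> b)\<^sup>2 \<le> (1 + norm x)\<^sup>2" using norm_ge_zero[of x] by linarith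
    qed (simp add: add_nonneg_nonneg)
    then have *: "(\<Prod>b\<in>Basis. 1 + (x \<bullet> b)\<^sup>2) \<le> (1 + norm x) ^ (2 * DIM('a))" by (simp add: power_mult)
    have pos: "(\<Prod>b\<in>Basis. 1 + (x \<bullet> b)\<^sup>2) > 0" by (intro prod_pos) (simp add: add_pos_nonneg)
    have "(\<Prod>b\<in>Basis. inverse (1 + (x \<bullet> b)\<^sup>2)) = 1 / (\<Prod>b\<in>Basis. 1 + (x \<bullet> b)\<^sup>2)"
      using prod_inversef[of "\<lambda>b. 1 + (x \<bullet> b)\<^sup>2" Basis] by (simp add: o_def inverse_eq_divide)
    then show "norm (1 / (1 + norm x) ^ (2 * DIM('a))) \<le> norm (\<Prod>b\<in>Basis. inverse (1 + (x \<bullet> b)\<^sup>2))"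
      using * pos by (simp add: frac_le)
  qed
qed simp

text \<open>Peetre's inequality: it distributes a polynomial weight over the two factors of a
  convolution.\<close>

lemma one_plus_norm_split:
  fixes x y :: "'a::real_normed_vector" shows "1 + norm x \<le> (1 + norm (x - y)) * (1 + norm y)"
proof -
  have "norm x \<le> norm (x - y) + norm y" using norm_triangle_sub[of x y] by simp
  moreover have "0 \<le> norm y * norm (x - y)" by simp
  moreover have "(1 + norm (x - y)) * (1 + norm y) = 1 + norm (x - y) + norm y + norm y * norm (x - y)"
    by (simp add: algebra_simps)
  ultimately show ?thesis by linarith
qed

text \<open>Schwartz decay without smoothness. Convolutions and products with coordinates are only
  followed at this level; continuity is carried separately where Fourier inversion asks for
  it.\<close>

definition rapid :: "('a::euclidean_space \<Rightarrow> complex) \<Rightarrow> bool" where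
  "rapid f \<longleftrightarrow> f \<in> borel_measurable borel \<and> (\<forall>N. \<exists>C. \<forall>x. norm (f x) * (1 + norm x) ^ N \<le> C)"

lemma rapid_measurable: "rapid f \<Longrightarrow> f \<in> borel_measurable borel"
  by (simp add: rapid_def)

lemma rapidE:
  assumes "rapid f" obtains C where "C > 0" "\<And>x. norm (f x) * (1 + norm x) ^ N \<le> C"
proof -
  obtain C where C: "\<And>x. norm (f x) * (1 + norm x) ^ N \<le> C" using assms by (auto simp: rapid_def)
  have "norm (f x) * (1 + norm x) ^ N \<le> max C 1" for x using C[of x] by auto
  then show ?thesis by (intro that[of "max C 1"]) auto
qed

lemma rapid_integrable_weight:
  fixes f :: "'a::euclidean_space \<Rightarrow> complex"
  assumes "rapid f" shows "integrable lborel (\<lambda>x. (1 + norm x) ^ N * norm (f x))"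
proof -
  have [measurable]: "f \<in> borel_measurable borel" using assms by (rule rapid_measurable)
  obtain C where C: "C > 0" "\<And>x. norm (f x) * (1 + norm x) ^ (N + 2 * DIM('a)) \<le> C"
    using rapidE[OF assms] by blast
  show ?thesis
  proof (rule Bochner_Integration.integrable_bound)
    show "integrable lborel (\<lambda>x::'a. C * (1 / (1 + norm x) ^ (2 * DIM('a))))"
      by (intro integrable_mult_right integrable_decay)
    show "AE x in lborel. norm ((1 + norm x) ^ N * norm (f x)) \<le> norm (C * (1 / (1 + norm x) ^ (2 * DIM('a))))"
    proof (intro AE_I2)
      fix x :: 'a
      have "(1 + norm x) ^ N * norm (f x) * (1 + norm x) ^ (2 * DIM('a)) \<le> C"
        using C(2)[of x] by (simp add: power_add mult_ac)
      then show "norm ((1 + norm x) ^ N * norm (f x)) \<le> norm (C * (1 / (1 + norm x) ^ (2 * DIM('a))))"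
        using C(1) by (simp add: pos_le_divide_eq add_pos_nonneg)
    qed
  qed simp
qed

lemma rapid_integrable: "rapid f \<Longrightarrow> integrable lborel f"
  using rapid_integrable_weight[of f 0] by (simp add: integrable_norm_iff rapid_measurable)

lemma rapid_bounded: "rapid f \<Longrightarrow> \<exists>C. \<forall>x. norm (f x) \<le> C"
  by (erule rapidE[where N=0]) auto

lemma rapid_cmult: "rapid f \<Longrightarrow> rapid (\<lambda>x. c * f x)"
proof -
  assume f: "rapid f"
  have "\<exists>C. \<forall>x. norm (c * f x) * (1 + norm x) ^ N \<le> C" for N
  proof -
    obtain C where C: "\<And>x. norm (f x) * (1 + norm x) ^ N \<le> C" using rapidE[OF f] by blast
    have "norm (c * f x) * (1 + norm x) ^ N \<le> norm c * C" for x
      using mult_left_mono[OF C[of x], of "norm c"] by (simp add: norm_mult mult_ac)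
    then show ?thesis by blast
  qed
  then show ?thesis using f by (auto simp: rapid_def)
qed

lemma rapid_add: "rapid f \<Longrightarrow> rapid g \<Longrightarrow> rapid (\<lambda>x. f x + g x)"
proof -
  assume f: "rapid f" and g: "rapid g"
  have "\<exists>C. \<forall>x. norm (f x + g x) * (1 + norm x) ^ N \<le> C" for N
  proof -
    obtain C where C: "\<And>x. norm (f x) * (1 + norm x) ^ N \<le> C" using rapidE[OF f] by blast
    obtain D where D: "\<And>x. norm (g x) * (1 + norm x) ^ N \<le> D" using rapidE[OF g] by blast
    have "norm (f x + g x) * (1 + norm x) ^ N \<le> C + D" for x
    proof -
      have "norm (f x + g x) * (1 + norm x) ^ N \<le> (norm (f x) + norm (g x)) * (1 + norm x) ^ N"
        by (intro mult_right_mono norm_triangle_ineq) auto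
      then show ?thesis using C[of x] D[of x] by (simp add: algebra_simps)
    qed
    then show ?thesis by blast
  qed
  then show ?thesis using f g by (auto simp: rapid_def)
qed

lemma rapid_inner_mult:
  fixes f :: "'a::euclidean_space \<Rightarrow> complex"
  assumes f: "rapid f" shows "rapid (\<lambda>x. of_real (x \<bullet> c) * f x)"
proof -
  have "\<exists>C. \<forall>x. norm (of_real (x \<bullet> c) * f x) * (1 + norm x) ^ N \<le> C" for N
  proof -
    obtain C where C: "\<And>x. norm (f x) * (1 + norm x) ^ Suc N \<le> C" using rapidE[OF f] by blast
    have "norm (of_real (x \<bullet> c) * f x) * (1 + norm x) ^ N \<le> norm c * C" for x
    proof -
      have "\<bar>x \<bullet> c\<bar> \<le> (1 + norm x) * norm c"
        using Cauchy_Schwarz_ineq2[of x c] by (simp add: algebra_simps add_increasing)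
      then have "\<bar>x \<bullet> c\<bar> * (norm (f x) * (1 + norm x) ^ N) \<le> ((1 + norm x) * norm c) * (norm (f x) * (1 + norm x) ^ N)"
        by (rule mult_right_mono) auto
      also have "\<dots> = norm c * (norm (f x) * (1 + norm x) ^ Suc N)" by (simp add: mult_ac)
      also have "\<dots> \<le> norm c * C" by (intro mult_left_mono C) auto
      finally show ?thesis by (simp add: norm_mult mult_ac)
    qed
    then show ?thesis by blast
  qed
  moreover have "f \<in> borel_measurable borel" using f by (rule rapid_measurable)
  ultimately show ?thesis by (auto simp: rapid_def)
qed

lemma rapid_scale:
  fixes f :: "'a::euclidean_space \<Rightarrow> complex"
  assumes f: "rapid f" and c: "c > 0" shows "rapid (\<lambda>x. f (c *\<^sub>R x))"
proof -
  have "\<exists>C. \<forall>x. norm (f (c *\<^sub>R x)) * (1 + norm x) ^ N \<le> C" for N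
  proof -
    obtain C where C: "C > 0" "\<And>x. norm (f x) * (1 + norm x) ^ N \<le> C" using rapidE[OF f] by blast
    have "norm (f (c *\<^sub>R x)) * (1 + norm x) ^ N \<le> (1 + 1 / c) ^ N * C" for x
    proof -
      have "1 + norm x \<le> (1 + 1/c) * (1 + norm (c *\<^sub>R x))" using c by (simp add: field_simps add_pos_nonneg add_increasing)
      then have "(1 + norm x) ^ N \<le> (1 + 1/c) ^ N * (1 + norm (c *\<^sub>R x)) ^ N"
        by (subst power_mult_distrib[symmetric]) (intro power_mono, auto)
      then have "norm (f (c *\<^sub>R x)) * (1 + norm x) ^ N \<le> norm (f (c *\<^sub>R x)) * ((1 + 1/c) ^ N * (1 + norm (c *\<^sub>R x)) ^ N)"
        by (rule mult_left_mono) auto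
      also have "\<dots> = (1 + 1/c) ^ N * (norm (f (c *\<^sub>R x)) * (1 + norm (c *\<^sub>R x)) ^ N)" by (simp add: mult_ac)
      also have "\<dots> \<le> (1 + 1/c) ^ N * C" using c by (intro mult_left_mono C) auto
      finally show ?thesis .
    qed
    then show ?thesis by blast
  qed
  moreover have [measurable]: "f \<in> borel_measurable borel" using f by (rule rapid_measurable)
  ultimately show ?thesis by (auto simp: rapid_def)
qed

lemma fourier_integrand:
  fixes f :: "'a::euclidean_space \<Rightarrow> complex"
  assumes "integrable lborel f" shows "integrable lborel (\<lambda>x. f x * cis (- 2 * pi * (x \<bullet> \<xi>)))"
  by (rule integrable_cis_mult[OF assms]) measurable

lemma norm_fourier_le:
  fixes f :: "'a::euclidean_space \<Rightarrow> complex"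
  shows "norm (fourier f \<xi>) \<le> (LINT x|lborel. norm (f x))"
  unfolding fourier_def using integral_norm_bound[of lborel "\<lambda>x. f x * cis (- 2 * pi * (x \<bullet> \<xi>))"]
  by (simp add: norm_mult)

lemma continuous_fourier:
  fixes f :: "'a::euclidean_space \<Rightarrow> complex"
  assumes f: "integrable lborel f" shows "continuous_on UNIV (fourier f)"
  unfolding continuous_on_sequentially
proof (intro ballI allI impI, elim conjE)
  fix \<xi> :: 'a and X :: "nat \<Rightarrow> 'a" assume X: "X \<longlonglongrightarrow> \<xi>"
  have [measurable]: "f \<in> borel_measurable borel" using f by auto
  have "(\<lambda>n. LINT x|lborel. f x * cis (- 2 * pi * (x \<bullet> X n))) \<longlonglongrightarrow> (LINT x|lborel. f x * cis (- 2 * pi * (x \<bullet> \<xi>)))"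
  proof (rule integral_dominated_convergence[where w="\<lambda>x. norm (f x)"])
    show "AE x in lborel. (\<lambda>n. f x * cis (- 2 * pi * (x \<bullet> X n))) \<longlonglongrightarrow> f x * cis (- 2 * pi * (x \<bullet> \<xi>))"
      by (intro AE_I2 tendsto_intros X)
  qed (use f in \<open>auto simp: norm_mult\<close>)
  then show "(fourier f \<circ> X) \<longlonglongrightarrow> fourier f \<xi>" by (simp add: fourier_def o_def)
qed

lemma fourier_measurable[measurable]:
  "integrable lborel f \<Longrightarrow> fourier f \<in> borel_measurable borel"
  by (intro borel_measurable_continuous_onI continuous_fourier)

lemma continuous_inv_fourier:
  "integrable lborel f \<Longrightarrow> continuous_on UNIV (inv_fourier f)"
  unfolding inv_fourier_def[abs_def]
  by (rule continuous_on_compose2[OF continuous_fourier]) (auto intro!: continuous_intros)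

lemma inv_fourier_eq: "inv_fourier f \<xi> = (LINT x|lborel. f x * cis (2 * pi * (x \<bullet> \<xi>)))"
  by (simp add: inv_fourier_def fourier_def)

lemma fourier_add:
  "integrable lborel f \<Longrightarrow> integrable lborel g \<Longrightarrow> fourier (\<lambda>x. f x + g x) \<xi> = fourier f \<xi> + fourier g \<xi>"
  unfolding fourier_def by (simp add: distrib_right fourier_integrand[simplified])

lemma fourier_cmult: "fourier (\<lambda>x. c * f x) \<xi> = c * fourier f \<xi>"
  unfolding fourier_def by (simp add: mult.assoc)

lemma fourier_scale:
  fixes f :: "'a::euclidean_space \<Rightarrow> complex"
  assumes [measurable]: "f \<in> borel_measurable borel" and c: "c > 0"
  shows "fourier (\<lambda>x. f (c *\<^sub>R x)) \<xi> = of_real (1 / c ^ DIM('a)) * fourier f (\<xi> /\<^sub>R c)"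
proof -
  have "fourier f (\<xi> /\<^sub>R c) = of_real (c ^ DIM('a)) * fourier (\<lambda>x. f (c *\<^sub>R x)) \<xi>"
    unfolding fourier_def using c
    by (subst integral_lborel_affine[of c _ 0]) (auto simp: scaleR_conv_of_real mult.assoc[symmetric])
  then show ?thesis using c by simp
qed

text \<open>One fixed positive sequence tending to 0, since the dominated convergence theorem is
  stated for sequences. It is the increment of difference quotients and the parameter of Gaussian
  damping.\<close>

definition null_seq :: "nat \<Rightarrow> real" where "null_seq n = 1 / real (Suc n)"
lemma null_seq_pos: "null_seq n > 0" by (simp add: null_seq_def)
lemma null_seq_lim: "null_seq \<longlonglongrightarrow> 0"
  unfolding null_seq_def[abs_def] by (rule LIMSEQ_Suc[OF lim_1_over_n])

lemma cis_diff_quotient_bound: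
  fixes a s :: real assumes "s > 0" shows "norm ((cis (a * s) - 1) / of_real s) \<le> \<bar>a\<bar>"
proof -
  have "norm (cis (a * s) - 1) \<le> \<bar>a * s\<bar>"
    using iexp_approx1[of "a * s" 0] by (simp add: cis_conv_exp)
  then show ?thesis using assms by (simp add: norm_divide abs_mult pos_divide_le_eq)
qed

lemma cis_diff_quotient_lim:
  fixes a :: real shows "(\<lambda>n. (cis (a * null_seq n) - 1) / of_real (null_seq n)) \<longlonglongrightarrow> \<i> * of_real a"
proof -
  have "((\<lambda>z. exp (\<i> * of_real a * z)) has_field_derivative \<i> * of_real a) (at 0)"
    by (auto intro!: derivative_eq_intros)
  then have "((\<lambda>z. (exp (\<i> * of_real a * z) - 1) / z) \<longlongrightarrow> \<i> * of_real a) (at 0)"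
    by (auto dest: DERIV_D)
  moreover have "filterlim (\<lambda>n. complex_of_real (null_seq n)) (at 0) sequentially"
  proof (rule filterlim_atI)
    show "(\<lambda>n. complex_of_real (null_seq n)) \<longlonglongrightarrow> 0" using tendsto_of_real[OF null_seq_lim, where ?'a=complex] by simp
  qed (simp add: null_seq_def del: of_nat_Suc)
  ultimately have "(\<lambda>n. (exp (\<i> * of_real a * of_real (null_seq n)) - 1) / of_real (null_seq n)) \<longlonglongrightarrow> \<i> * of_real a"
    by (rule filterlim_compose)
  then show ?thesis by (simp add: cis_conv_exp mult.assoc)
qed

text \<open>Up to the factor -2 pi i, the left side is the derivative of \<open>fourier f\<close> in
  direction c. On an open set where the transform vanishes its difference quotients are eventually
  0. Thus multiplication by a coordinate does not enlarge the spectrum.\<close>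

lemma fourier_multiplication_inner_vanish:
  fixes f :: "'a::euclidean_space \<Rightarrow> complex"
  assumes f: "rapid f" and S: "open S" "\<And>\<xi>. \<xi> \<in> S \<Longrightarrow> fourier f \<xi> = 0" and \<xi>: "\<xi> \<in> S"
  shows "fourier (\<lambda>x. of_real (x \<bullet> c) * f x) \<xi> = 0"
proof -
  have [measurable]: "f \<in> borel_measurable borel" using f by (rule rapid_measurable)
  have intf: "integrable lborel f" using f by (rule rapid_integrable)
  define t where "t = null_seq"
  have t0: "t \<longlonglongrightarrow> 0" unfolding t_def by (rule null_seq_lim)
  have tp: "t n > 0" for n by (simp add: t_def null_seq_pos)
  define q where "q = (\<lambda>n x. f x * cis (- 2 * pi * (x \<bullet> \<xi>)) * ((cis (- 2 * pi * (x \<bullet> c) * t n) - 1) / t n))"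
  note bound = cis_diff_quotient_bound
  have lim: "(\<lambda>n. (cis (a * t n) - 1) / of_real (t n)) \<longlonglongrightarrow> \<i> * of_real a" for a :: real
    unfolding t_def by (rule cis_diff_quotient_lim)
  have L1: "(\<lambda>n. LINT x|lborel. q n x) \<longlonglongrightarrow> (LINT x|lborel. f x * cis (- 2 * pi * (x \<bullet> \<xi>)) * (\<i> * of_real (- 2 * pi * (x \<bullet> c))))"
  proof (rule integral_dominated_convergence[where w="\<lambda>x. 2 * pi * norm (of_real (x \<bullet> c) * f x)"])
    show "AE x in lborel. (\<lambda>n. q n x) \<longlonglongrightarrow> f x * cis (- 2 * pi * (x \<bullet> \<xi>)) * (\<i> * of_real (- 2 * pi * (x \<bullet> c)))"
      unfolding q_def by (intro AE_I2 tendsto_mult tendsto_const lim)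
    show "integrable lborel (\<lambda>x. 2 * pi * norm (of_real (x \<bullet> c) * f x))"
      by (intro integrable_mult_right integrable_norm rapid_integrable rapid_inner_mult f)
    show "AE x in lborel. norm (q n x) \<le> 2 * pi * norm (of_real (x \<bullet> c) * f x)" for n
    proof (intro AE_I2)
      fix x
      have "norm (q n x) = norm (f x) * norm ((cis (- 2 * pi * (x \<bullet> c) * t n) - 1) / t n)"
        unfolding q_def norm_mult by (simp only: norm_cis mult_1_right)
      also have "\<dots> \<le> norm (f x) * \<bar>- 2 * pi * (x \<bullet> c)\<bar>"
        by (intro mult_left_mono bound tp) auto
      finally show "norm (q n x) \<le> 2 * pi * norm (of_real (x \<bullet> c) * f x)" by (simp add: norm_mult abs_mult mult_ac)
    qed
    show "(\<lambda>x. f x * cis (- 2 * pi * (x \<bullet> \<xi>)) * (\<i> * of_real (- 2 * pi * (x \<bullet> c)))) \<in> borel_measurable lborel"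
      by measurable
    show "q n \<in> borel_measurable lborel" for n unfolding q_def by measurable
  qed
  have L2: "(LINT x|lborel. q n x) = (fourier f (\<xi> + t n *\<^sub>R c) - fourier f \<xi>) / t n" for n
  proof -
    have "q n x = (f x * cis (- 2 * pi * (x \<bullet> (\<xi> + t n *\<^sub>R c))) - f x * cis (- 2 * pi * (x \<bullet> \<xi>))) / t n" for x
    proof -
      have "cis (- 2 * pi * (x \<bullet> (\<xi> + t n *\<^sub>R c))) = cis (- 2 * pi * (x \<bullet> \<xi>)) * cis (- 2 * pi * (x \<bullet> c) * t n)"
        unfolding cis_mult by (rule arg_cong[where f=cis]) (simp add: inner_add_right algebra_simps)
      then show ?thesis unfolding q_def by (simp only: right_diff_distrib mult.assoc times_divide_eq_right mult_1_right)
    qed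
    then have "(LINT x|lborel. q n x) = (LINT x|lborel. (f x * cis (- 2 * pi * (x \<bullet> (\<xi> + t n *\<^sub>R c))) - f x * cis (- 2 * pi * (x \<bullet> \<xi>))) / t n)"
      by (simp only:)
    also have "\<dots> = (fourier f (\<xi> + t n *\<^sub>R c) - fourier f \<xi>) / t n"
      unfolding fourier_def integral_divide_zero
      by (subst Bochner_Integration.integral_diff[OF fourier_integrand[OF intf] fourier_integrand[OF intf]]) (rule refl)
    finally show ?thesis .
  qed
  have L3: "\<forall>\<^sub>F n in sequentially. (fourier f (\<xi> + t n *\<^sub>R c) - fourier f \<xi>) / t n = 0"
  proof -
    have "(\<lambda>n. \<xi> + t n *\<^sub>R c) \<longlonglongrightarrow> \<xi> + 0 *\<^sub>R c" by (intro tendsto_intros t0)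
    then have "\<forall>\<^sub>F n in sequentially. \<xi> + t n *\<^sub>R c \<in> S" using S(1) \<xi> by (auto simp: topological_tendstoD)
    then show ?thesis by eventually_elim (simp add: S(2) \<xi>)
  qed
  have "(\<lambda>n. LINT x|lborel. q n x) \<longlonglongrightarrow> 0"
    using L3 by (intro tendsto_eventually) (simp add: L2)
  with L1 have "(LINT x|lborel. f x * cis (- 2 * pi * (x \<bullet> \<xi>)) * (\<i> * of_real (- 2 * pi * (x \<bullet> c)))) = 0"
    by (rule LIMSEQ_unique)
  moreover have "(LINT x|lborel. f x * cis (- 2 * pi * (x \<bullet> \<xi>)) * (\<i> * of_real (- 2 * pi * (x \<bullet> c)))) =
     (- 2 * pi * \<i>) * fourier (\<lambda>x. of_real (x \<bullet> c) * f x) \<xi>"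
    unfolding fourier_def integral_mult_right_zero[symmetric]
    by (rule Bochner_Integration.integral_cong[OF refl]) (simp only: of_real_mult of_real_minus of_real_numeral, algebra)
  ultimately have "(- 2 * pi * \<i>) * fourier (\<lambda>x. of_real (x \<bullet> c) * f x) \<xi> = 0" by (simp only:)
  then show ?thesis by (simp only: mult_eq_0_iff) simp
qed

section \<open>Gaussian summation: inversion and location of spectra\<close>

lemma gaussian_integral_2pi:
  fixes \<xi> :: "'a::euclidean_space" assumes t: "t > 0"
  shows "integrable lborel (\<lambda>x::'a. complex_of_real (exp (- t * (norm x)\<^sup>2)) * cis (2 * pi * (x \<bullet> \<xi>)))"
   and "(LINT x|lborel. complex_of_real (exp (- t * (norm x)\<^sup>2)) * cis (2 * pi * (x \<bullet> \<xi>))) =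
      of_real (sqrt (pi / t) ^ DIM('a) * exp (- pi\<^sup>2 * (norm \<xi>)\<^sup>2 / t))"
  using gaussian_integral[OF t, of "(2 * pi) *\<^sub>R \<xi>"] by (auto simp: power_mult_distrib field_simps)

lemma integrable_gaussian:
  assumes t: "t > 0" shows "integrable lborel (\<lambda>x::'a::euclidean_space. exp (- t * (norm x)\<^sup>2))"
  using gaussian_integral[OF t, of "0::'a"] by (simp add: complex_of_real_integrable_eq)

lemma integral_gaussian:
  assumes t: "t > 0" shows "(LINT x|lborel. exp (- t * (norm (x::'a::euclidean_space))\<^sup>2)) = sqrt (pi / t) ^ DIM('a)"
proof -
  have "complex_of_real (LINT x|lborel. exp (- t * (norm (x::'a))\<^sup>2)) = of_real (sqrt (pi / t) ^ DIM('a))"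
    using gaussian_integral(2)[OF t, of "0::'a"] by (simp flip: integral_complex_of_real)
  then show ?thesis using of_real_eq_iff by blast
qed

lemma gaussian_damping_lim:
  fixes g :: "'a::euclidean_space \<Rightarrow> complex"
  assumes g: "integrable lborel g"
  shows "(\<lambda>n. LINT x|lborel. g x * of_real (exp (- null_seq n * (norm x)\<^sup>2))) \<longlonglongrightarrow> (LINT x|lborel. g x)"
proof (rule integral_dominated_convergence[where w="\<lambda>x. norm (g x)"])
  have [measurable]: "g \<in> borel_measurable borel" using g by auto
  show "AE x in lborel. (\<lambda>n. g x * of_real (exp (- null_seq n * (norm x)\<^sup>2))) \<longlonglongrightarrow> g x"
  proof (intro AE_I2)
    fix x
    have "(\<lambda>n. g x * of_real (exp (- null_seq n * (norm x)\<^sup>2))) \<longlonglongrightarrow> g x * of_real (exp (- 0 * (norm x)\<^sup>2))"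
      by (intro tendsto_intros null_seq_lim)
    then show "(\<lambda>n. g x * of_real (exp (- null_seq n * (norm x)\<^sup>2))) \<longlonglongrightarrow> g x" by simp
  qed
  show "AE x in lborel. norm (g x * of_real (exp (- null_seq n * (norm x)\<^sup>2))) \<le> norm (g x)" for n
    using null_seq_pos[of n] by (auto simp: norm_mult intro!: mult_left_le)
  show "g \<in> borel_measurable lborel" by simp
  show "(\<lambda>x. g x * of_real (exp (- null_seq n * (norm x)\<^sup>2))) \<in> borel_measurable lborel" for n by measurable
  show "integrable lborel (\<lambda>x. norm (g x))" using g by simp
qed

lemma integrable_lborel_pair_mult:
  fixes f :: "'a::euclidean_space \<Rightarrow> complex" and g :: "'b::euclidean_space \<Rightarrow> complex"
  assumes "integrable lborel f" "integrable lborel g" "h \<in> borel_measurable (borel \<Otimes>\<^sub>M borel)" "\<And>x y. norm (h (x, y)) \<le> norm (f x) * norm (g y)"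
  shows "integrable (lborel \<Otimes>\<^sub>M lborel) (h :: 'a \<times> 'b \<Rightarrow> complex)"
proof (rule lborel_pair.Fubini_integrable)
  have fm[measurable]: "f \<in> borel_measurable borel" "g \<in> borel_measurable borel" using assms by auto
  have hm: "h \<in> borel_measurable (lborel \<Otimes>\<^sub>M lborel)"
    using assms(3) by (simp add: measurable_def sets_pair_measure_cong[of lborel borel lborel borel] space_pair_measure)
  then show "h \<in> borel_measurable (lborel \<Otimes>\<^sub>M lborel)" .
  note [measurable] = hm
  have i: "integrable lborel (\<lambda>y. h (x, y))" for x
    by (rule Bochner_Integration.integrable_bound[of _ "\<lambda>y. norm (f x) * norm (g y)"])
       (use assms in \<open>auto intro!: AE_I2\<close>)
  then show "AE x in lborel. integrable lborel (\<lambda>y. h (x, y))" by simp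
  show "integrable lborel (\<lambda>x. LINT y|lborel. norm (h (x, y)))"
  proof (rule Bochner_Integration.integrable_bound[of _ "\<lambda>x. norm (f x) * (LINT y|lborel. norm (g y))"])
    show "integrable lborel (\<lambda>x. norm (f x) * (LINT y|lborel. norm (g y)))" using assms(1) by simp
    show "AE x in lborel. norm (LINT y|lborel. norm (h (x, y))) \<le> norm (norm (f x) * (LINT y|lborel. norm (g y)))"
    proof (intro AE_I2)
      fix x
      have "(LINT y|lborel. norm (h (x, y))) \<le> (LINT y|lborel. norm (f x) * norm (g y))"
        by (intro integral_mono integrable_norm i) (use assms in auto)
      then show "norm (LINT y|lborel. norm (h (x, y))) \<le> norm (norm (f x) * (LINT y|lborel. norm (g y)))"
        by simp
    qed
  qed measurable
qed

lemma fubini_lborel_mult: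
  fixes f :: "'a::euclidean_space \<Rightarrow> complex" and g :: "'b::euclidean_space \<Rightarrow> complex"
  assumes f: "integrable lborel f" and g: "integrable lborel g"
   and h[measurable]: "(\<lambda>(x, y). h x y) \<in> borel_measurable (borel \<Otimes>\<^sub>M borel)" and b: "\<And>x y. norm (h x y) \<le> norm (f x) * norm (g y)"
  shows "(LINT x|lborel. LINT y|lborel. h x y) = (LINT y|lborel. LINT x|lborel. h x y :: complex)"
    and "integrable lborel (\<lambda>x. LINT y|lborel. h x y)"
proof -
  have i: "integrable (lborel \<Otimes>\<^sub>M lborel) (\<lambda>(x, y). h x y)"
    by (rule integrable_lborel_pair_mult[OF f g h]) (use b in auto)
  show "(LINT x|lborel. LINT y|lborel. h x y) = (LINT y|lborel. LINT x|lborel. h x y)"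
    using lborel_pair.Fubini_integral[OF i] by simp
  show "integrable lborel (\<lambda>x. LINT y|lborel. h x y)"
    using lborel_pair.integrable_fst'[OF i] by simp
qed

text \<open>The integral of the transform is damped by exp (-t |\<xi>|^2). By Fubini it becomes a
  Gaussian average of f around x at distance of order sqrt t, which tends to f x by continuity and
  boundedness.\<close>

lemma fourier_inversion:
  fixes f :: "'a::euclidean_space \<Rightarrow> complex"
  assumes f: "integrable lborel f" and fb: "\<And>x. norm (f x) \<le> C" and fc: "continuous_on UNIV f"
    and ff: "integrable lborel (fourier f)"
  shows "inv_fourier (fourier f) x = f x"
proof -
  have [measurable]: "f \<in> borel_measurable borel" "fourier f \<in> borel_measurable borel" using f ff by auto
  define K where "K = complex_of_real (sqrt pi ^ DIM('a))"
  have step: "(LINT \<xi>|lborel. fourier f \<xi> * cis (2 * pi * (\<xi> \<bullet> x)) * of_real (exp (- t * (norm \<xi>)\<^sup>2)))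
     = (LINT z|lborel. f (x + sqrt t *\<^sub>R z) * (K * of_real (exp (- pi\<^sup>2 * (norm z)\<^sup>2))))" if t: "t > 0" for t
  proof -
    have "(LINT \<xi>|lborel. fourier f \<xi> * cis (2 * pi * (\<xi> \<bullet> x)) * of_real (exp (- t * (norm \<xi>)\<^sup>2)))
      = (LINT \<xi>|lborel. LINT y|lborel. of_real (exp (- t * (norm \<xi>)\<^sup>2)) * f y * cis (2 * pi * (\<xi> \<bullet> (x - y))))"
    proof (rule Bochner_Integration.integral_cong[OF refl])
      fix \<xi> :: 'a
      have "(LINT y|lborel. of_real (exp (- t * (norm \<xi>)\<^sup>2)) * f y * cis (2 * pi * (\<xi> \<bullet> (x - y)))) =
        (LINT y|lborel. (of_real (exp (- t * (norm \<xi>)\<^sup>2)) * cis (2 * pi * (\<xi> \<bullet> x))) * (f y * cis (- 2 * pi * (y \<bullet> \<xi>))))"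
      proof (rule Bochner_Integration.integral_cong[OF refl])
        fix y :: 'a
        have "cis (2 * pi * (\<xi> \<bullet> (x - y))) = cis (2 * pi * (\<xi> \<bullet> x)) * cis (- 2 * pi * (y \<bullet> \<xi>))"
          unfolding cis_mult by (rule arg_cong[where f=cis]) (simp add: inner_diff_right inner_commute algebra_simps)
        then show "of_real (exp (- t * (norm \<xi>)\<^sup>2)) * f y * cis (2 * pi * (\<xi> \<bullet> (x - y))) =
          (of_real (exp (- t * (norm \<xi>)\<^sup>2)) * cis (2 * pi * (\<xi> \<bullet> x))) * (f y * cis (- 2 * pi * (y \<bullet> \<xi>)))"
          by (simp only: mult_ac)
      qed
      also have "\<dots> = (of_real (exp (- t * (norm \<xi>)\<^sup>2)) * cis (2 * pi * (\<xi> \<bullet> x))) * fourier f \<xi>"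
        by (simp only: integral_mult_right_zero fourier_def)
      finally show "fourier f \<xi> * cis (2 * pi * (\<xi> \<bullet> x)) * of_real (exp (- t * (norm \<xi>)\<^sup>2)) =
        (LINT y|lborel. of_real (exp (- t * (norm \<xi>)\<^sup>2)) * f y * cis (2 * pi * (\<xi> \<bullet> (x - y))))"
        by (simp only: mult_ac)
    qed
    also have "\<dots> = (LINT y|lborel. LINT \<xi>|lborel. of_real (exp (- t * (norm \<xi>)\<^sup>2)) * f y * cis (2 * pi * (\<xi> \<bullet> (x - y))))"
    proof (rule fubini_lborel_mult(1)[OF _ f])
      show "integrable lborel (\<lambda>\<xi>::'a. complex_of_real (exp (- t * (norm \<xi>)\<^sup>2)))"
        using integrable_gaussian[OF t, where 'a='a] by (rule integrable_of_real)
    qed (auto simp: norm_mult)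
    also have "\<dots> = (LINT y|lborel. f y * of_real (sqrt (pi / t) ^ DIM('a) * exp (- pi\<^sup>2 * (norm (x - y))\<^sup>2 / t)))"
      unfolding gaussian_integral_2pi(2)[OF t, symmetric] integral_mult_right_zero[symmetric]
      by (intro Bochner_Integration.integral_cong refl) (simp only: mult_ac)
    \<comment> \<open>The substitution y = x + sqrt t z makes the kernel independent of t, so that
      only f moves as t tends to 0.\<close>
    also have "\<dots> = (sqrt t ^ DIM('a)) *\<^sub>R (LINT z|lborel. f (x + sqrt t *\<^sub>R z) * of_real (sqrt (pi / t) ^ DIM('a) * exp (- pi\<^sup>2 * (norm z)\<^sup>2)))"
      using t by (subst integral_lborel_affine[of "sqrt t" _ x]) (auto simp: power_mult_distrib)
    also have "\<dots> = (LINT z|lborel. f (x + sqrt t *\<^sub>R z) * (K * of_real (exp (- pi\<^sup>2 * (norm z)\<^sup>2))))"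
    proof -
      have "sqrt t ^ DIM('a) * sqrt (pi / t) ^ DIM('a) = sqrt pi ^ DIM('a)"
        using t by (simp add: power_mult_distrib[symmetric] real_sqrt_mult[symmetric] del: real_sqrt_mult)
      then have K: "K = complex_of_real (sqrt t ^ DIM('a)) * of_real (sqrt (pi / t) ^ DIM('a))"
        unfolding K_def by (simp only: of_real_mult[symmetric])
      show ?thesis unfolding K scaleR_conv_of_real integral_mult_right_zero[symmetric]
        by (intro Bochner_Integration.integral_cong refl) (simp only: of_real_mult mult_ac)
    qed
    finally show ?thesis .
  qed
  have "(\<lambda>n. LINT \<xi>|lborel. (fourier f \<xi> * cis (2 * pi * (\<xi> \<bullet> x))) * of_real (exp (- null_seq n * (norm \<xi>)\<^sup>2)))
    \<longlonglongrightarrow> (LINT \<xi>|lborel. fourier f \<xi> * cis (2 * pi * (\<xi> \<bullet> x)))"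
    by (rule gaussian_damping_lim) (intro integrable_cis_mult ff, measurable)
  then have L1: "(\<lambda>n. LINT z|lborel. f (x + sqrt (null_seq n) *\<^sub>R z) * (K * of_real (exp (- pi\<^sup>2 * (norm z)\<^sup>2))))
    \<longlonglongrightarrow> inv_fourier (fourier f) x"
    unfolding step[OF null_seq_pos] inv_fourier_eq .
  have "pi\<^sup>2 > 0" by simp
  note gi = integrable_gaussian[OF this, where 'a='a] integral_gaussian[OF this, where 'a='a]
  have L2: "(\<lambda>n. LINT z|lborel. f (x + sqrt (null_seq n) *\<^sub>R z) * (K * of_real (exp (- pi\<^sup>2 * (norm z)\<^sup>2))))
    \<longlonglongrightarrow> (LINT z|lborel. f x * (K * of_real (exp (- pi\<^sup>2 * (norm (z::'a))\<^sup>2))))"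
  proof (rule integral_dominated_convergence[where w="\<lambda>z. (C * norm K) * exp (- pi\<^sup>2 * (norm z)\<^sup>2)"])
    show "AE z in lborel. (\<lambda>n. f (x + sqrt (null_seq n) *\<^sub>R z) * (K * of_real (exp (- pi\<^sup>2 * (norm z)\<^sup>2)))) \<longlonglongrightarrow> f x * (K * of_real (exp (- pi\<^sup>2 * (norm z)\<^sup>2)))"
    proof (intro AE_I2)
      fix z
      have "(\<lambda>n. x + sqrt (null_seq n) *\<^sub>R z) \<longlonglongrightarrow> x + sqrt 0 *\<^sub>R z" by (intro tendsto_intros null_seq_lim)
      then have "(\<lambda>n. f (x + sqrt (null_seq n) *\<^sub>R z)) \<longlonglongrightarrow> f x"
        using fc by (intro continuous_on_tendsto_compose[of UNIV f]) auto
      then show "(\<lambda>n. f (x + sqrt (null_seq n) *\<^sub>R z) * (K * of_real (exp (- pi\<^sup>2 * (norm z)\<^sup>2)))) \<longlonglongrightarrow> f x * (K * of_real (exp (- pi\<^sup>2 * (norm z)\<^sup>2)))"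
        by (intro tendsto_intros)
    qed
    show "AE z in lborel. norm (f (x + sqrt (null_seq n) *\<^sub>R z) * (K * of_real (exp (- pi\<^sup>2 * (norm z)\<^sup>2)))) \<le> (C * norm K) * exp (- pi\<^sup>2 * (norm z)\<^sup>2)" for n
      using fb by (intro AE_I2) (simp add: norm_mult mult.assoc mult_right_mono)
    show "integrable lborel (\<lambda>z::'a. (C * norm K) * exp (- pi\<^sup>2 * (norm z)\<^sup>2))" using gi(1) by (rule integrable_mult_right)
  qed measurable
  have "(LINT z|lborel. f x * (K * of_real (exp (- pi\<^sup>2 * (norm (z::'a))\<^sup>2)))) = f x * (K * of_real (sqrt (pi / pi\<^sup>2) ^ DIM('a)))"
    by (simp only: integral_mult_right_zero integral_complex_of_real gi(2))
  also have "K * of_real (sqrt (pi / pi\<^sup>2) ^ DIM('a)) = 1"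
    unfolding K_def of_real_mult[symmetric] power_mult_distrib[symmetric] real_sqrt_mult[symmetric] by (simp add: power2_eq_square)
  finally show ?thesis using LIMSEQ_unique[OF L1 L2] by simp
qed

text \<open>An absolutely convergent superposition of characters has no spectrum at a point \<omega>
  at positive distance d from all frequencies used. In the damped integral each character
  contributes at most t^(-n/2) exp (-pi^2 d^2 / t), up to a constant, and this tends to 0. It
  locates the spectrum of a squared modulus, whose frequencies are differences.\<close>

lemma fourier_zero_of_superposition:
  fixes f :: "'a::euclidean_space \<Rightarrow> complex" and k :: "'p::euclidean_space \<Rightarrow> complex"
  assumes f: "integrable lborel f" and k: "integrable lborel k" and w[measurable]: "w \<in> borel_measurable borel"
    and rep: "\<And>x. f x = (LINT p|lborel. k p * cis (2 * pi * (x \<bullet> w p)))"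
    and d: "d > 0" "\<And>p. k p \<noteq> 0 \<Longrightarrow> d \<le> norm (w p - \<omega>)"
  shows "fourier f \<omega> = 0"
proof -
  have [measurable]: "f \<in> borel_measurable borel" "k \<in> borel_measurable borel" using f k by auto
  define I where "I = (LINT p|lborel. norm (k p))"
  have step: "norm (LINT x|lborel. f x * cis (- 2 * pi * (x \<bullet> \<omega>)) * of_real (exp (- t * (norm x)\<^sup>2)))
     \<le> sqrt (pi / t) ^ DIM('a) * exp (- pi\<^sup>2 * d\<^sup>2 / t) * I" if t: "t > 0" for t
  proof -
    have "(LINT x|lborel. f x * cis (- 2 * pi * (x \<bullet> \<omega>)) * of_real (exp (- t * (norm x)\<^sup>2)))
      = (LINT x|lborel. LINT p|lborel. of_real (exp (- t * (norm x)\<^sup>2)) * k p * cis (2 * pi * (x \<bullet> (w p - \<omega>))))"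
    proof (rule Bochner_Integration.integral_cong[OF refl])
      fix x :: 'a
      have "(LINT p|lborel. of_real (exp (- t * (norm x)\<^sup>2)) * k p * cis (2 * pi * (x \<bullet> (w p - \<omega>)))) =
        (LINT p|lborel. (of_real (exp (- t * (norm x)\<^sup>2)) * cis (- 2 * pi * (x \<bullet> \<omega>))) * (k p * cis (2 * pi * (x \<bullet> w p))))"
      proof (rule Bochner_Integration.integral_cong[OF refl])
        fix p :: 'p
        have "cis (2 * pi * (x \<bullet> (w p - \<omega>))) = cis (- 2 * pi * (x \<bullet> \<omega>)) * cis (2 * pi * (x \<bullet> w p))"
          unfolding cis_mult by (rule arg_cong[where f=cis]) (simp add: inner_diff_right algebra_simps)
        then show "of_real (exp (- t * (norm x)\<^sup>2)) * k p * cis (2 * pi * (x \<bullet> (w p - \<omega>))) =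
          (of_real (exp (- t * (norm x)\<^sup>2)) * cis (- 2 * pi * (x \<bullet> \<omega>))) * (k p * cis (2 * pi * (x \<bullet> w p)))"
          by (simp only: mult_ac)
      qed
      also have "\<dots> = (of_real (exp (- t * (norm x)\<^sup>2)) * cis (- 2 * pi * (x \<bullet> \<omega>))) * f x"
        by (simp only: integral_mult_right_zero rep)
      finally show "f x * cis (- 2 * pi * (x \<bullet> \<omega>)) * of_real (exp (- t * (norm x)\<^sup>2)) =
        (LINT p|lborel. of_real (exp (- t * (norm x)\<^sup>2)) * k p * cis (2 * pi * (x \<bullet> (w p - \<omega>))))"
        by (simp only: mult_ac)
    qed
    also have "\<dots> = (LINT p|lborel. LINT x|lborel. of_real (exp (- t * (norm x)\<^sup>2)) * k p * cis (2 * pi * (x \<bullet> (w p - \<omega>))))"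
    proof (rule fubini_lborel_mult(1)[OF _ k])
      show "integrable lborel (\<lambda>x::'a. complex_of_real (exp (- t * (norm x)\<^sup>2)))"
        using integrable_gaussian[OF t, where 'a='a] by (rule integrable_of_real)
    qed (auto simp: norm_mult)
    also have "\<dots> = (LINT p|lborel. k p * of_real (sqrt (pi / t) ^ DIM('a) * exp (- pi\<^sup>2 * (norm (w p - \<omega>))\<^sup>2 / t)))"
      unfolding gaussian_integral_2pi(2)[OF t, symmetric] integral_mult_right_zero[symmetric]
      by (intro Bochner_Integration.integral_cong refl) (simp only: mult_ac)
    also have "norm \<dots> \<le> (LINT p|lborel. (sqrt (pi / t) ^ DIM('a) * exp (- pi\<^sup>2 * d\<^sup>2 / t)) * norm (k p))"
    proof (rule Bochner_Integration.integral_norm_bound_integral)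
      have b: "norm (k p * of_real (sqrt (pi / t) ^ DIM('a) * exp (- pi\<^sup>2 * (norm (w p - \<omega>))\<^sup>2 / t)))
        \<le> (sqrt (pi / t) ^ DIM('a) * exp (- pi\<^sup>2 * d\<^sup>2 / t)) * norm (k p)" for p
      proof (cases "k p = 0")
        case False
        have "d\<^sup>2 \<le> (norm (w p - \<omega>))\<^sup>2" using d(1) d(2)[OF False] by (intro power_mono) auto
        then have "exp (- pi\<^sup>2 * (norm (w p - \<omega>))\<^sup>2 / t) \<le> exp (- pi\<^sup>2 * d\<^sup>2 / t)"
          using t by (auto intro!: divide_right_mono mult_left_mono)
        then have "norm (k p) * (sqrt (pi / t) ^ DIM('a) * exp (- pi\<^sup>2 * (norm (w p - \<omega>))\<^sup>2 / t)) \<le>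
          norm (k p) * (sqrt (pi / t) ^ DIM('a) * exp (- pi\<^sup>2 * d\<^sup>2 / t))"
          using t by (intro mult_left_mono) auto
        then show ?thesis using t by (simp add: norm_mult norm_power mult_ac)
      qed simp
      then show "norm (k p * of_real (sqrt (pi / t) ^ DIM('a) * exp (- pi\<^sup>2 * (norm (w p - \<omega>))\<^sup>2 / t)))
        \<le> (sqrt (pi / t) ^ DIM('a) * exp (- pi\<^sup>2 * d\<^sup>2 / t)) * norm (k p)" for p .
      show i: "integrable lborel (\<lambda>p. (sqrt (pi / t) ^ DIM('a) * exp (- pi\<^sup>2 * d\<^sup>2 / t)) * norm (k p))"
        using k by (intro integrable_mult_right integrable_norm)
      show "integrable lborel (\<lambda>p. k p * of_real (sqrt (pi / t) ^ DIM('a) * exp (- pi\<^sup>2 * (norm (w p - \<omega>))\<^sup>2 / t)))"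
        by (rule Bochner_Integration.integrable_bound[OF i]) (measurable, intro AE_I2 order_trans[OF b], simp)
    qed
    also have "\<dots> = sqrt (pi / t) ^ DIM('a) * exp (- pi\<^sup>2 * d\<^sup>2 / t) * I"
      unfolding I_def by (rule integral_mult_right_zero)
    finally show ?thesis .
  qed
  have L1: "(\<lambda>n. LINT x|lborel. (f x * cis (- 2 * pi * (x \<bullet> \<omega>))) * of_real (exp (- null_seq n * (norm x)\<^sup>2))) \<longlonglongrightarrow> fourier f \<omega>"
    unfolding fourier_def by (rule gaussian_damping_lim[OF fourier_integrand[OF f]])
  \<comment> \<open>With s = 1/t the bound is a power of s times exp (-c s); the estimate sqrt (pi
    s) \<le> pi s for s \<ge> 1 removes the root.\<close>
  have "(\<lambda>n. sqrt (pi / null_seq n) ^ DIM('a) * exp (- pi\<^sup>2 * d\<^sup>2 / null_seq n) * I) \<longlonglongrightarrow> 0"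
  proof -
    have c: "pi\<^sup>2 * d\<^sup>2 > 0" using d by simp
    define c where "c = pi\<^sup>2 * d\<^sup>2"
    have c0: "c > 0" using c by (simp add: c_def)
    have cs: "filterlim (\<lambda>s. c * s) at_top at_top"
      using c0 by (intro filterlim_tendsto_pos_mult_at_top[OF tendsto_const]) (auto simp: filterlim_ident)
    have "((\<lambda>s. (pi / c) ^ DIM('a) * ((c * s) ^ DIM('a) / exp (c * s)) * \<bar>I\<bar>) \<longlongrightarrow> (pi / c) ^ DIM('a) * 0 * \<bar>I\<bar>) at_top"
      by (intro tendsto_intros filterlim_compose[OF tendsto_power_div_exp_0 cs])
    then have "((\<lambda>s. (pi / c) ^ DIM('a) * ((c * s) ^ DIM('a) / exp (c * s)) * \<bar>I\<bar>) \<longlongrightarrow> 0) at_top" by simp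
    moreover have "\<forall>\<^sub>F s in at_top. norm (sqrt (pi * s) ^ DIM('a) * exp (- c * s) * I) \<le> (pi / c) ^ DIM('a) * ((c * s) ^ DIM('a) / exp (c * s)) * \<bar>I\<bar>"
    proof (rule eventually_at_top_linorderI[of 1])
      fix s :: real assume s: "1 \<le> s"
      have ps: "1 \<le> pi * s" using mult_mono[of 1 pi 1 s] s pi_ge_two by simp
      have "sqrt (pi * s) * 1 \<le> sqrt (pi * s) * sqrt (pi * s)" using ps by (intro mult_left_mono) auto
      then have "sqrt (pi * s) ^ DIM('a) \<le> (pi * s) ^ DIM('a)" using ps by (intro power_mono) auto
      then have "sqrt (pi * s) ^ DIM('a) * (exp (- c * s) * \<bar>I\<bar>) \<le> (pi * s) ^ DIM('a) * (exp (- c * s) * \<bar>I\<bar>)"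
        by (rule mult_right_mono) simp
      also have "\<dots> = (pi / c) ^ DIM('a) * ((c * s) ^ DIM('a) / exp (c * s)) * \<bar>I\<bar>"
        using c0 by (simp add: power_mult_distrib power_divide exp_minus divide_inverse power_inverse)
      finally show "norm (sqrt (pi * s) ^ DIM('a) * exp (- c * s) * I) \<le> (pi / c) ^ DIM('a) * ((c * s) ^ DIM('a) / exp (c * s)) * \<bar>I\<bar>"
        using s by (simp add: abs_mult mult.assoc)
    qed
    ultimately have "((\<lambda>s. sqrt (pi * s) ^ DIM('a) * exp (- (pi\<^sup>2 * d\<^sup>2) * s) * I) \<longlongrightarrow> 0) at_top"
      unfolding c_def by (rule Lim_null_comparison[rotated])
    moreover have "filterlim (\<lambda>n. 1 / null_seq n) at_top sequentially"
    proof -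
      have "(\<lambda>n. 1 / null_seq n) = (\<lambda>n. real (Suc n))" by (simp add: null_seq_def)
      then show ?thesis using filterlim_compose[OF filterlim_real_sequentially filterlim_Suc] by simp
    qed
    ultimately have "(\<lambda>n. sqrt (pi * (1 / null_seq n)) ^ DIM('a) * exp (- (pi\<^sup>2 * d\<^sup>2) * (1 / null_seq n)) * I) \<longlonglongrightarrow> 0"
      by (rule filterlim_compose)
    then show ?thesis by simp
  qed
  then have "(\<lambda>n. LINT x|lborel. (f x * cis (- 2 * pi * (x \<bullet> \<omega>))) * of_real (exp (- null_seq n * (norm x)\<^sup>2))) \<longlonglongrightarrow> 0"
    by (rule Lim_null_comparison[rotated]) (intro always_eventually allI step null_seq_pos)
  with L1 show ?thesis by (rule LIMSEQ_unique)
qed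

section \<open>Convolution along a subspace\<close>

text \<open>Convolution of B with the density u spread over the image of R \<iota> and modulated by
  \<theta>. The point is its transform, \<open>fourier B \<xi> * fourier u (R *\<^sub>R (L \<xi> -
  \<theta>))\<close> with L the adjoint of \<iota>, which is one localised block of the multiplier.
  For the identity, R = 1 and \<theta> = 0 it is ordinary convolution.\<close>

definition skew_convolve ::
  "('b::euclidean_space \<Rightarrow> 'a::euclidean_space) \<Rightarrow> real \<Rightarrow> 'b \<Rightarrow> ('a \<Rightarrow> complex) \<Rightarrow> ('b \<Rightarrow> complex) \<Rightarrow> 'a \<Rightarrow> complex" where
  "skew_convolve \<iota> R \<theta> B u x = (LINT \<nu>|lborel. u \<nu> * cis (2 * pi * R * (\<nu> \<bullet> \<theta>)) * B (x - R *\<^sub>R \<iota> \<nu>))"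

lemma fubini_lborel:
  fixes h :: "'b::euclidean_space \<Rightarrow> 'a::euclidean_space \<Rightarrow> complex"
  assumes h[measurable]: "(\<lambda>(y, x). h y x) \<in> borel_measurable (borel \<Otimes>\<^sub>M borel)"
    and i: "\<And>y. integrable lborel (h y)" and b: "\<And>y. (LINT x|lborel. norm (h y x)) \<le> k y" and k: "integrable lborel k"
  shows "integrable lborel (\<lambda>x. LINT y|lborel. h y x)"
    and "(LINT x|lborel. LINT y|lborel. h y x) = (LINT y|lborel. LINT x|lborel. h y x)"
proof -
  have hm[measurable]: "(\<lambda>(y, x). h y x) \<in> borel_measurable (lborel \<Otimes>\<^sub>M lborel)"
    using h by (simp add: measurable_def sets_pair_measure_cong[of lborel borel lborel borel] space_pair_measure)
  have I: "integrable (lborel \<Otimes>\<^sub>M lborel) (\<lambda>(y, x). h y x)"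
  proof (rule lborel_pair.Fubini_integrable)
    show "integrable lborel (\<lambda>y. LINT x|lborel. norm (case (y, x) of (y, x) \<Rightarrow> h y x))"
    proof (rule Bochner_Integration.integrable_bound[OF k])
      show "AE y in lborel. norm (LINT x|lborel. norm (case (y, x) of (y, x) \<Rightarrow> h y x)) \<le> norm (k y)"
      proof (intro AE_I2)
        fix y
        have "0 \<le> (LINT x|lborel. norm (h y x))" by (rule integral_nonneg_AE) simp
        then show "norm (LINT x|lborel. norm (case (y, x) of (y, x) \<Rightarrow> h y x)) \<le> norm (k y)"
          using b[of y] by simp
      qed
    qed measurable
    show "AE y in lborel. integrable lborel (\<lambda>x. case (y, x) of (y, x) \<Rightarrow> h y x)" using i by simp
  qed measurable
  show "integrable lborel (\<lambda>x. LINT y|lborel. h y x)"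
    using lborel_pair.integrable_snd[OF I] by simp
  show "(LINT x|lborel. LINT y|lborel. h y x) = (LINT y|lborel. LINT x|lborel. h y x)"
    using lborel_pair.Fubini_integral[OF I] by simp
qed

text \<open>Three pairs occur: \<open>embed_on J\<close> with the partial sum
  \<open>sum_on J\<close> for the slab, \<open>axis i\<close> with the i-th component for the
  Sobolev weights, and the identity for ordinary convolution.\<close>

locale adjoint_pair =
  fixes \<iota> :: "'b::euclidean_space \<Rightarrow> 'a::euclidean_space" and L :: "'a \<Rightarrow> 'b"
  assumes lin: "linear \<iota>" and adj: "\<And>\<nu> x. \<iota> \<nu> \<bullet> x = \<nu> \<bullet> L x"
begin

lemma meas_\<iota>[measurable]: "\<iota> \<in> borel_measurable borel"
  using lin by (intro borel_measurable_continuous_onI linear_continuous_on linear_conv_bounded_linear[THEN iffD1])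

lemma skew_convolve_measurable:
  assumes [measurable]: "B \<in> borel_measurable borel" "u \<in> borel_measurable borel"
  shows "skew_convolve \<iota> R \<theta> B u \<in> borel_measurable borel"
  unfolding skew_convolve_def[abs_def] by measurable

text \<open>Translating B by R \<iota> \<nu> multiplies its transform by a character whose pairing
  with \<xi> equals R times the pairing of \<nu> with L \<xi>. The modulation replaces L \<xi> by L
  \<xi> - \<theta>, and the integral over \<nu> is then a transform of u.\<close>

lemma fourier_skew_convolve:
  assumes B: "integrable lborel B" and u: "integrable lborel u"
  shows "fourier (skew_convolve \<iota> R \<theta> B u) \<xi> = fourier B \<xi> * fourier u (R *\<^sub>R (L \<xi> - \<theta>))"
proof -
  have [measurable]: "B \<in> borel_measurable borel" "u \<in> borel_measurable borel" using B u by auto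
  define h where "h = (\<lambda>\<nu> x. u \<nu> * cis (2 * pi * R * (\<nu> \<bullet> \<theta>)) * B (x - R *\<^sub>R \<iota> \<nu>) * cis (- 2 * pi * (x \<bullet> \<xi>)))"
  have hm: "(\<lambda>(\<nu>, x). h \<nu> x) \<in> borel_measurable (borel \<Otimes>\<^sub>M borel)" unfolding h_def by measurable
  have Bt: "integrable lborel (\<lambda>x. B (x - R *\<^sub>R \<iota> \<nu>))" for \<nu>
    using integrable_lborel_affine[OF B, of 1 "- R *\<^sub>R \<iota> \<nu>"] by (simp add: algebra_simps)
  have i: "integrable lborel (h \<nu>)" for \<nu>
    unfolding h_def by (intro integrable_cis_mult integrable_mult_right Bt) measurable
  have nb: "(LINT x|lborel. norm (h \<nu> x)) \<le> norm (u \<nu>) * (LINT x|lborel. norm (B x))" for \<nu>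
  proof -
    have "(LINT x|lborel. norm (h \<nu> x)) = norm (u \<nu>) * (LINT x|lborel. norm (B (- R *\<^sub>R \<iota> \<nu> + x)))"
      by (simp add: h_def norm_mult algebra_simps)
    also have "\<dots> = norm (u \<nu>) * (LINT x|lborel. norm (B x))"
      by (subst integral_lborel_translate[of "\<lambda>x. norm (B x)"]) auto
    finally show ?thesis by simp
  qed
  have inner: "(LINT x|lborel. h \<nu> x) = u \<nu> * cis (- 2 * pi * (\<nu> \<bullet> (R *\<^sub>R (L \<xi> - \<theta>)))) * fourier B \<xi>" for \<nu>
  proof -
    have "(LINT x|lborel. h \<nu> x) = (LINT x|lborel. h \<nu> (R *\<^sub>R \<iota> \<nu> + x))"
      by (subst integral_lborel_translate) (auto simp: h_def)
    also have "\<dots> = (LINT x|lborel. u \<nu> * cis (- 2 * pi * (\<nu> \<bullet> (R *\<^sub>R (L \<xi> - \<theta>)))) * (B x * cis (- 2 * pi * (x \<bullet> \<xi>))))"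
    proof (rule Bochner_Integration.integral_cong[OF refl])
      fix x
      have "cis (2 * pi * R * (\<nu> \<bullet> \<theta>)) * cis (- 2 * pi * ((R *\<^sub>R \<iota> \<nu> + x) \<bullet> \<xi>)) =
        cis (- 2 * pi * (\<nu> \<bullet> (R *\<^sub>R (L \<xi> - \<theta>)))) * cis (- 2 * pi * (x \<bullet> \<xi>))"
        unfolding cis_mult by (rule arg_cong[where f=cis]) (simp add: inner_add_left inner_diff_right adj algebra_simps)
      then show "h \<nu> (R *\<^sub>R \<iota> \<nu> + x) = u \<nu> * cis (- 2 * pi * (\<nu> \<bullet> (R *\<^sub>R (L \<xi> - \<theta>)))) * (B x * cis (- 2 * pi * (x \<bullet> \<xi>)))"
        by (simp add: h_def mult_ac)
    qed
    also have "\<dots> = u \<nu> * cis (- 2 * pi * (\<nu> \<bullet> (R *\<^sub>R (L \<xi> - \<theta>)))) * fourier B \<xi>"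
      by (simp only: integral_mult_right_zero fourier_def)
    finally show ?thesis .
  qed
  have "fourier (skew_convolve \<iota> R \<theta> B u) \<xi> = (LINT x|lborel. LINT \<nu>|lborel. h \<nu> x)"
    unfolding fourier_def skew_convolve_def h_def by (simp only: integral_mult_left_zero)
  also have "\<dots> = (LINT \<nu>|lborel. LINT x|lborel. h \<nu> x)"
    by (rule fubini_lborel(2)[OF hm i nb]) (use u in auto)
  also have "\<dots> = fourier u (R *\<^sub>R (L \<xi> - \<theta>)) * fourier B \<xi>"
    unfolding inner integral_mult_left_zero by (simp only: fourier_def)
  finally show ?thesis by (simp only: mult.commute)
qed

lemma bound_\<iota>: "\<exists>K\<ge>0. \<forall>\<nu>. norm (\<iota> \<nu>) \<le> K * norm \<nu>"
proof -
  obtain K where "K > 0" "\<And>\<nu>. norm (\<iota> \<nu>) \<le> K * norm \<nu>" using linear_bounded_pos[OF lin] by auto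
  then show ?thesis by (intro exI[of _ K]) auto
qed

lemma rapid_skew_convolve:
  assumes B: "rapid B" and u: "rapid u"
  shows "rapid (skew_convolve \<iota> R \<theta> B u)"
proof -
  have [measurable]: "B \<in> borel_measurable borel" "u \<in> borel_measurable borel" using B u by (auto simp: rapid_measurable)
  obtain K where K: "K \<ge> 0" "\<And>\<nu>. norm (\<iota> \<nu>) \<le> K * norm \<nu>" using bound_\<iota> by blast
  have "\<exists>C. \<forall>x. norm (skew_convolve \<iota> R \<theta> B u x) * (1 + norm x) ^ N \<le> C" for N
  proof -
    obtain C where C: "C > 0" "\<And>x. norm (B x) * (1 + norm x) ^ N \<le> C" using rapidE[OF B] by blast
    define D where "D = 1 + \<bar>R\<bar> * K"
    have D: "D \<ge> 1" using K by (simp add: D_def)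
    have ab: "\<bar>(1 + norm x) ^ N\<bar> = (1 + norm x) ^ N" for x :: 'a by simp
    have iu: "integrable lborel (\<lambda>\<nu>. (C * D ^ N) * ((1 + norm \<nu>) ^ N * norm (u \<nu>)))"
      by (intro integrable_mult_right rapid_integrable_weight u)
    have "norm (skew_convolve \<iota> R \<theta> B u x) * (1 + norm x) ^ N \<le> (LINT \<nu>|lborel. (C * D ^ N) * ((1 + norm \<nu>) ^ N * norm (u \<nu>)))" for x
    proof -
      have "norm (of_real ((1 + norm x) ^ N) * skew_convolve \<iota> R \<theta> B u x) \<le> (LINT \<nu>|lborel. (C * D ^ N) * ((1 + norm \<nu>) ^ N * norm (u \<nu>)))"
        unfolding skew_convolve_def integral_mult_right_zero[symmetric]
      proof (rule Bochner_Integration.integral_norm_bound_integral)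
        have b: "norm (of_real ((1 + norm x) ^ N) * (u \<nu> * cis (2 * pi * R * (\<nu> \<bullet> \<theta>)) * B (x - R *\<^sub>R \<iota> \<nu>))) \<le> (C * D ^ N) * ((1 + norm \<nu>) ^ N * norm (u \<nu>))" for \<nu>
        proof -
          have "1 + norm (R *\<^sub>R \<iota> \<nu>) \<le> D * (1 + norm \<nu>)"
          proof -
            have "norm (R *\<^sub>R \<iota> \<nu>) \<le> \<bar>R\<bar> * (K * norm \<nu>)" using K(2)[of \<nu>] by (simp add: mult_left_mono)
            then show ?thesis using K(1) by (simp add: D_def algebra_simps add_increasing)
          qed
          then have "1 + norm x \<le> (1 + norm (x - R *\<^sub>R \<iota> \<nu>)) * (D * (1 + norm \<nu>))"
            using one_plus_norm_split[of x "R *\<^sub>R \<iota> \<nu>"] by (meson add_nonneg_nonneg mult_left_mono norm_ge_zero order_trans zero_le_one)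
          then have "(1 + norm x) ^ N \<le> (1 + norm (x - R *\<^sub>R \<iota> \<nu>)) ^ N * (D ^ N * (1 + norm \<nu>) ^ N)"
            unfolding power_mult_distrib[symmetric] by (intro power_mono) auto
          then have "(1 + norm x) ^ N * (norm (u \<nu>) * norm (B (x - R *\<^sub>R \<iota> \<nu>))) \<le>
             ((1 + norm (x - R *\<^sub>R \<iota> \<nu>)) ^ N * (D ^ N * (1 + norm \<nu>) ^ N)) * (norm (u \<nu>) * norm (B (x - R *\<^sub>R \<iota> \<nu>)))"
            by (rule mult_right_mono) auto
          also have "\<dots> = (norm (B (x - R *\<^sub>R \<iota> \<nu>)) * (1 + norm (x - R *\<^sub>R \<iota> \<nu>)) ^ N) * (D ^ N * ((1 + norm \<nu>) ^ N * norm (u \<nu>)))"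
            by (simp only: mult_ac)
          also have "\<dots> \<le> C * (D ^ N * ((1 + norm \<nu>) ^ N * norm (u \<nu>)))"
            using D by (intro mult_right_mono C) auto
          finally show ?thesis by (simp only: norm_mult norm_of_real ab norm_cis mult_1_right mult_ac)
        qed
        then show "norm (of_real ((1 + norm x) ^ N) * (u \<nu> * cis (2 * pi * R * (\<nu> \<bullet> \<theta>)) * B (x - R *\<^sub>R \<iota> \<nu>))) \<le> (C * D ^ N) * ((1 + norm \<nu>) ^ N * norm (u \<nu>))" for \<nu> .
        show "integrable lborel (\<lambda>\<nu>. of_real ((1 + norm x) ^ N) * (u \<nu> * cis (2 * pi * R * (\<nu> \<bullet> \<theta>)) * B (x - R *\<^sub>R \<iota> \<nu>)))"
          by (rule Bochner_Integration.integrable_bound[OF iu]) (measurable, intro AE_I2 order_trans[OF b], simp)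
      qed (rule iu)
      then show ?thesis by (simp only: norm_mult norm_of_real ab mult.commute)
    qed
    then show ?thesis by blast
  qed
  then show ?thesis by (auto simp: rapid_def skew_convolve_measurable)
qed

lemma continuous_skew_convolve:
  assumes B: "rapid B" "continuous_on UNIV B" and u: "rapid u"
  shows "continuous_on UNIV (skew_convolve \<iota> R \<theta> B u)"
  unfolding continuous_on_sequentially
proof (intro ballI allI impI, elim conjE)
  fix \<xi> :: 'a and X :: "nat \<Rightarrow> 'a" assume X: "X \<longlonglongrightarrow> \<xi>"
  have [measurable]: "B \<in> borel_measurable borel" "u \<in> borel_measurable borel" using B u by (auto simp: rapid_measurable)
  obtain C where C: "\<And>x. norm (B x) \<le> C" using rapid_bounded[OF B(1)] by blast
  have "(\<lambda>n. LINT \<nu>|lborel. u \<nu> * cis (2 * pi * R * (\<nu> \<bullet> \<theta>)) * B (X n - R *\<^sub>R \<iota> \<nu>)) \<longlonglongrightarrow>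
    (LINT \<nu>|lborel. u \<nu> * cis (2 * pi * R * (\<nu> \<bullet> \<theta>)) * B (\<xi> - R *\<^sub>R \<iota> \<nu>))"
  proof (rule integral_dominated_convergence[where w="\<lambda>\<nu>. C * norm (u \<nu>)"])
    show "AE \<nu> in lborel. (\<lambda>n. u \<nu> * cis (2 * pi * R * (\<nu> \<bullet> \<theta>)) * B (X n - R *\<^sub>R \<iota> \<nu>)) \<longlonglongrightarrow> u \<nu> * cis (2 * pi * R * (\<nu> \<bullet> \<theta>)) * B (\<xi> - R *\<^sub>R \<iota> \<nu>)"
      using B(2) by (intro AE_I2 tendsto_intros continuous_on_tendsto_compose[of UNIV B] X) auto
    show "integrable lborel (\<lambda>\<nu>. C * norm (u \<nu>))" using rapid_integrable[OF u] by simp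
    show "AE \<nu> in lborel. norm (u \<nu> * cis (2 * pi * R * (\<nu> \<bullet> \<theta>)) * B (X n - R *\<^sub>R \<iota> \<nu>)) \<le> C * norm (u \<nu>)" for n
      by (intro AE_I2) (simp add: norm_mult mult.commute[of C] mult_left_mono C)
  qed measurable
  then show "(skew_convolve \<iota> R \<theta> B u \<circ> X) \<longlonglongrightarrow> skew_convolve \<iota> R \<theta> B u \<xi>" by (simp add: skew_convolve_def o_def)
qed

text \<open>The product rule seen before the Fourier transform, from x = (x - R \<iota> \<nu>) + R
  \<iota> \<nu>. The term in which u is differentiated costs a factor R and disappears if L c = 0.
  Hence only the coordinates in J produce powers of R.\<close>

lemma skew_convolve_inner_mult:
  assumes B: "rapid B" and u: "rapid u"
  shows "of_real (x \<bullet> c) * skew_convolve \<iota> R \<theta> B u x =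
    skew_convolve \<iota> R \<theta> (\<lambda>x. of_real (x \<bullet> c) * B x) u x + of_real R * skew_convolve \<iota> R \<theta> B (\<lambda>\<nu>. of_real (\<nu> \<bullet> L c) * u \<nu>) x"
proof -
  have m[measurable]: "B \<in> borel_measurable borel" "u \<in> borel_measurable borel" using B u by (auto simp: rapid_measurable)
  have i: "integrable lborel (\<lambda>\<nu>. u \<nu> * cis (2 * pi * R * (\<nu> \<bullet> \<theta>)) * B (x - R *\<^sub>R \<iota> \<nu>))" if Bu: "rapid B" "rapid u" for B u
  proof -
    have m[measurable]: "B \<in> borel_measurable borel" "u \<in> borel_measurable borel" using Bu by (auto simp: rapid_measurable)
    obtain C where C: "\<And>x. norm (B x) \<le> C" using rapid_bounded[OF Bu(1)] by blast
    show ?thesis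
    proof (rule Bochner_Integration.integrable_bound)
      show "integrable lborel (\<lambda>\<nu>. C * norm (u \<nu>))" using rapid_integrable[OF Bu(2)] by simp
      show "AE \<nu> in lborel. norm (u \<nu> * cis (2 * pi * R * (\<nu> \<bullet> \<theta>)) * B (x - R *\<^sub>R \<iota> \<nu>)) \<le> norm (C * norm (u \<nu>))"
      proof (intro AE_I2)
        fix \<nu> show "norm (u \<nu> * cis (2 * pi * R * (\<nu> \<bullet> \<theta>)) * B (x - R *\<^sub>R \<iota> \<nu>)) \<le> norm (C * norm (u \<nu>))"
          using mult_left_mono[OF C[of "x - R *\<^sub>R \<iota> \<nu>"], of "norm (u \<nu>)"] by (simp add: norm_mult mult.commute[of C])
      qed
    qed measurable
  qed
  have "x \<bullet> c = (x - R *\<^sub>R \<iota> \<nu>) \<bullet> c + R * (\<nu> \<bullet> L c)" for \<nu> by (simp add: inner_diff_left adj)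
  then have o: "complex_of_real (x \<bullet> c) = of_real ((x - R *\<^sub>R \<iota> \<nu>) \<bullet> c) + of_real R * of_real (\<nu> \<bullet> L c)" for \<nu>
    by (simp only: of_real_add[symmetric] of_real_mult[symmetric])
  have "of_real (x \<bullet> c) * (u \<nu> * cis (2 * pi * R * (\<nu> \<bullet> \<theta>)) * B (x - R *\<^sub>R \<iota> \<nu>)) =
     u \<nu> * cis (2 * pi * R * (\<nu> \<bullet> \<theta>)) * (of_real ((x - R *\<^sub>R \<iota> \<nu>) \<bullet> c) * B (x - R *\<^sub>R \<iota> \<nu>)) +
     of_real R * ((of_real (\<nu> \<bullet> L c) * u \<nu>) * cis (2 * pi * R * (\<nu> \<bullet> \<theta>)) * B (x - R *\<^sub>R \<iota> \<nu>))" for \<nu>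
    by (subst o[of \<nu>]) (simp only: distrib_right distrib_left mult_ac)
  then show ?thesis unfolding skew_convolve_def integral_mult_right_zero[symmetric]
    by (subst Bochner_Integration.integral_add[symmetric])
       (use i[OF rapid_inner_mult[OF B] u] i[OF B rapid_inner_mult[OF u]] in \<open>auto intro!: Bochner_Integration.integral_cong integrable_mult_right\<close>)
qed

end

section \<open>Schwartz functions\<close>

abbreviation pd :: "'a::euclidean_space \<Rightarrow> ('a \<Rightarrow> complex) \<Rightarrow> 'a \<Rightarrow> complex" where
  "pd v f \<equiv> (\<lambda>x. frechet_derivative f (at x) v)"

lemma iter_deriv_append: "iter_deriv (vs @ ws) f = iter_deriv vs (iter_deriv ws f)"
  by (induction vs) auto

lemma pd_eqI: "(\<And>x. (f has_derivative f' x) (at x)) \<Longrightarrow> pd v f = (\<lambda>x. f' x v)"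
  by (rule ext) (metis frechet_derivative_at)

lemma differentiableI_all: "(\<And>x. (f has_derivative f' x) (at x)) \<Longrightarrow> \<forall>x. f differentiable (at x)"
  by (auto simp: differentiable_def)

lemma has_derivative_pd: "f differentiable (at x) \<Longrightarrow> (f has_derivative frechet_derivative f (at x)) (at x)"
  by (simp add: frechet_derivative_works)

lemma bounded_weight_iff:
  fixes h :: "'a::euclidean_space \<Rightarrow> complex"
  shows "bounded (range (\<lambda>x. (1 + norm x) ^ N *\<^sub>R h x)) \<longleftrightarrow> (\<exists>C. \<forall>x. norm (h x) * (1 + norm x) ^ N \<le> C)"
  by (auto simp: bounded_iff mult.commute)

text \<open>Higher derivatives need no formulas: it is enough to exhibit a class of differentiable,
  rapidly decreasing functions that contains f and is closed under partial derivatives.\<close>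

lemma schwartzI_closed:
  assumes "S f" and d: "\<And>g. S g \<Longrightarrow> \<forall>x. g differentiable (at x)"
    and p: "\<And>g v. S g \<Longrightarrow> v \<in> Basis \<Longrightarrow> S (pd v g)"
    and b: "\<And>g N. S g \<Longrightarrow> \<exists>C. \<forall>x. norm (g x) * (1 + norm x) ^ N \<le> C"
  shows "schwartz f"
proof -
  have "S (iter_deriv vs f)" if "set vs \<subseteq> Basis" for vs
    using that by (induction vs) (auto simp: assms(1) intro: p)
  then show ?thesis unfolding schwartz_def bounded_weight_iff using d b by blast
qed

lemma schwartz_differentiable: "schwartz f \<Longrightarrow> f differentiable (at x)"
  unfolding schwartz_def by (metis empty_set empty_subsetI iter_deriv.simps(1))

lemma schwartz_pd: "schwartz f \<Longrightarrow> v \<in> Basis \<Longrightarrow> schwartz (pd v f)"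
  unfolding schwartz_def
proof (intro allI impI)
  fix vs :: "'a list"
  assume a: "\<forall>vs. set vs \<subseteq> Basis \<longrightarrow>
          (\<forall>x. iter_deriv vs f differentiable at x) \<and>
          (\<forall>N. bounded (range (\<lambda>x. (1 + norm x) ^ N *\<^sub>R iter_deriv vs f x)))"
    and v: "v \<in> Basis" "set vs \<subseteq> Basis"
  have "iter_deriv vs (pd v f) = iter_deriv (vs @ [v]) f" by (simp add: iter_deriv_append)
  then show "(\<forall>x. iter_deriv vs (pd v f) differentiable at x) \<and>
     (\<forall>N. bounded (range (\<lambda>x. (1 + norm x) ^ N *\<^sub>R iter_deriv vs (pd v f) x)))"
    using a[rule_format, of "vs @ [v]"] v by simp
qed

lemma schwartz_continuous: "schwartz f \<Longrightarrow> continuous_on A f"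
  by (meson continuous_at_imp_continuous_on differentiable_imp_continuous_within schwartz_differentiable)

lemma schwartz_bound: "schwartz f \<Longrightarrow> \<exists>C. \<forall>x. norm (f x) * (1 + norm x) ^ N \<le> C"
  unfolding schwartz_def bounded_weight_iff by (metis empty_set empty_subsetI iter_deriv.simps(1))

lemma schwartz_rapid: "schwartz f \<Longrightarrow> rapid f"
  unfolding rapid_def using schwartz_bound schwartz_continuous borel_measurable_continuous_onI by blast

text \<open>The multipliers of Schwartz space: smooth functions all of whose derivatives grow at
  most polynomially. Coordinates, characters and Schwartz functions are instances.\<close>

definition moderate :: "('a::euclidean_space \<Rightarrow> complex) \<Rightarrow> bool" where
  "moderate g \<longleftrightarrow> (\<forall>vs. set vs \<subseteq> Basis \<longrightarrow> (\<forall>x. iter_deriv vs g differentiable (at x)) \<and>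
     (\<exists>N C. \<forall>x. norm (iter_deriv vs g x) \<le> C * (1 + norm x) ^ N))"

lemma moderateI_closed:
  assumes "S f" and d: "\<And>g. S g \<Longrightarrow> \<forall>x. g differentiable (at x)"
    and p: "\<And>g v. S g \<Longrightarrow> v \<in> Basis \<Longrightarrow> S (pd v g)"
    and b: "\<And>g. S g \<Longrightarrow> \<exists>N C. \<forall>x. norm (g x) \<le> C * (1 + norm x) ^ N"
  shows "moderate f"
proof -
  have "S (iter_deriv vs f)" if "set vs \<subseteq> Basis" for vs
    using that by (induction vs) (auto simp: assms(1) intro: p)
  then show ?thesis unfolding moderate_def using d b by blast
qed

lemma moderate_differentiable: "moderate f \<Longrightarrow> f differentiable (at x)"
  unfolding moderate_def by (metis empty_set empty_subsetI iter_deriv.simps(1))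

lemma moderate_bound: "moderate f \<Longrightarrow> \<exists>N C. \<forall>x. norm (f x) \<le> C * (1 + norm x) ^ N"
  unfolding moderate_def by (metis empty_set empty_subsetI iter_deriv.simps(1))

lemma moderate_pd: "moderate f \<Longrightarrow> v \<in> Basis \<Longrightarrow> moderate (pd v f)"
  unfolding moderate_def
proof (intro allI impI)
  fix vs :: "'a list"
  assume a: "\<forall>vs. set vs \<subseteq> Basis \<longrightarrow> (\<forall>x. iter_deriv vs f differentiable (at x)) \<and>
     (\<exists>N C. \<forall>x. norm (iter_deriv vs f x) \<le> C * (1 + norm x) ^ N)"
    and v: "v \<in> Basis" "set vs \<subseteq> Basis"
  have "iter_deriv vs (pd v f) = iter_deriv (vs @ [v]) f" by (simp add: iter_deriv_append)
  then show "(\<forall>x. iter_deriv vs (pd v f) differentiable (at x)) \<and>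
     (\<exists>N C. \<forall>x. norm (iter_deriv vs (pd v f) x) \<le> C * (1 + norm x) ^ N)"
    using a[rule_format, of "vs @ [v]"] v by simp
qed

text \<open>The closed class for the Leibniz rule: a derivative of a product is a sum of two
  products of the same kind. It serves as S in \<open>schwartzI_closed\<close>.\<close>

inductive product_span :: "('a::euclidean_space \<Rightarrow> complex) \<Rightarrow> bool" where
  prod: "moderate g \<Longrightarrow> schwartz f \<Longrightarrow> product_span (\<lambda>x. g x * f x)"
| add: "product_span h \<Longrightarrow> product_span k \<Longrightarrow> product_span (\<lambda>x. h x + k x)"

lemma pd_add:
  assumes "\<forall>x. f differentiable (at x)" "\<forall>x. g differentiable (at x)"
  shows "\<forall>x. (\<lambda>x. f x + g x) differentiable (at x)" "pd v (\<lambda>x. f x + g x) = (\<lambda>x. pd v f x + pd v g x)"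
proof -
  have "((\<lambda>x. f x + g x) has_derivative (\<lambda>h. frechet_derivative f (at x) h + frechet_derivative g (at x) h)) (at x)" for x
    using assms by (intro has_derivative_add has_derivative_pd) auto
  then show "\<forall>x. (\<lambda>x. f x + g x) differentiable (at x)" "pd v (\<lambda>x. f x + g x) = (\<lambda>x. pd v f x + pd v g x)"
    by (rule differentiableI_all, rule pd_eqI)
qed

lemma pd_mult:
  fixes f g :: "'a::euclidean_space \<Rightarrow> complex"
  assumes "\<forall>x. f differentiable (at x)" "\<forall>x. g differentiable (at x)"
  shows "\<forall>x. (\<lambda>x. f x * g x) differentiable (at x)" "pd v (\<lambda>x. f x * g x) = (\<lambda>x. f x * pd v g x + pd v f x * g x)"
proof -
  have "((\<lambda>x. f x * g x) has_derivative (\<lambda>h. f x * frechet_derivative g (at x) h + frechet_derivative f (at x) h * g x)) (at x)" for x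
    using assms by (intro has_derivative_mult has_derivative_pd) auto
  then show "\<forall>x. (\<lambda>x. f x * g x) differentiable (at x)" "pd v (\<lambda>x. f x * g x) = (\<lambda>x. f x * pd v g x + pd v f x * g x)"
    by (rule differentiableI_all, rule pd_eqI)
qed

lemma schwartz_bound_add:
  fixes f g :: "'a::euclidean_space \<Rightarrow> complex"
  assumes "\<exists>C. \<forall>x. norm (f x) * (1 + norm x) ^ N \<le> C" "\<exists>C. \<forall>x. norm (g x) * (1 + norm x) ^ N \<le> C"
  shows "\<exists>C. \<forall>x. norm (f x + g x) * (1 + norm x) ^ N \<le> C"
proof -
  obtain C D where C: "\<And>x. norm (f x) * (1 + norm x) ^ N \<le> C" and D: "\<And>x. norm (g x) * (1 + norm x) ^ N \<le> D"
    using assms by blast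
  have "norm (f x + g x) * (1 + norm x) ^ N \<le> C + D" for x
  proof -
    have "norm (f x + g x) * (1 + norm x) ^ N \<le> (norm (f x) + norm (g x)) * (1 + norm x) ^ N"
      by (intro mult_right_mono norm_triangle_ineq) auto
    then show ?thesis using C[of x] D[of x] by (simp add: algebra_simps)
  qed
  then show ?thesis by blast
qed

lemma schwartz_moderate_mult:
  fixes f g :: "'a::euclidean_space \<Rightarrow> complex"
  assumes g: "moderate g" and f: "schwartz f" shows "schwartz (\<lambda>x. g x * f x)"
proof (rule schwartzI_closed[where S=product_span])
  show "product_span (\<lambda>x. g x * f x)" using g f by (rule product_span.prod)
  have dp: "(\<forall>x. g differentiable (at x)) \<and> (\<forall>v\<in>Basis. product_span (pd v g)) \<and> (\<forall>N. \<exists>C. \<forall>x. norm (g x) * (1 + norm x) ^ N \<le> C)"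
    if "product_span g" for g :: "'a \<Rightarrow> complex"
    using that
  proof induction
    case (prod g f)
    have gd: "\<forall>x. g differentiable (at x)" using moderate_differentiable[OF prod(1)] by blast
    have fd: "\<forall>x. f differentiable (at x)" using schwartz_differentiable[OF prod(2)] by blast
    have "product_span (pd v (\<lambda>x. g x * f x))" if "v \<in> Basis" for v
      unfolding pd_mult(2)[OF gd fd]
      by (intro product_span.add product_span.prod prod moderate_pd schwartz_pd that)
    moreover have "\<exists>C. \<forall>x. norm (g x * f x) * (1 + norm x) ^ N \<le> C" for N
    proof -
      obtain M C where C: "\<And>x. norm (g x) \<le> C * (1 + norm x) ^ M" using moderate_bound[OF prod(1)] by blast
      obtain D where D: "\<And>x. norm (f x) * (1 + norm x) ^ (M + N) \<le> D" using schwartz_bound[OF prod(2)] by blast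
      have C0: "C \<ge> 0" using order_trans[OF norm_ge_zero C[of 0]] by simp
      have "norm (g x * f x) * (1 + norm x) ^ N \<le> C * D" for x
      proof -
        have "norm (g x) * (norm (f x) * (1 + norm x) ^ N) \<le> (C * (1 + norm x) ^ M) * (norm (f x) * (1 + norm x) ^ N)"
          by (intro mult_right_mono C) auto
        also have "\<dots> = C * (norm (f x) * (1 + norm x) ^ (M + N))" by (simp add: power_add mult_ac)
        also have "\<dots> \<le> C * D" by (intro mult_left_mono D C0)
        finally show ?thesis by (simp add: norm_mult mult_ac)
      qed
      then show ?thesis by blast
    qed
    ultimately show ?case using pd_mult(1)[OF gd fd] by blast
  next
    case (add h k)
    then have hd: "\<forall>x. h differentiable (at x)" and kd: "\<forall>x. k differentiable (at x)" by auto
    have "product_span (pd v (\<lambda>x. h x + k x))" if "v \<in> Basis" for v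
      unfolding pd_add(2)[OF hd kd] using add that by (intro product_span.add) auto
    moreover have "\<exists>C. \<forall>x. norm (h x + k x) * (1 + norm x) ^ N \<le> C" for N
      using add by (intro schwartz_bound_add) auto
    ultimately show ?case using pd_add(1)[OF hd kd] by blast
  qed
  show "\<forall>x. g differentiable (at x)" if "product_span g" for g :: "'a \<Rightarrow> complex" using dp[OF that] by blast
  show "product_span (pd v g)" if "product_span g" "v \<in> Basis" for g :: "'a \<Rightarrow> complex" and v using dp[OF that(1)] that(2) by blast
  show "\<exists>C. \<forall>x. norm (g x) * (1 + norm x) ^ N \<le> C" if "product_span g" for g :: "'a \<Rightarrow> complex" and N using dp[OF that] by blast
qed

lemma schwartz_add:
  assumes "schwartz f" "schwartz g" shows "schwartz (\<lambda>x. f x + g x)"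
proof (rule schwartzI_closed[where S="\<lambda>h. \<exists>f g. schwartz f \<and> schwartz g \<and> h = (\<lambda>x. f x + g x)"])
  show "\<exists>f' g'. schwartz f' \<and> schwartz g' \<and> (\<lambda>x. f x + g x) = (\<lambda>x. f' x + g' x)" using assms by blast
next
  fix h :: "'a \<Rightarrow> complex" assume "\<exists>f g. schwartz f \<and> schwartz g \<and> h = (\<lambda>x. f x + g x)"
  then obtain f g where fg: "schwartz f" "schwartz g" and h: "h = (\<lambda>x. f x + g x)" by blast
  have fd: "\<forall>x. f differentiable (at x)" and gd: "\<forall>x. g differentiable (at x)"
    using fg schwartz_differentiable by blast+
  show "\<forall>x. h differentiable (at x)" unfolding h by (rule pd_add(1)[OF fd gd])
  show "\<exists>f g. schwartz f \<and> schwartz g \<and> pd v h = (\<lambda>x. f x + g x)" if v: "v \<in> Basis" for v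
    unfolding h pd_add(2)[OF fd gd] using schwartz_pd[OF fg(1) v] schwartz_pd[OF fg(2) v] by blast
  show "\<exists>C. \<forall>x. norm (h x) * (1 + norm x) ^ N \<le> C" for N
    unfolding h by (intro schwartz_bound_add schwartz_bound fg)
qed

lemma moderate_const: "moderate (\<lambda>_. c)"
proof (rule moderateI_closed[where S="\<lambda>g. \<exists>c. g = (\<lambda>_. c)"])
  fix g :: "'a \<Rightarrow> complex" assume "\<exists>c. g = (\<lambda>_. c)"
  then obtain c where g: "g = (\<lambda>_. c)" by blast
  have h: "(g has_derivative (\<lambda>_. 0)) (at x)" for x unfolding g by (rule has_derivative_const)
  then show "\<forall>x. g differentiable (at x)" by (rule differentiableI_all)
  show "\<exists>c. pd v g = (\<lambda>_. c)" for v using pd_eqI[OF h] by auto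
  show "\<exists>N C. \<forall>x. norm (g x) \<le> C * (1 + norm x) ^ N" unfolding g by (intro exI[of _ 0] exI[of _ "norm c"]) simp
qed blast

lemma schwartz_cmult: "schwartz f \<Longrightarrow> schwartz (\<lambda>x. c * f x)"
  by (rule schwartz_moderate_mult[OF moderate_const])

lemma schwartz_sum:
  assumes "finite A" "A \<noteq> {}" "\<And>a. a \<in> A \<Longrightarrow> schwartz (f a)" shows "schwartz (\<lambda>x. \<Sum>a\<in>A. f a x)"
  using assms by (induction rule: finite_ne_induct) (auto intro!: schwartz_add)

lemma moderate_inner: "moderate (\<lambda>x. of_real (x \<bullet> c))"
proof (rule moderateI_closed[where S="\<lambda>g. (\<exists>c. g = (\<lambda>_. c)) \<or> (\<exists>c. g = (\<lambda>x. of_real (x \<bullet> c)))"])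
  fix g :: "'a \<Rightarrow> complex" assume g: "(\<exists>c. g = (\<lambda>_. c)) \<or> (\<exists>c. g = (\<lambda>x. of_real (x \<bullet> c)))"
  have a: "\<exists>k. \<forall>x. (g has_derivative k) (at x)"
    using g
  proof
    assume "\<exists>c. g = (\<lambda>x. of_real (x \<bullet> c))"
    then obtain c where g: "g = (\<lambda>x. of_real (x \<bullet> c))" by blast
    have "(g has_derivative (\<lambda>h. of_real (h \<bullet> c))) (at x)" for x unfolding g by (intro derivative_intros)
    then show ?thesis by blast
  qed (auto intro!: exI[of _ "\<lambda>_. 0"])
  then obtain k where k: "\<And>x. (g has_derivative k) (at x)" by blast
  then show "\<forall>x. g differentiable (at x)" by (rule differentiableI_all)
  show "(\<exists>c. pd v g = (\<lambda>_. c)) \<or> (\<exists>c. pd v g = (\<lambda>x. of_real (x \<bullet> c)))" for v using pd_eqI[OF k] by blast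
  show "\<exists>N C. \<forall>x. norm (g x) \<le> C * (1 + norm x) ^ N"
    using g
  proof
    assume "\<exists>c. g = (\<lambda>x. of_real (x \<bullet> c))"
    then obtain c where g: "g = (\<lambda>x. of_real (x \<bullet> c))" by blast
    have "\<bar>x \<bullet> c\<bar> \<le> norm c * (1 + norm x) ^ 1" for x
      using Cauchy_Schwarz_ineq2[of x c] by (simp add: algebra_simps add_increasing)
    then show ?thesis unfolding g by (intro exI[of _ 1] exI[of _ "norm c"]) simp
  next
    assume "\<exists>c. g = (\<lambda>_. c)"
    then obtain c where "g = (\<lambda>_. c)" by blast
    then show ?thesis by (intro exI[of _ 0] exI[of _ "norm c"]) simp
  qed
qed blast

lemma schwartz_inner_mult: "schwartz f \<Longrightarrow> schwartz (\<lambda>x. of_real (x \<bullet> c) * f x)"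
  by (rule schwartz_moderate_mult[OF moderate_inner])

lemma moderate_cis: "moderate (\<lambda>x. cis (2 * pi * (x \<bullet> e)))"
proof (rule moderateI_closed[where S="\<lambda>g. \<exists>c. g = (\<lambda>x. c * cis (2 * pi * (x \<bullet> e)))"])
  show "\<exists>c. (\<lambda>x. cis (2 * pi * (x \<bullet> e))) = (\<lambda>x. c * cis (2 * pi * (x \<bullet> e)))" by (intro exI[of _ 1]) simp
  fix g :: "'a \<Rightarrow> complex" assume "\<exists>c. g = (\<lambda>x. c * cis (2 * pi * (x \<bullet> e)))"
  then obtain c where g: "g = (\<lambda>x. c * cis (2 * pi * (x \<bullet> e)))" by blast
  have h: "(g has_derivative (\<lambda>h. (c * (\<i> * of_real (2 * pi * (h \<bullet> e)))) * cis (2 * pi * (x \<bullet> e)))) (at x)" for x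
  proof -
    have "((\<lambda>x. \<i> * of_real (2 * pi * (x \<bullet> e))) has_derivative (\<lambda>h. \<i> * of_real (2 * pi * (h \<bullet> e)))) (at x)"
      by (intro derivative_intros)
    moreover have "(exp has_derivative (*) (exp z)) (at z)" for z :: complex
      using DERIV_exp[of z] by (simp add: has_field_derivative_def)
    ultimately have "((\<lambda>x. exp (\<i> * of_real (2 * pi * (x \<bullet> e)))) has_derivative (\<lambda>h. exp (\<i> * of_real (2 * pi * (x \<bullet> e))) * (\<i> * of_real (2 * pi * (h \<bullet> e))))) (at x)"
      by (rule has_derivative_compose)
    then have "((\<lambda>x. c * exp (\<i> * of_real (2 * pi * (x \<bullet> e)))) has_derivative (\<lambda>h. c * (exp (\<i> * of_real (2 * pi * (x \<bullet> e))) * (\<i> * of_real (2 * pi * (h \<bullet> e)))))) (at x)"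
      by (rule has_derivative_mult_right)
    then show ?thesis unfolding g cis_conv_exp by (simp only: mult_ac)
  qed
  then show "\<forall>x. g differentiable (at x)" by (rule differentiableI_all)
  show "\<exists>c. pd v g = (\<lambda>x. c * cis (2 * pi * (x \<bullet> e)))" for v using pd_eqI[OF h] by blast
  show "\<exists>N C. \<forall>x. norm (g x) \<le> C * (1 + norm x) ^ N" unfolding g by (intro exI[of _ 0] exI[of _ "norm c"]) (simp add: norm_mult)
qed

lemma schwartz_moderate: "schwartz f \<Longrightarrow> moderate f"
proof (rule moderateI_closed[where S=schwartz])
  fix g :: "'a \<Rightarrow> complex" assume g: "schwartz g"
  show "\<forall>x. g differentiable (at x)" using schwartz_differentiable[OF g] by blast
  show "schwartz (pd v g)" if "v \<in> Basis" for v using g that by (rule schwartz_pd)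
  show "\<exists>N C. \<forall>x. norm (g x) \<le> C * (1 + norm x) ^ N"
  proof -
    obtain C where "\<And>x. norm (g x) * (1 + norm x) ^ 0 \<le> C" using schwartz_bound[OF g] by blast
    then show ?thesis by (intro exI[of _ 0] exI[of _ C]) simp
  qed
qed

lemma schwartz_cnj: "schwartz f \<Longrightarrow> schwartz (\<lambda>x. cnj (f x))"
proof (rule schwartzI_closed[where S="\<lambda>h. \<exists>f. schwartz f \<and> h = (\<lambda>x. cnj (f x))"])
  fix h :: "'a \<Rightarrow> complex" assume "\<exists>f. schwartz f \<and> h = (\<lambda>x. cnj (f x))"
  then obtain f where f: "schwartz f" and h: "h = (\<lambda>x. cnj (f x))" by blast
  have d: "(h has_derivative (\<lambda>v. cnj (frechet_derivative f (at x) v))) (at x)" for x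
    unfolding h by (intro bounded_linear.has_derivative[OF bounded_linear_cnj] has_derivative_pd schwartz_differentiable f)
  then show "\<forall>x. h differentiable (at x)" by (rule differentiableI_all)
  show "\<exists>f. schwartz f \<and> pd v h = (\<lambda>x. cnj (f x))" if "v \<in> Basis" for v
    using pd_eqI[OF d] schwartz_pd[OF f that] by blast
  show "\<exists>C. \<forall>x. norm (h x) * (1 + norm x) ^ N \<le> C" for N unfolding h using schwartz_bound[OF f] by simp
qed blast

text \<open>Since \<iota> sends basis vectors to basis vectors, a partial derivative of the
  composite is \<delta> times a partial derivative of f in the same affine argument, so the class of
  composites is closed. The norm condition transfers decay. Applied to slices of \<Psi> along one
  component and to translations.\<close>

lemma schwartz_affine:
  fixes f :: "'a::euclidean_space \<Rightarrow> complex" and \<iota> :: "'b::euclidean_space \<Rightarrow> 'a"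
  assumes f: "schwartz f" and lin: "linear \<iota>" and B: "\<And>b. b \<in> Basis \<Longrightarrow> \<iota> b \<in> Basis"
    and iso: "\<And>x. norm (\<iota> x) = norm x" and \<delta>: "\<delta> > 0"
  shows "schwartz (\<lambda>x. f (a + \<delta> *\<^sub>R \<iota> x))"
proof (rule schwartzI_closed[where S="\<lambda>h. \<exists>g. schwartz g \<and> h = (\<lambda>x. g (a + \<delta> *\<^sub>R \<iota> x))"])
  fix h :: "'b \<Rightarrow> complex" assume "\<exists>g. schwartz g \<and> h = (\<lambda>x. g (a + \<delta> *\<^sub>R \<iota> x))"
  then obtain g where g: "schwartz g" and h: "h = (\<lambda>x. g (a + \<delta> *\<^sub>R \<iota> x))" by blast
  have bl: "bounded_linear \<iota>" using lin by (simp add: linear_conv_bounded_linear)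
  have d: "(h has_derivative (\<lambda>v. frechet_derivative g (at (a + \<delta> *\<^sub>R \<iota> x)) (\<delta> *\<^sub>R \<iota> v))) (at x)" for x
  proof -
    have "((\<lambda>x. a + \<delta> *\<^sub>R \<iota> x) has_derivative (\<lambda>v. \<delta> *\<^sub>R \<iota> v)) (at x)"
      by (auto intro!: derivative_eq_intros bounded_linear.has_derivative[OF bl])
    then show ?thesis unfolding h
      by (rule has_derivative_compose[of _ _ _ _ g]) (intro has_derivative_pd schwartz_differentiable g)
  qed
  then show "\<forall>x. h differentiable (at x)" by (rule differentiableI_all)
  show "\<exists>g. schwartz g \<and> pd v h = (\<lambda>x. g (a + \<delta> *\<^sub>R \<iota> x))" if v: "v \<in> Basis" for v
  proof -
    have "linear (frechet_derivative g (at y))" for y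
      using schwartz_differentiable[OF g] by (rule linear_frechet_derivative)
    then have "pd v h = (\<lambda>x. of_real \<delta> * pd (\<iota> v) g (a + \<delta> *\<^sub>R \<iota> x))"
      unfolding pd_eqI[OF d] by (simp add: linear_cmul scaleR_conv_of_real)
    then show ?thesis using schwartz_cmult[OF schwartz_pd[OF g B[OF v]], of "of_real \<delta>"]
      by (intro exI[of _ "\<lambda>y. of_real \<delta> * pd (\<iota> v) g y"]) simp
  qed
  show "\<exists>C. \<forall>x. norm (h x) * (1 + norm x) ^ N \<le> C" for N
  proof -
    obtain C where C: "\<And>x. norm (g x) * (1 + norm x) ^ N \<le> C" using schwartz_bound[OF g] by blast
    define D where "D = 1 + (1 + norm a) / \<delta>"
    have D: "D \<ge> 1" using \<delta> by (simp add: D_def)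
    have "norm (h x) * (1 + norm x) ^ N \<le> D ^ N * C" for x
    proof -
      define y where "y = a + \<delta> *\<^sub>R \<iota> x"
      have "\<delta> * norm x = norm (y - a)" using \<delta> iso by (simp add: y_def)
      also have "\<dots> \<le> norm y + norm a" by (rule norm_triangle_ineq4)
      also have "\<dots> \<le> (1 + norm a) * (1 + norm y)" by (simp add: algebra_simps)
      finally have "norm x \<le> (1 + norm a) / \<delta> * (1 + norm y)" using \<delta> by (simp add: field_simps)
      moreover have "D * (1 + norm y) = 1 + norm y + (1 + norm a) / \<delta> * (1 + norm y)" by (simp add: D_def distrib_right)
      ultimately have "1 + norm x \<le> D * (1 + norm y)" using norm_ge_zero[of y] by linarith
      then have "(1 + norm x) ^ N \<le> D ^ N * (1 + norm y) ^ N"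
        unfolding power_mult_distrib[symmetric] by (intro power_mono) auto
      then have "norm (g y) * (1 + norm x) ^ N \<le> norm (g y) * (D ^ N * (1 + norm y) ^ N)"
        by (rule mult_left_mono) simp
      also have "\<dots> = D ^ N * (norm (g y) * (1 + norm y) ^ N)" by (simp add: mult_ac)
      also have "\<dots> \<le> D ^ N * C" using D by (intro mult_left_mono C) auto
      finally show ?thesis by (simp add: h y_def)
    qed
    then show ?thesis by blast
  qed
qed (use f in blast)

lemma schwartz_translate: "schwartz f \<Longrightarrow> schwartz (\<lambda>x. f (a + x))"
  using schwartz_affine[of f "\<lambda>x. x" 1 a] by (simp add: linear_iff)

lemma fourier_pd:
  fixes f :: "'a::euclidean_space \<Rightarrow> complex"
  assumes f: "schwartz f" and v: "v \<in> Basis"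
  shows "fourier (pd v f) \<xi> = 2 * pi * \<i> * of_real (v \<bullet> \<xi>) * fourier f \<xi>"
proof -
  have sp: "schwartz (pd v f)" using f v by (rule schwartz_pd)
  have intf: "integrable lborel f" "integrable lborel (pd v f)" using f sp by (auto intro: rapid_integrable schwartz_rapid)
  have [measurable]: "f \<in> borel_measurable borel" "pd v f \<in> borel_measurable borel" using intf by auto
  obtain C where C: "C > 0" "\<And>x. norm (pd v f x) * (1 + norm x) ^ (2 * DIM('a)) \<le> C"
    using rapidE[OF schwartz_rapid[OF sp]] by blast
  define t where "t = null_seq"
  have tp: "t n > 0" "t n \<noteq> 0" "t n \<le> 1" for n using null_seq_pos[of n] by (auto simp: t_def null_seq_def)
  have t0: "t \<longlonglongrightarrow> 0" by (simp add: t_def null_seq_lim)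
  have hd: "((\<lambda>s. f (x + s *\<^sub>R v)) has_vector_derivative pd v f (x + s *\<^sub>R v)) (at s)" for x s
  proof -
    have "linear (frechet_derivative f (at (x + s *\<^sub>R v)))"
      using schwartz_differentiable[OF f] by (rule linear_frechet_derivative)
    then have e: "(\<lambda>h. h *\<^sub>R pd v f (x + s *\<^sub>R v)) = (\<lambda>h. frechet_derivative f (at (x + s *\<^sub>R v)) (h *\<^sub>R v))"
      by (simp add: linear_cmul)
    show ?thesis unfolding has_vector_derivative_def e
      by (rule has_derivative_compose[of "\<lambda>s. x + s *\<^sub>R v" _ _ _ f])
         (auto intro!: derivative_eq_intros has_derivative_pd schwartz_differentiable f)
  qed
  define q where "q = (\<lambda>n x. (f (x + t n *\<^sub>R v) - f x) / of_real (t n) * cis (- 2 * pi * (x \<bullet> \<xi>)))"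
  \<comment> \<open>Dominated convergence for difference quotients. By the mean value inequality
    they are bounded by the derivative on a segment of length at most 1, where 1 + |x| \<le> 2 (1 +
    |x + s v|); this is the origin of the factor 2^(2 DIM).\<close>
  have lim1: "(\<lambda>n. LINT x|lborel. q n x) \<longlonglongrightarrow> (LINT x|lborel. pd v f x * cis (- 2 * pi * (x \<bullet> \<xi>)))"
  proof (rule integral_dominated_convergence[where w="\<lambda>x. (C * 2 ^ (2 * DIM('a))) * (1 / (1 + norm x) ^ (2 * DIM('a)))"])
    show "integrable lborel (\<lambda>x::'a. (C * 2 ^ (2 * DIM('a))) * (1 / (1 + norm x) ^ (2 * DIM('a))))"
      by (intro integrable_mult_right integrable_decay)
    show "AE x in lborel. (\<lambda>n. q n x) \<longlonglongrightarrow> pd v f x * cis (- 2 * pi * (x \<bullet> \<xi>))"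
    proof (intro AE_I2)
      fix x
      have "((\<lambda>s. (f (x + s *\<^sub>R v) - f x) /\<^sub>R s) \<longlongrightarrow> pd v f x) (at 0)"
        using hd[of x 0] unfolding has_vector_derivative_def has_derivative_iff_norm
      proof (elim conjE)
        assume "((\<lambda>y. norm (f (x + y *\<^sub>R v) - f (x + 0 *\<^sub>R v) - (y - 0) *\<^sub>R pd v f (x + 0 *\<^sub>R v)) / norm (y - 0)) \<longlongrightarrow> 0) (at 0)"
        then have "((\<lambda>y. norm ((f (x + y *\<^sub>R v) - f x) /\<^sub>R y - pd v f x)) \<longlongrightarrow> 0) (at 0)"
        proof (rule Lim_transform_eventually)
          show "\<forall>\<^sub>F y in at 0. norm (f (x + y *\<^sub>R v) - f (x + 0 *\<^sub>R v) - (y - 0) *\<^sub>R pd v f (x + 0 *\<^sub>R v)) / norm (y - 0) = norm ((f (x + y *\<^sub>R v) - f x) /\<^sub>R y - pd v f x)"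
          proof (rule eventually_at_topological[THEN iffD2], intro exI[of _ UNIV] conjI ballI impI open_UNIV UNIV_I)
            fix y :: real assume y: "y \<noteq> 0"
            have "(f (x + y *\<^sub>R v) - f x) /\<^sub>R y - pd v f x = (f (x + y *\<^sub>R v) - f x - y *\<^sub>R pd v f x) /\<^sub>R y"
              using y by (simp add: scaleR_diff_right)
            then show "norm (f (x + y *\<^sub>R v) - f (x + 0 *\<^sub>R v) - (y - 0) *\<^sub>R pd v f (x + 0 *\<^sub>R v)) / norm (y - 0) = norm ((f (x + y *\<^sub>R v) - f x) /\<^sub>R y - pd v f x)"
              by (simp add: divide_inverse mult.commute)
          qed
        qed
        then show ?thesis by (rule LIM_zero_cancel[OF tendsto_norm_zero_cancel])
      qed
      moreover have "filterlim t (at 0) sequentially" using t0 tp(2) by (intro filterlim_atI) auto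
      ultimately have "(\<lambda>n. (f (x + t n *\<^sub>R v) - f x) /\<^sub>R t n) \<longlonglongrightarrow> pd v f x" by (rule filterlim_compose)
      then have "(\<lambda>n. (f (x + t n *\<^sub>R v) - f x) / of_real (t n)) \<longlonglongrightarrow> pd v f x"
        by (simp add: scaleR_conv_of_real divide_inverse mult.commute)
      then show "(\<lambda>n. q n x) \<longlonglongrightarrow> pd v f x * cis (- 2 * pi * (x \<bullet> \<xi>))"
        unfolding q_def by (intro tendsto_intros)
    qed
    show "AE x in lborel. norm (q n x) \<le> (C * 2 ^ (2 * DIM('a))) * (1 / (1 + norm x) ^ (2 * DIM('a)))" for n
    proof (intro AE_I2)
      fix x :: 'a
      have db: "norm (pd v f (x + s *\<^sub>R v)) \<le> (C * 2 ^ (2 * DIM('a))) * (1 / (1 + norm x) ^ (2 * DIM('a)))" if s: "0 \<le> s" "s \<le> 1" for s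
      proof -
        have "norm (s *\<^sub>R v) \<le> 1" using s v by simp
        then have "norm x \<le> norm (x + s *\<^sub>R v) + 1" using norm_triangle_sub[of x "x + s *\<^sub>R v"] by simp
        moreover have "1 + p \<le> 2 * (1 + q)" if "p \<le> q + 1" "0 \<le> q" for p q :: real using that by simp
        ultimately have "1 + norm x \<le> 2 * (1 + norm (x + s *\<^sub>R v))" by (meson norm_ge_zero)
        then have "(1 + norm x) ^ (2 * DIM('a)) \<le> 2 ^ (2 * DIM('a)) * (1 + norm (x + s *\<^sub>R v)) ^ (2 * DIM('a))"
          unfolding power_mult_distrib[symmetric] by (intro power_mono) auto
        then have "norm (pd v f (x + s *\<^sub>R v)) * (1 + norm x) ^ (2 * DIM('a)) \<le> norm (pd v f (x + s *\<^sub>R v)) * (2 ^ (2 * DIM('a)) * (1 + norm (x + s *\<^sub>R v)) ^ (2 * DIM('a)))"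
          by (rule mult_left_mono) simp
        also have "\<dots> = 2 ^ (2 * DIM('a)) * (norm (pd v f (x + s *\<^sub>R v)) * (1 + norm (x + s *\<^sub>R v)) ^ (2 * DIM('a)))"
          by (simp only: mult_ac)
        also have "\<dots> \<le> 2 ^ (2 * DIM('a)) * C" by (intro mult_left_mono C) auto
        finally show ?thesis by (simp add: pos_le_divide_eq add_pos_nonneg mult.commute)
      qed
      have "norm (f (x + t n *\<^sub>R v) - f (x + 0 *\<^sub>R v)) \<le> ((C * 2 ^ (2 * DIM('a))) * (1 / (1 + norm x) ^ (2 * DIM('a)))) * norm (t n - 0)"
      proof (rule differentiable_bound[of "{0..1}" "\<lambda>s. f (x + s *\<^sub>R v)" "\<lambda>s h. h *\<^sub>R pd v f (x + s *\<^sub>R v)"])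
        show "((\<lambda>s. f (x + s *\<^sub>R v)) has_derivative (\<lambda>h. h *\<^sub>R pd v f (x + s *\<^sub>R v))) (at s within {0..1})" for s
          using hd[of x s] unfolding has_vector_derivative_def by (rule has_derivative_at_withinI)
        show "onorm (\<lambda>h. h *\<^sub>R pd v f (x + s *\<^sub>R v)) \<le> (C * 2 ^ (2 * DIM('a))) * (1 / (1 + norm x) ^ (2 * DIM('a)))" if "s \<in> {0..1}" for s
        proof (rule onorm_le)
          fix h :: real
          show "norm (h *\<^sub>R pd v f (x + s *\<^sub>R v)) \<le> (C * 2 ^ (2 * DIM('a))) * (1 / (1 + norm x) ^ (2 * DIM('a))) * norm h"
            using mult_right_mono[OF db[of s], of "norm h"] that by (simp only: norm_scaleR real_norm_def mult.commute atLeastAtMost_iff abs_ge_zero)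
        qed
      qed (use tp[of n] in auto)
      then show "norm (q n x) \<le> (C * 2 ^ (2 * DIM('a))) * (1 / (1 + norm x) ^ (2 * DIM('a)))"
        using tp[of n] by (simp add: q_def norm_mult norm_divide pos_divide_le_eq)
    qed
    show "q n \<in> borel_measurable lborel" for n unfolding q_def by measurable
  qed measurable
  \<comment> \<open>A translation by t v only multiplies the integral by a character, so the
    transform of the difference quotient is explicit and no integration by parts is needed.\<close>
  have int2: "(LINT x|lborel. q n x) = (cis (2 * pi * (v \<bullet> \<xi>) * t n) - 1) / of_real (t n) * fourier f \<xi>" for n
  proof -
    define g where "g = (\<lambda>x. f x * cis (- 2 * pi * (x \<bullet> \<xi>)))"
    have g: "integrable lborel g" unfolding g_def by (rule fourier_integrand[OF intf(1)])
    have [measurable]: "g \<in> borel_measurable borel" using g by auto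
    have gt: "integrable lborel (\<lambda>x. g (t n *\<^sub>R v + x))" using integrable_lborel_affine[OF g, of 1 "t n *\<^sub>R v"] by simp
    have "q n x = cis (2 * pi * (v \<bullet> \<xi>) * t n) / of_real (t n) * g (t n *\<^sub>R v + x) - 1 / of_real (t n) * g x" for x
    proof -
      have "cis (2 * pi * (v \<bullet> \<xi>) * t n) * cis (- 2 * pi * ((t n *\<^sub>R v + x) \<bullet> \<xi>)) = cis (- 2 * pi * (x \<bullet> \<xi>))"
        unfolding cis_mult by (rule arg_cong[where f=cis]) (simp add: inner_add_left algebra_simps)
      then have "cis (2 * pi * (v \<bullet> \<xi>) * t n) * g (t n *\<^sub>R v + x) = f (x + t n *\<^sub>R v) * cis (- 2 * pi * (x \<bullet> \<xi>))"
        by (simp add: g_def add.commute mult_ac)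
      then show ?thesis by (simp add: q_def g_def diff_divide_distrib left_diff_distrib)
    qed
    then have "(LINT x|lborel. q n x) = cis (2 * pi * (v \<bullet> \<xi>) * t n) / of_real (t n) * (LINT x|lborel. g (t n *\<^sub>R v + x)) - 1 / of_real (t n) * (LINT x|lborel. g x)"
      using g gt by simp
    also have "(LINT x|lborel. g (t n *\<^sub>R v + x)) = (LINT x|lborel. g x)" by (rule integral_lborel_translate) simp
    also have "(LINT x|lborel. g x) = fourier f \<xi>" by (simp add: g_def fourier_def)
    finally show ?thesis by (simp add: diff_divide_distrib left_diff_distrib)
  qed
  have lim2: "(\<lambda>n. (cis (a * t n) - 1) / of_real (t n)) \<longlonglongrightarrow> \<i> * of_real a" for a :: real
    unfolding t_def by (rule cis_diff_quotient_lim)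
  have "(\<lambda>n. LINT x|lborel. q n x) \<longlonglongrightarrow> (\<i> * of_real (2 * pi * (v \<bullet> \<xi>))) * fourier f \<xi>"
    unfolding int2 by (intro tendsto_intros lim2)
  then show ?thesis using LIMSEQ_unique[OF lim1] by (simp add: fourier_def mult_ac)
qed

text \<open>Induction on the weight, over all Schwartz functions at once: one more factor |\<xi>| is
  at most the sum of the |\<xi> \<bullet> b|, and each of these is absorbed into the transform of a
  partial derivative.\<close>

lemma schwartz_fourier_rapid:
  fixes f :: "'a::euclidean_space \<Rightarrow> complex"
  assumes f: "schwartz f" shows "rapid (fourier f)"
proof -
  have "\<forall>f::'a\<Rightarrow>complex. schwartz f \<longrightarrow> (\<exists>C. \<forall>\<xi>. norm (fourier f \<xi>) * (1 + norm \<xi>) ^ N \<le> C)" for N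
  proof (induction N)
    case 0
    show ?case using norm_fourier_le by (auto intro!: exI)
  next
    case (Suc N)
    show ?case
    proof (intro allI impI)
      fix f :: "'a \<Rightarrow> complex" assume f: "schwartz f"
      obtain C where C: "\<And>\<xi>. norm (fourier f \<xi>) * (1 + norm \<xi>) ^ N \<le> C" using Suc f by blast
      have "\<exists>D. \<forall>b\<in>Basis. \<forall>\<xi>. norm (fourier (pd b f) \<xi>) * (1 + norm \<xi>) ^ N \<le> D b"
        using Suc schwartz_pd[OF f] by (intro bchoice) blast
      then obtain D where D: "\<And>b \<xi>. b \<in> Basis \<Longrightarrow> norm (fourier (pd b f) \<xi>) * (1 + norm \<xi>) ^ N \<le> D b" by blast
      have "norm (fourier f \<xi>) * (1 + norm \<xi>) ^ Suc N \<le> C + (\<Sum>b\<in>Basis. D b)" for \<xi>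
      proof -
        define P where "P = norm (fourier f \<xi>) * (1 + norm \<xi>) ^ N"
        have P: "P \<ge> 0" by (simp add: P_def)
        have "\<bar>\<xi> \<bullet> b\<bar> * P \<le> D b" if b: "b \<in> Basis" for b
        proof -
          have "norm (fourier (pd b f) \<xi>) = 2 * pi * \<bar>\<xi> \<bullet> b\<bar> * norm (fourier f \<xi>)"
            unfolding fourier_pd[OF f b] by (simp add: norm_mult inner_commute)
          then have "2 * pi * (\<bar>\<xi> \<bullet> b\<bar> * P) \<le> D b" using D[OF b, of \<xi>] by (simp add: P_def mult_ac)
          moreover have "1 * (\<bar>\<xi> \<bullet> b\<bar> * P) \<le> 2 * pi * (\<bar>\<xi> \<bullet> b\<bar> * P)"
            using pi_ge_two P by (intro mult_right_mono) auto
          ultimately show ?thesis by simp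
        qed
        then have s: "(\<Sum>b\<in>Basis. \<bar>\<xi> \<bullet> b\<bar> * P) \<le> (\<Sum>b\<in>Basis. D b)" by (intro sum_mono) auto
        have "norm \<xi> * P \<le> (\<Sum>b\<in>Basis. \<bar>\<xi> \<bullet> b\<bar>) * P" by (intro mult_right_mono norm_le_l1 P)
        then have "norm \<xi> * P \<le> (\<Sum>b\<in>Basis. D b)" using s by (simp add: sum_distrib_right)
        moreover have "norm (fourier f \<xi>) * (1 + norm \<xi>) ^ Suc N = P + norm \<xi> * P" by (simp add: P_def algebra_simps)
        ultimately show ?thesis using C[of \<xi>] by (simp add: P_def)
      qed
      then show "\<exists>C. \<forall>\<xi>. norm (fourier f \<xi>) * (1 + norm \<xi>) ^ Suc N \<le> C" by blast
    qed
  qed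
  moreover have "fourier f \<in> borel_measurable borel" by (intro fourier_measurable rapid_integrable schwartz_rapid f)
  ultimately show ?thesis using f by (simp add: rapid_def)
qed

section \<open>Fourier multipliers on $L^r$\<close>

text \<open>The tangent line at A, from which both forms of Jensen's inequality below are obtained
  by averaging. The point x = 0 is separate because convexity is applied on the open half
  line.\<close>

lemma powr_above_tangent:
  fixes A x r :: real assumes A: "A > 0" and x: "x \<ge> 0" and r: "r \<ge> 1"
  shows "A powr r + r * A powr (r - 1) * (x - A) \<le> x powr r"
proof (cases "x = 0")
  case True
  have "A powr r = A powr (r - 1) * A" using A by (simp add: powr_diff)
  then have "A powr r + r * A powr (r - 1) * (x - A) = (1 - r) * A powr r" using True by (simp add: algebra_simps)
  also have "\<dots> \<le> 0" using r by (simp add: mult_nonpos_nonneg)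
  finally show ?thesis using True by simp
next
  case False
  have "r * A powr (r - 1) * (x - A) \<le> x powr r - A powr r"
  proof (rule convex_on_imp_above_tangent[where A="{0<..}"])
    show "convex_on {0<..} (\<lambda>x. x powr r)" using r by (rule powr_convex)
    show "((\<lambda>x. x powr r) has_real_derivative r * A powr (r - 1)) (at A within {0<..})"
      using has_real_derivative_powr[OF A] by (rule has_field_derivative_at_within)
    show "connected {0::real<..}" by simp
    show "A \<in> interior {0<..}" using A by (simp add: interior_open)
    show "x \<in> {0<..}" using x False by simp
  qed
  then show ?thesis by simp
qed

text \<open>Jensen's inequality, obtained by averaging the tangent at the mean A. The right side
  takes extended values so that no integrability has to be assumed.\<close>

lemma (in prob_space) norm_integral_powr_le:
  fixes f :: "'a \<Rightarrow> complex"
  assumes f[measurable]: "f \<in> borel_measurable M" and r: "r \<ge> 1"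
  shows "ennreal (norm (LINT t|M. f t) powr r) \<le> (\<integral>\<^sup>+t. ennreal (norm (f t) powr r) \<partial>M)"
proof (cases "integrable M f \<and> (\<integral>\<^sup>+t. ennreal (norm (f t) powr r) \<partial>M) < \<infinity> \<and> (LINT t|M. norm (f t)) > 0")
  case True
  define A where "A = (LINT t|M. norm (f t))"
  have A: "A > 0" using True by (simp add: A_def)
  have i: "integrable M (\<lambda>t. norm (f t) powr r)"
    using True by (intro integrableI_nonneg) auto
  have n: "integrable M (\<lambda>t. norm (f t))" using True by simp
  have "norm (LINT t|M. f t) powr r \<le> A powr r"
    using r by (intro powr_mono2) (auto simp: A_def)
  also have "A powr r = (LINT t|M. A powr r + r * A powr (r - 1) * (norm (f t) - A))"
    using n by (simp add: A_def[symmetric] prob_space)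
  also have "\<dots> \<le> (LINT t|M. norm (f t) powr r)"
    using i n A r by (intro integral_mono powr_above_tangent) auto
  finally have "ennreal (norm (LINT t|M. f t) powr r) \<le> ennreal (LINT t|M. norm (f t) powr r)" by (rule ennreal_leI)
  also have "\<dots> = (\<integral>\<^sup>+t. ennreal (norm (f t) powr r) \<partial>M)"
    using i by (subst nn_integral_eq_integral) auto
  finally show ?thesis .
next
  \<comment> \<open>A non-integrable f has Bochner integral 0, a mean of |f| that is not positive
    forces the integral to vanish, and in the last case the right side is infinite.\<close>
  case False
  moreover have "norm (LINT t|M. f t) = 0" if "\<not> integrable M f" using that by (simp add: not_integrable_integral_eq)
  moreover have "norm (LINT t|M. f t) = 0" if "\<not> (LINT t|M. norm (f t)) > 0"
    using that integral_norm_bound[of M f] norm_ge_zero[of "LINT t|M. f t"] by linarith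
  moreover have "(\<integral>\<^sup>+t. ennreal (norm (f t) powr r) \<partial>M) = \<infinity>" if "\<not> (\<integral>\<^sup>+t. ennreal (norm (f t) powr r) \<partial>M) < \<infinity>"
    using that by (simp add: less_top[symmetric])
  ultimately show ?thesis by fastforce
qed

text \<open>The r-th power of the norm, without the root, so that Jensen and Fubini apply directly.
  \<open>Lp_norm_Lr_pow\<close> puts the root back.\<close>

definition Lr_pow :: "real \<Rightarrow> ('a::euclidean_space \<Rightarrow> complex) \<Rightarrow> ennreal" where
  "Lr_pow r G = (\<integral>\<^sup>+x. ennreal (norm (G x) powr r) \<partial>lborel)"

text \<open>Contractions rather than bounded multipliers: constant 1 keeps products and averages
  over probability measures in the class. Testing on integrable K with |B| \<le> 1 makes both
  inverse transforms genuine integrals.\<close>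

definition Lr_multiplier :: "real \<Rightarrow> ('a::euclidean_space \<Rightarrow> complex) \<Rightarrow> bool" where
  "Lr_multiplier r B \<longleftrightarrow> B \<in> borel_measurable borel \<and> (\<forall>x. norm (B x) \<le> 1) \<and>
     (\<forall>K. integrable lborel K \<longrightarrow> Lr_pow r (inv_fourier (\<lambda>x. B x * K x)) \<le> Lr_pow r (inv_fourier K))"

lemma integrable_bounded_mult:
  fixes K :: "'a \<Rightarrow> complex"
  assumes "integrable M K" "B \<in> borel_measurable M" "\<And>x. norm (B x) \<le> 1"
  shows "integrable M (\<lambda>x. B x * K x)"
proof (rule Bochner_Integration.integrable_bound[OF assms(1)])
  have [measurable]: "B \<in> borel_measurable M" "K \<in> borel_measurable M" using assms by auto
  show "(\<lambda>x. B x * K x) \<in> borel_measurable M" by measurable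
  show "AE x in M. norm (B x * K x) \<le> norm (K x)"
    using assms(3) by (intro AE_I2) (simp add: norm_mult mult_left_le_one_le)
qed

lemma Lr_multiplier_mult:
  assumes "Lr_multiplier r A" "Lr_multiplier r B" shows "Lr_multiplier r (\<lambda>x. A x * B x)"
  unfolding Lr_multiplier_def
proof (intro conjI allI impI)
  have [measurable]: "A \<in> borel_measurable borel" "B \<in> borel_measurable borel" using assms by (auto simp: Lr_multiplier_def)
  show "(\<lambda>x. A x * B x) \<in> borel_measurable borel" by measurable
  show "norm (A x * B x) \<le> 1" for x using assms by (auto simp: norm_mult Lr_multiplier_def intro!: mult_le_one)
  fix K :: "'a \<Rightarrow> complex" assume K: "integrable lborel K"
  have "integrable lborel (\<lambda>x. B x * K x)" using assms by (intro integrable_bounded_mult K) (auto simp: Lr_multiplier_def)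
  then have "Lr_pow r (inv_fourier (\<lambda>x. A x * (B x * K x))) \<le> Lr_pow r (inv_fourier (\<lambda>x. B x * K x))"
    using assms(1) by (auto simp: Lr_multiplier_def)
  also have "\<dots> \<le> Lr_pow r (inv_fourier K)" using assms(2) K by (auto simp: Lr_multiplier_def)
  finally show "Lr_pow r (inv_fourier (\<lambda>x. A x * B x * K x)) \<le> Lr_pow r (inv_fourier K)" by (simp add: mult.assoc)
qed

lemma Lr_multiplier_const:
  assumes "norm c \<le> 1" "r \<ge> 1" shows "Lr_multiplier r (\<lambda>_. c)"
  unfolding Lr_multiplier_def
proof (intro conjI allI impI)
  fix K :: "'a \<Rightarrow> complex"
  have "inv_fourier (\<lambda>x. c * K x) \<xi> = c * inv_fourier K \<xi>" for \<xi> by (simp add: inv_fourier_def fourier_cmult)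
  moreover have "norm (c * z) powr r \<le> norm z powr r" for z
    using assms by (intro powr_mono2) (auto simp: norm_mult mult_left_le_one_le)
  ultimately show "Lr_pow r (inv_fourier (\<lambda>x. c * K x)) \<le> Lr_pow r (inv_fourier K)"
    unfolding Lr_pow_def by (intro nn_integral_mono ennreal_leI) simp
qed (use assms in auto)

lemma Lr_multiplier_prod:
  assumes "finite I" "r \<ge> 1" "\<And>i. i \<in> I \<Longrightarrow> Lr_multiplier r (B i)" shows "Lr_multiplier r (\<lambda>x. \<Prod>i\<in>I. B i x)"
  using assms by (induction rule: finite_induct) (auto intro!: Lr_multiplier_mult Lr_multiplier_const)

lemma inv_fourier_measurable[measurable]: "integrable lborel K \<Longrightarrow> inv_fourier K \<in> borel_measurable borel"
  by (intro borel_measurable_continuous_onI continuous_inv_fourier)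

text \<open>A modulation becomes a translation after the inverse transform. All later contractions
  are averages and products built from this isometry and constants.\<close>

lemma Lr_multiplier_cis:
  fixes y :: "'a::euclidean_space"
  shows "Lr_multiplier r (\<lambda>x. cis (2 * pi * (x \<bullet> y)))"
  unfolding Lr_multiplier_def
proof (intro conjI allI impI)
  fix K :: "'a \<Rightarrow> complex" assume K: "integrable lborel K"
  have "inv_fourier (\<lambda>x. cis (2 * pi * (x \<bullet> y)) * K x) \<xi> = inv_fourier K (y + \<xi>)" for \<xi>
  proof -
    have "cis (2 * pi * (x \<bullet> y)) * K x * cis (2 * pi * (x \<bullet> \<xi>)) = K x * cis (2 * pi * (x \<bullet> (y + \<xi>)))" for x
    proof -
      have "cis (2 * pi * (x \<bullet> y)) * cis (2 * pi * (x \<bullet> \<xi>)) = cis (2 * pi * (x \<bullet> (y + \<xi>)))"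
        unfolding cis_mult by (rule arg_cong[where f=cis]) (simp add: inner_add_right algebra_simps)
      then show ?thesis by (simp add: mult_ac)
    qed
    then show ?thesis unfolding inv_fourier_eq by (simp only:)
  qed
  then have "Lr_pow r (inv_fourier (\<lambda>x. cis (2 * pi * (x \<bullet> y)) * K x)) = Lr_pow r (inv_fourier K)"
    unfolding Lr_pow_def using K
    by (simp add: nn_integral_lborel_translate[of "\<lambda>\<xi>. ennreal (norm (inv_fourier K \<xi>) powr r)" y])
  then show "Lr_pow r (inv_fourier (\<lambda>x. cis (2 * pi * (x \<bullet> y)) * K x)) \<le> Lr_pow r (inv_fourier K)" by simp
qed auto

text \<open>The inverse transform of B K is the M-average of those of b t K. Jensen for each
  frequency, Fubini, and the contraction property for each t give the bound.\<close>

lemma Lr_multiplier_superposition: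
  fixes b :: "'t \<Rightarrow> 'a::euclidean_space \<Rightarrow> complex"
  assumes M: "prob_space M" and r: "r \<ge> 1"
    and bm[measurable]: "(\<lambda>(t, x). b t x) \<in> borel_measurable (M \<Otimes>\<^sub>M borel)"
    and b: "\<And>t. Lr_multiplier r (b t)" and B: "\<And>x. B x = (LINT t|M. b t x)"
  shows "Lr_multiplier r B"
proof -
  interpret M: prob_space M by fact
  interpret P: pair_sigma_finite M "lborel :: 'a measure" ..
  have bm': "(\<lambda>(t, x). b t x) \<in> borel_measurable (M \<Otimes>\<^sub>M lborel)"
    using bm by (simp add: measurable_def sets_pair_measure_cong[of M M lborel borel] space_pair_measure)
  note [measurable] = bm'
  have b1: "norm (b t x) \<le> 1" for t x using b[of t] by (simp add: Lr_multiplier_def)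
  have bi: "integrable M (\<lambda>t. b t x)" for x
    by (rule M.integrable_const_bound[of _ 1]) (use b1 in auto)
  have Bm: "B \<in> borel_measurable borel" unfolding B by measurable
  moreover have "norm (B x) \<le> 1" for x
  proof -
    have "norm (B x) \<le> (LINT t|M. norm (b t x))" unfolding B by (rule integral_norm_bound)
    also have "\<dots> \<le> (LINT t|M. 1)" using bi b1 by (intro integral_mono) auto
    finally show ?thesis by (simp add: M.prob_space)
  qed
  moreover have "Lr_pow r (inv_fourier (\<lambda>x. B x * K x)) \<le> Lr_pow r (inv_fourier K)" if K: "integrable lborel K" for K
  proof -
    have [measurable]: "K \<in> borel_measurable borel" using K by auto
    define h where "h = (\<lambda>\<xi> t x. b t x * K x * cis (2 * pi * (x \<bullet> \<xi>)))"
    have I: "integrable (M \<Otimes>\<^sub>M lborel) (\<lambda>(t, x). h \<xi> t x)" for \<xi>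
    proof (rule P.Fubini_integrable)
      show "(\<lambda>(t, x). h \<xi> t x) \<in> borel_measurable (M \<Otimes>\<^sub>M lborel)" unfolding h_def by measurable
      have i: "integrable lborel (h \<xi> t)" if "t \<in> space M" for t
        unfolding h_def using b[of t] by (intro integrable_cis_mult integrable_bounded_mult K) (auto simp: Lr_multiplier_def)
      then show "AE t in M. integrable lborel (\<lambda>x. case (t, x) of (t, x) \<Rightarrow> h \<xi> t x)" by simp
      show "integrable M (\<lambda>t. LINT x|lborel. norm (case (t, x) of (t, x) \<Rightarrow> h \<xi> t x))"
      proof (rule M.integrable_const_bound[of _ "LINT x|lborel. norm (K x)"])
        show "AE t in M. norm (LINT x|lborel. norm (case (t, x) of (t, x) \<Rightarrow> h \<xi> t x)) \<le> (LINT x|lborel. norm (K x))"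
        proof (intro AE_I2)
          fix t assume t: "t \<in> space M"
          have "(LINT x|lborel. norm (h \<xi> t x)) \<le> (LINT x|lborel. norm (K x))"
            using i[OF t] K b1 by (intro integral_mono integrable_norm) (auto simp: h_def norm_mult mult_left_le_one_le)
          moreover have "0 \<le> (LINT x|lborel. norm (h \<xi> t x))" by (rule integral_nonneg_AE) simp
          ultimately show "norm (LINT x|lborel. norm (case (t, x) of (t, x) \<Rightarrow> h \<xi> t x)) \<le> (LINT x|lborel. norm (K x))" by simp
        qed
      qed (unfold h_def, measurable)
    qed
    have eq: "inv_fourier (\<lambda>x. B x * K x) \<xi> = (LINT t|M. inv_fourier (\<lambda>x. b t x * K x) \<xi>)" for \<xi>
    proof -
      have "inv_fourier (\<lambda>x. B x * K x) \<xi> = (LINT x|lborel. LINT t|M. h \<xi> t x)"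
        unfolding inv_fourier_eq B h_def by (simp only: integral_mult_left_zero)
      also have "\<dots> = (LINT t|M. LINT x|lborel. h \<xi> t x)" using P.Fubini_integral[OF I] by simp
      finally show ?thesis unfolding h_def inv_fourier_eq .
    qed
    have m: "(\<lambda>(t, \<xi>). inv_fourier (\<lambda>x. b t x * K x) \<xi>) \<in> borel_measurable (M \<Otimes>\<^sub>M lborel)"
      unfolding inv_fourier_eq by measurable
    note [measurable] = m
    have "Lr_pow r (inv_fourier (\<lambda>x. B x * K x)) \<le> (\<integral>\<^sup>+\<xi>. \<integral>\<^sup>+t. ennreal (norm (inv_fourier (\<lambda>x. b t x * K x) \<xi>) powr r) \<partial>M \<partial>lborel)"
      unfolding Lr_pow_def eq by (intro nn_integral_mono M.norm_integral_powr_le r) measurable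
    also have "\<dots> = (\<integral>\<^sup>+t. \<integral>\<^sup>+\<xi>. ennreal (norm (inv_fourier (\<lambda>x. b t x * K x) \<xi>) powr r) \<partial>lborel \<partial>M)"
      by (rule P.Fubini') measurable
    also have "\<dots> \<le> (\<integral>\<^sup>+t. Lr_pow r (inv_fourier K) \<partial>M)"
    proof (rule nn_integral_mono)
      fix t
      have "Lr_pow r (inv_fourier (\<lambda>x. b t x * K x)) \<le> Lr_pow r (inv_fourier K)"
        using b[of t] K by (simp add: Lr_multiplier_def)
      then show "(\<integral>\<^sup>+\<xi>. ennreal (norm (inv_fourier (\<lambda>x. b t x * K x) \<xi>) powr r) \<partial>lborel) \<le> Lr_pow r (inv_fourier K)"
        by (simp add: Lr_pow_def)
    qed
    also have "\<dots> = Lr_pow r (inv_fourier K)" by (simp add: M.emeasure_space_1)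
    finally show ?thesis .
  qed
  ultimately show ?thesis by (simp add: Lr_multiplier_def)
qed

lemma (in adjoint_pair) meas_L[measurable]: "L \<in> borel_measurable borel"
proof -
  have "linear L"
  proof (rule linearI)
    show "L (x + y) = L x + L y" for x y
      by (rule vector_eq_ldot[THEN iffD1]) (simp add: inner_add_right adj[symmetric])
    show "L (c *\<^sub>R x) = c *\<^sub>R L x" for c x
      by (rule vector_eq_ldot[THEN iffD1]) (simp add: adj[symmetric])
  qed
  then show ?thesis by (intro borel_measurable_continuous_onI linear_continuous_on linear_conv_bounded_linear[THEN iffD1])
qed

text \<open>A Gaussian in L x is the characteristic function of a normal law on the smaller space,
  hence an average of the characters \<open>cis (2 * pi * (x \<bullet> \<iota> y))\<close>.\<close>

lemma (in adjoint_pair) Lr_multiplier_gaussian: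
  assumes r: "r \<ge> 1" and k: "k \<ge> 0"
  shows "Lr_multiplier r (\<lambda>x. of_real (exp (- k * (norm (L x))\<^sup>2)))"
proof (cases "k = 0")
  case True
  then show ?thesis using Lr_multiplier_const[of 1 r] r by simp
next
  case False
  \<comment> \<open>Chosen so that the transform of exp (-t |y|^2) has exponent pi^2 / t =
    k.\<close>
  define t where "t = pi\<^sup>2 / k"
  have t: "t > 0" using False k by (simp add: t_def)
  define G where "G = sqrt (pi / t) ^ DIM('b)"
  have G: "G > 0" using t by (simp add: G_def)
  define g where "g = (\<lambda>y::'b. exp (- t * (norm y)\<^sup>2) / G)"
  have [measurable]: "g \<in> borel_measurable borel" unfolding g_def by measurable
  have g0: "g y \<ge> 0" for y using G by (simp add: g_def)
  have gi: "integrable lborel g" unfolding g_def using integrable_gaussian[OF t, where 'a='b] by simp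
  have gI: "(LINT y|lborel. g y) = 1" unfolding g_def using integral_gaussian[OF t, where 'a='b] G t by (simp add: G_def)
  show ?thesis
  proof (rule Lr_multiplier_superposition[where M="density lborel (\<lambda>y. ennreal (g y))" and b="\<lambda>y x. cis (2 * pi * (x \<bullet> \<iota> y))"])
    show "prob_space (density lborel (\<lambda>y. ennreal (g y)))"
    proof
      have "(\<integral>\<^sup>+y. ennreal (g y) \<partial>lborel) = 1" using gi g0 gI by (subst nn_integral_eq_integral) auto
      then show "emeasure (density lborel (\<lambda>y. ennreal (g y))) (space (density lborel (\<lambda>y. ennreal (g y)))) = 1"
        by (simp add: emeasure_density)
    qed
    show "Lr_multiplier r (\<lambda>x. cis (2 * pi * (x \<bullet> \<iota> y)))" for y by (rule Lr_multiplier_cis)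
    show "complex_of_real (exp (- k * (norm (L x))\<^sup>2)) = (LINT y|density lborel (\<lambda>y. ennreal (g y)). cis (2 * pi * (x \<bullet> \<iota> y)))" for x
    proof -
      have "(LINT y|density lborel (\<lambda>y. ennreal (g y)). cis (2 * pi * (x \<bullet> \<iota> y))) = (LINT y|lborel. g y *\<^sub>R cis (2 * pi * (x \<bullet> \<iota> y)))"
        using g0 by (subst integral_density) auto
      also have "\<dots> = (LINT y|lborel. (1 / of_real G) * (of_real (exp (- t * (norm y)\<^sup>2)) * cis (2 * pi * (y \<bullet> L x))))"
        by (intro Bochner_Integration.integral_cong refl) (simp add: g_def scaleR_conv_of_real inner_commute[of x] adj)
      also have "\<dots> = (1 / of_real G) * of_real (G * exp (- pi\<^sup>2 * (norm (L x))\<^sup>2 / t))"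
        by (simp only: integral_mult_right_zero gaussian_integral_2pi(2)[OF t] G_def)
      also have "\<dots> = of_real (exp (- k * (norm (L x))\<^sup>2))" using G k False by (simp add: t_def)
      finally show ?thesis by simp
    qed
  qed (use r in auto)
qed

text \<open>The Laplace transform of the gamma density of shape b, normalised so that c = 1 gives
  total mass 1 and c = 1 + a gives the average of exp (-t a). The substitution of c t for t in the
  integral for Gamma b proves it.\<close>

lemma gamma_laplace:
  fixes b c :: real assumes b: "b > 0" and c: "c > 0"
  shows "(\<integral>\<^sup>+t. ennreal (indicator {0..} t * t powr (b - 1) / exp t / Gamma b * exp (- t * (c - 1))) \<partial>lborel) = ennreal (c powr - b)"
proof -
  have G: "Gamma b > 0" using b by (rule Gamma_real_pos)
  have "ennreal (Gamma b) = (\<integral>\<^sup>+t. ennreal (indicator {0..} t * t powr (b - 1) / exp t) \<partial>lborel)"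
    by (rule Gamma_conv_nn_integral_real[OF b])
  also have "\<dots> = ennreal \<bar>c\<bar> * (\<integral>\<^sup>+t. ennreal (indicator {0..} (0 + c * t) * (0 + c * t) powr (b - 1) / exp (0 + c * t)) \<partial>lborel)"
    using c by (intro nn_integral_real_affine) auto
  also have "(\<integral>\<^sup>+t. ennreal (indicator {0..} (0 + c * t) * (0 + c * t) powr (b - 1) / exp (0 + c * t)) \<partial>lborel) =
     (\<integral>\<^sup>+t. ennreal (c powr (b - 1) * Gamma b) * ennreal (indicator {0..} t * t powr (b - 1) / exp t / Gamma b * exp (- t * (c - 1))) \<partial>lborel)"
  proof (intro nn_integral_cong)
    fix t :: real
    have "indicator {0..} (0 + c * t) * (0 + c * t) powr (b - 1) / exp (0 + c * t) =
       (c powr (b - 1) * Gamma b) * (indicator {0..} t * t powr (b - 1) / exp t / Gamma b * exp (- t * (c - 1)))"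
    proof (cases "t \<ge> 0")
      case True
      have "exp (c * t) = exp t * exp (t * (c - 1))" by (simp add: exp_add[symmetric] algebra_simps)
      moreover have "exp (t - c * t) * exp (c * t - t) = 1" by (simp add: exp_add[symmetric])
      ultimately show ?thesis using True c G by (simp add: powr_mult exp_minus field_simps)
    next
      case False
      then have "\<not> c * t \<ge> 0" using c by (simp add: zero_le_mult_iff)
      then show ?thesis using False by simp
    qed
    then show "ennreal (indicator {0..} (0 + c * t) * (0 + c * t) powr (b - 1) / exp (0 + c * t)) =
      ennreal (c powr (b - 1) * Gamma b) * ennreal (indicator {0..} t * t powr (b - 1) / exp t / Gamma b * exp (- t * (c - 1)))"
      using c G by (subst ennreal_mult[symmetric]) (auto simp: indicator_def)
  qed
  also have "\<dots> = ennreal (c powr (b - 1) * Gamma b) * (\<integral>\<^sup>+t. ennreal (indicator {0..} t * t powr (b - 1) / exp t / Gamma b * exp (- t * (c - 1))) \<partial>lborel)"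
    by (rule nn_integral_cmult) measurable
  finally have e: "ennreal (Gamma b) = ennreal (c powr b * Gamma b) * (\<integral>\<^sup>+t. ennreal (indicator {0..} t * t powr (b - 1) / exp t / Gamma b * exp (- t * (c - 1))) \<partial>lborel)"
    using c G by (simp add: mult.assoc[symmetric] ennreal_mult[symmetric] powr_diff)
  \<comment> \<open>X is not yet known to be finite, so the equation is multiplied by c^(-b) / Gamma
    b instead of being divided.\<close>
  define X where "X = (\<integral>\<^sup>+t. ennreal (indicator {0..} t * t powr (b - 1) / exp t / Gamma b * exp (- t * (c - 1))) \<partial>lborel)"
  have "ennreal (c powr - b / Gamma b) * ennreal (Gamma b) = ennreal (c powr - b / Gamma b) * (ennreal (c powr b * Gamma b) * X)"
    using e by (simp add: X_def)
  also have "\<dots> = ennreal (c powr - b / Gamma b * (c powr b * Gamma b)) * X"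
    using c G by (simp add: mult.assoc[symmetric] ennreal_mult[symmetric])
  also have "c powr - b / Gamma b * (c powr b * Gamma b) = 1" using c G by (simp add: powr_minus)
  finally have "X = ennreal (c powr - b / Gamma b * Gamma b)" using c G by (simp add: ennreal_mult[symmetric])
  then show ?thesis using G by (simp add: X_def)
qed

text \<open>Subordination: the negative power of 1 + a is the gamma average of exp (-t a), and for t
  \<ge> 0 each of these is a constant at most 1 times a Gaussian in L x.\<close>

lemma (in adjoint_pair) Lr_multiplier_bessel:
  assumes r: "r \<ge> 1" and b: "b > 0" and e: "\<epsilon> > 0"
  shows "Lr_multiplier r (\<lambda>x. of_real ((1 + \<epsilon> * (1 + 4 * pi\<^sup>2 * (norm (L x))\<^sup>2)) powr - b))"
proof -
  define g where "g = (\<lambda>t::real. indicator {0..} t * t powr (b - 1) / exp t / Gamma b)"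
  have [measurable]: "g \<in> borel_measurable borel" unfolding g_def by measurable
  have G: "Gamma b > 0" using b by (rule Gamma_real_pos)
  have g0: "g y \<ge> 0" for y using G by (simp add: g_def)
  define a where "a = (\<lambda>x. \<epsilon> * (1 + 4 * pi\<^sup>2 * (norm (L x))\<^sup>2))"
  have a0: "a x \<ge> 0" for x using e by (simp add: a_def)
  have [measurable]: "a \<in> borel_measurable borel" unfolding a_def by measurable
  show ?thesis
  proof (rule Lr_multiplier_superposition[where M="density lborel (\<lambda>y. ennreal (g y))" and b="\<lambda>t x. of_real (exp (- max t 0 * a x))"])
    show "prob_space (density lborel (\<lambda>y. ennreal (g y)))"
    proof
      have "(\<integral>\<^sup>+y. ennreal (g y) \<partial>lborel) = 1" using gamma_laplace[OF b, of 1] by (simp add: g_def)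
      then show "emeasure (density lborel (\<lambda>y. ennreal (g y))) (space (density lborel (\<lambda>y. ennreal (g y)))) = 1"
        by (simp add: emeasure_density)
    qed
    \<comment> \<open>The maximum with 0 keeps every member a contraction; negative t carry no mass,
      so the average is unchanged.\<close>
    show "Lr_multiplier r (\<lambda>x. complex_of_real (exp (- max t 0 * a x)))" for t
    proof -
      define m where "m = max t 0"
      have m: "m \<ge> 0" by (simp add: m_def)
      have eq: "complex_of_real (exp (- m * a x)) = of_real (exp (- m * \<epsilon>)) * of_real (exp (- (m * \<epsilon> * 4 * pi\<^sup>2) * (norm (L x))\<^sup>2))" for x
        unfolding of_real_mult[symmetric] exp_add[symmetric] by (simp add: a_def algebra_simps)
      have c: "Lr_multiplier r (\<lambda>_. complex_of_real (exp (- m * \<epsilon>)))"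
        using m e r by (intro Lr_multiplier_const) (auto simp: mult_nonneg_nonneg)
      have "Lr_multiplier r (\<lambda>x. complex_of_real (exp (- m * a x)))"
        unfolding eq by (intro Lr_multiplier_mult c Lr_multiplier_gaussian r) (use m e in auto)
      then show ?thesis by (simp add: m_def)
    qed
    show "complex_of_real ((1 + \<epsilon> * (1 + 4 * pi\<^sup>2 * (norm (L x))\<^sup>2)) powr - b) = (LINT t|density lborel (\<lambda>y. ennreal (g y)). complex_of_real (exp (- max t 0 * a x)))" for x
    proof -
      have "(LINT t|density lborel (\<lambda>y. ennreal (g y)). complex_of_real (exp (- max t 0 * a x))) = (LINT t|lborel. g t *\<^sub>R complex_of_real (exp (- max t 0 * a x)))"
        using g0 by (subst integral_density) auto
      also have "\<dots> = (LINT t|lborel. complex_of_real (g t * exp (- max t 0 * a x)))" by (simp add: scaleR_conv_of_real)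
      also have "\<dots> = of_real (LINT t|lborel. g t * exp (- max t 0 * a x))" by (rule integral_complex_of_real)
      also have "(LINT t|lborel. g t * exp (- max t 0 * a x)) = enn2real (\<integral>\<^sup>+t. ennreal (g t * exp (- max t 0 * a x)) \<partial>lborel)"
        using g0 by (intro integral_eq_nn_integral) auto
      also have "(\<integral>\<^sup>+t. ennreal (g t * exp (- max t 0 * a x)) \<partial>lborel) = (\<integral>\<^sup>+t. ennreal (g t * exp (- t * ((1 + a x) - 1))) \<partial>lborel)"
        by (intro nn_integral_cong arg_cong[where f=ennreal]) (auto simp: g_def indicator_def)
      also have "\<dots> = ennreal ((1 + a x) powr - b)" unfolding g_def using a0[of x] by (intro gamma_laplace b) auto
      finally show ?thesis by (simp add: a_def)
    qed
  qed (use r in auto)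
qed

text \<open>By \<open>gbinomial_asymptotic\<close> the coefficients are O(n^(-z-1)), which is
  summable for z > 0. This corresponds to absolute convergence of the binomial series up to the
  boundary of the disc.\<close>

lemma summable_abs_gbinomial:
  fixes z :: real assumes z: "z > 0" shows "summable (\<lambda>n. \<bar>z gchoose n\<bar>)"
proof -
  have "(\<lambda>n. (z gchoose n) / ((-1)^n / exp ((z+1) * of_real (ln (real n))))) \<longlonglongrightarrow> inverse (Gamma (- z))"
    by (rule gbinomial_asymptotic)
  then have "Bseq (\<lambda>n. (z gchoose n) / ((-1)^n / exp ((z+1) * of_real (ln (real n)))))"
    by (intro convergent_imp_Bseq) (auto simp: convergent_def)
  then obtain K where K: "K > 0" "\<And>n. norm ((z gchoose n) / ((-1)^n / exp ((z+1) * of_real (ln (real n))))) \<le> K"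
    by (auto simp: Bseq_def)
  have s: "summable (\<lambda>n. K * real n powr - (z + 1))"
    by (intro summable_mult) (subst summable_real_powr_iff, use z in auto)
  show ?thesis
  proof (rule summable_comparison_test_ev[OF _ s])
    show "\<forall>\<^sub>F n in sequentially. norm \<bar>z gchoose n\<bar> \<le> K * real n powr - (z + 1)"
    proof (rule eventually_sequentiallyI[of 1])
      fix n :: nat assume n: "1 \<le> n"
      have "\<bar>z gchoose n\<bar> * exp ((z + 1) * ln (real n)) \<le> K"
        using K(2)[of n] by (simp add: abs_mult power_abs)
      moreover have "exp ((z + 1) * ln (real n)) = real n powr (z + 1)" using n by (simp add: powr_def)
      ultimately have "\<bar>z gchoose n\<bar> * real n powr (z + 1) * real n powr - (z + 1) \<le> K * real n powr - (z + 1)"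
        by (intro mult_right_mono) auto
      moreover have "real n powr (z + 1) * real n powr - (z + 1) = 1" using n by (simp add: powr_add[symmetric])
      ultimately show "norm \<bar>z gchoose n\<bar> \<le> K * real n powr - (z + 1)" by (simp add: mult.assoc)
    qed
  qed
qed

text \<open>Stein's device: with $y = (1+a)^{-1}$ the factor $(a/(1+a))^z = (1-y)^z$ is expanded in its binomial
  series, whose coefficients are absolutely summable for positive $z$.\<close>

lemma (in adjoint_pair) Lr_multiplier_weight:
  assumes r: "r \<ge> 1" and z: "z > 0" and N: "real N > z"
  obtains S where "S > 0" "\<And>\<epsilon>. \<epsilon> > 0 \<Longrightarrow>
     Lr_multiplier r (\<lambda>x. of_real ((\<epsilon> * (1 + 4 * pi\<^sup>2 * (norm (L x))\<^sup>2)) powr z / (1 + \<epsilon> * (1 + 4 * pi\<^sup>2 * (norm (L x))\<^sup>2)) ^ N / S))"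
proof -
  define c where "c = (\<lambda>n. (-1) ^ n * (z gchoose n))"
  define S where "S = (\<Sum>n. \<bar>c n\<bar>)"
  have cs: "summable (\<lambda>n. \<bar>c n\<bar>)" unfolding c_def using summable_abs_gbinomial[OF z] by (simp add: abs_mult power_abs)
  have "\<bar>c 0\<bar> \<le> S" unfolding S_def using sum_le_suminf[OF cs, of "{0}"] by simp
  then have S: "S > 0" by (simp add: c_def)
  \<comment> \<open>With y = 1 / (1 + a), the symbol a^z / (1 + a)^N equals (1 - y)^z y^\<beta>.
    Since \<beta> > 0, every term y^(n + \<beta>) of the expansion is covered by
    \<open>Lr_multiplier_bessel\<close>.\<close>
  define \<beta> where "\<beta> = real N - z"
  have \<beta>: "\<beta> > 0" using N by (simp add: \<beta>_def)
  \<comment> \<open>The numbers |c n| / S are probability weights, and the signs of c n are moved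
    into the multipliers as constants of modulus at most 1. S depends on z alone and not on
    \<epsilon>; the uniformity in R of the Sobolev bound rests on this.\<close>
  have pr: "prob_space (density (count_space UNIV) (\<lambda>n. ennreal (\<bar>c n\<bar> / S)))"
  proof
    have "(\<integral>\<^sup>+n. ennreal (\<bar>c n\<bar> / S) \<partial>count_space UNIV) = (\<Sum>n. ennreal (\<bar>c n\<bar> / S))" by (rule nn_integral_count_space_nat)
    also have "\<dots> = ennreal (\<Sum>n. \<bar>c n\<bar> / S)" using cs S by (intro suminf_ennreal2) (auto intro!: summable_divide)
    also have "(\<Sum>n. \<bar>c n\<bar> / S) = 1" using cs S by (subst suminf_divide) (auto simp: S_def)
    finally show "emeasure (density (count_space UNIV) (\<lambda>n. ennreal (\<bar>c n\<bar> / S))) (space (density (count_space UNIV) (\<lambda>n. ennreal (\<bar>c n\<bar> / S)))) = 1"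
      by (simp add: emeasure_density)
  qed
  show ?thesis
  proof (rule that[OF S])
    fix \<epsilon> :: real assume e: "\<epsilon> > 0"
    define a where "a = (\<lambda>x. \<epsilon> * (1 + 4 * pi\<^sup>2 * (norm (L x))\<^sup>2))"
    have a0: "a x > 0" for x using e by (simp add: a_def add_pos_nonneg)
    have [measurable]: "a \<in> borel_measurable borel" unfolding a_def by measurable
    have "Lr_multiplier r (\<lambda>x. of_real (a x powr z / (1 + a x) ^ N / S))"
    proof (rule Lr_multiplier_superposition[OF pr r, where b="\<lambda>n x. of_real (sgn (c n)) * of_real ((1 + a x) powr - (real n + \<beta>))"])
      have eq: "sets (density (count_space UNIV) (\<lambda>n. ennreal (\<bar>c n\<bar> / S)) \<Otimes>\<^sub>M (borel :: 'a measure)) = sets (count_space UNIV \<Otimes>\<^sub>M (borel :: 'a measure))"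
        by (intro sets_pair_measure_cong) auto
      have "(\<lambda>(n, x). complex_of_real (sgn (c n)) * of_real ((1 + a x) powr - (real n + \<beta>))) \<in> borel_measurable (count_space UNIV \<Otimes>\<^sub>M borel)"
        by (rule measurable_pair_measure_countable1) (auto, measurable)
      then show "(\<lambda>(n, x). complex_of_real (sgn (c n)) * of_real ((1 + a x) powr - (real n + \<beta>)))
         \<in> borel_measurable (density (count_space UNIV) (\<lambda>n. ennreal (\<bar>c n\<bar> / S)) \<Otimes>\<^sub>M borel)"
        using measurable_cong_sets[OF eq refl] by blast
      show "Lr_multiplier r (\<lambda>x. complex_of_real (sgn (c n)) * of_real ((1 + a x) powr - (real n + \<beta>)))" for n
        unfolding a_def by (intro Lr_multiplier_mult Lr_multiplier_const Lr_multiplier_bessel r e) (use \<beta> in \<open>auto simp: sgn_if\<close>)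
      fix x
      define y where "y = 1 / (1 + a x)"
      have y: "0 < y" "y < 1" using a0[of x] by (auto simp: y_def)
      have yp: "(1 + a x) powr - (real n + \<beta>) = y ^ n * y powr \<beta>" for n
      proof -
        have "(1 + a x) powr - (real n + \<beta>) = y powr (real n + \<beta>)" unfolding y_def powr_minus_divide using a0[of x] by (simp add: powr_divide)
        also have "\<dots> = y ^ n * y powr \<beta>" using y by (simp add: powr_add powr_realpow)
        finally show ?thesis .
      qed
      have "(\<lambda>n. (z gchoose n) * (- y) ^ n) sums (1 + (- y)) powr z"
        using y by (intro gen_binomial_real) auto
      then have "(\<lambda>n. c n * y ^ n) sums (1 - y) powr z"
        by (simp add: c_def power_minus[of y] mult_ac)
      then have sm: "(\<lambda>n. (1 / S) * (c n * (y ^ n * y powr \<beta>))) sums ((1 / S) * ((1 - y) powr z * y powr \<beta>))"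
        by (intro sums_mult) (use sums_mult2[of "\<lambda>n. c n * y ^ n" "(1 - y) powr z" "y powr \<beta>"] in \<open>simp add: mult.assoc\<close>)
      have ab: "summable (\<lambda>n. \<bar>(1 / S) * (c n * (y ^ n * y powr \<beta>))\<bar>)"
      proof (rule summable_comparison_test'[OF summable_mult[OF cs, of "1 / S * y powr \<beta>"], of 0])
        fix n
        have "(1 / S * y powr \<beta> * \<bar>c n\<bar>) * y ^ n \<le> (1 / S * y powr \<beta> * \<bar>c n\<bar>) * 1"
          using y S by (intro mult_left_mono power_le_one) auto
        then show "norm \<bar>(1 / S) * (c n * (y ^ n * y powr \<beta>))\<bar> \<le> 1 / S * y powr \<beta> * \<bar>c n\<bar>"
          using y S by (simp add: abs_mult mult_ac)
      qed
      have "(LINT n|density (count_space UNIV) (\<lambda>n. ennreal (\<bar>c n\<bar> / S)). complex_of_real (sgn (c n)) * of_real ((1 + a x) powr - (real n + \<beta>)))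
        = (LINT n|count_space UNIV. (\<bar>c n\<bar> / S) *\<^sub>R (complex_of_real (sgn (c n)) * of_real ((1 + a x) powr - (real n + \<beta>))))"
        using S by (subst integral_density) auto
      also have "\<dots> = (LINT n|count_space UNIV. complex_of_real ((1 / S) * (c n * (y ^ n * y powr \<beta>))))"
      proof (rule Bochner_Integration.integral_cong[OF refl])
        fix n
        have "\<bar>c n\<bar> * sgn (c n) = c n" by (simp add: abs_mult_sgn)
        then have "(\<bar>c n\<bar> / S) * (sgn (c n) * (y ^ n * y powr \<beta>)) = (1 / S) * (c n * (y ^ n * y powr \<beta>))"
          by (simp add: mult.assoc[symmetric])
        then show "(\<bar>c n\<bar> / S) *\<^sub>R (complex_of_real (sgn (c n)) * of_real ((1 + a x) powr - (real n + \<beta>))) = complex_of_real ((1 / S) * (c n * (y ^ n * y powr \<beta>)))"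
          unfolding yp scaleR_conv_of_real of_real_mult[symmetric] by (rule arg_cong)
      qed
      also have "\<dots> = of_real (LINT n|count_space UNIV. (1 / S) * (c n * (y ^ n * y powr \<beta>)))" by (rule integral_complex_of_real)
      also have "(LINT n|count_space UNIV. (1 / S) * (c n * (y ^ n * y powr \<beta>))) = (1 / S) * ((1 - y) powr z * y powr \<beta>)"
        using ab sm by (subst integral_count_space_nat) (auto simp: integrable_count_space_nat_iff sums_iff)
      also have "(1 - y) powr z * y powr \<beta> = a x powr z / (1 + a x) ^ N"
      proof -
        have "1 - y = a x / (1 + a x)" using a0[of x] by (simp add: y_def field_simps)
        then have "(1 - y) powr z * y powr \<beta> = a x powr z / ((1 + a x) powr z * (1 + a x) powr \<beta>)"
          using a0[of x] by (simp add: y_def powr_divide)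
        also have "(1 + a x) powr z * (1 + a x) powr \<beta> = (1 + a x) ^ N"
          using a0[of x] by (simp add: powr_add[symmetric] \<beta>_def powr_realpow)
        finally show ?thesis .
      qed
      finally show "complex_of_real (a x powr z / (1 + a x) ^ N / S) =
        (LINT n|density (count_space UNIV) (\<lambda>n. ennreal (\<bar>c n\<bar> / S)). complex_of_real (sgn (c n)) * of_real ((1 + a x) powr - (real n + \<beta>)))"
        by simp
    qed
    then show "Lr_multiplier r (\<lambda>x. of_real ((\<epsilon> * (1 + 4 * pi\<^sup>2 * (norm (L x))\<^sup>2)) powr z / (1 + \<epsilon> * (1 + 4 * pi\<^sup>2 * (norm (L x))\<^sup>2)) ^ N / S))"
      by (simp add: a_def)
  qed
qed

section \<open>Sobolev potentials near a subspace\<close>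

definition band_rapid :: "('a::euclidean_space \<Rightarrow> complex) \<Rightarrow> bool" where
  "band_rapid B \<longleftrightarrow> rapid B \<and> continuous_on UNIV B \<and> (\<forall>\<xi>. norm \<xi> > 2 \<longrightarrow> fourier B \<xi> = 0)"

lemma band_rapid_inner_mult:
  assumes "band_rapid B" shows "band_rapid (\<lambda>x. of_real (x \<bullet> c) * B x)"
proof -
  have "open {\<xi>::'a. norm \<xi> > 2}" by (intro open_Collect_less continuous_intros)
  then have "fourier (\<lambda>x. of_real (x \<bullet> c) * B x) \<xi> = 0" if "norm \<xi> > 2" for \<xi>
    using assms that by (intro fourier_multiplication_inner_vanish[of B "{\<xi>. norm \<xi> > 2}"]) (auto simp: band_rapid_def)
  then show ?thesis using assms by (auto simp: band_rapid_def intro!: rapid_inner_mult continuous_intros)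
qed

text \<open>Families of functions, indexed by a scale and a frequency shift, whose Fourier transforms are
  concentrated near the subspace $L\xi = \theta$ at scale $1/R$, uniformly in the parameters.\<close>

inductive scaled_family ::
  "('b::euclidean_space \<Rightarrow> 'a::euclidean_space) \<Rightarrow> (real \<Rightarrow> 'b \<Rightarrow> 'a \<Rightarrow> complex) \<Rightarrow> bool" for \<iota> where
  base: "band_rapid B \<Longrightarrow> schwartz u \<Longrightarrow> scaled_family \<iota> (\<lambda>R \<theta> x. skew_convolve \<iota> R \<theta> B u x)"
| add: "scaled_family \<iota> F \<Longrightarrow> scaled_family \<iota> G \<Longrightarrow> scaled_family \<iota> (\<lambda>R \<theta> x. F R \<theta> x + G R \<theta> x)"
| scale: "scaled_family \<iota> F \<Longrightarrow> (\<And>R. R \<ge> 1/16 \<Longrightarrow> norm (c R) \<le> C) \<Longrightarrow> scaled_family \<iota> (\<lambda>R \<theta> x. c R * F R \<theta> x)"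

lemma scaled_family_sum:
  assumes "finite A" "A \<noteq> {}" "\<And>a. a \<in> A \<Longrightarrow> scaled_family \<iota> (F a)"
  shows "scaled_family \<iota> (\<lambda>R \<theta> x. \<Sum>a\<in>A. F a R \<theta> x)"
  using assms by (induction rule: finite_ne_induct) (auto intro: scaled_family.add)

context adjoint_pair begin

lemma scaled_family_rapid:
  assumes "scaled_family \<iota> F" shows "rapid (F R \<theta>)"
  using assms
proof induction
  case (base B u)
  then show ?case unfolding band_rapid_def
    using rapid_skew_convolve[of B u R \<theta>] schwartz_rapid[of u] by (simp add: eta_contract_eq)
qed (auto intro: rapid_add rapid_cmult)

text \<open>The factor R produced by the product rule is compensated by \<rho> R of order 1/R,
  unless L c = 0, in which case a bounded \<rho> is enough.\<close>

lemma scaled_family_inner_mult: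
  assumes "scaled_family \<iota> F" and \<rho>: "\<And>R. R \<ge> 1/16 \<Longrightarrow> \<bar>\<rho> R\<bar> \<le> C" and R: "L c = 0 \<or> (\<forall>R\<ge>1/16. \<bar>\<rho> R * R\<bar> \<le> D)"
  shows "scaled_family \<iota> (\<lambda>R \<theta> x. of_real (\<rho> R * (x \<bullet> c)) * F R \<theta> x)"
  using assms(1)
proof induction
  case (base B u)
  have rB: "rapid B" using base(1) by (simp add: band_rapid_def)
  have ru: "rapid u" using base(2) by (rule schwartz_rapid)
  have 1: "scaled_family \<iota> (\<lambda>R \<theta> x. of_real (\<rho> R) * skew_convolve \<iota> R \<theta> (\<lambda>x. of_real (x \<bullet> c) * B x) u x)"
    by (rule scaled_family.scale[where C=C]) (use base \<rho> in \<open>auto intro!: scaled_family.base band_rapid_inner_mult\<close>)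
  show ?case
  proof (cases "L c = 0")
    case True
    have "of_real (\<rho> R * (x \<bullet> c)) * skew_convolve \<iota> R \<theta> B u x = of_real (\<rho> R) * skew_convolve \<iota> R \<theta> (\<lambda>x. of_real (x \<bullet> c) * B x) u x" for R \<theta> x
      unfolding of_real_mult mult.assoc skew_convolve_inner_mult[OF rB ru] True by (simp add: skew_convolve_def)
    then show ?thesis using 1 by (simp only:)
  next
    case False
    have 2: "scaled_family \<iota> (\<lambda>R \<theta> x. of_real (\<rho> R * R) * skew_convolve \<iota> R \<theta> B (\<lambda>\<nu>. of_real (\<nu> \<bullet> L c) * u \<nu>) x)"
      by (rule scaled_family.scale[where C=D]) (use base R False in \<open>auto simp: norm_mult abs_mult intro!: scaled_family.base schwartz_inner_mult\<close>)
    have "of_real (\<rho> R * (x \<bullet> c)) * skew_convolve \<iota> R \<theta> B u x = of_real (\<rho> R) * skew_convolve \<iota> R \<theta> (\<lambda>x. of_real (x \<bullet> c) * B x) u x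
       + of_real (\<rho> R * R) * skew_convolve \<iota> R \<theta> B (\<lambda>\<nu>. of_real (\<nu> \<bullet> L c) * u \<nu>) x" for R \<theta> x
      unfolding of_real_mult mult.assoc skew_convolve_inner_mult[OF rB ru] by (simp only: distrib_left)
    then show ?thesis using scaled_family.add[OF 1 2] by (simp only:)
  qed
next
  case (add F G)
  then show ?case using scaled_family.add[OF add.IH] by (simp add: distrib_left)
next
  case (scale F c' C')
  then show ?case using scaled_family.scale[OF scale.IH scale(2)] by (simp add: mult.left_commute)
qed

text \<open>For a base family the transform is \<open>fourier B \<xi>\<close> times a transform of u
  at R (L \<xi> - \<theta>). The decay of the latter is a property of u, so the constant does not
  see R or \<theta>, and the spectrum stays in the ball of radius 2.\<close>

lemma scaled_family_fourier_bound:
  assumes "scaled_family \<iota> F"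
  shows "(\<exists>C. \<forall>R\<ge>1/16. \<forall>\<theta> \<xi>. norm (fourier (F R \<theta>) \<xi>) * (1 + norm (R *\<^sub>R (L \<xi> - \<theta>))) ^ M \<le> C) \<and>
    (\<forall>R \<theta> \<xi>. norm \<xi> > 2 \<longrightarrow> fourier (F R \<theta>) \<xi> = 0)"
  using assms
proof induction
  case (base B u)
  have rB: "rapid B" using base(1) by (simp add: band_rapid_def)
  have ru: "rapid u" using base(2) by (rule schwartz_rapid)
  obtain C where C: "\<And>\<eta>. norm (fourier u \<eta>) * (1 + norm \<eta>) ^ M \<le> C"
    using rapidE[OF schwartz_fourier_rapid[OF base(2)]] by blast
  define D where "D = (LINT x|lborel. norm (B x))"
  have D: "norm (fourier B \<xi>) \<le> D" for \<xi> unfolding D_def by (rule norm_fourier_le)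
  have e: "fourier (\<lambda>x. skew_convolve \<iota> R \<theta> B u x) \<xi> = fourier B \<xi> * fourier u (R *\<^sub>R (L \<xi> - \<theta>))" for R \<theta> \<xi>
    using fourier_skew_convolve[OF rapid_integrable[OF rB] rapid_integrable[OF ru]] by simp
  have "norm (fourier B \<xi> * fourier u (R *\<^sub>R (L \<xi> - \<theta>))) * (1 + norm (R *\<^sub>R (L \<xi> - \<theta>))) ^ M \<le> D * C" for R \<theta> \<xi>
    unfolding norm_mult mult.assoc using D[of 0] by (intro mult_mono D C) (auto intro: order_trans[OF norm_ge_zero])
  then have "\<exists>C. \<forall>R\<ge>1/16. \<forall>\<theta> \<xi>. norm (fourier B \<xi> * fourier u (R *\<^sub>R (L \<xi> - \<theta>))) * (1 + norm (R *\<^sub>R (L \<xi> - \<theta>))) ^ M \<le> C"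
    by blast
  then show ?case unfolding e using base(1) by (auto simp: band_rapid_def)
next
  case (add F G)
  obtain C where C: "\<And>R \<theta> \<xi>. R \<ge> 1/16 \<Longrightarrow> norm (fourier (F R \<theta>) \<xi>) * (1 + norm (R *\<^sub>R (L \<xi> - \<theta>))) ^ M \<le> C" using add.IH(1) by blast
  obtain D where D: "\<And>R \<theta> \<xi>. R \<ge> 1/16 \<Longrightarrow> norm (fourier (G R \<theta>) \<xi>) * (1 + norm (R *\<^sub>R (L \<xi> - \<theta>))) ^ M \<le> D" using add.IH(2) by blast
  have e: "fourier (\<lambda>x. F R \<theta> x + G R \<theta> x) \<xi> = fourier (F R \<theta>) \<xi> + fourier (G R \<theta>) \<xi>" for R \<theta> \<xi>
    by (intro fourier_add rapid_integrable scaled_family_rapid add)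
  have "norm (fourier (F R \<theta>) \<xi> + fourier (G R \<theta>) \<xi>) * (1 + norm (R *\<^sub>R (L \<xi> - \<theta>))) ^ M \<le> C + D" if "R \<ge> 1/16" for R \<theta> \<xi>
  proof -
    have "norm (fourier (F R \<theta>) \<xi> + fourier (G R \<theta>) \<xi>) * (1 + norm (R *\<^sub>R (L \<xi> - \<theta>))) ^ M \<le>
       (norm (fourier (F R \<theta>) \<xi>) + norm (fourier (G R \<theta>) \<xi>)) * (1 + norm (R *\<^sub>R (L \<xi> - \<theta>))) ^ M"
      by (intro mult_right_mono norm_triangle_ineq) auto
    then show ?thesis using C[OF that, of \<theta> \<xi>] D[OF that, of \<theta> \<xi>] by (simp add: distrib_right)
  qed
  then show ?case unfolding e using add.IH by auto
next
  case (scale F c C')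
  obtain C where C: "\<And>R \<theta> \<xi>. R \<ge> 1/16 \<Longrightarrow> norm (fourier (F R \<theta>) \<xi>) * (1 + norm (R *\<^sub>R (L \<xi> - \<theta>))) ^ M \<le> C" using scale.IH by blast
  have "norm (c R * fourier (F R \<theta>) \<xi>) * (1 + norm (R *\<^sub>R (L \<xi> - \<theta>))) ^ M \<le> C' * C" if "R \<ge> 1/16" for R \<theta> \<xi>
    unfolding norm_mult mult.assoc using scale(2)[OF that] by (intro mult_mono C that) (auto intro: order_trans[OF norm_ge_zero])
  then show ?case unfolding fourier_cmult using scale.IH by auto
qed

text \<open>Bounds an integral over a ball of a function of L \<xi> without choosing coordinates on
  the fibres. The integral is averaged over translations by \<kappa> y with |y| \<le> 1, where
  \<kappa> is a norm-preserving right inverse of L. This keeps \<xi> in the ball of radius 3, and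
  the integral over y of g (L \<xi> + y) is at most the full integral of g.\<close>

lemma nn_integral_ball_fibre_le:
  fixes g :: "'b \<Rightarrow> ennreal" and \<kappa> :: "'b \<Rightarrow> 'a"
  assumes [measurable]: "g \<in> borel_measurable borel" "\<kappa> \<in> borel_measurable borel"
    and \<kappa>: "\<And>y. L (\<kappa> y) = y" "\<And>y. norm (\<kappa> y) = norm y" and Ladd: "\<And>x y. L (x + y) = L x + L y"
  shows "(\<integral>\<^sup>+\<xi>. indicator (cball 0 2) \<xi> * g (L \<xi>) \<partial>lborel)
     \<le> ennreal (measure lborel (cball (0::'a) 3) / measure lborel (cball (0::'b) 1)) * (\<integral>\<^sup>+\<eta>. g \<eta> \<partial>lborel)"
proof -
  have fm: "emeasure lborel (cball (0::'c::euclidean_space) a) = ennreal (measure lborel (cball (0::'c) a))" for a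
    using emeasure_lborel_cball_finite[of "0::'c" a] by (intro emeasure_eq_ennreal_measure) auto
  have [measurable]: "indicator (cball (0::'a) a) \<in> borel_measurable borel" for a
    by (intro borel_measurable_indicator borel_closed closed_cball)
  define V where "V = measure lborel (cball (0::'b) 1)"
  define W where "W = measure lborel (cball (0::'a) 3)"
  have V: "V > 0" unfolding V_def using content_cball_pos[of 1 "0::'b"] by (simp add: measure_completion)
  define I where "I = (\<integral>\<^sup>+\<xi>. indicator (cball 0 2) \<xi> * g (L \<xi>) \<partial>lborel)"
  \<comment> \<open>I is written as its average over the unit ball of y, before each copy is
    translated by its own \<kappa> y.\<close>
  have "ennreal V * I = (\<integral>\<^sup>+y. indicator (cball (0::'b) 1) y * I \<partial>lborel)"
    by (subst nn_integral_multc) (auto simp: V_def fm intro!: borel_measurable_indicator)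
  also have "\<dots> = (\<integral>\<^sup>+y. (\<integral>\<^sup>+\<xi>. indicator (cball (0::'b) 1) y * (indicator (cball 0 2) (\<kappa> y + \<xi>) * g (L \<xi> + y)) \<partial>lborel) \<partial>lborel)"
  proof (intro nn_integral_cong)
    fix y :: 'b
    have "I = (\<integral>\<^sup>+\<xi>. indicator (cball 0 2) (\<kappa> y + \<xi>) * g (L \<xi> + y) \<partial>lborel)"
      unfolding I_def by (subst nn_integral_lborel_translate[symmetric, of _ "\<kappa> y"]) (auto simp: Ladd \<kappa> add.commute)
    then show "indicator (cball 0 1) y * I = (\<integral>\<^sup>+\<xi>. indicator (cball (0::'b) 1) y * (indicator (cball 0 2) (\<kappa> y + \<xi>) * g (L \<xi> + y)) \<partial>lborel)"
      by (subst nn_integral_cmult) auto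
  qed
  also have "\<dots> \<le> (\<integral>\<^sup>+y. (\<integral>\<^sup>+\<xi>. indicator (cball (0::'a) 3) \<xi> * g (L \<xi> + y) \<partial>lborel) \<partial>lborel)"
  proof (intro nn_integral_mono)
    fix y :: 'b and \<xi> :: 'a
    have "norm \<xi> \<le> norm (\<kappa> y + \<xi>) + norm y" using norm_triangle_ineq4[of "\<kappa> y + \<xi>" "\<kappa> y"] \<kappa>(2)[of y] by simp
    then show "indicator (cball (0::'b) 1) y * (indicator (cball 0 2) (\<kappa> y + \<xi>) * g (L \<xi> + y)) \<le> indicator (cball (0::'a) 3) \<xi> * g (L \<xi> + y)"
      by (auto simp: indicator_def)
  qed
  also have "\<dots> = (\<integral>\<^sup>+\<xi>. (\<integral>\<^sup>+y. indicator (cball (0::'a) 3) \<xi> * g (L \<xi> + y) \<partial>lborel) \<partial>lborel)"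
    by (rule lborel_pair.Fubini') measurable
  also have "\<dots> = (\<integral>\<^sup>+\<xi>. indicator (cball (0::'a) 3) \<xi> * (\<integral>\<^sup>+y. g y \<partial>lborel) \<partial>lborel)"
    by (intro nn_integral_cong) (simp add: nn_integral_cmult nn_integral_lborel_translate)
  also have "\<dots> = ennreal W * (\<integral>\<^sup>+y. g y \<partial>lborel)"
    by (subst nn_integral_multc) (auto simp: W_def fm intro!: borel_measurable_indicator)
  finally have "ennreal V * I \<le> ennreal W * (\<integral>\<^sup>+y. g y \<partial>lborel)" .
  then have "ennreal (1 / V) * (ennreal V * I) \<le> ennreal (1 / V) * (ennreal W * (\<integral>\<^sup>+y. g y \<partial>lborel))"
    by (rule mult_left_mono) simp
  moreover have "ennreal (1 / V) * (ennreal V * I) = I" using V by (simp add: mult.assoc[symmetric] ennreal_mult[symmetric])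
  moreover have "ennreal (1 / V) * (ennreal W * (\<integral>\<^sup>+y. g y \<partial>lborel)) = ennreal (W / V) * (\<integral>\<^sup>+y. g y \<partial>lborel)"
    using V by (simp add: mult.assoc[symmetric] ennreal_mult[symmetric] W_def)
  ultimately show ?thesis by (simp add: I_def V_def W_def)
qed

text \<open>The transform lives in a slab of width 1/R around L \<xi> = \<theta>, which has
  codimension DIM('b). After the reduction to an integral over 'b, scaling by R gives the power of
  R. Decay of order 2 DIM('b) is integrable, and raising a quantity in (0, 1] to the power r \<ge> 1
  only decreases it.\<close>

lemma scaled_family_Lr_pow:
  fixes \<kappa> :: "'b \<Rightarrow> 'a"
  assumes F: "scaled_family \<iota> F" and r: "r \<ge> 1" and [measurable]: "\<kappa> \<in> borel_measurable borel"
    and \<kappa>: "\<And>y. L (\<kappa> y) = y" "\<And>y. norm (\<kappa> y) = norm y" and Ladd: "\<And>x y. L (x + y) = L x + L y"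
  shows "\<exists>C\<ge>0. \<forall>R\<ge>1/16. \<forall>\<theta>. Lr_pow r (fourier (F R \<theta>)) \<le> ennreal (C / R ^ DIM('b))"
proof -
  obtain C0 where C0: "\<And>R \<theta> \<xi>. R \<ge> 1/16 \<Longrightarrow> norm (fourier (F R \<theta>) \<xi>) * (1 + norm (R *\<^sub>R (L \<xi> - \<theta>))) ^ (2 * DIM('b)) \<le> C0"
    and z: "\<And>R \<theta> \<xi>. norm \<xi> > 2 \<Longrightarrow> fourier (F R \<theta>) \<xi> = 0"
    using scaled_family_fourier_bound[OF F, of "2 * DIM('b)"] by blast
  define C where "C = max C0 1"
  define Q where "Q = measure lborel (cball (0::'a) 3) / measure lborel (cball (0::'b) 1)"
  define I where "I = (LINT y|lborel. 1 / (1 + norm (y::'b)) ^ (2 * DIM('b)))"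
  have I0: "I \<ge> 0" unfolding I_def by (rule integral_nonneg_AE) simp
  have Q0: "Q \<ge> 0" by (simp add: Q_def)
  have "Lr_pow r (fourier (F R \<theta>)) \<le> ennreal ((Q * (C powr r) * I) / R ^ DIM('b))" if R: "R \<ge> 1/16" for R \<theta>
  proof -
    have R0: "R > 0" using R by simp
    define g where "g = (\<lambda>\<eta>::'b. ennreal (C powr r * (1 / (1 + norm (R *\<^sub>R (\<eta> - \<theta>))) ^ (2 * DIM('b)))))"
    have [measurable]: "g \<in> borel_measurable borel" unfolding g_def by measurable
    have "Lr_pow r (fourier (F R \<theta>)) \<le> (\<integral>\<^sup>+\<xi>. indicator (cball 0 2) \<xi> * g (L \<xi>) \<partial>lborel)"
      unfolding Lr_pow_def
    proof (intro nn_integral_mono)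
      fix \<xi> :: 'a
      show "ennreal (norm (fourier (F R \<theta>) \<xi>) powr r) \<le> indicator (cball 0 2) \<xi> * g (L \<xi>)"
      proof (cases "norm \<xi> > 2")
        case True then show ?thesis by (simp add: z)
      next
        case False
        define q where "q = (1 + norm (R *\<^sub>R (L \<xi> - \<theta>))) ^ (2 * DIM('b))"
        have q: "q \<ge> 1" unfolding q_def by (intro one_le_power) simp
        have "norm (fourier (F R \<theta>) \<xi>) * q \<le> C" using C0[OF R, of \<theta> \<xi>] by (simp add: C_def q_def)
        then have "norm (fourier (F R \<theta>) \<xi>) \<le> C * (1 / q)" using q by (simp add: field_simps)
        then have "norm (fourier (F R \<theta>) \<xi>) powr r \<le> (C * (1 / q)) powr r" using r by (intro powr_mono2) auto
        also have "\<dots> = C powr r * (1 / q) powr r" using q by (intro powr_mult)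
        also have "\<dots> \<le> C powr r * (1 / q) powr 1" using q r by (intro mult_left_mono powr_mono') auto
        finally have "ennreal (norm (fourier (F R \<theta>) \<xi>) powr r) \<le> g (L \<xi>)"
          unfolding g_def q_def[symmetric] using q by (intro ennreal_leI) simp
        then show ?thesis using False by simp
      qed
    qed
    also have "\<dots> \<le> ennreal Q * (\<integral>\<^sup>+\<eta>. g \<eta> \<partial>lborel)"
      unfolding Q_def by (rule nn_integral_ball_fibre_le) (use \<kappa> Ladd in auto)
    also have "(\<integral>\<^sup>+\<eta>. g \<eta> \<partial>lborel) = ennreal (\<bar>1 / R\<bar> ^ DIM('b)) * (\<integral>\<^sup>+y. g (\<theta> + (1 / R) *\<^sub>R y) \<partial>lborel)"
      using R0 by (intro nn_integral_lborel_affine) auto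
    also have "(\<integral>\<^sup>+y. g (\<theta> + (1 / R) *\<^sub>R y) \<partial>lborel) = (\<integral>\<^sup>+y. ennreal (C powr r * (1 / (1 + norm (y::'b)) ^ (2 * DIM('b)))) \<partial>lborel)"
      using R0 by (simp add: g_def)
    also have "\<dots> = ennreal (C powr r * I)"
      unfolding I_def integral_mult_right_zero[symmetric]
      by (intro nn_integral_eq_integral integrable_mult_right integrable_decay) auto
    also have "ennreal Q * (ennreal (\<bar>1 / R\<bar> ^ DIM('b)) * ennreal (C powr r * I)) = ennreal ((Q * (C powr r) * I) / R ^ DIM('b))"
      using R0 Q0 I0 by (simp add: ennreal_mult[symmetric] power_divide mult_ac)
    finally show ?thesis .
  qed
  then show ?thesis using Q0 I0 by (intro exI[of _ "Q * (C powr r) * I"]) auto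
qed

end

section \<open>Bessel potentials with an integrable symbol\<close>

lemma potential_of_integrable:
  fixes F :: "(real ^ 'n) ^ 'm::finite \<Rightarrow> complex"
  assumes i: "integrable lborel (\<lambda>x. of_real (sobolev_weight s x) * fourier F x)"
  shows "sobolev_potential s F (inv_fourier (\<lambda>x. of_real (sobolev_weight s x) * fourier F x))"
  unfolding sobolev_potential_def
proof (intro conjI allI impI)
  define W where "W = (\<lambda>x. of_real (sobolev_weight s x) * fourier F x)"
  have iW: "integrable lborel W" using i by (simp add: W_def)
  have [measurable]: "W \<in> borel_measurable borel" using iW by auto
  have [measurable]: "inv_fourier W \<in> borel_measurable borel" using iW by (rule inv_fourier_measurable)
  show "inv_fourier (\<lambda>x. of_real (sobolev_weight s x) * fourier F x) \<in> borel_measurable borel"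
    using inv_fourier_measurable[OF i] .
  fix \<theta> :: "(real ^ 'n) ^ 'm \<Rightarrow> complex" assume \<theta>: "schwartz \<theta>"
  have it: "integrable lborel \<theta>" using \<theta> by (intro rapid_integrable schwartz_rapid)
  have [measurable]: "\<theta> \<in> borel_measurable borel" using it by auto
  define h where "h = (\<lambda>x y. W y * cis (2 * pi * (y \<bullet> x)) * \<theta> x)"
  have e: "inv_fourier W x * \<theta> x = (LINT y|lborel. h x y)" for x
    unfolding h_def inv_fourier_eq by (simp only: integral_mult_left_zero)
  have m: "(\<lambda>(x, y). h x y) \<in> borel_measurable (borel \<Otimes>\<^sub>M borel)" unfolding h_def by measurable
  have b: "norm (h x y) \<le> norm (\<theta> x) * norm (W y)" for x y by (simp add: h_def norm_mult)
  show "integrable lborel (\<lambda>x. inv_fourier (\<lambda>x. of_real (sobolev_weight s x) * fourier F x) x * \<theta> x)"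
    unfolding W_def[symmetric] e by (rule fubini_lborel_mult(2)[OF it iW m b])
  have "(LINT x|lborel. inv_fourier W x * \<theta> x) = (LINT y|lborel. LINT x|lborel. h x y)"
    unfolding e by (rule fubini_lborel_mult(1)[OF it iW m b])
  also have "\<dots> = (LINT y|lborel. W y * inv_fourier \<theta> y)"
  proof (rule Bochner_Integration.integral_cong[OF refl])
    fix y
    have "(LINT x|lborel. h x y) = (LINT x|lborel. W y * (\<theta> x * cis (2 * pi * (x \<bullet> y))))"
      by (intro Bochner_Integration.integral_cong refl) (simp add: h_def inner_commute mult_ac)
    then show "(LINT x|lborel. h x y) = W y * inv_fourier \<theta> y" by (simp only: integral_mult_right_zero inv_fourier_eq)
  qed
  finally show "(LINT x|lborel. inv_fourier (\<lambda>x. of_real (sobolev_weight s x) * fourier F x) x * \<theta> x) =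
     (LINT y|lborel. of_real (sobolev_weight s y) * fourier F y * inv_fourier \<theta> y)"
    unfolding W_def .
qed

section \<open>Partial sums of components and the two-scale weight\<close>

definition sum_on :: "'m set \<Rightarrow> 'b::euclidean_space ^ 'm::finite \<Rightarrow> 'b" where
  "sum_on J \<xi> = (\<Sum>i\<in>J. \<xi> $ i)"

definition embed_on :: "'m set \<Rightarrow> 'b::euclidean_space \<Rightarrow> 'b ^ 'm::finite" where
  "embed_on J \<nu> = (\<chi> i. if i \<in> J then \<nu> else 0)"

lemma adjoint_pair_on:
  fixes J :: "'m::finite set"
  shows "adjoint_pair (embed_on J :: 'b::euclidean_space \<Rightarrow> 'b ^ 'm) (sum_on J)"
proof (rule adjoint_pair.intro)
  show "linear (embed_on J :: 'b \<Rightarrow> 'b ^ 'm)"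
    by (rule linearI) (auto simp: embed_on_def vec_eq_iff)
  show "embed_on J \<nu> \<bullet> x = \<nu> \<bullet> sum_on J x" for \<nu> and x :: "'b ^ 'm"
    by (simp add: embed_on_def sum_on_def inner_vec_def inner_sum_right if_distrib[of "\<lambda>v. v \<bullet> _"] sum.If_cases cong: if_cong)
qed

lemma adjoint_pair_axis:
  fixes i :: "'m::finite"
  shows "adjoint_pair (axis i :: 'b::euclidean_space \<Rightarrow> 'b ^ 'm) (\<lambda>x. x $ i)"
proof (rule adjoint_pair.intro)
  show "linear (axis i :: 'b \<Rightarrow> 'b ^ 'm)"
    by (rule linearI) (auto simp: axis_def vec_eq_iff)
  show "axis i \<nu> \<bullet> x = \<nu> \<bullet> x $ i" for \<nu> and x :: "'b ^ 'm"
    by (simp add: inner_axis inner_commute)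
qed

lemma sum_on_axis: "sum_on J (axis i b) = (if i \<in> J then b else 0)"
  by (simp add: sum_on_def axis_def if_distrib cong: if_cong)

lemma sum_on_add: "sum_on J (x + y) = sum_on J x + sum_on J y"
  by (simp add: sum_on_def sum.distrib)

lemma sum_on_scaleR: "sum_on J (c *\<^sub>R x) = c *\<^sub>R sum_on J x"
  by (simp add: sum_on_def scaleR_sum_right)

text \<open>A block varies at scale 1/R in the coordinates of J and at scale 1 in the others; the
  Sobolev weight is rescaled accordingly in each coordinate.\<close>

definition local_scale :: "'m set \<Rightarrow> 'm \<Rightarrow> real \<Rightarrow> real" where
  "local_scale J i R = (if i \<in> J then 1 / R else 1)"

lemma norm_component_sq: "(norm ((x::'b::euclidean_space ^ 'm::finite) $ i))\<^sup>2 = (\<Sum>b\<in>Basis. (x \<bullet> axis i b)\<^sup>2)"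
  by (simp add: norm_sq_Basis inner_axis)

text \<open>The substitute for the Sobolev weight with integer exponents. Being a polynomial, it
  preserves scaled families, and the true weight divided by it is, up to constants and powers of R,
  a contraction from \<open>Lr_multiplier_weight\<close>.\<close>

definition weight_poly :: "'m set \<Rightarrow> nat \<Rightarrow> real \<Rightarrow> 'b::euclidean_space ^ 'm::finite \<Rightarrow> real" where
  "weight_poly J N R x = (\<Prod>i\<in>UNIV. (1 + (local_scale J i R)\<^sup>2 * (1 + 4 * pi\<^sup>2 * (norm (x $ i))\<^sup>2)) ^ N)"

text \<open>Each factor is built from 1 and two successive multiplications by a scaled coordinate,
  summed over the basis. Induction on N and on the set of coordinates does the rest.\<close>

lemma scaled_family_weight_poly:
  fixes F :: "real \<Rightarrow> 'b::euclidean_space \<Rightarrow> 'b ^ 'm::finite \<Rightarrow> complex"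
  assumes F: "scaled_family (embed_on J) F"
  shows "scaled_family (embed_on J) (\<lambda>R \<theta> x. of_real (weight_poly J N R x) * F R \<theta> x)"
proof -
  interpret adjoint_pair "embed_on J :: 'b \<Rightarrow> 'b ^ 'm" "sum_on J" by (rule adjoint_pair_on)
  let ?\<rho> = "local_scale J"
  \<comment> \<open>The lower bound 1/16 on R is that of R = 2^j 2^k with j \<ge> -4 and k \<ge> 0,
    the scales met in \<open>hormander_norm_lacunary\<close>.\<close>
  have rb: "\<bar>?\<rho> i R\<bar> \<le> 16" if "R \<ge> 1/16" for i R
  proof -
    have "R > 0" using that by simp
    then show ?thesis using that by (auto simp: local_scale_def pos_divide_le_eq)
  qed
  have rb2: "\<bar>(?\<rho> i R)\<^sup>2\<bar> \<le> 16\<^sup>2" if "R \<ge> 1/16" for i R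
    using power_mono[OF rb[OF that], where n=2] by simp
  \<comment> \<open>For i in J the product of \<open>local_scale J i R\<close> and R is exactly 1;
    for the other i the vector \<open>axis i b\<close> is annihilated by \<open>sum_on J\<close>.
    These are the two alternatives of \<open>scaled_family_inner_mult\<close>.\<close>
  have mult: "scaled_family (embed_on J) (\<lambda>R \<theta> x. of_real (?\<rho> i R * (x \<bullet> axis i b)) * F R \<theta> x)"
    if "scaled_family (embed_on J) F" for F :: "real \<Rightarrow> 'b \<Rightarrow> 'b ^ 'm \<Rightarrow> complex" and i and b :: 'b
    by (rule scaled_family_inner_mult[OF that, where C=16 and D=1]) (rule rb, assumption, auto simp: sum_on_axis local_scale_def)
  have one: "scaled_family (embed_on J) (\<lambda>R \<theta> x. of_real (1 + (?\<rho> i R)\<^sup>2 * (1 + 4 * pi\<^sup>2 * (norm (x $ i))\<^sup>2)) * F R \<theta> x)"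
    if F: "scaled_family (embed_on J) F" for F :: "real \<Rightarrow> 'b \<Rightarrow> 'b ^ 'm \<Rightarrow> complex" and i :: 'm
  proof -
    have 1: "scaled_family (embed_on J) (\<lambda>R \<theta> x. of_real ((?\<rho> i R)\<^sup>2) * F R \<theta> x)"
      by (rule scaled_family.scale[OF F, where C="16\<^sup>2"]) (use rb2 in \<open>simp only: norm_of_real\<close>)
    have 2: "scaled_family (embed_on J) (\<lambda>R \<theta> x. \<Sum>b\<in>(Basis::'b set). of_real (4 * pi\<^sup>2) * (of_real (?\<rho> i R * (x \<bullet> axis i b)) * (of_real (?\<rho> i R * (x \<bullet> axis i b)) * F R \<theta> x)))"
    proof (intro scaled_family_sum finite_Basis nonempty_Basis)
      fix b :: 'b
      show "scaled_family (embed_on J) (\<lambda>R \<theta> x. of_real (4 * pi\<^sup>2) * (of_real (?\<rho> i R * (x \<bullet> axis i b)) * (of_real (?\<rho> i R * (x \<bullet> axis i b)) * F R \<theta> x)))"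
        by (rule scaled_family.scale[OF mult[OF mult[OF F]], where C="4 * pi\<^sup>2"]) (subst norm_of_real, simp)
    qed
    have "of_real (1 + (?\<rho> i R)\<^sup>2 * (1 + 4 * pi\<^sup>2 * (norm (x $ i))\<^sup>2)) * F R \<theta> x =
      (F R \<theta> x + of_real ((?\<rho> i R)\<^sup>2) * F R \<theta> x) + (\<Sum>b\<in>(Basis::'b set). of_real (4 * pi\<^sup>2) * (of_real (?\<rho> i R * (x \<bullet> axis i b)) * (of_real (?\<rho> i R * (x \<bullet> axis i b)) * F R \<theta> x)))" for R \<theta> x
    proof -
      have "(\<Sum>b\<in>(Basis::'b set). of_real (4 * pi\<^sup>2) * (of_real (?\<rho> i R * (x \<bullet> axis i b)) * (of_real (?\<rho> i R * (x \<bullet> axis i b)) * F R \<theta> x)))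
        = (\<Sum>b\<in>(Basis::'b set). of_real ((4 * pi\<^sup>2 * (?\<rho> i R)\<^sup>2) * (x \<bullet> axis i b)\<^sup>2) * F R \<theta> x)"
        by (intro sum.cong refl) (simp add: power2_eq_square)
      also have "\<dots> = of_real (4 * pi\<^sup>2 * (?\<rho> i R)\<^sup>2 * (norm (x $ i))\<^sup>2) * F R \<theta> x"
        by (simp only: norm_component_sq sum_distrib_left sum_distrib_right of_real_sum)
      finally show ?thesis by (simp add: algebra_simps)
    qed
    then show ?thesis using scaled_family.add[OF scaled_family.add[OF F 1] 2] by (simp only:)
  qed
  have pw: "scaled_family (embed_on J) (\<lambda>R \<theta> x. of_real ((1 + (?\<rho> i R)\<^sup>2 * (1 + 4 * pi\<^sup>2 * (norm (x $ i))\<^sup>2)) ^ N) * F R \<theta> x)"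
    if F: "scaled_family (embed_on J) F" for F :: "real \<Rightarrow> 'b \<Rightarrow> 'b ^ 'm \<Rightarrow> complex" and i :: 'm
  proof (induction N)
    case 0 then show ?case using F by simp
  next
    case (Suc N)
    show ?case using one[OF Suc, of i] by (simp only: power_Suc of_real_mult mult.assoc)
  qed
  define q where "q = (\<lambda>i R (x::'b^'m). (1 + (?\<rho> i R)\<^sup>2 * (1 + 4 * pi\<^sup>2 * (norm (x $ i))\<^sup>2)) ^ N)"
  have "scaled_family (embed_on J) (\<lambda>R \<theta> x. of_real (\<Prod>i\<in>I. q i R x) * F R \<theta> x)"
    if "finite I" for I :: "'m set"
    using that
  proof (induction I)
    case empty then show ?case using F by simp
  next
    case (insert i I)
    have "of_real (\<Prod>i\<in>insert i I. q i R x) * F R \<theta> x = of_real (q i R x) * (of_real (\<Prod>i\<in>I. q i R x) * F R \<theta> x)" for R \<theta> x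
      using insert.hyps by simp
    then show ?case using pw[OF insert.IH, of i] by (simp only: q_def)
  qed
  then show ?thesis unfolding weight_poly_def q_def by simp
qed

text \<open>With w = 1 + 4 pi^2 |x_i|^2, the weight w^(s/2) equals S R^s \<mu> (1 + w/R^2)^N for i
  in J and S \<mu> (1 + w)^N otherwise. The factors \<mu> are contractions, and the integer powers
  form \<open>weight_poly\<close>, under which the block stays in a scaled family with
  \<open>Lr_pow\<close> of order R^(-n). What remains is the constant R^(s i) for each i in
  J.\<close>

lemma sobolev_block:
  fixes B :: "(real ^ 'n) ^ 'm::finite \<Rightarrow> complex" and u :: "real ^ 'n \<Rightarrow> complex"
  assumes B: "band_rapid B" and u: "schwartz u" and r: "r \<ge> 1" and s: "\<And>i. s i > 0" and i0: "i0 \<in> J"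
  shows "\<exists>C\<ge>0. \<forall>R\<ge>1/16. \<forall>\<theta>. \<exists>G. sobolev_potential s (\<lambda>\<xi>. fourier B \<xi> * fourier u (R *\<^sub>R (sum_on J \<xi> - \<theta>))) G \<and>
     Lr_pow r G \<le> ennreal (C * (R powr (\<Sum>i\<in>J. s i)) powr r / R ^ CARD('n))"
proof -
  interpret adjoint_pair "embed_on J :: real ^ 'n \<Rightarrow> (real ^ 'n) ^ 'm" "sum_on J" by (rule adjoint_pair_on)
  obtain N where N: "\<And>i. real N > s i / 2"
  proof -
    obtain N where "real N > (\<Sum>i\<in>UNIV. s i)" using reals_Archimedean2 by blast
    moreover have "s i \<le> (\<Sum>i\<in>UNIV. s i)" for i
      using s by (intro member_le_sum) (auto intro: less_imp_le)
    ultimately have "s i / 2 < real N" for i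
    proof -
      have "s i / 2 \<le> s i" using s[of i] by simp
      also have "\<dots> \<le> (\<Sum>i\<in>UNIV. s i)" by fact
      also have "\<dots> < real N" by fact
      finally show ?thesis .
    qed
    then show ?thesis by (rule that)
  qed
  define Q where "Q = (\<lambda>i S. \<forall>\<epsilon>>0. Lr_multiplier r (\<lambda>x::(real ^ 'n) ^ 'm. of_real ((\<epsilon> * (1 + 4 * pi\<^sup>2 * (norm (x $ i))\<^sup>2)) powr (s i / 2) / (1 + \<epsilon> * (1 + 4 * pi\<^sup>2 * (norm (x $ i))\<^sup>2)) ^ N / S)))"
  have "\<exists>S. S > 0 \<and> Q i S" for i
  proof (rule adjoint_pair.Lr_multiplier_weight[OF adjoint_pair_axis r _ N[of i]])
    show "s i / 2 > 0" using s[of i] by simp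
  qed (unfold Q_def, blast)
  then obtain S where SQ: "\<And>i. S i > 0 \<and> Q i (S i)" by metis
  then have S: "S i > 0" for i by blast
  have mult: "Lr_multiplier r (\<lambda>x::(real ^ 'n) ^ 'm. of_real ((\<epsilon> * (1 + 4 * pi\<^sup>2 * (norm (x $ i))\<^sup>2)) powr (s i / 2) / (1 + \<epsilon> * (1 + 4 * pi\<^sup>2 * (norm (x $ i))\<^sup>2)) ^ N / S i))"
    if "\<epsilon> > 0" for i \<epsilon> using SQ[of i] that by (simp add: Q_def)
  define A where "A = (\<lambda>R \<theta>. skew_convolve (embed_on J) R \<theta> B u)"
  have famA: "scaled_family (embed_on J) A"
    unfolding A_def using scaled_family.base[OF B u, of "embed_on J"] by (simp add: eta_contract_eq)
  have famP: "scaled_family (embed_on J) (\<lambda>R \<theta> x. of_real (weight_poly J N R x) * A R \<theta> x)"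
    by (rule scaled_family_weight_poly[OF famA])
  \<comment> \<open>For i0 in J, \<open>axis i0\<close> is a norm-preserving right inverse of
    \<open>sum_on J\<close>, the \<kappa> wanted by \<open>scaled_family_Lr_pow\<close>.\<close>
  have kap1: "(axis i0 :: real^'n \<Rightarrow> (real^'n)^'m) \<in> borel_measurable borel"
    by (rule adjoint_pair.meas_\<iota>[OF adjoint_pair_axis])
  have kap2: "sum_on J (axis i0 y) = y" for y :: "real^'n" using i0 by (simp add: sum_on_axis)
  have kap3: "norm (axis i0 y :: (real^'n)^'m) = norm y" for y :: "real^'n" by (simp add: norm_eq_sqrt_inner inner_axis_axis)
  define PF where "PF = (\<lambda>R \<theta> x. of_real (weight_poly J N R x) * A R \<theta> x)"
  have PFfam: "scaled_family (embed_on J) PF" using famP unfolding PF_def .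
  have "\<exists>C\<ge>0. \<forall>R\<ge>1/16. \<forall>\<theta>. Lr_pow r (fourier (PF R \<theta>)) \<le> ennreal (C / R ^ DIM(real^'n))"
  proof (rule scaled_family_Lr_pow[OF PFfam r kap1])
    show "sum_on J (axis i0 y) = y" for y :: "real^'n" by (rule kap2)
    show "norm (axis i0 y :: (real^'n)^'m) = norm y" for y :: "real^'n" by (rule kap3)
    show "sum_on J (x + y) = sum_on J x + sum_on J y" for x y :: "(real^'n)^'m" by (rule sum_on_add)
  qed
  then obtain C where C0: "C \<ge> 0" and C1: "\<forall>R\<ge>1/16. \<forall>\<theta>. Lr_pow r (fourier (PF R \<theta>)) \<le> ennreal (C / R ^ DIM(real^'n))"
    by (elim exE conjE)
  have "Lr_pow r (fourier (\<lambda>x. of_real (weight_poly J N R x) * A R \<theta> x)) \<le> ennreal (C / R ^ CARD('n))" if "R \<ge> 1/16" for R \<theta>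
    using C1[rule_format, OF that, of \<theta>] by (simp only: DIM_cart DIM_real mult_1_right PF_def)
  note C = C0 this
  define Sp where "Sp = (\<Prod>i\<in>UNIV. S i)"
  have Sp: "Sp > 0" unfolding Sp_def by (intro prod_pos) (use S in auto)
  have "\<exists>G. sobolev_potential s (\<lambda>\<xi>. fourier B \<xi> * fourier u (R *\<^sub>R (sum_on J \<xi> - \<theta>))) G \<and>
     Lr_pow r G \<le> ennreal ((Sp powr r * C) * (R powr (\<Sum>i\<in>J. s i)) powr r / R ^ CARD('n))" if R: "R \<ge> 1/16" for R \<theta>
  proof -
    have R0: "R > 0" using R by simp
    define F where "F = (\<lambda>\<xi>. fourier B \<xi> * fourier u (R *\<^sub>R (sum_on J \<xi> - \<theta>)))"
    have rB: "rapid B" and cB: "continuous_on UNIV B" using B by (auto simp: band_rapid_def)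
    have ru: "rapid u" using u by (rule schwartz_rapid)
    have FA: "F = fourier (A R \<theta>)"
      unfolding F_def A_def by (rule ext) (rule fourier_skew_convolve[OF rapid_integrable[OF rB] rapid_integrable[OF ru], symmetric])
    have rA: "rapid (A R \<theta>)" by (rule scaled_family_rapid[OF famA])
    have [measurable]: "A R \<theta> \<in> borel_measurable borel" using rA by (rule rapid_measurable)
    have cA: "continuous_on UNIV (A R \<theta>)" unfolding A_def by (rule continuous_skew_convolve[OF rB cB ru])
    obtain CA where CA: "\<And>x. norm (A R \<theta> x) \<le> CA" using rapid_bounded[OF rA] by blast
    have iA: "integrable lborel (A R \<theta>)" using rA by (rule rapid_integrable)
    have iF: "integrable lborel (fourier (A R \<theta>))"
    proof (rule integrableI_bounded_set[where A="cball 0 2" and B="LINT x|lborel. norm (A R \<theta> x)"])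
      show "AE x in lborel. x \<in> cball 0 2 \<longrightarrow> norm (fourier (A R \<theta>) x) \<le> (LINT x|lborel. norm (A R \<theta> x))"
        using norm_fourier_le by (intro AE_I2) blast
      show "emeasure lborel (cball 0 2 :: ((real^'n)^'m) set) < \<infinity>" by (rule emeasure_lborel_cball_finite)
      show "AE x in lborel. x \<notin> cball 0 2 \<longrightarrow> fourier (A R \<theta>) x = 0"
        using scaled_family_fourier_bound[OF famA, of 0] by (intro AE_I2) auto
    qed (use fourier_measurable[OF iA] in auto)
    have FF: "fourier F x = A R \<theta> (- x)" for x
      using fourier_inversion[OF iA CA cA iF, of "- x"] by (simp add: inv_fourier_def FA)
    \<comment> \<open>F is the transform of A, so its own transform is A reflected. Since the weight
      is even, the inverse transform of K is the transform of \<open>weight_poly\<close> times A, a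
      member of the scaled family.\<close>
    define K where "K = (\<lambda>x. of_real (weight_poly J N R x) * A R \<theta> (- x))"
    have rPA: "rapid (\<lambda>x. of_real (weight_poly J N R x) * A R \<theta> x)" by (rule scaled_family_rapid[OF famP])
    then have iPA: "integrable lborel (\<lambda>x. of_real (weight_poly J N R x) * A R \<theta> x)" by (rule rapid_integrable)
    have even: "weight_poly J N R (- x) = weight_poly J N R x" for x :: "(real^'n)^'m" by (simp add: weight_poly_def)
    have iK: "integrable lborel K"
      unfolding K_def using integrable_lborel_affine[OF iPA, of "-1" 0] by (simp add: even)
    have [measurable]: "(\<lambda>x. of_real (weight_poly J N R x) * A R \<theta> x) \<in> borel_measurable borel" using iPA by simp
    have IK: "inv_fourier K = fourier (\<lambda>x. of_real (weight_poly J N R x) * A R \<theta> x)"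
    proof (rule ext)
      fix \<xi>
      have "fourier (\<lambda>x. of_real (weight_poly J N R x) * A R \<theta> x) \<xi> =
        (LINT x|lborel. of_real (weight_poly J N R (0 - x)) * A R \<theta> (0 - x) * cis (- 2 * pi * ((0 - x) \<bullet> \<xi>)))"
        unfolding fourier_def by (rule integral_lborel_reflect[symmetric]) measurable
      then show "inv_fourier K \<xi> = fourier (\<lambda>x. of_real (weight_poly J N R x) * A R \<theta> x) \<xi>"
        by (simp add: inv_fourier_eq K_def even)
    qed
    define mu where "mu = (\<lambda>i (x::(real^'n)^'m). ((local_scale J i R)\<^sup>2 * (1 + 4 * pi\<^sup>2 * (norm (x $ i))\<^sup>2)) powr (s i / 2) / (1 + (local_scale J i R)\<^sup>2 * (1 + 4 * pi\<^sup>2 * (norm (x $ i))\<^sup>2)) ^ N / S i)"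
    have ls: "local_scale J i R > 0" for i using R0 by (simp add: local_scale_def)
    have mm: "Lr_multiplier r (\<lambda>x. complex_of_real (mu i x))" for i
      unfolding mu_def using ls[of i] by (intro mult) simp
    have MM: "Lr_multiplier r (\<lambda>x. \<Prod>i\<in>UNIV. complex_of_real (mu i x))"
      by (rule Lr_multiplier_prod) (use r mm in auto)
    define k where "k = Sp * R powr (\<Sum>i\<in>J. s i)"
    have k0: "k \<ge> 0" using Sp by (simp add: k_def)
    \<comment> \<open>The symbol of the potential is a constant times a product of contractions
      times K; this is the factorisation announced above the lemma.\<close>
    have W: "complex_of_real (sobolev_weight s x) * fourier F x = of_real k * ((\<Prod>i\<in>UNIV. complex_of_real (mu i x)) * K x)" for x
    proof -
      have c: "(1 + 4 * pi\<^sup>2 * (norm (x $ i))\<^sup>2) powr (s i / 2) = (S i * (if i \<in> J then R powr s i else 1)) * (mu i x * (1 + (local_scale J i R)\<^sup>2 * (1 + 4 * pi\<^sup>2 * (norm (x $ i))\<^sup>2)) ^ N)" for i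
      proof -
        define w where "w = 1 + 4 * pi\<^sup>2 * (norm (x $ i))\<^sup>2"
        have w: "w > 0" by (simp add: w_def add_pos_nonneg)
        have "(if i \<in> J then R powr s i else 1) * ((local_scale J i R)\<^sup>2 * w) powr (s i / 2) = w powr (s i / 2)"
        proof (cases "i \<in> J")
          case True
          have "((1 / R)\<^sup>2) powr (s i / 2) = (1 / R) powr s i"
          proof -
            have "((1 / R)\<^sup>2) powr (s i / 2) = ((1 / R) powr 2) powr (s i / 2)" using R0 by simp
            also have "\<dots> = (1 / R) powr s i" unfolding powr_powr by simp
            finally show ?thesis .
          qed
          then show ?thesis using True R0 w by (simp add: local_scale_def powr_mult powr_divide)
        qed (simp add: local_scale_def)
        moreover have "(1 + (local_scale J i R)\<^sup>2 * w) > 0" using w ls[of i] by (simp add: add_pos_nonneg)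
        ultimately show ?thesis using S[of i] by (simp add: mu_def w_def[symmetric])
      qed
      have "(\<Prod>i\<in>UNIV. if i \<in> J then R powr s i else 1) = R powr (\<Sum>i\<in>J. s i)"
        using R0 by (simp add: prod.If_cases powr_sum)
      then have "sobolev_weight s x = k * ((\<Prod>i\<in>UNIV. mu i x) * weight_poly J N R x)"
        unfolding sobolev_weight_def c weight_poly_def prod.distrib k_def Sp_def by simp
      then show ?thesis unfolding FF K_def by simp
    qed
    have iMK: "integrable lborel (\<lambda>x. (\<Prod>i\<in>UNIV. complex_of_real (mu i x)) * K x)"
      using MM by (intro integrable_bounded_mult iK) (auto simp: Lr_multiplier_def)
    have iW: "integrable lborel (\<lambda>x. complex_of_real (sobolev_weight s x) * fourier F x)"
      unfolding W by (intro integrable_mult_right iMK)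
    define G where "G = inv_fourier (\<lambda>x. complex_of_real (sobolev_weight s x) * fourier F x)"
    have G: "sobolev_potential s F G" unfolding G_def by (rule potential_of_integrable[OF iW])
    have Gk: "G \<xi> = of_real k * inv_fourier (\<lambda>x. (\<Prod>i\<in>UNIV. complex_of_real (mu i x)) * K x) \<xi>" for \<xi>
      unfolding G_def W by (simp only: inv_fourier_def fourier_cmult)
    have "Lr_pow r G = ennreal (k powr r) * Lr_pow r (inv_fourier (\<lambda>x. (\<Prod>i\<in>UNIV. complex_of_real (mu i x)) * K x))"
      unfolding Lr_pow_def Gk using inv_fourier_measurable[OF iMK] k0
      by (subst nn_integral_cmult[symmetric]) (auto intro!: nn_integral_cong simp: norm_mult powr_mult ennreal_mult)
    also have "\<dots> \<le> ennreal (k powr r) * Lr_pow r (inv_fourier K)"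
      using MM iK by (intro mult_left_mono) (auto simp: Lr_multiplier_def)
    also have "\<dots> \<le> ennreal (k powr r) * ennreal (C / R ^ CARD('n))"
      unfolding IK by (intro mult_left_mono C R) auto
    also have "\<dots> = ennreal ((Sp powr r * C) * (R powr (\<Sum>i\<in>J. s i)) powr r / R ^ CARD('n))"
      using Sp R0 C(1) by (subst ennreal_mult[symmetric]) (auto simp: k_def powr_mult mult_ac)
    finally show ?thesis using G unfolding F_def by blast
  qed
  then show ?thesis using C(1) by (intro exI[of _ "Sp powr r * C"]) auto
qed

lemma ennreal_powr_mono: "x \<le> y \<Longrightarrow> a \<ge> 0 \<Longrightarrow> ennreal_powr x a \<le> ennreal_powr y a"
  unfolding ennreal_powr_def
  by (auto simp: top_unique less_top intro!: ennreal_leI powr_mono2 enn2real_mono)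

lemma ennreal_powr_ennreal: "x \<ge> 0 \<Longrightarrow> ennreal_powr (ennreal x) a = ennreal (x powr a)"
  by (simp add: ennreal_powr_def)

lemma Lp_norm_Lr_pow:
  assumes r: "r > 0" shows "Lp_norm (ennreal r) G = ennreal_powr (Lr_pow r G) (1 / r)"
  using r by (simp add: Lp_norm_def Lp_norm_nonneg_def Lr_pow_def ennreal_powr_ennreal)

lemma sobolev_norm_le_potential:
  assumes "sobolev_potential s F G" "Lr_pow r G \<le> ennreal D" "r > 0" "D \<ge> 0"
  shows "sobolev_norm r s F \<le> ennreal (D powr (1 / r))"
proof -
  have "sobolev_norm r s F \<le> Lp_norm (ennreal r) G"
    unfolding sobolev_norm_def using assms(1) by (intro INF_lower) simp
  also have "\<dots> \<le> ennreal_powr (ennreal D) (1 / r)"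
    unfolding Lp_norm_Lr_pow[OF assms(3)] using assms by (intro ennreal_powr_mono) auto
  also have "\<dots> = ennreal (D powr (1 / r))" using assms by (simp add: ennreal_powr_ennreal)
  finally show ?thesis .
qed

section \<open>Summing potentials\<close>

lemma sobolev_weight_bound:
  fixes s :: "'m::finite \<Rightarrow> real"
  assumes s: "\<And>i. s i > 0"
  shows "\<exists>K N. \<forall>\<xi>::(real^'n)^'m. sobolev_weight s \<xi> \<le> K * (1 + norm \<xi>) ^ N"
proof -
  define k where "k = 1 + 4 * pi\<^sup>2"
  have k: "k \<ge> 1" by (simp add: k_def)
  define S where "S = (\<Sum>i\<in>UNIV. s i)"
  obtain N where N: "real N \<ge> S" using real_arch_simple by blast
  have "sobolev_weight s \<xi> \<le> k powr (S / 2) * (1 + norm \<xi>) ^ N" for \<xi> :: "(real^'n)^'m"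
  proof -
    define t where "t = 1 + norm \<xi>"
    have t: "t \<ge> 1" by (simp add: t_def)
    have "sobolev_weight s \<xi> \<le> (\<Prod>i\<in>(UNIV::'m set). (k * t\<^sup>2) powr (s i / 2))"
      unfolding sobolev_weight_def
    proof (intro prod_mono conjI powr_mono2)
      fix i :: 'm
      have "(norm (\<xi> $ i))\<^sup>2 \<le> t\<^sup>2" 
        using Finite_Cartesian_Product.norm_nth_le[of \<xi> i] by (intro power_mono) (auto simp: t_def)
      moreover have "1 \<le> t\<^sup>2" using t by (simp add: one_le_power)
      moreover have "k * t\<^sup>2 = t\<^sup>2 + 4 * pi\<^sup>2 * t\<^sup>2" by (simp add: k_def distrib_right)
      moreover have "4 * pi\<^sup>2 * (norm (\<xi> $ i))\<^sup>2 \<le> 4 * pi\<^sup>2 * t\<^sup>2" using calculation(1) by (intro mult_left_mono) auto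
      ultimately show "1 + 4 * pi\<^sup>2 * (norm (\<xi> $ i))\<^sup>2 \<le> k * t\<^sup>2" by linarith
    qed (use s in \<open>auto intro: less_imp_le\<close>)
    also have "\<dots> = (k * t\<^sup>2) powr (S / 2)" using k t by (simp add: powr_sum S_def sum_divide_distrib)
    also have "\<dots> = k powr (S / 2) * t powr S"
    proof -
      have "(t\<^sup>2) powr (S / 2) = (t powr 2) powr (S / 2)" using t by simp
      also have "\<dots> = t powr S" unfolding powr_powr by simp
      finally show ?thesis using k by (simp add: powr_mult)
    qed
    also have "\<dots> \<le> k powr (S / 2) * t powr real N" using N t by (intro mult_left_mono powr_mono) auto
    also have "\<dots> = k powr (S / 2) * t ^ N" using t by (simp add: powr_realpow)
    finally show ?thesis by (simp add: t_def)
  qed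
  then show ?thesis by blast
qed

lemma sobolev_weight_nonneg: "sobolev_weight s \<xi> \<ge> 0"
  unfolding sobolev_weight_def by (intro prod_nonneg) auto

lemma sobolev_weight_measurable[measurable]: "sobolev_weight s \<in> borel_measurable borel"
proof -
  have [measurable]: "(\<lambda>x::(real^'n)^'m. x $ i) \<in> borel_measurable borel" for i
    by (intro borel_measurable_continuous_onI continuous_intros)
  show ?thesis unfolding sobolev_weight_def[abs_def] by measurable
qed

lemma integrable_weight_inv_fourier:
  fixes s :: "'m::finite \<Rightarrow> real" and \<theta> :: "(real^'n)^'m \<Rightarrow> complex"
  assumes s: "\<And>i. s i > 0" and \<theta>: "schwartz \<theta>"
  shows "integrable lborel (\<lambda>\<xi>. sobolev_weight s \<xi> * norm (inv_fourier \<theta> \<xi>))"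
proof -
  obtain K N where K: "\<And>\<xi>::(real^'n)^'m. sobolev_weight s \<xi> \<le> K * (1 + norm \<xi>) ^ N" using sobolev_weight_bound[where s=s, OF s] by blast
  have "integrable lborel (\<lambda>\<xi>. (1 + norm \<xi>) ^ N * norm (fourier \<theta> \<xi>))"
    by (intro rapid_integrable_weight schwartz_fourier_rapid \<theta>)
  from integrable_lborel_affine[OF this, of "-1" 0]
  have i: "integrable lborel (\<lambda>\<xi>. (1 + norm \<xi>) ^ N * norm (inv_fourier \<theta> \<xi>))" by (simp add: inv_fourier_def)
  have [measurable]: "inv_fourier \<theta> \<in> borel_measurable borel"
    by (intro inv_fourier_measurable rapid_integrable schwartz_rapid \<theta>)
  show ?thesis
  proof (rule Bochner_Integration.integrable_bound[OF integrable_mult_right[OF i, of K]])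
    show "AE \<xi> in lborel. norm (sobolev_weight s \<xi> * norm (inv_fourier \<theta> \<xi>)) \<le> norm (K * ((1 + norm \<xi>) ^ N * norm (inv_fourier \<theta> \<xi>)))"
    proof (intro AE_I2)
      fix \<xi> :: "(real^'n)^'m"
      have "sobolev_weight s \<xi> * norm (inv_fourier \<theta> \<xi>) \<le> (K * (1 + norm \<xi>) ^ N) * norm (inv_fourier \<theta> \<xi>)"
        by (intro mult_right_mono K) auto
      then show "norm (sobolev_weight s \<xi> * norm (inv_fourier \<theta> \<xi>)) \<le> norm (K * ((1 + norm \<xi>) ^ N * norm (inv_fourier \<theta> \<xi>)))"
        using sobolev_weight_nonneg[of s \<xi>] by (simp add: mult.assoc)
    qed
  qed measurable
qed

text \<open>The triangle inequality in L^r in the form of Jensen: the series is C times an average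
  of the G k with probability weights c k / C. The bound E on the F k, uniform in size and in L^1,
  lets the transform and the pairing with a test function be summed term by term.\<close>

lemma potential_series:
  fixes F G :: "nat \<Rightarrow> (real ^ 'n) ^ 'm::finite \<Rightarrow> complex" and c :: "nat \<Rightarrow> real"
  assumes r: "r \<ge> 1" and s: "\<And>i. s i > 0" and c0: "\<And>k. c k \<ge> 0" and cs: "summable c" and cpos: "(\<Sum>k. c k) > 0"
    and pot: "\<And>k. sobolev_potential s (F k) (G k)" and GD: "\<And>k. Lr_pow r (G k) \<le> ennreal D" and D: "D \<ge> 0"
    and Fi: "\<And>k. integrable lborel (F k)" and Fb: "\<And>k x. norm (F k x) \<le> E" and FL: "\<And>k. (LINT x|lborel. norm (F k x)) \<le> E"
  shows "\<exists>G. sobolev_potential s (\<lambda>x. \<Sum>k. of_real (c k) * F k x) G \<and> Lr_pow r G \<le> ennreal ((\<Sum>k. c k) powr r * D)"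
proof -
  define C where "C = (\<Sum>k. c k)"
  have C: "C > 0" using cpos by (simp add: C_def)
  have [measurable]: "G k \<in> borel_measurable borel" for k using pot[of k] by (simp add: sobolev_potential_def)
  have [measurable]: "F k \<in> borel_measurable borel" for k using Fi[of k] by auto
  define H where "H = (\<lambda>x. \<Sum>k. of_real (c k) * G k x)"
  have Hm[measurable]: "H \<in> borel_measurable borel" unfolding H_def by measurable
  have E0: "E \<ge> 0" using order_trans[OF norm_ge_zero Fb[of 0 0]] .
  define M where "M = density (count_space UNIV) (\<lambda>n. ennreal (c n / C))"
  interpret M: prob_space M
  proof
    have "(\<integral>\<^sup>+n. ennreal (c n / C) \<partial>count_space UNIV) = (\<Sum>n. ennreal (c n / C))" by (rule nn_integral_count_space_nat)
    also have "\<dots> = ennreal (\<Sum>n. c n / C)" using cs C c0 by (intro suminf_ennreal2) (auto intro!: summable_divide)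
    also have "(\<Sum>n. c n / C) = 1" using cs C by (subst suminf_divide) (auto simp: C_def)
    finally show "emeasure M (space M) = 1" by (simp add: M_def emeasure_density)
  qed
  have nnM: "(\<integral>\<^sup>+k. f k \<partial>M) = (\<Sum>k. ennreal (c k / C) * f k)" for f :: "nat \<Rightarrow> ennreal"
    unfolding M_def by (subst nn_integral_density) (auto simp: nn_integral_count_space_nat)
  \<comment> \<open>The average of |G k|^r. Its integral is at most D, so it is finite almost
    everywhere, and |G| \<le> 1 + |G|^r then makes the series for H converge absolutely almost
    everywhere.\<close>
  define Z where "Z = (\<lambda>x. \<integral>\<^sup>+k. ennreal (norm (G k x) powr r) \<partial>M)"
  have Zm[measurable]: "Z \<in> borel_measurable borel" unfolding Z_def nnM by measurable
  have IZ: "(\<integral>\<^sup>+x. Z x \<partial>lborel) \<le> ennreal D"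
  proof -
    have "(\<integral>\<^sup>+x. Z x \<partial>lborel) = (\<Sum>k. \<integral>\<^sup>+x. ennreal (c k / C) * ennreal (norm (G k x) powr r) \<partial>lborel)"
      unfolding Z_def nnM by (rule nn_integral_suminf) measurable
    also have "\<dots> = (\<Sum>k. ennreal (c k / C) * Lr_pow r (G k))"
      unfolding Lr_pow_def by (simp add: nn_integral_cmult)
    also have "\<dots> \<le> (\<Sum>k. ennreal (c k / C) * ennreal D)" by (intro suminf_le mult_left_mono GD) auto
    also have "\<dots> = (\<integral>\<^sup>+k. ennreal D \<partial>M)" by (rule nnM[symmetric])
    also have "\<dots> = ennreal D" by (simp add: M.emeasure_space_1)
    finally show ?thesis .
  qed
  have "(\<integral>\<^sup>+x. Z x \<partial>lborel) \<noteq> \<infinity>" using IZ by (auto simp: top_unique)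
  then have "AE x in lborel. Z x \<noteq> \<infinity>" by (intro nn_integral_noteq_infinite) auto
  then have sm: "AE x in lborel. summable (\<lambda>k. c k * norm (G k x))"
  proof eventually_elim
    fix x assume "Z x \<noteq> \<infinity>"
    then have "(\<Sum>k. ennreal (c k / C * norm (G k x) powr r)) \<noteq> \<infinity>"
      using C c0 by (simp add: Z_def nnM ennreal_mult[symmetric])
    then have "summable (\<lambda>k. c k / C * norm (G k x) powr r)"
      using C c0 by (intro summable_suminf_not_top) auto
    then have "summable (\<lambda>k. C * (c k / C * norm (G k x) powr r))" by (rule summable_mult)
    then have "summable (\<lambda>k. c k + c k * norm (G k x) powr r)" using C by (intro summable_add cs) simp
    then show "summable (\<lambda>k. c k * norm (G k x))"
    proof (rule summable_comparison_test'[where N=0])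
      fix k
      have "norm (G k x) \<le> 1 + norm (G k x) powr r"
      proof (cases "norm (G k x) \<le> 1")
        case False
        then have "norm (G k x) powr 1 \<le> norm (G k x) powr r" using r by (intro powr_mono) auto
        then show ?thesis using False by (simp)
      qed (simp add: add_increasing2)
      then have "c k * norm (G k x) \<le> c k * (1 + norm (G k x) powr r)" by (intro mult_left_mono c0)
      then show "norm (c k * norm (G k x)) \<le> c k + c k * norm (G k x) powr r" using c0[of k] by (simp add: distrib_left)
    qed
  qed
  have HZ: "AE x in lborel. ennreal (norm (H x) powr r) \<le> ennreal (C powr r) * Z x"
    using sm
  proof eventually_elim
    fix x assume S: "summable (\<lambda>k. c k * norm (G k x))"
    have S': "summable (\<lambda>k. norm (complex_of_real (c k / C) * G k x))"
      using summable_divide[OF S, of C] C c0 by (simp add: norm_mult norm_divide)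
    have "(LINT k|M. G k x) = (LINT k|count_space UNIV. of_real (c k / C) * G k x)"
      unfolding M_def using c0 C by (subst integral_density) (auto simp: scaleR_conv_of_real)
    also have "\<dots> = (\<Sum>k. of_real (c k / C) * G k x)"
      using S' by (intro integral_count_space_nat) (simp add: integrable_count_space_nat_iff)
    also have "\<dots> = (\<Sum>k. (1 / of_real C) * (of_real (c k) * G k x))" by (simp add: mult_ac)
    also have "\<dots> = (1 / of_real C) * H x"
      unfolding H_def using summable_norm_cancel[of "\<lambda>k. of_real (c k) * G k x"] S c0
      by (intro suminf_mult) (simp add: norm_mult)
    finally have "H x = of_real C * (LINT k|M. G k x)" using C by simp
    then have "ennreal (norm (H x) powr r) = ennreal (C powr r) * ennreal (norm (LINT k|M. G k x) powr r)"
      using C by (simp add: norm_mult powr_mult ennreal_mult)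
    also have "\<dots> \<le> ennreal (C powr r) * Z x"
      unfolding Z_def by (intro mult_left_mono M.norm_integral_powr_le r) (auto simp: M_def)
    finally show "ennreal (norm (H x) powr r) \<le> ennreal (C powr r) * Z x" .
  qed
  have HL: "Lr_pow r H \<le> ennreal (C powr r * D)"
  proof -
    have "Lr_pow r H \<le> (\<integral>\<^sup>+x. ennreal (C powr r) * Z x \<partial>lborel)"
      unfolding Lr_pow_def by (rule nn_integral_mono_AE[OF HZ])
    also have "\<dots> = ennreal (C powr r) * (\<integral>\<^sup>+x. Z x \<partial>lborel)" by (rule nn_integral_cmult) measurable
    also have "\<dots> \<le> ennreal (C powr r) * ennreal D" by (intro mult_left_mono IZ) auto
    finally show ?thesis using D by (simp add: ennreal_mult)
  qed
  have Fs: "summable (\<lambda>k. norm (of_real (c k) * F k x))" for x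
  proof (rule summable_comparison_test'[OF summable_mult2[OF cs, of E], where N=0])
    show "norm (norm (of_real (c k) * F k x)) \<le> c k * E" for k
      using c0[of k] Fb[of k x] by (simp add: norm_mult mult_left_mono)
  qed
  have FF: "(\<lambda>k. of_real (c k) * fourier (F k) \<xi>) sums fourier (\<lambda>x. \<Sum>k. of_real (c k) * F k x) \<xi>" for \<xi>
  proof -
    define f where "f = (\<lambda>k x. (of_real (c k) * F k x) * cis (- 2 * pi * (x \<bullet> \<xi>)))"
    have i: "integrable lborel (f k)" for k unfolding f_def by (intro fourier_integrand integrable_mult_right Fi)
    have "(\<lambda>k. LINT x|lborel. f k x) sums (LINT x|lborel. (\<Sum>k. f k x))"
    proof (rule sums_integral[OF i])
      show "AE x in lborel. summable (\<lambda>k. norm (f k x))" using Fs by (simp add: f_def norm_mult)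
      show "summable (\<lambda>k. LINT x|lborel. norm (f k x))"
      proof (rule summable_comparison_test'[OF summable_mult2[OF cs, of E], where N=0])
        show "norm (LINT x|lborel. norm (f k x)) \<le> c k * E" for k
          using c0[of k] FL[of k] by (simp add: f_def norm_mult abs_mult mult_left_mono)
      qed
    qed
    moreover have "(LINT x|lborel. f k x) = of_real (c k) * fourier (F k) \<xi>" for k
      unfolding f_def fourier_def mult.assoc by (rule integral_mult_right_zero)
    moreover have "(LINT x|lborel. (\<Sum>k. f k x)) = fourier (\<lambda>x. \<Sum>k. of_real (c k) * F k x) \<xi>"
      unfolding f_def fourier_def
      by (intro Bochner_Integration.integral_cong refl suminf_mult2[symmetric] summable_norm_cancel[OF Fs])
    ultimately show ?thesis by simp
  qed
  have "sobolev_potential s (\<lambda>x. \<Sum>k. of_real (c k) * F k x) H"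
    unfolding sobolev_potential_def
  proof (intro conjI allI impI Hm)
    fix \<theta> :: "(real ^ 'n) ^ 'm \<Rightarrow> complex" assume \<theta>: "schwartz \<theta>"
    have it: "integrable lborel \<theta>" using \<theta> by (intro rapid_integrable schwartz_rapid)
    have [measurable]: "\<theta> \<in> borel_measurable borel" using it by auto
    obtain T where T: "\<And>x. norm (\<theta> x) \<le> T" using rapid_bounded[OF schwartz_rapid[OF \<theta>]] by blast
    have T0: "T \<ge> 0" using order_trans[OF norm_ge_zero T[of 0]] .
    define f where "f = (\<lambda>k x. of_real (c k) * (G k x * \<theta> x))"
    have gi: "integrable lborel (\<lambda>x. G k x * \<theta> x)" for k using pot[of k] \<theta> by (simp add: sobolev_potential_def)
    have fi: "integrable lborel (f k)" for k unfolding f_def by (intro integrable_mult_right gi)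
    \<comment> \<open>A bound on the pairings that is uniform in k, from |G \<theta>| \<le> T |G|^r
      + |\<theta>| according as |G| exceeds 1 or not. It takes the place of Hoelder's
      inequality.\<close>
    have gb: "(LINT x|lborel. norm (G k x * \<theta> x)) \<le> T * D + (LINT x|lborel. norm (\<theta> x))" for k
    proof -
      have Gi: "integrable lborel (\<lambda>x. norm (G k x) powr r)"
        using GD[of k] by (intro integrableI_nonneg) (auto simp: Lr_pow_def less_top[symmetric] top_unique)
      have GI: "(LINT x|lborel. norm (G k x) powr r) \<le> D"
        using GD[of k] D nn_integral_eq_integral[OF Gi] by (simp add: Lr_pow_def)
      have "(LINT x|lborel. norm (G k x * \<theta> x)) \<le> (LINT x|lborel. T * norm (G k x) powr r + norm (\<theta> x))"
      proof (rule integral_mono)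
        fix x
        show "norm (G k x * \<theta> x) \<le> T * norm (G k x) powr r + norm (\<theta> x)"
        proof (cases "norm (G k x) \<le> 1")
          case True
          then have "norm (G k x) * norm (\<theta> x) \<le> 1 * norm (\<theta> x)" by (rule mult_right_mono) simp
          then show ?thesis using T0 by (simp add: norm_mult add_increasing)
        next
          case False
          then have "norm (G k x) powr 1 \<le> norm (G k x) powr r" using r by (intro powr_mono) auto
          then have "norm (\<theta> x) * norm (G k x) \<le> T * norm (G k x) powr r" using False T0 by (intro mult_mono T) auto
          then show ?thesis by (simp add: norm_mult mult.commute add_increasing2)
        qed
      qed (use Gi it gi[of k] in auto)
      also have "\<dots> = T * (LINT x|lborel. norm (G k x) powr r) + (LINT x|lborel. norm (\<theta> x))" using Gi it by simp
      also have "\<dots> \<le> T * D + (LINT x|lborel. norm (\<theta> x))" using GI T0 by (simp add: mult_left_mono)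
      finally show ?thesis .
    qed
    define U where "U = T * D + (LINT x|lborel. norm (\<theta> x))"
    have fs: "summable (\<lambda>k. LINT x|lborel. norm (f k x))"
    proof (rule summable_comparison_test'[OF summable_mult2[OF cs, of U], where N=0])
      show "norm (LINT x|lborel. norm (f k x)) \<le> c k * U" for k
      proof -
        have "(LINT x|lborel. norm (f k x)) = c k * (LINT x|lborel. norm (G k x * \<theta> x))"
          using c0[of k] by (simp add: f_def norm_mult)
        moreover have "(LINT x|lborel. norm (G k x * \<theta> x)) \<ge> 0" by (rule integral_nonneg_AE) simp
        ultimately show ?thesis using gb[of k] c0[of k] by (simp add: U_def mult_left_mono)
      qed
    qed
    have fa: "AE x in lborel. summable (\<lambda>k. norm (f k x))"
      using sm
    proof eventually_elim
      fix x assume S: "summable (\<lambda>k. c k * norm (G k x))"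
      show "summable (\<lambda>k. norm (f k x))"
        using summable_mult2[OF S, of "norm (\<theta> x)"] c0 by (simp add: f_def norm_mult mult.assoc)
    qed
    have eqA: "AE x in lborel. (\<Sum>k. f k x) = H x * \<theta> x"
      using sm
    proof eventually_elim
      fix x assume S: "summable (\<lambda>k. c k * norm (G k x))"
      have "summable (\<lambda>k. of_real (c k) * G k x)"
        using S c0 by (intro summable_norm_cancel[of "\<lambda>k. of_real (c k) * G k x"]) (simp add: norm_mult)
      from suminf_mult2[OF this, of "\<theta> x"] show "(\<Sum>k. f k x) = H x * \<theta> x" by (simp add: H_def f_def mult.assoc)
    qed
    have [measurable]: "f k \<in> borel_measurable borel" for k using fi[of k] by auto
    show Hi: "integrable lborel (\<lambda>x. H x * \<theta> x)"
    proof -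
      have "integrable lborel (\<lambda>x. \<Sum>k. f k x) \<longleftrightarrow> integrable lborel (\<lambda>x. H x * \<theta> x)"
        using eqA by (intro integrable_cong_AE) measurable
      then show ?thesis using integrable_suminf[OF fi fa fs] by blast
    qed
    define g where "g = (\<lambda>k \<xi>. of_real (c k) * (of_real (sobolev_weight s \<xi>) * fourier (F k) \<xi> * inv_fourier \<theta> \<xi>))"
    note wi = integrable_weight_inv_fourier[of s, OF s \<theta>]
    have [measurable]: "fourier (F k) \<in> borel_measurable borel" for k by (intro fourier_measurable Fi)
    have [measurable]: "inv_fourier \<theta> \<in> borel_measurable borel" by (intro inv_fourier_measurable it)
    have nb: "norm (fourier (F k) \<xi>) \<le> E" for k \<xi> using norm_fourier_le[of "F k" \<xi>] FL[of k] by linarith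
    have gnb: "norm (g k \<xi>) \<le> c k * E * (sobolev_weight s \<xi> * norm (inv_fourier \<theta> \<xi>))" for k \<xi>
    proof -
      have "norm (g k \<xi>) = c k * norm (fourier (F k) \<xi>) * (sobolev_weight s \<xi> * norm (inv_fourier \<theta> \<xi>))"
        using c0[of k] sobolev_weight_nonneg[of s \<xi>] by (simp add: g_def norm_mult)
      also have "\<dots> \<le> c k * E * (sobolev_weight s \<xi> * norm (inv_fourier \<theta> \<xi>))"
        using c0[of k] sobolev_weight_nonneg[of s \<xi>] by (intro mult_right_mono mult_left_mono nb) auto
      finally show ?thesis .
    qed
    have gi': "integrable lborel (g k)" for k
    proof (rule Bochner_Integration.integrable_bound[OF integrable_mult_right[OF wi, of "c k * E"]])
      show "AE \<xi> in lborel. norm (g k \<xi>) \<le> norm (c k * E * (sobolev_weight s \<xi> * norm (inv_fourier \<theta> \<xi>)))"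
        by (intro AE_I2 order_trans[OF gnb]) simp
    qed (unfold g_def, measurable)
    define V where "V = (LINT \<xi>|lborel. sobolev_weight s \<xi> * norm (inv_fourier \<theta> \<xi>))"
    have "(\<lambda>k. LINT \<xi>|lborel. g k \<xi>) sums (LINT \<xi>|lborel. (\<Sum>k. g k \<xi>))"
    proof (rule sums_integral[OF gi'])
      show "AE \<xi> in lborel. summable (\<lambda>k. norm (g k \<xi>))"
      proof (intro AE_I2)
        fix \<xi>
        show "summable (\<lambda>k. norm (g k \<xi>))"
          by (rule summable_comparison_test'[OF summable_mult2[OF cs, of "E * (sobolev_weight s \<xi> * norm (inv_fourier \<theta> \<xi>))"], where N=0])
             (use gnb in \<open>simp add: mult.assoc\<close>)
      qed
      show "summable (\<lambda>k. LINT \<xi>|lborel. norm (g k \<xi>))"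
      proof (rule summable_comparison_test'[OF summable_mult2[OF cs, of "E * V"], where N=0])
        fix k
        have "(LINT \<xi>|lborel. norm (g k \<xi>)) \<le> (LINT \<xi>|lborel. c k * E * (sobolev_weight s \<xi> * norm (inv_fourier \<theta> \<xi>)))"
          using gi'[of k] wi gnb by (intro integral_mono) auto
        also have "\<dots> = c k * (E * V)" unfolding V_def by (simp add: mult.assoc)
        finally show "norm (LINT \<xi>|lborel. norm (g k \<xi>)) \<le> c k * (E * V)" by (simp add: integral_nonneg_AE)
      qed
    qed
    moreover have "(LINT \<xi>|lborel. g k \<xi>) = (LINT x|lborel. f k x)" for k
      using pot[of k] \<theta> unfolding g_def f_def sobolev_potential_def by simp
    moreover have "(\<Sum>k. g k \<xi>) = of_real (sobolev_weight s \<xi>) * fourier (\<lambda>x. \<Sum>k. of_real (c k) * F k x) \<xi> * inv_fourier \<theta> \<xi>" for \<xi>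
    proof -
      have "(\<lambda>k. of_real (sobolev_weight s \<xi>) * (of_real (c k) * fourier (F k) \<xi>) * inv_fourier \<theta> \<xi>) sums
        (of_real (sobolev_weight s \<xi>) * fourier (\<lambda>x. \<Sum>k. of_real (c k) * F k x) \<xi> * inv_fourier \<theta> \<xi>)"
        by (intro sums_mult sums_mult2 FF)
      then show ?thesis by (simp add: g_def sums_iff mult_ac)
    qed
    moreover have "(\<lambda>k. LINT x|lborel. f k x) sums (LINT x|lborel. H x * \<theta> x)"
    proof -
      have "(LINT x|lborel. (\<Sum>k. f k x)) = (LINT x|lborel. H x * \<theta> x)"
        using eqA by (intro integral_cong_AE) auto
      then show ?thesis using sums_integral[OF fi fa fs] by simp
    qed
    ultimately show "(LINT x|lborel. H x * \<theta> x) = (LINT \<xi>|lborel. of_real (sobolev_weight s \<xi>) * fourier (\<lambda>x. \<Sum>k. of_real (c k) * F k x) \<xi> * inv_fourier \<theta> \<xi>)"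
      using sums_unique2 by simp
  qed
  then show ?thesis using HL unfolding C_def by blast
qed

section \<open>Band-limited functions and the maximal function\<close>

lemma fourier_translate:
  fixes f :: "'a::euclidean_space \<Rightarrow> complex"
  assumes [measurable]: "f \<in> borel_measurable borel"
  shows "fourier (\<lambda>x. f (x - z)) \<xi> = cis (- 2 * pi * (z \<bullet> \<xi>)) * fourier f \<xi>"
proof -
  have "fourier (\<lambda>x. f (x - z)) \<xi> = (LINT x|lborel. f ((z + x) - z) * cis (- 2 * pi * ((z + x) \<bullet> \<xi>)))"
    unfolding fourier_def by (rule integral_lborel_translate[symmetric]) measurable
  also have "\<dots> = (LINT x|lborel. cis (- 2 * pi * (z \<bullet> \<xi>)) * (f x * cis (- 2 * pi * (x \<bullet> \<xi>))))"
  proof (rule Bochner_Integration.integral_cong[OF refl])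
    fix x
    have "cis (- 2 * pi * ((z + x) \<bullet> \<xi>)) = cis (- 2 * pi * (z \<bullet> \<xi>)) * cis (- 2 * pi * (x \<bullet> \<xi>))"
      unfolding cis_mult by (rule arg_cong[where f=cis]) (simp add: inner_add_left algebra_simps)
    then show "f ((z + x) - z) * cis (- 2 * pi * ((z + x) \<bullet> \<xi>)) = cis (- 2 * pi * (z \<bullet> \<xi>)) * (f x * cis (- 2 * pi * (x \<bullet> \<xi>)))"
      by (simp add: mult_ac)
  qed
  also have "\<dots> = cis (- 2 * pi * (z \<bullet> \<xi>)) * fourier f \<xi>" by (simp only: integral_mult_right_zero fourier_def)
  finally show ?thesis .
qed

lemma integral_lborel_prod_mult:
  fixes f :: "'a::euclidean_space \<Rightarrow> complex" and g :: "'b::euclidean_space \<Rightarrow> complex"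
  assumes f: "integrable lborel f" and g: "integrable lborel g"
  shows "integrable lborel (\<lambda>p::'a\<times>'b. f (fst p) * g (snd p))"
    "(LINT p|lborel. f (fst p) * g (snd (p::'a\<times>'b))) = (LINT x|lborel. f x) * (LINT y|lborel. g y)"
proof -
  have [measurable]: "f \<in> borel_measurable borel" "g \<in> borel_measurable borel" using f g by auto
  have i: "integrable (lborel \<Otimes>\<^sub>M lborel) (\<lambda>p. f (fst p) * g (snd p))"
    by (rule integrable_lborel_pair_mult[OF f g]) (auto simp: norm_mult)
  then show "integrable lborel (\<lambda>p::'a\<times>'b. f (fst p) * g (snd p))" by (simp only: lborel_prod)
  have "(LINT p|lborel. f (fst p) * g (snd (p::'a\<times>'b))) = (LINT p|(lborel \<Otimes>\<^sub>M lborel). f (fst p) * g (snd p))"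
    by (simp only: lborel_prod)
  also have "\<dots> = (LINT x|lborel. LINT y|lborel. f x * g y)"
    using lborel_pair.integral_fst'[OF i] by simp
  also have "\<dots> = (LINT x|lborel. f x) * (LINT y|lborel. g y)" by (simp only: integral_mult_right_zero integral_mult_left_zero)
  finally show "(LINT p|lborel. f (fst p) * g (snd (p::'a\<times>'b))) = (LINT x|lborel. f x) * (LINT y|lborel. g y)" .
qed

lemma integrable_fourier_band:
  fixes f :: "'a::euclidean_space \<Rightarrow> complex"
  assumes f: "integrable lborel f" and z: "\<And>\<xi>. norm \<xi> > a \<Longrightarrow> fourier f \<xi> = 0"
  shows "integrable lborel (fourier f)"
proof (rule integrableI_bounded_set[where A="cball 0 a" and B="LINT x|lborel. norm (f x)"])
  show "AE x in lborel. x \<in> cball 0 a \<longrightarrow> norm (fourier f x) \<le> (LINT x|lborel. norm (f x))"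
    using norm_fourier_le by (intro AE_I2) blast
  show "emeasure lborel (cball 0 a :: 'a set) < \<infinity>" by (rule emeasure_lborel_cball_finite)
  show "AE x in lborel. x \<notin> cball 0 a \<longrightarrow> fourier f x = 0" using z by (intro AE_I2) auto
qed (use fourier_measurable[OF f] in auto)

lemma inv_fourier_fourier_band:
  fixes f :: "'a::euclidean_space \<Rightarrow> complex"
  assumes f: "rapid f" "continuous_on UNIV f" and z: "\<And>\<xi>. norm \<xi> > a \<Longrightarrow> fourier f \<xi> = 0"
  shows "inv_fourier (fourier f) x = f x"
proof -
  obtain C where C: "\<And>x. norm (f x) \<le> C" using rapid_bounded[OF f(1)] by blast
  show ?thesis
    by (rule fourier_inversion[OF rapid_integrable[OF f(1)] C f(2) integrable_fourier_band[OF rapid_integrable[OF f(1)] z]])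
qed

text \<open>Squared moduli of slowly varying copies of a band-limited Schwartz function are
  nonnegative, and their spectrum is as close to the origin as desired.\<close>

lemma nonneg_band_bump:
  fixes \<Psi> :: "(real ^ 'n) ^ 'm::finite \<Rightarrow> complex"
  assumes \<Psi>: "schwartz \<Psi>" and band: "\<And>\<xi>. norm \<xi> > 2 \<Longrightarrow> fourier \<Psi> \<xi> = 0" and nz: "\<Psi> c \<noteq> 0"
    and \<rho>: "\<rho> > 0" and \<eta>: "\<eta> > 0"
  shows "\<exists>(\<psi>::real^'n \<Rightarrow> real) \<kappa>. \<kappa> > 0 \<and> schwartz (\<lambda>x. of_real (\<psi> x)) \<and> (\<forall>x. \<psi> x \<ge> 0) \<and> (\<forall>x. norm x \<le> \<rho> \<longrightarrow> \<kappa> \<le> \<psi> x) \<and>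
    (\<forall>e \<omega>. norm (\<omega> - e) > \<eta> \<longrightarrow> fourier (\<lambda>x. cis (2 * pi * (x \<bullet> e)) * of_real (\<psi> x)) \<omega> = 0)"
proof -
  define i0 :: 'm where "i0 = undefined"
  have cont: "continuous (at c) \<Psi>" using schwartz_continuous[OF \<Psi>, of UNIV] by (simp add: continuous_on_eq_continuous_at)
  have "norm (\<Psi> c) / 2 > 0" using nz by simp
  then obtain d where d: "d > 0" "\<And>y. dist y c < d \<Longrightarrow> dist (\<Psi> y) (\<Psi> c) < norm (\<Psi> c) / 2"
    using cont unfolding continuous_at_eps_delta by blast
  \<comment> \<open>The first bound makes \<delta> times a difference of two frequencies of norm at
    most 2 no longer than \<eta>/2. The second keeps c + \<delta> x within distance d of c for |x|
    \<le> \<rho>, where \<Psi> stays at least half as large as at c.\<close>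
  define \<delta> where "\<delta> = min (\<eta> / 8) (d / (2 * \<rho>))"
  have \<delta>: "\<delta> > 0" "\<delta> \<le> \<eta> / 8" "\<delta> * \<rho> < d" using d(1) \<rho> \<eta>
  proof -
    have "\<delta> * \<rho> \<le> d / (2 * \<rho>) * \<rho>" using \<rho> by (intro mult_right_mono) (auto simp: \<delta>_def)
    also have "\<dots> < d" using d(1) \<rho> by simp
    finally show "\<delta> * \<rho> < d" .
  qed (auto simp: \<delta>_def)
  \<comment> \<open>An n-dimensional slice of \<Psi> through c in the direction of one
    component.\<close>
  define \<psi>0 where "\<psi>0 = (\<lambda>x::real^'n. \<Psi> (c + \<delta> *\<^sub>R axis i0 x))"
  have nax: "norm (axis i0 x :: (real^'n)^'m) = norm x" for x :: "real^'n" by (simp add: norm_eq_sqrt_inner inner_axis_axis)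
  have lin: "linear (axis i0 :: real^'n \<Rightarrow> (real^'n)^'m)" by (rule adjoint_pair.lin[OF adjoint_pair_axis])
  have s0: "schwartz \<psi>0"
    unfolding \<psi>0_def by (rule schwartz_affine[OF \<Psi> lin _ nax \<delta>(1)]) (auto simp: Basis_vec_def)
  define \<psi> where "\<psi> = (\<lambda>x. (norm (\<psi>0 x))\<^sup>2)"
  have \<psi>eq: "complex_of_real (\<psi> x) = \<psi>0 x * cnj (\<psi>0 x)" for x unfolding \<psi>_def by (rule complex_norm_square)
  have s: "schwartz (\<lambda>x. complex_of_real (\<psi> x))"
    unfolding \<psi>eq by (intro schwartz_moderate_mult schwartz_moderate schwartz_cnj s0)
  have low: "(norm (\<Psi> c) / 2)\<^sup>2 \<le> \<psi> x" if x: "norm x \<le> \<rho>" for x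
  proof -
    have "norm (\<delta> *\<^sub>R (axis i0 x :: (real^'n)^'m)) \<le> \<delta> * \<rho>" using \<delta>(1) x by (simp add: nax)
    then have "dist (c + \<delta> *\<^sub>R axis i0 x) c < d" using \<delta>(3) by (simp add: dist_norm)
    then have "dist (\<psi>0 x) (\<Psi> c) < norm (\<Psi> c) / 2" unfolding \<psi>0_def by (rule d(2))
    then have "norm (\<Psi> c) / 2 \<le> norm (\<psi>0 x)" using norm_triangle_ineq2[of "\<Psi> c" "\<psi>0 x"] by (simp add: dist_norm norm_minus_commute)
    then show ?thesis unfolding \<psi>_def by (intro power_mono) auto
  qed
  have i\<Psi>: "integrable lborel \<Psi>" by (intro rapid_integrable schwartz_rapid \<Psi>)
  have iF: "integrable lborel (fourier \<Psi>)" by (rule integrable_fourier_band[OF i\<Psi> band])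
  have [measurable]: "fourier \<Psi> \<in> borel_measurable borel" using iF by auto
  have inv: "\<Psi> y = (LINT \<xi>|lborel. fourier \<Psi> \<xi> * cis (2 * pi * (\<xi> \<bullet> y)))" for y
    using inv_fourier_fourier_band[OF schwartz_rapid[OF \<Psi>] schwartz_continuous[OF \<Psi>] band, where x=y] by (simp add: inv_fourier_eq)
  have supp: "fourier (\<lambda>x. cis (2 * pi * (x \<bullet> e)) * of_real (\<psi> x)) \<omega> = 0" if om: "norm (\<omega> - e) > \<eta>" for e \<omega>
  proof -
    \<comment> \<open>By inversion for \<Psi>, the modulated squared modulus is a double integral
      over a pair of frequencies. The pair contributes the single frequency w, within \<eta>/2 of
      e.\<close>
    define k where "k = (\<lambda>p. (fourier \<Psi> (fst p) * cis (2 * pi * (fst p \<bullet> c))) * (cnj (fourier \<Psi> (snd p)) * cis (- 2 * pi * (snd p \<bullet> c))))"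
    define w where "w = (\<lambda>p::((real^'n)^'m) \<times> ((real^'n)^'m). e + \<delta> *\<^sub>R (fst p $ i0 - snd p $ i0))"
    have i1: "integrable lborel (\<lambda>\<xi>. fourier \<Psi> \<xi> * cis (2 * pi * (\<xi> \<bullet> y)))" for y by (intro integrable_cis_mult iF) measurable
    have i2: "integrable lborel (\<lambda>\<xi>. cnj (fourier \<Psi> \<xi>) * cis (- 2 * pi * (\<xi> \<bullet> y)))" for y
      using integrable_cnj[OF i1[of y]] by (simp add: cis_cnj)
    show ?thesis
    proof (rule fourier_zero_of_superposition[where k=k and w=w and d="norm (\<omega> - e) - \<eta> / 2"])
      have sf: "schwartz (\<lambda>x. cis (2 * pi * (x \<bullet> e)) * of_real (\<psi> x))"
        by (rule schwartz_moderate_mult[OF moderate_cis s])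
      then show "integrable lborel (\<lambda>x. cis (2 * pi * (x \<bullet> e)) * of_real (\<psi> x))" by (intro rapid_integrable schwartz_rapid)
      show "integrable lborel k" unfolding k_def by (rule integral_lborel_prod_mult(1)[OF i1 i2])
      show "w \<in> borel_measurable borel" unfolding w_def
        by (intro borel_measurable_continuous_onI continuous_intros)
      show "norm (\<omega> - e) - \<eta> / 2 > 0" using om \<eta> by linarith
      show "norm (\<omega> - e) - \<eta> / 2 \<le> norm (w p - \<omega>)" if "k p \<noteq> 0" for p
      proof -
        have "fourier \<Psi> (fst p) \<noteq> 0" "fourier \<Psi> (snd p) \<noteq> 0" using that by (auto simp: k_def)
        then have n: "norm (fst p) \<le> 2" "norm (snd p) \<le> 2" using band by (meson not_le)+
        have "norm (fst p $ i0 - snd p $ i0) \<le> 4"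
          using norm_triangle_ineq4[of "fst p $ i0" "snd p $ i0"] Finite_Cartesian_Product.norm_nth_le[of "fst p" i0]
            Finite_Cartesian_Product.norm_nth_le[of "snd p" i0] n by linarith
        then have "\<delta> * norm (fst p $ i0 - snd p $ i0) \<le> \<eta> / 8 * 4" using \<delta> by (intro mult_mono) auto
        then have "norm (w p - e) \<le> \<eta> / 2" using \<delta>(1) by (simp add: w_def)
        moreover have "norm (\<omega> - e) \<le> norm (w p - \<omega>) + norm (w p - e)"
          using norm_triangle_ineq4[of "w p - e" "w p - \<omega>"] by (simp add: algebra_simps)
        ultimately show ?thesis by simp
      qed
      fix x :: "real^'n"
      let ?y = "c + \<delta> *\<^sub>R axis i0 x"
      have "(LINT p|lborel. k p * cis (2 * pi * (x \<bullet> w p))) =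
        (LINT p|lborel. cis (2 * pi * (x \<bullet> e)) * ((fourier \<Psi> (fst p) * cis (2 * pi * (fst p \<bullet> ?y))) * (cnj (fourier \<Psi> (snd p)) * cis (- 2 * pi * (snd p \<bullet> ?y)))))"
      proof (rule Bochner_Integration.integral_cong[OF refl])
        fix p :: "((real^'n)^'m) \<times> ((real^'n)^'m)"
        have "cis (2 * pi * (fst p \<bullet> c)) * (cis (- 2 * pi * (snd p \<bullet> c)) * cis (2 * pi * (x \<bullet> w p))) =
          cis (2 * pi * (x \<bullet> e)) * (cis (2 * pi * (fst p \<bullet> ?y)) * cis (- 2 * pi * (snd p \<bullet> ?y)))"
          unfolding cis_mult by (rule arg_cong[where f=cis])
            (simp add: w_def inner_add_right inner_diff_right inner_axis inner_commute[of x] algebra_simps)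
        then show "k p * cis (2 * pi * (x \<bullet> w p)) = cis (2 * pi * (x \<bullet> e)) * ((fourier \<Psi> (fst p) * cis (2 * pi * (fst p \<bullet> ?y))) * (cnj (fourier \<Psi> (snd p)) * cis (- 2 * pi * (snd p \<bullet> ?y))))"
          unfolding k_def by (simp only: mult_ac)
      qed
      also have "\<dots> = cis (2 * pi * (x \<bullet> e)) * (\<Psi> ?y * cnj (\<Psi> ?y))"
      proof -
        have "(LINT \<xi>|lborel. cnj (fourier \<Psi> \<xi>) * cis (- 2 * pi * (\<xi> \<bullet> ?y))) = cnj (\<Psi> ?y)"
        proof -
          have i: "cnj (fourier \<Psi> \<xi>) * cis (- 2 * pi * (\<xi> \<bullet> ?y)) = cnj (fourier \<Psi> \<xi> * cis (2 * pi * (\<xi> \<bullet> ?y)))" for \<xi>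
            by (simp add: cis_cnj)
          show ?thesis unfolding i inv[of ?y] by (rule Bochner_Integration.integral_cnj)
        qed
        then show ?thesis
          unfolding integral_mult_right_zero integral_lborel_prod_mult(2)[OF i1 i2] inv[symmetric] by (simp only:)
      qed
      finally show "cis (2 * pi * (x \<bullet> e)) * of_real (\<psi> x) = (LINT p|lborel. k p * cis (2 * pi * (x \<bullet> w p)))"
        by (simp add: \<psi>eq \<psi>0_def)
    qed
  qed
  show ?thesis
    by (intro exI[of _ \<psi>] exI[of _ "(norm (\<Psi> c) / 2)\<^sup>2"] conjI allI impI s low supp) (use nz in \<open>auto simp: \<psi>_def\<close>)
qed

section \<open>Maximal functions of waves with annular spectrum\<close>

lemma convolve_eq_skew: "convolve g f = skew_convolve (\<lambda>x. x) 1 0 g f"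
  by (rule ext) (simp add: convolve_def skew_convolve_def mult.commute)

lemma adjoint_pair_id: "adjoint_pair (\<lambda>x::'a::euclidean_space. x) (\<lambda>x. x)"
  by (rule adjoint_pair.intro) (auto simp: linear_iff)

text \<open>The dyadic dilation with a real parameter t in place of 2^j, so that low and high
  frequencies are the cases t \<le> 1 and t \<ge> 1.\<close>

definition L1_dilate :: "real \<Rightarrow> ('a::euclidean_space \<Rightarrow> complex) \<Rightarrow> 'a \<Rightarrow> complex" where
  "L1_dilate t \<phi> x = of_real (t ^ DIM('a)) * \<phi> (t *\<^sub>R x)"

lemma dyadic_dilate_eq: "dyadic_dilate \<phi> j = L1_dilate (2 powi j) (\<phi> :: real ^ 'n \<Rightarrow> complex)"
  by (rule ext) (simp add: dyadic_dilate_def L1_dilate_def power_int_mult)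

lemma rapid_L1_dilate: "rapid \<phi> \<Longrightarrow> t > 0 \<Longrightarrow> rapid (L1_dilate t \<phi>)"
  unfolding L1_dilate_def[abs_def] by (intro rapid_cmult rapid_scale)

lemma fourier_L1_dilate:
  "\<phi> \<in> borel_measurable borel \<Longrightarrow> t > 0 \<Longrightarrow> fourier (L1_dilate t \<phi>) \<xi> = fourier \<phi> (\<xi> /\<^sub>R t)"
  unfolding L1_dilate_def[abs_def] by (simp add: fourier_cmult fourier_scale)

text \<open>The spectral gap around 0 plays the role of vanishing moments of all orders, and puts f
  in every Hardy space.\<close>

definition annular :: "real \<Rightarrow> ('a::euclidean_space \<Rightarrow> complex) \<Rightarrow> bool" where
  "annular a f \<longleftrightarrow> rapid f \<and> continuous_on UNIV f \<and> (\<forall>\<xi>. norm \<xi> < a \<or> norm \<xi> > 2 \<longrightarrow> fourier f \<xi> = 0)"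

lemma annular_inner_mult:
  assumes "annular a f" shows "annular a (\<lambda>x. of_real (x \<bullet> c) * f x)"
proof -
  have "open {\<xi>::'a. norm \<xi> > 2}" "open {\<xi>::'a. norm \<xi> < a}" by (intro open_Collect_less continuous_intros)+
  then have "open ({\<xi>::'a. norm \<xi> < a} \<union> {\<xi>. norm \<xi> > 2})" by auto
  then have "fourier (\<lambda>x. of_real (x \<bullet> c) * f x) \<xi> = 0" if "norm \<xi> < a \<or> norm \<xi> > 2" for \<xi>
    using assms that by (intro fourier_multiplication_inner_vanish[of f "{\<xi>. norm \<xi> < a} \<union> {\<xi>. norm \<xi> > 2}"]) (auto simp: annular_def)
  then show ?thesis using assms by (auto simp: annular_def intro!: rapid_inner_mult continuous_intros)
qed

text \<open>The transform of the convolution is \<open>fourier \<phi> (\<xi> /\<^sub>R t)\<close>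
  times that of f. On the spectrum of f the argument has norm at least a/t, so the decay of the
  first factor gives (t/a)^Q for any Q.\<close>

lemma convolve_low_frequency:
  fixes f :: "'a::euclidean_space \<Rightarrow> complex"
  assumes \<phi>: "schwartz \<phi>" and f: "annular a f" and a: "a > 0"
  shows "\<exists>C\<ge>0. \<forall>t. 0 < t \<and> t \<le> 1 \<longrightarrow> (\<forall>x. norm (convolve (L1_dilate t \<phi>) f x) \<le> C * t ^ Q)"
proof -
  interpret I: adjoint_pair "\<lambda>x::'a. x" "\<lambda>x. x" by (rule adjoint_pair_id)
  have rf: "rapid f" and cf: "continuous_on UNIV f" and ff: "\<And>\<xi>. norm \<xi> < a \<or> norm \<xi> > 2 \<Longrightarrow> fourier f \<xi> = 0"
    using f by (auto simp: annular_def)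
  have if': "integrable lborel f" using rf by (rule rapid_integrable)
  have iff: "integrable lborel (fourier f)" by (rule integrable_fourier_band[OF if', where a=2]) (simp add: ff)
  obtain C where C: "C > 0" "\<And>\<xi>. norm (fourier \<phi> \<xi>) * (1 + norm \<xi>) ^ Q \<le> C" using rapidE[OF schwartz_fourier_rapid[OF \<phi>]] by blast
  define D where "D = (LINT \<xi>|lborel. norm (fourier f \<xi>))"
  have "norm (convolve (L1_dilate t \<phi>) f x) \<le> (C / a ^ Q * D) * t ^ Q" if t: "0 < t" "t \<le> 1" for t x
  proof -
    define h where "h = convolve (L1_dilate t \<phi>) f"
    have r\<phi>: "rapid (L1_dilate t \<phi>)" by (intro rapid_L1_dilate schwartz_rapid \<phi> t)
    have c\<phi>: "continuous_on UNIV (L1_dilate t \<phi>)"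
      unfolding L1_dilate_def[abs_def]
      by (intro continuous_intros continuous_on_compose2[OF schwartz_continuous[OF \<phi>, of UNIV]]) auto
    have rh: "rapid h" unfolding h_def convolve_eq_skew by (rule I.rapid_skew_convolve[OF r\<phi> rf])
    have ch: "continuous_on UNIV h" unfolding h_def convolve_eq_skew by (rule I.continuous_skew_convolve[OF r\<phi> c\<phi> rf])
    have fh: "fourier h \<xi> = fourier \<phi> (\<xi> /\<^sub>R t) * fourier f \<xi>" for \<xi>
      unfolding h_def convolve_eq_skew I.fourier_skew_convolve[OF rapid_integrable[OF r\<phi>] if']
      using fourier_L1_dilate[OF rapid_measurable[OF schwartz_rapid[OF \<phi>]] t(1)] by simp
    have "h x = inv_fourier (fourier h) x"
      by (rule inv_fourier_fourier_band[OF rh ch, where a=2, symmetric]) (simp add: fh ff)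
    then have "norm (h x) \<le> (LINT \<xi>|lborel. norm (fourier h \<xi>))" using norm_fourier_le[of "fourier h" "- x"] by (simp add: inv_fourier_def)
    also have "\<dots> \<le> (LINT \<xi>|lborel. (C / a ^ Q * t ^ Q) * norm (fourier f \<xi>))"
    proof (rule integral_mono)
      have "integrable lborel (fourier h)" by (rule integrable_fourier_band[OF rapid_integrable[OF rh], where a=2]) (simp add: fh ff)
      then show "integrable lborel (\<lambda>\<xi>. norm (fourier h \<xi>))" by simp
      show "integrable lborel (\<lambda>\<xi>. (C / a ^ Q * t ^ Q) * norm (fourier f \<xi>))" using iff by simp
      fix \<xi> :: 'a
      show "norm (fourier h \<xi>) \<le> (C / a ^ Q * t ^ Q) * norm (fourier f \<xi>)"
      proof (cases "norm \<xi> < a")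
        case True then show ?thesis by (simp add: fh ff)
      next
        case False
        have "a / t \<le> 1 + norm (\<xi> /\<^sub>R t)" using False t by (simp add: divide_right_mono add_increasing divide_inverse mult.commute)
        then have "(a / t) ^ Q \<le> (1 + norm (\<xi> /\<^sub>R t)) ^ Q" using a t by (intro power_mono) auto
        then have "norm (fourier \<phi> (\<xi> /\<^sub>R t)) * (a / t) ^ Q \<le> norm (fourier \<phi> (\<xi> /\<^sub>R t)) * (1 + norm (\<xi> /\<^sub>R t)) ^ Q"
          by (rule mult_left_mono) simp
        also have "\<dots> \<le> C" by (rule C(2))
        finally have "norm (fourier \<phi> (\<xi> /\<^sub>R t)) \<le> C / a ^ Q * t ^ Q" using a t by (simp add: power_divide field_simps)
        then show ?thesis unfolding fh norm_mult by (rule mult_right_mono) simp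
      qed
    qed
    also have "\<dots> = (C / a ^ Q * D) * t ^ Q" unfolding D_def by simp
    finally show ?thesis by (simp add: h_def)
  qed
  moreover have "C / a ^ Q * D \<ge> 0" using C a by (auto simp: D_def)
  ultimately show ?thesis by blast
qed

lemma convolve_inner_mult:
  fixes f :: "'a::euclidean_space \<Rightarrow> complex"
  assumes \<phi>: "rapid \<phi>" and f: "rapid f" and t: "t > 0"
  shows "of_real (x \<bullet> c) * convolve (L1_dilate t \<phi>) f x =
    of_real (1 / t) * convolve (L1_dilate t (\<lambda>x. of_real (x \<bullet> c) * \<phi> x)) f x + convolve (L1_dilate t \<phi>) (\<lambda>x. of_real (x \<bullet> c) * f x) x"
proof -
  interpret I: adjoint_pair "\<lambda>x::'a. x" "\<lambda>x. x" by (rule adjoint_pair_id)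
  have e: "(\<lambda>x. of_real (x \<bullet> c) * L1_dilate t \<phi> x) = (\<lambda>x. of_real (1 / t) * L1_dilate t (\<lambda>x. of_real (x \<bullet> c) * \<phi> x) x)"
    using t by (simp add: L1_dilate_def fun_eq_iff)
  have "convolve (\<lambda>x. of_real (x \<bullet> c) * L1_dilate t \<phi> x) f x = of_real (1 / t) * convolve (L1_dilate t (\<lambda>x. of_real (x \<bullet> c) * \<phi> x)) f x"
    unfolding e convolve_def mult.assoc by (rule integral_mult_right_zero)
  then show ?thesis
    using I.skew_convolve_inner_mult[OF rapid_L1_dilate[OF \<phi> t] f, where R=1 and \<theta>=0, of x c] by (simp add: convolve_eq_skew)
qed

text \<open>Induction on M with Q left free. When a coordinate falls on the dilated \<phi> it costs
  1/t, which is paid by using the induction hypothesis with Q + 1; when it falls on f, the spectral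
  gap is kept.\<close>

lemma convolve_low_frequency_decay:
  fixes f :: "'a::euclidean_space \<Rightarrow> complex"
  assumes \<phi>: "schwartz \<phi>" and f: "annular a f" and a: "a > 0"
  shows "\<exists>C\<ge>0. \<forall>t. 0 < t \<and> t \<le> 1 \<longrightarrow> (\<forall>x. norm x ^ M * norm (convolve (L1_dilate t \<phi>) f x) \<le> C * t ^ Q)"
  using \<phi> f
proof (induction M arbitrary: \<phi> f Q)
  case 0
  then show ?case using convolve_low_frequency[of \<phi> a f Q] a by simp
next
  case (Suc M)
  define PC where "PC = (\<lambda>b C. C \<ge> 0 \<and> (\<forall>t. 0 < t \<and> t \<le> 1 \<longrightarrow> (\<forall>x. norm x ^ M * norm (convolve (L1_dilate t (\<lambda>x. of_real (x \<bullet> b) * \<phi> x)) f x) \<le> C * t ^ Suc Q)))"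
  define PD where "PD = (\<lambda>b D. D \<ge> 0 \<and> (\<forall>t. 0 < t \<and> t \<le> 1 \<longrightarrow> (\<forall>x. norm x ^ M * norm (convolve (L1_dilate t \<phi>) (\<lambda>x. of_real (x \<bullet> b) * f x) x) \<le> D * t ^ Q)))"
  have "\<exists>C. PC b C" for b unfolding PC_def by (rule Suc.IH[OF schwartz_inner_mult[OF Suc.prems(1)] Suc.prems(2)])
  then obtain C where PC: "\<And>b. PC b (C b)" by metis
  have "\<exists>D. PD b D" for b unfolding PD_def by (rule Suc.IH[OF Suc.prems(1) annular_inner_mult[OF Suc.prems(2)]])
  then obtain D where PD: "\<And>b. PD b (D b)" by metis
  have C: "0 < t \<Longrightarrow> t \<le> 1 \<Longrightarrow> norm x ^ M * norm (convolve (L1_dilate t (\<lambda>x. of_real (x \<bullet> b) * \<phi> x)) f x) \<le> C b * t ^ Suc Q"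
    and D: "0 < t \<Longrightarrow> t \<le> 1 \<Longrightarrow> norm x ^ M * norm (convolve (L1_dilate t \<phi>) (\<lambda>x. of_real (x \<bullet> b) * f x) x) \<le> D b * t ^ Q"
    and CD: "C b \<ge> 0 \<and> D b \<ge> 0" for b t x
    using PC[of b] PD[of b] unfolding PC_def PD_def by auto
  have rp: "rapid \<phi>" "rapid f" using Suc.prems by (auto simp: schwartz_rapid annular_def)
  have "norm x ^ Suc M * norm (convolve (L1_dilate t \<phi>) f x) \<le> (\<Sum>b\<in>Basis. C b + D b) * t ^ Q" if t: "0 < t" "t \<le> 1" for t x
  proof -
    define v where "v = convolve (L1_dilate t \<phi>) f x"
    have "\<bar>x \<bullet> b\<bar> * (norm x ^ M * norm v) \<le> (C b + D b) * t ^ Q" if b: "b \<in> Basis" for b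
    proof -
      define p q where "p = convolve (L1_dilate t (\<lambda>x. of_real (x \<bullet> b) * \<phi> x)) f x"
        and "q = convolve (L1_dilate t \<phi>) (\<lambda>x. of_real (x \<bullet> b) * f x) x"
      have "\<bar>x \<bullet> b\<bar> * norm v = norm (of_real (1 / t) * p + q)"
        unfolding p_def q_def convolve_inner_mult[OF rp t(1), symmetric] v_def by (simp add: norm_mult)
      also have "\<dots> \<le> norm (of_real (1 / t) * p) + norm q" by (rule norm_triangle_ineq)
      also have "norm (of_real (1 / t) * p) = 1 / t * norm p" using t by (simp add: norm_mult norm_divide)
      finally have "norm x ^ M * (\<bar>x \<bullet> b\<bar> * norm v) \<le> norm x ^ M * (1 / t * norm p + norm q)" by (rule mult_left_mono) simp
      also have "\<dots> = 1 / t * (norm x ^ M * norm p) + norm x ^ M * norm q" by (simp add: distrib_left)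
      also have "\<dots> \<le> 1 / t * (C b * t ^ Suc Q) + D b * t ^ Q"
        unfolding p_def q_def using t by (intro add_mono mult_left_mono C D) auto
      also have "\<dots> = (C b + D b) * t ^ Q" using t by (simp add: distrib_right)
      finally show ?thesis by (simp add: mult_ac)
    qed
    then have s: "(\<Sum>b\<in>Basis. \<bar>x \<bullet> b\<bar> * (norm x ^ M * norm v)) \<le> (\<Sum>b\<in>Basis. (C b + D b) * t ^ Q)" by (intro sum_mono) auto
    have "norm x * (norm x ^ M * norm v) \<le> (\<Sum>b\<in>Basis. \<bar>x \<bullet> b\<bar>) * (norm x ^ M * norm v)" by (intro mult_right_mono norm_le_l1) auto
    also have "\<dots> \<le> (\<Sum>b\<in>Basis. C b + D b) * t ^ Q" using s by (simp only: sum_distrib_right)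
    finally show ?thesis by (simp add: v_def mult.assoc)
  qed
  moreover have "(\<Sum>b\<in>Basis. C b + D b) \<ge> 0" using CD by (intro sum_nonneg) auto
  ultimately show ?case by blast
qed

text \<open>For t \<ge> 1 the weighted L^1 norm of the dilate is at most that of \<phi> itself, and
  Peetre's inequality transfers the decay of f to the convolution.\<close>

lemma convolve_high_frequency_decay:
  fixes f :: "'a::euclidean_space \<Rightarrow> complex"
  assumes \<phi>: "rapid \<phi>" and f: "rapid f"
  shows "\<exists>C\<ge>0. \<forall>t\<ge>1. \<forall>x. (1 + norm x) ^ M * norm (convolve (L1_dilate t \<phi>) f x) \<le> C"
proof -
  have [measurable]: "\<phi> \<in> borel_measurable borel" "f \<in> borel_measurable borel" using \<phi> f by (auto simp: rapid_measurable)
  obtain C where C: "C > 0" "\<And>x. norm (f x) * (1 + norm x) ^ M \<le> C" using rapidE[OF f] by blast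
  define D where "D = (LINT w|lborel. (1 + norm w) ^ M * norm (\<phi> w))"
  have "(1 + norm x) ^ M * norm (convolve (L1_dilate t \<phi>) f x) \<le> C * D" if t: "t \<ge> 1" for t x
  proof -
    have rd: "rapid (L1_dilate t \<phi>)" using \<phi> t by (intro rapid_L1_dilate) auto
    have [measurable]: "L1_dilate t \<phi> \<in> borel_measurable borel" using rd by (rule rapid_measurable)
    have iz: "integrable lborel (\<lambda>z. (1 + norm z) ^ M * norm (L1_dilate t \<phi> z))" by (rule rapid_integrable_weight[OF rd])
    have iy: "integrable lborel (\<lambda>y. C * ((1 + norm (x - y)) ^ M * norm (L1_dilate t \<phi> (x - y))))"
      using integrable_lborel_affine[OF iz, of "-1" x] by (intro integrable_mult_right) simp
    have ab: "\<bar>(1 + norm x) ^ M\<bar> = (1 + norm x) ^ M" by simp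
    have "norm (of_real ((1 + norm x) ^ M) * convolve (L1_dilate t \<phi>) f x) \<le> (LINT y|lborel. C * ((1 + norm (x - y)) ^ M * norm (L1_dilate t \<phi> (x - y))))"
      unfolding convolve_def integral_mult_right_zero[symmetric]
    proof (rule Bochner_Integration.integral_norm_bound_integral)
      have b: "norm (of_real ((1 + norm x) ^ M) * (L1_dilate t \<phi> (x - y) * f y)) \<le> C * ((1 + norm (x - y)) ^ M * norm (L1_dilate t \<phi> (x - y)))" for y
      proof -
        have "(1 + norm x) ^ M \<le> (1 + norm (x - y)) ^ M * (1 + norm y) ^ M"
          unfolding power_mult_distrib[symmetric] by (intro power_mono one_plus_norm_split) auto
        then have "(1 + norm x) ^ M * (norm (L1_dilate t \<phi> (x - y)) * norm (f y)) \<le> ((1 + norm (x - y)) ^ M * (1 + norm y) ^ M) * (norm (L1_dilate t \<phi> (x - y)) * norm (f y))"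
          by (rule mult_right_mono) auto
        also have "\<dots> = (norm (f y) * (1 + norm y) ^ M) * ((1 + norm (x - y)) ^ M * norm (L1_dilate t \<phi> (x - y)))" by (simp only: mult_ac)
        also have "\<dots> \<le> C * ((1 + norm (x - y)) ^ M * norm (L1_dilate t \<phi> (x - y)))" by (intro mult_right_mono C) auto
        finally show ?thesis by (simp only: norm_mult norm_of_real ab)
      qed
      show "norm (of_real ((1 + norm x) ^ M) * (L1_dilate t \<phi> (x - y) * f y)) \<le> C * ((1 + norm (x - y)) ^ M * norm (L1_dilate t \<phi> (x - y)))" for y by (rule b)
      show "integrable lborel (\<lambda>y. of_real ((1 + norm x) ^ M) * (L1_dilate t \<phi> (x - y) * f y))"
        by (rule Bochner_Integration.integrable_bound[OF iy]) (measurable, intro AE_I2 order_trans[OF b], simp)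
    qed (rule iy)
    also have "\<dots> = C * (LINT y|lborel. (1 + norm (x - y)) ^ M * norm (L1_dilate t \<phi> (x - y)))" by (rule integral_mult_right_zero)
    also have "(LINT y|lborel. (1 + norm (x - y)) ^ M * norm (L1_dilate t \<phi> (x - y))) = (LINT z|lborel. (1 + norm z) ^ M * norm (L1_dilate t \<phi> z))"
      by (rule integral_lborel_reflect) measurable
    also have "\<dots> = (\<bar>1 / t\<bar> ^ DIM('a)) *\<^sub>R (LINT w|lborel. (1 + norm (0 + (1 / t) *\<^sub>R w)) ^ M * norm (L1_dilate t \<phi> (0 + (1 / t) *\<^sub>R w)))"
      using t by (intro integral_lborel_affine) auto
    also have "\<dots> = (LINT w|lborel. (1 + norm w / t) ^ M * norm (\<phi> w))"
      using t by (simp add: L1_dilate_def norm_mult norm_power power_divide mult.left_commute[of _ "t ^ _"])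
    finally have A: "(1 + norm x) ^ M * norm (convolve (L1_dilate t \<phi>) f x) \<le> C * (LINT w|lborel. (1 + norm w / t) ^ M * norm (\<phi> w))"
      by (simp only: norm_mult norm_of_real ab)
    have "(LINT w|lborel. (1 + norm w / t) ^ M * norm (\<phi> w)) \<le> D"
      unfolding D_def
    proof (rule integral_mono)
      have le: "(1 + norm w / t) ^ M \<le> (1 + norm w) ^ M" for w :: 'a
        using t by (intro power_mono) (auto simp: divide_le_eq mult_left_le mult_le_cancel_left1)
      show "(1 + norm w / t) ^ M * norm (\<phi> w) \<le> (1 + norm w) ^ M * norm (\<phi> w)" for w by (intro mult_right_mono le) auto
      show i: "integrable lborel (\<lambda>w. (1 + norm w) ^ M * norm (\<phi> w))" by (rule rapid_integrable_weight[OF \<phi>])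
      show "integrable lborel (\<lambda>w. (1 + norm w / t) ^ M * norm (\<phi> w))"
        by (rule Bochner_Integration.integrable_bound[OF i]) (use t le in \<open>auto intro!: AE_I2 mult_right_mono\<close>)
    qed
    then have "C * (LINT w|lborel. (1 + norm w / t) ^ M * norm (\<phi> w)) \<le> C * D" using C(1) by (intro mult_left_mono) auto
    with A show ?thesis by (rule order_trans)
  qed
  moreover have "C * D \<ge> 0" using C(1) by (auto simp: D_def intro!: mult_nonneg_nonneg integral_nonneg_AE)
  ultimately show ?thesis by blast
qed

text \<open>Both regimes together bound the maximal function by any power of 1 / (1 + |x|), so it is
  p-integrable even for small p.\<close>

lemma maximal_function_decay:
  fixes \<phi> f :: "real ^ 'n \<Rightarrow> complex"
  assumes \<phi>: "schwartz \<phi>" and f: "annular a f" and a: "a > 0"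
  shows "\<exists>C\<ge>0. \<forall>j x. norm (convolve (dyadic_dilate \<phi> j) f x) \<le> C / (1 + norm x) ^ M"
proof -
  obtain C1 where C1: "C1 \<ge> 0" "\<And>t x. t \<ge> 1 \<Longrightarrow> (1 + norm x) ^ M * norm (convolve (L1_dilate t \<phi>) f x) \<le> C1"
    using convolve_high_frequency_decay[OF schwartz_rapid[OF \<phi>], of f M] f by (auto simp: annular_def)
  obtain C2 where C2: "C2 \<ge> 0" "\<And>t x. 0 < t \<Longrightarrow> t \<le> 1 \<Longrightarrow> norm x ^ M * norm (convolve (L1_dilate t \<phi>) f x) \<le> C2"
    using convolve_low_frequency_decay[OF \<phi> f a, of M 0] by auto
  obtain C3 where C3: "C3 \<ge> 0" "\<And>t x. 0 < t \<Longrightarrow> t \<le> 1 \<Longrightarrow> norm (convolve (L1_dilate t \<phi>) f x) \<le> C3"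
    using convolve_low_frequency_decay[OF \<phi> f a, of 0 0] by auto
  \<comment> \<open>From (1 + |x|)^M \<le> 2^M (|x|^M + 1): for t < 1 the constant C2 controls the
    first term and C3 the second.\<close>
  define C where "C = C1 + 2 ^ M * (C2 + C3)"
  have "norm (convolve (L1_dilate t \<phi>) f x) \<le> C / (1 + norm x) ^ M" if t: "t > 0" for t x
  proof -
    define v where "v = norm (convolve (L1_dilate t \<phi>) f x)"
    have v: "v \<ge> 0" by (simp add: v_def)
    have "(1 + norm x) ^ M * v \<le> C"
    proof (cases "t \<ge> 1")
      case True
      then have "(1 + norm x) ^ M * v \<le> C1" unfolding v_def by (rule C1(2))
      then show ?thesis using C2(1) C3(1) by (simp add: C_def add_increasing2)
    next
      case False
      have "(1 + norm x) ^ M \<le> 2 ^ M * (norm x ^ M + 1)"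
      proof (cases "norm x \<le> 1")
        case True
        then have "(1 + norm x) ^ M \<le> 2 ^ M" by (intro power_mono) auto
        also have "\<dots> \<le> 2 ^ M * (norm x ^ M + 1)" by simp
        finally show ?thesis .
      next
        case False
        then have "(1 + norm x) ^ M \<le> (2 * norm x) ^ M" by (intro power_mono) auto
        also have "\<dots> \<le> 2 ^ M * (norm x ^ M + 1)" by (simp add: power_mult_distrib)
        finally show ?thesis .
      qed
      then have "(1 + norm x) ^ M * v \<le> (2 ^ M * (norm x ^ M + 1)) * v" using v by (rule mult_right_mono)
      also have "\<dots> = 2 ^ M * (norm x ^ M * v + v)" by (simp add: algebra_simps)
      also have "\<dots> \<le> 2 ^ M * (C2 + C3)" unfolding v_def using False t by (intro mult_left_mono add_mono C2 C3) auto
      finally show ?thesis using C1(1) by (simp add: C_def)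
    qed
    then show ?thesis by (simp add: v_def pos_le_divide_eq add_pos_nonneg mult.commute)
  qed
  then have "\<forall>j x. norm (convolve (dyadic_dilate \<phi> j) f x) \<le> C / (1 + norm x) ^ M" unfolding dyadic_dilate_eq by simp
  moreover have "C \<ge> 0" using C1(1) C2(1) C3(1) by (simp add: C_def)
  ultimately show ?thesis by blast
qed

section \<open>Lattice sums and multiplier blocks\<close>

definition lattice_set :: "(real ^ 'n) set \<Rightarrow> bool" where
  "lattice_set Z \<longleftrightarrow> finite Z \<and> (\<forall>z\<in>Z. \<forall>i. z $ i \<in> \<int>)"

text \<open>Each lattice point owns an open unit cube, on which the summand changes by at most the
  factor A. The cubes are disjoint, so the sum is dominated by an integral that is independent of x
  and Z.\<close>

lemma lattice_sum_bound:
  "\<exists>K>0. \<forall>Z (x::real^'n). lattice_set Z \<longrightarrow> (\<Sum>z\<in>Z. 1 / (1 + norm (x - z)) ^ (2 * CARD('n))) \<le> K"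
proof -
  define M where "M = 2 * CARD('n)"
  define h where "h = (\<lambda>y::real^'n. 1 / (1 + norm y) ^ M)"
  have [measurable]: "h \<in> borel_measurable borel" unfolding h_def by measurable
  have h0: "h y \<ge> 0" for y by (simp add: h_def)
  have ih: "integrable lborel h" unfolding h_def M_def using integrable_decay[where 'a="real^'n"] by simp
  define A where "A = (1 + real CARD('n)) ^ M"
  define K where "K = A * (LINT y|lborel. h y)"
  have "(\<Sum>z\<in>Z. h (x - z)) \<le> K" if Z: "lattice_set Z" for Z and x :: "real^'n"
  proof -
    have fZ: "finite Z" and Zint: "\<And>z i. z \<in> Z \<Longrightarrow> z $ i \<in> \<int>" using Z by (auto simp: lattice_set_def)
    define Q where "Q = (\<lambda>z::real^'n. box z (z + (\<chi> i. 1)))"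
    have Q: "y \<in> Q z \<longleftrightarrow> (\<forall>i. z $ i < y $ i \<and> y $ i < z $ i + 1)" for y z by (auto simp: Q_def mem_box_cart)
    have [measurable]: "Q z \<in> sets borel" for z by (simp add: Q_def)
    have eQ: "emeasure lborel (Q z) = 1" for z
    proof -
      have one: "((\<chi> i. 1) :: real^'n) \<bullet> b = 1" if "b \<in> Basis" for b using that by (auto simp: Basis_vec_def inner_axis)
      then show ?thesis unfolding Q_def by (subst emeasure_lborel_box) (auto simp: inner_add_left)
    qed
    have hb: "h (x - z) \<le> A * h (x - y)" if "y \<in> Q z" for y z
    proof -
      have "norm (z - y) \<le> (\<Sum>i\<in>UNIV. \<bar>(z - y) $ i\<bar>)" by (rule norm_le_l1_cart)
      also have "\<dots> \<le> (\<Sum>i\<in>(UNIV::'n set). 1)"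
      proof (rule sum_mono)
        fix i show "\<bar>(z - y) $ i\<bar> \<le> 1" using that[unfolded Q, rule_format, of i] by simp
      qed
      finally have n: "norm (z - y) \<le> real CARD('n)" by simp
      have "1 + norm (x - y) \<le> (1 + norm ((x - y) - (z - y))) * (1 + norm (z - y))" by (rule one_plus_norm_split)
      also have "\<dots> \<le> (1 + norm (x - z)) * (1 + real CARD('n))" using n by (intro mult_mono) auto
      finally have "(1 + norm (x - y)) ^ M \<le> (1 + norm (x - z)) ^ M * A"
        unfolding A_def power_mult_distrib[symmetric] by (intro power_mono) auto
      then show ?thesis by (simp add: h_def field_simps add_pos_nonneg)
    qed
    have one: "(\<Sum>z\<in>Z. indicator (Q z) y) \<le> (1::ennreal)" for y
    proof -
      define zz where "zz = ((\<chi> i. of_int \<lfloor>y $ i\<rfloor>) :: real^'n)"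
      have "indicator (Q z) y \<le> (if z = zz then 1 else (0::ennreal))" if z: "z \<in> Z" for z
      proof (cases "y \<in> Q z")
        case True
        have "z $ i = of_int \<lfloor>y $ i\<rfloor>" for i
        proof -
          obtain k where k: "z $ i = of_int k" using Zint[OF z, of i] by (auto elim: Ints_cases)
          then have "\<lfloor>y $ i\<rfloor> = k" using True[unfolded Q, rule_format, of i] by (intro floor_unique) auto
          then show ?thesis using k by simp
        qed
        then have "z = zz" by (simp add: zz_def vec_eq_iff)
        then show ?thesis using True by simp
      qed simp
      then have "(\<Sum>z\<in>Z. indicator (Q z) y) \<le> (\<Sum>z\<in>Z. if z = zz then 1 else (0::ennreal))" by (rule sum_mono)
      also have "\<dots> \<le> 1" using fZ by (simp add: sum.delta)
      finally show ?thesis .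
    qed
    have "ennreal (\<Sum>z\<in>Z. h (x - z)) = (\<Sum>z\<in>Z. ennreal (h (x - z)))" using h0 by (simp add: sum_ennreal)
    also have "\<dots> = (\<Sum>z\<in>Z. \<integral>\<^sup>+y. ennreal (h (x - z)) * indicator (Q z) y \<partial>lborel)"
      by (simp add: nn_integral_cmult_indicator eQ)
    also have "\<dots> \<le> (\<Sum>z\<in>Z. \<integral>\<^sup>+y. ennreal (A * h (x - y)) * indicator (Q z) y \<partial>lborel)"
      by (intro sum_mono nn_integral_mono) (auto simp: indicator_def intro!: ennreal_leI hb)
    also have "\<dots> = (\<integral>\<^sup>+y. (\<Sum>z\<in>Z. ennreal (A * h (x - y)) * indicator (Q z) y) \<partial>lborel)"
      by (rule nn_integral_sum[symmetric]) measurable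
    also have "\<dots> = (\<integral>\<^sup>+y. ennreal (A * h (x - y)) * (\<Sum>z\<in>Z. indicator (Q z) y) \<partial>lborel)"
      by (simp add: sum_distrib_left)
    also have "\<dots> \<le> (\<integral>\<^sup>+y. ennreal (A * h (x - y)) * 1 \<partial>lborel)"
      by (intro nn_integral_mono mult_left_mono one) auto
    also have "\<dots> = (\<integral>\<^sup>+y. ennreal (A * h (x - y)) \<partial>lborel)" by simp
    also have "\<dots> = (\<integral>\<^sup>+y. ennreal (A * h y) \<partial>lborel)"
      by (rule nn_integral_lborel_reflect[of "\<lambda>y. ennreal (A * h y)"]) measurable
    also have "\<dots> = ennreal K" unfolding K_def integral_mult_right_zero[symmetric]
      using ih h0 by (intro nn_integral_eq_integral) (auto simp: A_def)
    finally show ?thesis using h0 by (subst (asm) ennreal_le_iff) (auto simp: K_def A_def intro!: mult_nonneg_nonneg integral_nonneg_AE)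
  qed
  then have "\<forall>Z (x::real^'n). lattice_set Z \<longrightarrow> (\<Sum>z\<in>Z. 1 / (1 + norm (x - z)) ^ (2 * CARD('n))) \<le> max K 1"
    unfolding h_def M_def by (auto simp: le_max_iff_disj)
  then show ?thesis by (intro exI[of _ "max K 1"]) auto
qed

section \<open>L^p quasi-norms of lattice sums\<close>

lemma powr_add_le:
  fixes a b P :: real assumes "a \<ge> 0" "b \<ge> 0" "0 < P" "P \<le> 1"
  shows "(a + b) powr P \<le> a powr P + b powr P"
proof (cases "a + b = 0")
  case False
  then have s: "a + b > 0" using assms by simp
  have *: "t \<le> t powr P" if "0 \<le> t" "t \<le> 1" for t :: real
    using powr_mono'[of P 1 t] assms that by simp
  have "1 = a / (a + b) + b / (a + b)" using s by (simp add: add_divide_distrib[symmetric])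
  also have "\<dots> \<le> (a / (a + b)) powr P + (b / (a + b)) powr P"
    using assms s by (intro add_mono *) auto
  also have "\<dots> = (a powr P + b powr P) / (a + b) powr P" using assms s by (simp add: powr_divide add_divide_distrib)
  finally show ?thesis using s by (simp add: pos_le_divide_eq)
qed (use assms in auto)

lemma powr_sum_le:
  fixes f :: "'i \<Rightarrow> real" assumes "finite I" "\<And>i. i \<in> I \<Longrightarrow> f i \<ge> 0" "0 < P" "P \<le> 1"
  shows "(\<Sum>i\<in>I. f i) powr P \<le> (\<Sum>i\<in>I. f i powr P)"
  using assms
proof (induction I rule: finite_induct)
  case (insert i I)
  have "(f i + (\<Sum>i\<in>I. f i)) powr P \<le> f i powr P + (\<Sum>i\<in>I. f i) powr P"
    using insert by (intro powr_add_le sum_nonneg) auto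
  then show ?case using insert by (auto intro: order_trans)
qed simp

text \<open>Jensen's inequality for the weights w i divided by their sum H, obtained by summing the
  tangent at the mean; then H is replaced by its bound K.\<close>

lemma weighted_powr_sum_le:
  fixes w c :: "'i \<Rightarrow> real" assumes "finite I" and w: "\<And>i. i \<in> I \<Longrightarrow> w i \<ge> 0" and c: "\<And>i. i \<in> I \<Longrightarrow> c i \<ge> 0" and P: "P \<ge> 1"
    and K: "(\<Sum>i\<in>I. w i) \<le> K"
  shows "(\<Sum>i\<in>I. c i * w i) powr P \<le> K powr (P - 1) * (\<Sum>i\<in>I. c i powr P * w i)"
proof -
  define H where "H = (\<Sum>i\<in>I. w i)"
  define S where "S = (\<Sum>i\<in>I. c i * w i)"
  have S0: "S \<ge> 0" unfolding S_def using w c by (intro sum_nonneg) auto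
  have H0: "H \<ge> 0" unfolding H_def using w by (intro sum_nonneg) auto
  have R0: "(\<Sum>i\<in>I. c i powr P * w i) \<ge> 0" using w by (intro sum_nonneg) auto
  show ?thesis
  proof (cases "S = 0")
    case True then show ?thesis using R0 P by (simp add: S_def)
  next
    case False
    have H: "H > 0"
    proof (rule ccontr)
      assume "\<not> H > 0"
      then have "H = 0" using H0 by simp
      then have "\<forall>i\<in>I. w i = 0" unfolding H_def using w assms(1) by (subst (asm) sum_nonneg_eq_0_iff) auto
      then show False using False by (simp add: S_def)
    qed
    define A where "A = S / H"
    have A: "A > 0" using S0 False H by (simp add: A_def)
    have "H * A powr P = (\<Sum>i\<in>I. (A powr P + P * A powr (P - 1) * (c i - A)) * w i)"
    proof -
      have "(\<Sum>i\<in>I. (A powr P + P * A powr (P - 1) * (c i - A)) * w i) =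
        (\<Sum>i\<in>I. A powr P * w i + P * A powr (P - 1) * (c i * w i) - P * A powr (P - 1) * A * w i)"
        by (intro sum.cong refl) (simp add: algebra_simps)
      also have "\<dots> = A powr P * H + P * A powr (P - 1) * S - P * A powr (P - 1) * A * H"
        by (simp add: sum.distrib sum_subtractf H_def S_def sum_distrib_left)
      also have "\<dots> = H * A powr P" using H by (simp add: A_def)
      finally show ?thesis by simp
    qed
    also have "\<dots> \<le> (\<Sum>i\<in>I. c i powr P * w i)"
      using w c A P by (intro sum_mono mult_right_mono powr_above_tangent) auto
    finally have HA: "H * A powr P \<le> (\<Sum>i\<in>I. c i powr P * w i)" .
    have "S powr P = H powr (P - 1) * (H * A powr P)"
      using H S0 by (simp add: A_def powr_divide powr_diff)
    also have "\<dots> \<le> K powr (P - 1) * (\<Sum>i\<in>I. c i powr P * w i)"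
      using HA K H P R0 by (intro mult_mono powr_mono2) (auto simp: H_def)
    finally show ?thesis by (simp add: S_def)
  qed
qed

text \<open>Bumps at lattice points behave as if they had disjoint supports: the L^p size of the sum
  is that of the coefficients in l^p. For p \<le> 1 the power is subadditive, for larger finite p
  Jensen is applied with the bumps as weights, and for p = \<infinity> the lattice sum itself is
  bounded.\<close>

lemma lattice_Lp_bound:
  fixes p :: ennreal
  assumes p: "p > 0"
  shows "\<exists>M K. K > 0 \<and> (\<forall>Z c (g::real^'n \<Rightarrow> ennreal). lattice_set Z \<longrightarrow> (\<forall>z. c z \<ge> 0) \<longrightarrow> g \<in> borel_measurable borel \<longrightarrow>
     (\<forall>x. g x \<le> ennreal (\<Sum>z\<in>Z. c z / (1 + norm (x - z)) ^ M)) \<longrightarrow>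
     (if p = \<infinity> then (\<forall>b\<ge>0. (\<forall>z\<in>Z. c z \<le> b) \<longrightarrow> Lp_norm_nonneg p g \<le> ennreal (K * b))
      else Lp_norm_nonneg p g \<le> ennreal (K * (\<Sum>z\<in>Z. c z powr enn2real p) powr (1 / enn2real p))))"
proof -
  obtain K where K: "K > 0" "\<And>Z (x::real^'n). lattice_set Z \<Longrightarrow> (\<Sum>z\<in>Z. 1 / (1 + norm (x - z)) ^ (2 * CARD('n))) \<le> K"
    using lattice_sum_bound by blast
  show ?thesis
  proof (cases "p = \<infinity>")
    case True
    have "Lp_norm_nonneg p g \<le> ennreal (K * b)" if Z: "lattice_set Z" and c: "\<forall>z. c z \<ge> 0" and [measurable]: "g \<in> borel_measurable borel"
      and g: "\<forall>x. g x \<le> ennreal (\<Sum>z\<in>Z. c z / (1 + norm (x - z)) ^ (2 * CARD('n)))" and b: "b \<ge> 0" and c1: "\<forall>z\<in>Z. c z \<le> b"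
      for Z c b and g :: "real^'n \<Rightarrow> ennreal"
    proof -
      have "g x \<le> ennreal (K * b)" for x
      proof -
        have "g x \<le> ennreal (\<Sum>z\<in>Z. c z / (1 + norm (x - z)) ^ (2 * CARD('n)))" using g by blast
        also have "\<dots> \<le> ennreal (\<Sum>z\<in>Z. b * (1 / (1 + norm (x - z)) ^ (2 * CARD('n))))"
          using c1 by (intro ennreal_leI sum_mono) (auto intro!: divide_right_mono)
        also have "\<dots> = ennreal (b * (\<Sum>z\<in>Z. 1 / (1 + norm (x - z)) ^ (2 * CARD('n))))" by (simp only: sum_distrib_left)
        also have "\<dots> \<le> ennreal (K * b)" unfolding mult.commute[of K] by (intro ennreal_leI mult_left_mono K(2) Z b)
        finally show ?thesis .
      qed
      then show ?thesis using True by (auto simp: Lp_norm_nonneg_def intro!: esssup_I)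
    qed
    then show ?thesis using K(1) True by (intro exI[of _ "2 * CARD('n)"] exI[of _ K]) auto
  next
    case False
    define P where "P = enn2real p"
    have P: "P > 0" using p False by (simp add: P_def enn2real_positive_iff less_top)
    \<comment> \<open>M P \<ge> 2n makes even the P-th power of a bump integrable when P is small,
      and M \<ge> 2n keeps the lattice sum of the bumps bounded, as Jensen requires.\<close>
    obtain M0 where M0: "real M0 \<ge> 2 * CARD('n) / P" using real_arch_simple by blast
    define M where "M = max (2 * CARD('n)) M0"
    have M: "M \<ge> 2 * CARD('n)" "real M * P \<ge> 2 * CARD('n)"
      using M0 P by (auto simp: M_def pos_divide_le_eq intro: order_trans[OF _ mult_right_mono])
    define h where "h = (\<lambda>y::real^'n. 1 / (1 + norm y) ^ (2 * CARD('n)))"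
    have [measurable]: "h \<in> borel_measurable borel" unfolding h_def by measurable
    have h0: "h y \<ge> 0" for y by (simp add: h_def)
    have ih: "integrable lborel h" unfolding h_def using integrable_decay[where 'a="real^'n"] by simp
    define I where "I = (LINT y|lborel. h y)"
    have I0: "I \<ge> 0" unfolding I_def using h0 by (intro integral_nonneg_AE) auto
    define w where "w = (\<lambda>y::real^'n. 1 / (1 + norm y) ^ M)"
    have w0: "w y \<ge> 0" for y by (simp add: w_def)
    have wh: "w y \<le> h y" for y unfolding w_def h_def using M(1) by (intro divide_left_mono power_increasing mult_pos_pos) (auto simp: add_pos_nonneg)
    have whP: "w y powr P \<le> h y" for y
    proof -
      have "w y powr P = (1 + norm y) powr - (real M * P)"
        unfolding w_def by (simp add: powr_realpow[symmetric] add_pos_nonneg powr_divide powr_powr powr_minus_divide)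
      also have "\<dots> \<le> (1 + norm y) powr - (2 * real CARD('n))" using M(2) by (intro powr_mono) auto
      also have "\<dots> = h y"
      proof -
        have "(1 + norm y) powr (2 * real CARD('n)) = (1 + norm y) ^ (2 * CARD('n))"
          using powr_realpow[of "1 + norm y" "2 * CARD('n)"] by (simp add: add_pos_nonneg)
        then show ?thesis by (simp add: h_def powr_minus_divide)
      qed
      finally show ?thesis .
    qed
    define K1 where "K1 = max 1 (K powr (P - 1))"
    have K1: "K1 \<ge> 1" by (simp add: K1_def)
    have pt: "(\<Sum>z\<in>Z. c z * w (x - z)) powr P \<le> K1 * (\<Sum>z\<in>Z. c z powr P * h (x - z))"
      if Z: "lattice_set Z" and c: "\<And>z. c z \<ge> 0" for Z c x
    proof -
      have fZ: "finite Z" using Z by (simp add: lattice_set_def)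
      have s0: "(\<Sum>z\<in>Z. c z powr P * h (x - z)) \<ge> 0" using h0 by (intro sum_nonneg) auto
      show ?thesis
      proof (cases "P \<le> 1")
        case True
        have "(\<Sum>z\<in>Z. c z * w (x - z)) powr P \<le> (\<Sum>z\<in>Z. (c z * w (x - z)) powr P)"
          using c w0 P True by (intro powr_sum_le fZ) auto
        also have "\<dots> = (\<Sum>z\<in>Z. c z powr P * w (x - z) powr P)" using c w0 by (simp add: powr_mult)
        also have "\<dots> \<le> (\<Sum>z\<in>Z. c z powr P * h (x - z))" by (intro sum_mono mult_left_mono whP) auto
        also have "\<dots> \<le> K1 * (\<Sum>z\<in>Z. c z powr P * h (x - z))" using mult_right_mono[OF K1 s0] by simp
        finally show ?thesis .
      next
        case False
        have wK: "(\<Sum>z\<in>Z. w (x - z)) \<le> K"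
        proof -
          have "(\<Sum>z\<in>Z. w (x - z)) \<le> (\<Sum>z\<in>Z. h (x - z))" by (intro sum_mono wh)
          also have "\<dots> \<le> K" using K(2)[OF Z, of x] by (simp add: h_def)
          finally show ?thesis .
        qed
        have "(\<Sum>z\<in>Z. c z * w (x - z)) powr P \<le> K powr (P - 1) * (\<Sum>z\<in>Z. c z powr P * w (x - z))"
          using c w0 False wK by (intro weighted_powr_sum_le fZ) auto
        also have "\<dots> \<le> K1 * (\<Sum>z\<in>Z. c z powr P * h (x - z))"
          using wh w0 by (intro mult_mono sum_mono mult_left_mono) (auto simp: K1_def intro!: sum_nonneg)
        finally show ?thesis .
      qed
    qed
    define KK where "KK = (K1 * I) powr (1 / P) + 1"
    have "Lp_norm_nonneg p g \<le> ennreal (KK * (\<Sum>z\<in>Z. c z powr P) powr (1 / P))"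
      if Z: "lattice_set Z" and c: "\<forall>z. c z \<ge> 0"
      and g: "\<forall>x. g x \<le> ennreal (\<Sum>z\<in>Z. c z / (1 + norm (x - z)) ^ M)"
      for Z c and g :: "real^'n \<Rightarrow> ennreal"
    proof -
      define Sc where "Sc = (\<Sum>z\<in>Z. c z powr P)"
      have Sc0: "Sc \<ge> 0" unfolding Sc_def by (intro sum_nonneg) auto
      have fZ: "finite Z" using Z by (simp add: lattice_set_def)
      have "(\<integral>\<^sup>+x. ennreal_powr (g x) P \<partial>lborel) \<le> (\<integral>\<^sup>+x. (\<Sum>z\<in>Z. ennreal (K1 * c z powr P) * ennreal (h (x - z))) \<partial>lborel)"
      proof (rule nn_integral_mono)
        fix x :: "real^'n"
        have "ennreal_powr (g x) P \<le> ennreal_powr (ennreal (\<Sum>z\<in>Z. c z * w (x - z))) P"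
          using g P by (intro ennreal_powr_mono) (auto simp: w_def)
        also have "\<dots> = ennreal ((\<Sum>z\<in>Z. c z * w (x - z)) powr P)"
          using c w0 by (intro ennreal_powr_ennreal sum_nonneg) auto
        also have "\<dots> \<le> ennreal (K1 * (\<Sum>z\<in>Z. c z powr P * h (x - z)))" using c by (intro ennreal_leI pt Z) auto
        also have "\<dots> = (\<Sum>z\<in>Z. ennreal (K1 * c z powr P) * ennreal (h (x - z)))"
          using K1 h0 by (simp add: sum_distrib_left ennreal_mult[symmetric] sum_ennreal mult.assoc)
        finally show "ennreal_powr (g x) P \<le> (\<Sum>z\<in>Z. ennreal (K1 * c z powr P) * ennreal (h (x - z)))" .
      qed
      also have "\<dots> = (\<Sum>z\<in>Z. ennreal (K1 * c z powr P) * (\<integral>\<^sup>+x. ennreal (h (x - z)) \<partial>lborel))"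
        by (subst nn_integral_sum) (auto simp: nn_integral_cmult)
      also have "\<dots> = (\<Sum>z\<in>Z. ennreal (K1 * c z powr P) * ennreal I)"
      proof (intro sum.cong refl arg_cong2[where f="(*)"])
        fix z :: "real^'n"
        have "(\<integral>\<^sup>+x. ennreal (h (x - z)) \<partial>lborel) = (\<integral>\<^sup>+x. ennreal (h x) \<partial>lborel)"
          using nn_integral_lborel_translate[of "\<lambda>x. ennreal (h x)" "- z"] by simp
        then show "(\<integral>\<^sup>+x. ennreal (h (x - z)) \<partial>lborel) = ennreal I"
          unfolding I_def using ih h0 by (subst (asm) (2) nn_integral_eq_integral) auto
      qed
      also have "\<dots> = ennreal (K1 * I * Sc)"
        using K1 I0 unfolding Sc_def by (simp add: ennreal_mult[symmetric] sum_ennreal sum_distrib_left mult_ac)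
      finally have "Lp_norm_nonneg p g \<le> ennreal_powr (ennreal (K1 * I * Sc)) (1 / P)"
        unfolding Lp_norm_nonneg_def P_def[symmetric] using False P by (auto intro!: ennreal_powr_mono)
      also have "\<dots> = ennreal ((K1 * I) powr (1 / P) * Sc powr (1 / P))"
        using K1 I0 Sc0 by (subst ennreal_powr_ennreal) (auto simp: powr_mult)
      also have "\<dots> \<le> ennreal (KK * Sc powr (1 / P))" unfolding KK_def by (intro ennreal_leI mult_right_mono) auto
      finally show ?thesis by (simp add: Sc_def)
    qed
    moreover have "KK > 0" by (simp add: KK_def add_nonneg_pos)
    ultimately show ?thesis using False unfolding P_def by (intro exI[of _ M] exI[of _ KK]) auto
  qed
qed

text \<open>Writing the transform of \<psi> as an integral over \<nu> replaces x by x - R \<nu> in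
  the factors with index in J. The modulations of the f j then contribute -R (card J) (\<nu>
  \<bullet> e) to the phase, which the shift by (card J) e in the symbol cancels. The remaining
  phase depends on x alone, and everything else is real and is nonnegative when \<psi> and the g j
  are.\<close>

lemma multiplier_block_integral:
  fixes f :: "'m::finite \<Rightarrow> real ^ 'n \<Rightarrow> complex" and g :: "'m \<Rightarrow> real ^ 'n \<Rightarrow> real" and \<psi> :: "real ^ 'n \<Rightarrow> real"
  assumes u: "integrable lborel (\<lambda>x. complex_of_real (\<psi> x))"
    and f: "\<And>j x. f j x = cis (2 * pi * (x \<bullet> e)) * of_real (g j x)"
    and ff: "\<And>j. integrable lborel (fourier (f j))" and inv: "\<And>j x. inv_fourier (fourier (f j)) x = f j x"
  shows "(LINT \<xi>|lborel. fourier (\<lambda>x. of_real (\<psi> x)) (R *\<^sub>R (sum_on J \<xi> - real (card J) *\<^sub>R e)) * (\<Prod>j\<in>UNIV. fourier (f j) (\<xi> $ j)) * cis (2 * pi * (x \<bullet> (\<Sum>j\<in>UNIV. \<xi> $ j))))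
    = cis (2 * pi * real CARD('m) * (x \<bullet> e)) * of_real (LINT \<nu>|lborel. \<psi> \<nu> * ((\<Prod>j\<in>J. g j (x - R *\<^sub>R \<nu>)) * (\<Prod>j\<in>-J. g j x)))"
proof -
  have [measurable]: "(\<lambda>x. complex_of_real (\<psi> x)) \<in> borel_measurable borel" using u by auto
  have [measurable]: "fourier (f j) \<in> borel_measurable borel" for j using ff[of j] by auto
  have [measurable]: "(\<lambda>x::(real^'n)^'m. x $ i) \<in> borel_measurable borel" for i
    by (intro borel_measurable_continuous_onI continuous_intros)
  interpret adjoint_pair "embed_on J :: real ^ 'n \<Rightarrow> (real ^ 'n) ^ 'm" "sum_on J" by (rule adjoint_pair_on)
  note [measurable] = meas_L
  define F where "F = (\<lambda>\<xi>::(real^'n)^'m. \<Prod>j\<in>UNIV. fourier (f j) (\<xi> $ j))"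
  have iF: "integrable lborel F" unfolding F_def by (rule lborel_integral_vec_prod(1)[OF ff])
  have [measurable]: "F \<in> borel_measurable borel" using iF by auto
  define h where "h = (\<lambda>(\<xi>::(real^'n)^'m) \<nu>. of_real (\<psi> \<nu>) * cis (- 2 * pi * (\<nu> \<bullet> (R *\<^sub>R (sum_on J \<xi> - real (card J) *\<^sub>R e)))) * F \<xi> * cis (2 * pi * (x \<bullet> (\<Sum>j\<in>UNIV. \<xi> $ j))))"
  have "(LINT \<xi>|lborel. fourier (\<lambda>x. of_real (\<psi> x)) (R *\<^sub>R (sum_on J \<xi> - real (card J) *\<^sub>R e)) * F \<xi> * cis (2 * pi * (x \<bullet> (\<Sum>j\<in>UNIV. \<xi> $ j))))
    = (LINT \<xi>|lborel. LINT \<nu>|lborel. h \<xi> \<nu>)"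
    unfolding h_def fourier_def by (simp only: integral_mult_left_zero)
  also have "\<dots> = (LINT \<nu>|lborel. LINT \<xi>|lborel. h \<xi> \<nu>)"
  proof (rule fubini_lborel_mult(1)[OF iF u])
    show "(\<lambda>(\<xi>, \<nu>). h \<xi> \<nu>) \<in> borel_measurable (borel \<Otimes>\<^sub>M borel)" unfolding h_def by measurable
  qed (simp add: h_def norm_mult)
  also have "\<dots> = (LINT \<nu>|lborel. cis (2 * pi * real CARD('m) * (x \<bullet> e)) * of_real (\<psi> \<nu> * ((\<Prod>j\<in>J. g j (x - R *\<^sub>R \<nu>)) * (\<Prod>j\<in>-J. g j x))))"
  proof (rule Bochner_Integration.integral_cong[OF refl])
    fix \<nu> :: "real^'n"
    \<comment> \<open>The point at which the j-th input is evaluated: the slab couples only the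
      coordinates of J.\<close>
    define y where "y = (\<lambda>j. if j \<in> J then x - R *\<^sub>R \<nu> else x)"
    have "h \<xi> \<nu> = (of_real (\<psi> \<nu>) * cis (2 * pi * (R * real (card J) * (\<nu> \<bullet> e)))) * (\<Prod>j\<in>UNIV. fourier (f j) (\<xi> $ j) * cis (2 * pi * (\<xi> $ j \<bullet> y j)))" for \<xi>
    proof -
      have s: "(\<Sum>j\<in>UNIV. \<xi> $ j \<bullet> y j) = x \<bullet> (\<Sum>j\<in>UNIV. \<xi> $ j) - R * (\<nu> \<bullet> sum_on J \<xi>)"
      proof -
        have "(\<Sum>j\<in>UNIV. \<xi> $ j \<bullet> y j) = (\<Sum>j\<in>UNIV. x \<bullet> \<xi> $ j - (if j \<in> J then R * (\<nu> \<bullet> \<xi> $ j) else 0))"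
          by (intro sum.cong refl) (simp add: y_def inner_diff_right inner_commute)
        also have "\<dots> = x \<bullet> (\<Sum>j\<in>UNIV. \<xi> $ j) - R * (\<nu> \<bullet> sum_on J \<xi>)"
          by (simp add: sum_subtractf inner_sum_right sum_on_def sum.If_cases sum_distrib_left)
        finally show ?thesis .
      qed
      have "(\<Prod>j\<in>UNIV. cis (2 * pi * (\<xi> $ j \<bullet> y j))) = cis (2 * pi * (\<Sum>j\<in>UNIV. \<xi> $ j \<bullet> y j))"
        by (simp add: cis_sum[symmetric] sum_distrib_left)
      then have c: "cis (- 2 * pi * (\<nu> \<bullet> (R *\<^sub>R (sum_on J \<xi> - real (card J) *\<^sub>R e)))) * cis (2 * pi * (x \<bullet> (\<Sum>j\<in>UNIV. \<xi> $ j)))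
         = cis (2 * pi * (R * real (card J) * (\<nu> \<bullet> e))) * (\<Prod>j\<in>UNIV. cis (2 * pi * (\<xi> $ j \<bullet> y j)))"
        unfolding s by (simp only: cis_mult) (rule arg_cong[where f=cis], simp add: inner_diff_right algebra_simps)
      have "h \<xi> \<nu> = of_real (\<psi> \<nu>) * F \<xi> * (cis (- 2 * pi * (\<nu> \<bullet> (R *\<^sub>R (sum_on J \<xi> - real (card J) *\<^sub>R e)))) * cis (2 * pi * (x \<bullet> (\<Sum>j\<in>UNIV. \<xi> $ j))))"
        by (simp only: h_def mult_ac)
      then show ?thesis unfolding c F_def prod.distrib by (simp only: mult_ac)
    qed
    then have "(LINT \<xi>|lborel. h \<xi> \<nu>) = (of_real (\<psi> \<nu>) * cis (2 * pi * (R * real (card J) * (\<nu> \<bullet> e)))) * (LINT \<xi>|lborel. (\<Prod>j\<in>UNIV. fourier (f j) (\<xi> $ j) * cis (2 * pi * (\<xi> $ j \<bullet> y j))))"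
      by (simp only: integral_mult_right_zero)
    also have "(LINT \<xi>|lborel. (\<Prod>j\<in>UNIV. fourier (f j) ((\<xi>::(real^'n)^'m) $ j) * cis (2 * pi * (\<xi> $ j \<bullet> y j)))) = (\<Prod>j\<in>UNIV. LINT t|lborel. fourier (f j) t * cis (2 * pi * (t \<bullet> y j)))"
      by (rule lborel_integral_vec_prod(2)) (intro integrable_cis_mult ff, measurable)
    also have "\<dots> = (\<Prod>j\<in>UNIV. f j (y j))" by (simp only: inv_fourier_eq[symmetric] inv)
    also have "\<dots> = (\<Prod>j\<in>UNIV. cis (2 * pi * (y j \<bullet> e))) * of_real (\<Prod>j\<in>UNIV. g j (y j))"
      by (simp only: f prod.distrib of_real_prod)
    also have "(\<Prod>j\<in>UNIV. g j (y j)) = (\<Prod>j\<in>J. g j (x - R *\<^sub>R \<nu>)) * (\<Prod>j\<in>-J. g j x)"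
    proof -
      have "(\<Prod>j\<in>UNIV. g j (y j)) = (\<Prod>j\<in>UNIV. if j \<in> J then g j (x - R *\<^sub>R \<nu>) else g j x)"
        by (intro prod.cong refl) (simp add: y_def)
      also have "\<dots> = (\<Prod>j\<in>J. g j (x - R *\<^sub>R \<nu>)) * (\<Prod>j\<in>-J. g j x)"
        by (simp add: prod.If_cases Compl_eq)
      finally show ?thesis .
    qed
    also have "(\<Prod>j\<in>UNIV. cis (2 * pi * (y j \<bullet> e))) = cis (2 * pi * (real CARD('m) * (x \<bullet> e) - R * real (card J) * (\<nu> \<bullet> e)))"
    proof -
      have "(\<Sum>j\<in>UNIV. y j \<bullet> e) = (\<Sum>j\<in>(UNIV::'m set). x \<bullet> e - (if j \<in> J then R * (\<nu> \<bullet> e) else 0))"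
        by (intro sum.cong refl) (simp add: y_def inner_diff_left)
      also have "\<dots> = real CARD('m) * (x \<bullet> e) - R * real (card J) * (\<nu> \<bullet> e)"
        by (simp add: sum_subtractf sum.If_cases)
      finally show ?thesis by (simp add: cis_sum[symmetric] sum_distrib_left[symmetric])
    qed
    finally have "(LINT \<xi>|lborel. h \<xi> \<nu>) = of_real (\<psi> \<nu>) * ((cis (2 * pi * (R * real (card J) * (\<nu> \<bullet> e))) * cis (2 * pi * (real CARD('m) * (x \<bullet> e) - R * real (card J) * (\<nu> \<bullet> e)))) * of_real ((\<Prod>j\<in>J. g j (x - R *\<^sub>R \<nu>)) * (\<Prod>j\<in>-J. g j x)))"
      by (simp only: mult_ac)
    also have "cis (2 * pi * (R * real (card J) * (\<nu> \<bullet> e))) * cis (2 * pi * (real CARD('m) * (x \<bullet> e) - R * real (card J) * (\<nu> \<bullet> e))) = cis (2 * pi * real CARD('m) * (x \<bullet> e))"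
      unfolding cis_mult by (rule arg_cong[where f=cis]) (simp add: algebra_simps)
    finally show "(LINT \<xi>|lborel. h \<xi> \<nu>) = cis (2 * pi * real CARD('m) * (x \<bullet> e)) * of_real (\<psi> \<nu> * ((\<Prod>j\<in>J. g j (x - R *\<^sub>R \<nu>)) * (\<Prod>j\<in>-J. g j x)))"
      by (simp only: of_real_mult mult_ac)
  qed
  also have "\<dots> = cis (2 * pi * real CARD('m) * (x \<bullet> e)) * of_real (LINT \<nu>|lborel. \<psi> \<nu> * ((\<Prod>j\<in>J. g j (x - R *\<^sub>R \<nu>)) * (\<Prod>j\<in>-J. g j x)))"
    by (simp only: integral_mult_right_zero integral_complex_of_real)
  finally show ?thesis unfolding F_def .
qed

text \<open>After removal of the common phase the output is a series of nonnegative reals, so its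
  modulus is at least any single term.\<close>

lemma norm_multiplier_op_ge_block:
  fixes f :: "'m::finite \<Rightarrow> real ^ 'n \<Rightarrow> complex" and g :: "'m \<Rightarrow> real ^ 'n \<Rightarrow> real" and \<psi> :: "real ^ 'n \<Rightarrow> real"
  assumes u: "integrable lborel (\<lambda>x. complex_of_real (\<psi> x))" and \<psi>0: "\<And>x. \<psi> x \<ge> 0"
    and f: "\<And>j x. f j x = cis (2 * pi * (x \<bullet> e)) * of_real (g j x)" and g0: "\<And>j x. g j x \<ge> 0"
    and ff: "\<And>j. integrable lborel (fourier (f j))" and inv: "\<And>j x. inv_fourier (fourier (f j)) x = f j x"
    and d0: "\<And>k. d k \<ge> 0" and ds: "summable d"
    and \<sigma>: "\<And>\<xi>. \<sigma> \<xi> = a \<xi> * (\<Sum>k. of_real (d k) * fourier (\<lambda>x. of_real (\<psi> x)) (R k *\<^sub>R (sum_on J \<xi> - real (card J) *\<^sub>R e)))"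
    and a: "\<And>\<xi>. (\<And>j. fourier (f j) (\<xi> $ j) \<noteq> 0) \<Longrightarrow> a \<xi> = 1"
  shows "d k * (LINT \<nu>|lborel. \<psi> \<nu> * ((\<Prod>j\<in>J. g j (x - R k *\<^sub>R \<nu>)) * (\<Prod>j\<in>-J. g j x))) \<le> norm (multiplier_op \<sigma> f x)"
proof -
  define t where "t = (\<lambda>k. LINT \<nu>|lborel. \<psi> \<nu> * ((\<Prod>j\<in>J. g j (x - R k *\<^sub>R \<nu>)) * (\<Prod>j\<in>-J. g j x)))"
  have t0: "t k \<ge> 0" for k unfolding t_def using \<psi>0 g0 by (intro integral_nonneg_AE AE_I2 mult_nonneg_nonneg prod_nonneg) auto
  have [measurable]: "fourier (\<lambda>x. complex_of_real (\<psi> x)) \<in> borel_measurable borel" using u by (rule fourier_measurable)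
  interpret adjoint_pair "embed_on J :: real ^ 'n \<Rightarrow> (real ^ 'n) ^ 'm" "sum_on J" by (rule adjoint_pair_on)
  note [measurable] = meas_L
  define F where "F = (\<lambda>\<xi>::(real^'n)^'m. \<Prod>j\<in>UNIV. fourier (f j) (\<xi> $ j))"
  have iF: "integrable lborel F" unfolding F_def by (rule lborel_integral_vec_prod(1)[OF ff])
  have [measurable]: "F \<in> borel_measurable borel" using iF by auto
  define U where "U = (LINT x|lborel. norm (complex_of_real (\<psi> x)))"
  define v where "v = (\<lambda>k \<xi>. fourier (\<lambda>x. complex_of_real (\<psi> x)) (R k *\<^sub>R (sum_on J \<xi> - real (card J) *\<^sub>R e)))"
  have vU: "norm (v k \<xi>) \<le> U" for k \<xi> unfolding v_def U_def by (rule norm_fourier_le)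
  have [measurable]: "v k \<in> borel_measurable borel" for k unfolding v_def by measurable
  define q where "q = (\<lambda>k \<xi>. of_real (d k) * (v k \<xi> * F \<xi> * cis (2 * pi * (x \<bullet> (\<Sum>j\<in>UNIV. \<xi> $ j)))))"
  have [measurable]: "(\<lambda>x::(real^'n)^'m. x $ i) \<in> borel_measurable borel" for i
    by (intro borel_measurable_continuous_onI continuous_intros)
  have qb: "norm (q k \<xi>) \<le> d k * (U * norm (F \<xi>))" for k \<xi>
    unfolding q_def using d0[of k] by (simp add: norm_mult mult_left_mono mult_right_mono vU)
  have qi: "integrable lborel (q k)" for k
  proof (rule Bochner_Integration.integrable_bound)
    show "integrable lborel (\<lambda>\<xi>. d k * (U * norm (F \<xi>)))" using iF by simp
    show "AE \<xi> in lborel. norm (q k \<xi>) \<le> norm (d k * (U * norm (F \<xi>)))" by (intro AE_I2 order_trans[OF qb]) simp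
  qed (unfold q_def, measurable)
  have qs: "summable (\<lambda>k. norm (q k \<xi>))" for \<xi>
    by (rule summable_comparison_test'[OF summable_mult2[OF ds, of "U * norm (F \<xi>)"], where N=0]) (use qb in simp)
  have qI: "(LINT \<xi>|lborel. q k \<xi>) = cis (2 * pi * real CARD('m) * (x \<bullet> e)) * of_real (d k * t k)" for k
  proof -
    have "(LINT \<xi>|lborel. q k \<xi>) = of_real (d k) * (LINT \<xi>|lborel. v k \<xi> * F \<xi> * cis (2 * pi * (x \<bullet> (\<Sum>j\<in>UNIV. \<xi> $ j))))"
      unfolding q_def by (rule integral_mult_right_zero)
    also have "\<dots> = of_real (d k) * (cis (2 * pi * real CARD('m) * (x \<bullet> e)) * of_real (t k))"
      unfolding v_def F_def t_def by (subst multiplier_block_integral[OF u f ff inv]) (rule refl)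
    finally show ?thesis by (simp only: of_real_mult mult_ac)
  qed
  have "(\<lambda>k. LINT \<xi>|lborel. q k \<xi>) sums (LINT \<xi>|lborel. (\<Sum>k. q k \<xi>))"
  proof (rule sums_integral[OF qi])
    show "AE \<xi> in lborel. summable (\<lambda>k. norm (q k \<xi>))" using qs by simp
    show "summable (\<lambda>k. LINT \<xi>|lborel. norm (q k \<xi>))"
    proof (rule summable_comparison_test'[OF summable_mult2[OF ds, of "U * (LINT \<xi>|lborel. norm (F \<xi>))"], where N=0])
      fix k
      have "(LINT \<xi>|lborel. norm (q k \<xi>)) \<le> (LINT \<xi>|lborel. d k * (U * norm (F \<xi>)))"
        using qi[of k] iF qb by (intro integral_mono) auto
      then show "norm (LINT \<xi>|lborel. norm (q k \<xi>)) \<le> d k * (U * (LINT \<xi>|lborel. norm (F \<xi>)))"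
        by (simp add: integral_nonneg_AE)
    qed
  qed
  moreover have "(\<Sum>k. q k \<xi>) = \<sigma> \<xi> * F \<xi> * cis (2 * pi * (x \<bullet> (\<Sum>j\<in>UNIV. \<xi> $ j)))" for \<xi>
  proof (cases "F \<xi> = 0")
    \<comment> \<open>Here all the transforms are nonzero at the components of \<xi>, so the cut-off
      a equals 1 there.\<close>
    case False
    then have "\<And>j. fourier (f j) (\<xi> $ j) \<noteq> 0" by (simp add: F_def)
    then have a1: "a \<xi> = 1" by (rule a)
    have "summable (\<lambda>k. of_real (d k) * v k \<xi>)"
    proof (rule summable_comparison_test'[OF summable_mult2[OF ds, of U], where N=0])
      show "norm (of_real (d k) * v k \<xi>) \<le> d k * U" for k using d0[of k] vU[of k \<xi>] by (simp add: norm_mult mult_left_mono)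
    qed
    from suminf_mult2[OF this, of "F \<xi> * cis (2 * pi * (x \<bullet> (\<Sum>j\<in>UNIV. \<xi> $ j)))"]
    show ?thesis by (simp add: \<sigma> a1 q_def v_def mult.assoc)
  qed (simp add: q_def)
  ultimately have "(\<lambda>k. cis (2 * pi * real CARD('m) * (x \<bullet> e)) * of_real (d k * t k)) sums multiplier_op \<sigma> f x"
    unfolding multiplier_op_def qI F_def by simp
  from sums_mult[OF this, of "cis (- (2 * pi * real CARD('m) * (x \<bullet> e)))"]
  have "(\<lambda>k. complex_of_real (d k * t k)) sums (cis (- (2 * pi * real CARD('m) * (x \<bullet> e))) * multiplier_op \<sigma> f x)"
    by (simp add: mult.assoc[symmetric] cis_mult)
  from sums_Re[OF this]
  have S: "(\<lambda>k. d k * t k) sums Re (cis (- (2 * pi * real CARD('m) * (x \<bullet> e))) * multiplier_op \<sigma> f x)" by simp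
  have "d k * t k \<le> Re (cis (- (2 * pi * real CARD('m) * (x \<bullet> e))) * multiplier_op \<sigma> f x)"
    using sum_le_suminf[OF sums_summable[OF S], of "{k}"] sums_unique[OF S] d0 t0 by simp
  also have "\<dots> \<le> norm (cis (- (2 * pi * real CARD('m) * (x \<bullet> e))) * multiplier_op \<sigma> f x)" by (rule complex_Re_le_cmod)
  also have "\<dots> = norm (multiplier_op \<sigma> f x)" by (simp add: norm_mult)
  finally show ?thesis by (simp add: t_def)
qed

section \<open>The lacunary multiplier\<close>

lemma fourier_sum:
  assumes "finite A" "\<And>a. a \<in> A \<Longrightarrow> integrable lborel (f a)"
  shows "fourier (\<lambda>x. \<Sum>a\<in>A. f a x) \<xi> = (\<Sum>a\<in>A. fourier (f a) \<xi>)"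
  using assms by (induction rule: finite_induct) (auto simp: fourier_add, simp add: fourier_def)

lemma rapid_sum:
  assumes "finite A" "A \<noteq> {}" "\<And>a. a \<in> A \<Longrightarrow> rapid (f a)" shows "rapid (\<lambda>x. \<Sum>a\<in>A. f a x)"
  using assms by (induction rule: finite_ne_induct) (auto intro: rapid_add)

lemma littlewood_paley_schwartz: "littlewood_paley \<Psi> \<Longrightarrow> schwartz \<Psi>"
  by (simp add: littlewood_paley_def)

lemma littlewood_paley_supp: "littlewood_paley \<Psi> \<Longrightarrow> norm \<xi> < 1/2 \<or> norm \<xi> > 2 \<Longrightarrow> fourier \<Psi> \<xi> = 0"
  unfolding littlewood_paley_def by (metis linorder_not_le)

text \<open>The five terms of the Littlewood-Paley sum that meet the annulus 1/2 \<le> |\<xi>| \<le>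
  2. There it equals the full sum 1, and it lives in 1/8 \<le> |\<xi>| \<le> 8.\<close>

definition plateau :: "('a::euclidean_space \<Rightarrow> complex) \<Rightarrow> 'a \<Rightarrow> complex" where
  "plateau \<Psi> \<xi> = (\<Sum>i\<in>{-2..2::int}. fourier \<Psi> (\<xi> /\<^sub>R 2 powi i))"

lemma powi_le_imp_le: "(2::real) powi i \<le> 2 powi j \<Longrightarrow> i \<le> j"
  using power_int_strict_increasing[of j i "2::real"] by (cases "i \<le> j") auto

lemma plateau_eq_1:
  assumes \<Psi>: "littlewood_paley \<Psi>" and \<xi>: "1/2 \<le> norm \<xi>" "norm \<xi> \<le> 2"
  shows "plateau \<Psi> \<xi> = 1"
proof -
  have "\<xi> \<noteq> 0" using \<xi> by auto
  then have "((\<lambda>j::int. fourier \<Psi> (\<xi> /\<^sub>R 2 powi j)) has_sum 1) UNIV" using \<Psi> by (simp add: littlewood_paley_def)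
  moreover have "fourier \<Psi> (\<xi> /\<^sub>R 2 powi j) = 0" if "j \<notin> {-2..2}" for j :: int
  proof (rule littlewood_paley_supp[OF \<Psi>], rule ccontr)
    assume "\<not> (norm (\<xi> /\<^sub>R 2 powi j) < 1 / 2 \<or> 2 < norm (\<xi> /\<^sub>R 2 powi j))"
    moreover have "norm (\<xi> /\<^sub>R 2 powi j) = norm \<xi> / 2 powi j" by (simp add: divide_inverse mult.commute)
    ultimately have a: "1/2 \<le> norm \<xi> / 2 powi j" "norm \<xi> / 2 powi j \<le> 2" by linarith+
    have p: "(2::real) powi j > 0" by simp
    have "2 powi j \<le> 2 * norm \<xi>" using a(1) p by (simp add: field_simps)
    then have "(2::real) powi j \<le> 2 powi 2" using \<xi> by simp
    then have 1: "j \<le> 2" by (rule powi_le_imp_le)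
    have "norm \<xi> \<le> 2 * 2 powi j" using a(2) p by (simp add: field_simps)
    then have "(2::real) powi (-2) \<le> 2 powi j" using \<xi> by (simp add: power_int_minus)
    then have "-2 \<le> j" by (rule powi_le_imp_le)
    then show False using 1 that by simp
  qed
  ultimately have "((\<lambda>j::int. fourier \<Psi> (\<xi> /\<^sub>R 2 powi j)) has_sum 1) {-2..2}"
    by (subst has_sum_cong_neutral[of UNIV]) auto
  then show ?thesis unfolding plateau_def using has_sum_finite[of "{-2..2::int}" "\<lambda>j. fourier \<Psi> (\<xi> /\<^sub>R 2 powi j)"] has_sum_unique
    by (metis finite_atLeastAtMost_int)
qed

lemma plateau_zero:
  assumes \<Psi>: "littlewood_paley \<Psi>" and \<xi>: "norm \<xi> < 1/8 \<or> norm \<xi> > 8"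
  shows "plateau \<Psi> \<xi> = 0"
  unfolding plateau_def
proof (rule sum.neutral, intro ballI)
  fix i :: int assume i: "i \<in> {-2..2}"
  have "(2::real) powi i \<le> 2 powi 2" by (rule power_int_increasing) (use i in auto)
  moreover have "(2::real) powi (-2) \<le> 2 powi i" by (rule power_int_increasing) (use i in auto)
  moreover have "(2::real) powi 2 = 4" "(2::real) powi (-2) = 1/4" by (auto simp: power_int_minus)
  ultimately have p: "(2::real) powi i \<le> 4" "1/4 \<le> (2::real) powi i" "(2::real) powi i > 0" by (simp_all only: zero_less_power_int zero_less_numeral)
  have n: "norm (\<xi> /\<^sub>R 2 powi i) = norm \<xi> / 2 powi i" by (simp add: divide_inverse mult.commute)
  show "fourier \<Psi> (\<xi> /\<^sub>R 2 powi i) = 0"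
  proof (rule littlewood_paley_supp[OF \<Psi>])
    from \<xi> have "norm \<xi> < 1/2 * 2 powi i \<or> 2 * 2 powi i < norm \<xi>" using p by linarith
    then show "norm (\<xi> /\<^sub>R 2 powi i) < 1/2 \<or> 2 < norm (\<xi> /\<^sub>R 2 powi i)"
      unfolding n pos_divide_less_eq[OF p(3)] pos_less_divide_eq[OF p(3)] .
  qed
qed

lemma plateau_measurable_bounded:
  fixes \<Psi> :: "'a::euclidean_space \<Rightarrow> complex"
  assumes \<Psi>: "littlewood_paley \<Psi>"
  shows "plateau \<Psi> \<in> borel_measurable borel" "\<exists>C. \<forall>\<xi>. norm (plateau \<Psi> \<xi>) \<le> C"
proof -
  have "integrable lborel \<Psi>" by (intro rapid_integrable schwartz_rapid littlewood_paley_schwartz \<Psi>)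
  then have [measurable]: "fourier \<Psi> \<in> borel_measurable borel" by (rule fourier_measurable)
  show "plateau \<Psi> \<in> borel_measurable borel" unfolding plateau_def[abs_def] by measurable
  have "norm (plateau \<Psi> \<xi>) \<le> (\<Sum>i\<in>{-2..2::int}. LINT x|lborel. norm (\<Psi> x))" for \<xi>
    unfolding plateau_def by (rule order_trans[OF norm_sum]) (intro sum_mono norm_fourier_le)
  then show "\<exists>C. \<forall>\<xi>. norm (plateau \<Psi> \<xi>) \<le> C" by blast
qed

text \<open>The dilate of \<Psi> by 2^(i-j) has transform \<open>fourier \<Psi>\<close> at 2^j \<xi>
  / 2^i, so B is the sum over the five i of the convolutions of these dilates with \<Psi>.\<close>

lemma band_rapid_plateau_dilate:
  fixes \<Psi> :: "'a::euclidean_space \<Rightarrow> complex"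
  assumes \<Psi>: "littlewood_paley \<Psi>"
  shows "\<exists>B. band_rapid B \<and> (\<forall>\<xi>. fourier B \<xi> = plateau \<Psi> (2 powi j *\<^sub>R \<xi>) * fourier \<Psi> \<xi>)"
proof -
  interpret I: adjoint_pair "\<lambda>x::'a. x" "\<lambda>x. x" by (rule adjoint_pair_id)
  have s: "schwartz \<Psi>" using \<Psi> by (rule littlewood_paley_schwartz)
  have r\<Psi>: "rapid \<Psi>" using s by (rule schwartz_rapid)
  define t where "t = (\<lambda>i::int. (2::real) powi (i - j))"
  have t: "t i > 0" for i by (simp add: t_def)
  define B where "B = (\<lambda>x. \<Sum>i\<in>{-2..2::int}. convolve (L1_dilate (t i) \<Psi>) \<Psi> x)"
  have rd: "rapid (L1_dilate (t i) \<Psi>)" for i by (intro rapid_L1_dilate r\<Psi> t)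
  have cd: "continuous_on UNIV (L1_dilate (t i) \<Psi>)" for i
    unfolding L1_dilate_def[abs_def]
    by (intro continuous_intros continuous_on_compose2[OF schwartz_continuous[OF s, of UNIV]]) auto
  have rc: "rapid (convolve (L1_dilate (t i) \<Psi>) \<Psi>)" for i
    unfolding convolve_eq_skew by (rule I.rapid_skew_convolve[OF rd r\<Psi>])
  have cc: "continuous_on UNIV (convolve (L1_dilate (t i) \<Psi>) \<Psi>)" for i
    unfolding convolve_eq_skew by (rule I.continuous_skew_convolve[OF rd cd r\<Psi>])
  have fc: "fourier (convolve (L1_dilate (t i) \<Psi>) \<Psi>) \<xi> = fourier \<Psi> (\<xi> /\<^sub>R t i) * fourier \<Psi> \<xi>" for i \<xi>
    unfolding convolve_eq_skew I.fourier_skew_convolve[OF rapid_integrable[OF rd] rapid_integrable[OF r\<Psi>]]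
    using fourier_L1_dilate[OF rapid_measurable[OF r\<Psi>] t[of i]] by simp
  have fB: "fourier B \<xi> = plateau \<Psi> (2 powi j *\<^sub>R \<xi>) * fourier \<Psi> \<xi>" for \<xi>
  proof -
    have "fourier B \<xi> = (\<Sum>i\<in>{-2..2::int}. fourier (convolve (L1_dilate (t i) \<Psi>) \<Psi>) \<xi>)"
      unfolding B_def by (intro fourier_sum rapid_integrable rc) auto
    also have "\<dots> = (\<Sum>i\<in>{-2..2::int}. fourier \<Psi> ((2 powi j *\<^sub>R \<xi>) /\<^sub>R 2 powi i) * fourier \<Psi> \<xi>)"
      unfolding fc by (intro sum.cong refl) (simp add: t_def power_int_diff divide_inverse mult.commute)
    finally show ?thesis by (simp add: plateau_def sum_distrib_right)
  qed
  have "rapid B" unfolding B_def by (intro rapid_sum rc) auto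
  moreover have "continuous_on UNIV B" unfolding B_def by (intro continuous_intros cc)
  ultimately have "band_rapid B" using littlewood_paley_supp[OF \<Psi>] by (simp add: band_rapid_def fB)
  then show ?thesis using fB by blast
qed

lemma potential_cmult:
  assumes "sobolev_potential s F G" shows "sobolev_potential s (\<lambda>x. c * F x) (\<lambda>x. c * G x)"
  unfolding sobolev_potential_def
proof (intro conjI allI impI)
  have [measurable]: "G \<in> borel_measurable borel" using assms by (simp add: sobolev_potential_def)
  show "(\<lambda>x. c * G x) \<in> borel_measurable borel" by measurable
  fix \<theta> :: "(real^'b)^'a \<Rightarrow> complex" assume \<theta>: "schwartz \<theta>"
  have i: "integrable lborel (\<lambda>x. G x * \<theta> x)" and e: "(LINT x|lborel. G x * \<theta> x) = (LINT \<xi>|lborel. of_real (sobolev_weight s \<xi>) * fourier F \<xi> * inv_fourier \<theta> \<xi>)"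
    using assms \<theta> by (auto simp: sobolev_potential_def)
  show "integrable lborel (\<lambda>x. c * G x * \<theta> x)" using integrable_mult_right[OF i, of c] by (simp add: mult.assoc)
  have "(LINT x|lborel. c * G x * \<theta> x) = c * (LINT x|lborel. G x * \<theta> x)"
    by (simp only: mult.assoc integral_mult_right_zero)
  also have "\<dots> = (LINT \<xi>|lborel. c * (of_real (sobolev_weight s \<xi>) * fourier F \<xi> * inv_fourier \<theta> \<xi>))"
    unfolding e by (simp only: integral_mult_right_zero)
  also have "\<dots> = (LINT \<xi>|lborel. of_real (sobolev_weight s \<xi>) * fourier (\<lambda>x. c * F x) \<xi> * inv_fourier \<theta> \<xi>)"
    unfolding fourier_cmult by (intro Bochner_Integration.integral_cong refl) (simp only: mult_ac)
  finally show "(LINT x|lborel. c * G x * \<theta> x) = (LINT \<xi>|lborel. of_real (sobolev_weight s \<xi>) * fourier (\<lambda>x. c * F x) \<xi> * inv_fourier \<theta> \<xi>)" .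
qed

lemma sobolev_norm_zero: "r > 0 \<Longrightarrow> sobolev_norm r s (\<lambda>_. 0) \<le> 0"
  using sobolev_norm_le_potential[of s "\<lambda>_. 0" "\<lambda>_. 0" r 0]
  by (simp add: sobolev_potential_def Lr_pow_def fourier_def)

text \<open>The plateau and the transform of \<Psi> overlap after dilation by 2^j only for j between
  -4 and 4, so the supremum is over finitely many pieces. In each piece the k-th term is a block
  with R = 2^(j+k), and the factor 2^(k(n/r - E)) normalises its L^r size. The coefficients c k then
  sum.\<close>

lemma hormander_norm_lacunary:
  fixes \<Psi> :: "(real ^ 'n) ^ 'm::finite \<Rightarrow> complex" and u :: "real ^ 'n \<Rightarrow> complex"
  assumes \<Psi>: "littlewood_paley \<Psi>" and u: "schwartz u" and r: "r \<ge> 1" and s: "\<And>i. s i > 0" and i0: "i0 \<in> J"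
    and E: "real CARD('n) / r \<le> (\<Sum>i\<in>J. s i)" and c0: "\<And>k. c k \<ge> 0" and cs: "summable c" and cpos: "(\<Sum>k. c k) > 0"
  shows "hormander_norm r s \<Psi> (\<lambda>\<xi>. plateau \<Psi> \<xi> * (\<Sum>k. of_real (c k * (2 ^ k) powr (real CARD('n) / r - (\<Sum>i\<in>J. s i))) *
      fourier u (2 ^ k *\<^sub>R (sum_on J \<xi> - \<theta>)))) < \<infinity>"
proof -
  define e where "e = real CARD('n) / r - (\<Sum>i\<in>J. s i)"
  define \<mu> where "\<mu> = (\<lambda>k::nat. ((2::real) ^ k) powr e)"
  have \<mu>: "\<mu> k > 0" "\<mu> k \<le> 1" for k
  proof -
    show "\<mu> k > 0" by (simp add: \<mu>_def)
    have "((2::real) ^ k) powr e \<le> (2 ^ k) powr 0" using E by (intro powr_mono) (auto simp: e_def)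
    then show "\<mu> k \<le> 1" by (simp add: \<mu>_def)
  qed
  define \<sigma> where "\<sigma> = (\<lambda>\<xi>. plateau \<Psi> \<xi> * (\<Sum>k. of_real (c k * \<mu> k) * fourier u (2 ^ k *\<^sub>R (sum_on J \<xi> - \<theta>))))"
  have iu: "integrable lborel u" by (intro rapid_integrable schwartz_rapid u)
  define U where "U = (LINT x|lborel. norm (u x))"
  have U: "norm (fourier u \<eta>) \<le> U" for \<eta> unfolding U_def by (rule norm_fourier_le)
  have U0: "U \<ge> 0" using order_trans[OF norm_ge_zero U[of 0]] .
  have "\<exists>X\<ge>0. sobolev_norm r s (\<lambda>\<xi>. \<sigma> (2 powi j *\<^sub>R \<xi>) * fourier \<Psi> \<xi>) \<le> ennreal X" if j: "j \<in> {-4..4}" for j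
  proof -
    obtain B where B: "band_rapid B" "\<And>\<xi>. fourier B \<xi> = plateau \<Psi> (2 powi j *\<^sub>R \<xi>) * fourier \<Psi> \<xi>"
      using band_rapid_plateau_dilate[OF \<Psi>] by blast
    have iB: "integrable lborel B" using B(1) by (auto simp: band_rapid_def rapid_integrable)
    have ifB: "integrable lborel (fourier B)"
      by (rule integrable_fourier_band[OF iB, where a=2]) (use B(1) in \<open>auto simp: band_rapid_def\<close>)
    have [measurable]: "fourier B \<in> borel_measurable borel" "fourier u \<in> borel_measurable borel" using iB iu by (auto intro: fourier_measurable)
    interpret adjoint_pair "embed_on J :: real ^ 'n \<Rightarrow> (real ^ 'n) ^ 'm" "sum_on J" by (rule adjoint_pair_on)
    note [measurable] = meas_L
    define y where "y = (2::real) powi j"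
    have y: "y \<ge> 1/16" "y > 0"
    proof -
      have "(2::real) powi (-4) \<le> 2 powi j" using j by (intro power_int_increasing) auto
      then show "y \<ge> 1/16" by (simp add: y_def power_int_minus)
    qed (simp add: y_def)
    from sobolev_block[where s=s, OF B(1) u r s i0] obtain C where C: "C \<ge> 0" and blk: "\<forall>R\<ge>1/16. \<forall>\<theta>. \<exists>G. sobolev_potential s (\<lambda>\<xi>. fourier B \<xi> * fourier u (R *\<^sub>R (sum_on J \<xi> - \<theta>))) G \<and>
       Lr_pow r G \<le> ennreal (C * (R powr (\<Sum>i\<in>J. s i)) powr r / R ^ CARD('n))"
      by (elim exE conjE)
    define F where "F = (\<lambda>k \<xi>. of_real (\<mu> k) * (fourier B \<xi> * fourier u ((y * 2 ^ k) *\<^sub>R (sum_on J \<xi> - \<theta> /\<^sub>R y))))"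
    \<comment> \<open>Independent of k: with R = y 2^k the block has L^r size of order R^(-e), the
      factor \<mu> k = 2^(k e) cancels the part depending on k, and y^(-e) remains.\<close>
    define D where "D = C * (y powr (- e)) powr r"
    have D: "D \<ge> 0" using C by (simp add: D_def)
    have ex: "\<exists>G. sobolev_potential s (F k) G \<and> Lr_pow r G \<le> ennreal D" for k
    proof -
      define R where "R = y * 2 ^ k"
      have R: "R \<ge> 1/16" "R > 0" using y mult_mono[of "1/16" y 1 "2 ^ k"] by (auto simp: R_def)
      from blk[rule_format, OF R(1), of "\<theta> /\<^sub>R y"]
      obtain G where G: "sobolev_potential s (\<lambda>\<xi>. fourier B \<xi> * fourier u (R *\<^sub>R (sum_on J \<xi> - \<theta> /\<^sub>R y))) G"
        and GL: "Lr_pow r G \<le> ennreal (C * (R powr (\<Sum>i\<in>J. s i)) powr r / R ^ CARD('n))" by (elim exE conjE)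
      have Gm[measurable]: "G \<in> borel_measurable borel" using G by (simp add: sobolev_potential_def)
      have "Lr_pow r (\<lambda>x. of_real (\<mu> k) * G x) = ennreal (\<mu> k powr r) * Lr_pow r G"
        unfolding Lr_pow_def using \<mu>(1)[of k]
        by (subst nn_integral_cmult[symmetric]) (auto intro!: nn_integral_cong simp: norm_mult powr_mult ennreal_mult)
      also have "\<dots> \<le> ennreal (\<mu> k powr r) * ennreal (C * (R powr (\<Sum>i\<in>J. s i)) powr r / R ^ CARD('n))"
        by (intro mult_left_mono GL) auto
      also have "\<dots> = ennreal (\<mu> k powr r * (C * (R powr (\<Sum>i\<in>J. s i)) powr r / R ^ CARD('n)))"
        using C R by (intro ennreal_mult[symmetric]) auto
      also have "\<mu> k powr r * (C * (R powr (\<Sum>i\<in>J. s i)) powr r / R ^ CARD('n)) = D"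
      proof -
        have q: "(R powr (\<Sum>i\<in>J. s i)) powr r / R ^ CARD('n) = (R powr (- e)) powr r"
        proof -
          have "R ^ CARD('n) = R powr (real CARD('n))" using R by (simp add: powr_realpow)
          then have "(R powr (\<Sum>i\<in>J. s i)) powr r / R ^ CARD('n) = R powr ((\<Sum>i\<in>J. s i) * r - real CARD('n))"
            by (simp add: powr_powr powr_diff)
          also have "(\<Sum>i\<in>J. s i) * r - real CARD('n) = (- e) * r" using r by (simp add: e_def field_simps)
          finally show ?thesis by (simp add: powr_powr)
        qed
        have "\<mu> k powr r * (C * (R powr (\<Sum>i\<in>J. s i)) powr r / R ^ CARD('n)) = C * (\<mu> k powr r * ((R powr (\<Sum>i\<in>J. s i)) powr r / R ^ CARD('n)))"
          by simp
        also have "\<dots> = C * ((((2::real) ^ k) powr e) powr r * (R powr (- e)) powr r)"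
          unfolding q by (simp only: \<mu>_def)
        also have "(((2::real) ^ k) powr e) powr r * (R powr (- e)) powr r = (((2::real) ^ k) powr e * R powr (- e)) powr r"
          by (simp add: powr_mult)
        also have "((2::real) ^ k) powr e * R powr (- e) = y powr (- e)"
          using y by (simp add: R_def powr_mult powr_minus field_simps)
        finally show ?thesis by (simp add: D_def)
      qed
      finally have "Lr_pow r (\<lambda>x. of_real (\<mu> k) * G x) \<le> ennreal D" .
      moreover have "sobolev_potential s (F k) (\<lambda>x. of_real (\<mu> k) * G x)"
        unfolding F_def R_def[symmetric] by (rule potential_cmult[OF G])
      ultimately show ?thesis by blast
    qed
    then obtain G where G: "\<And>k. sobolev_potential s (F k) (G k)" "\<And>k. Lr_pow r (G k) \<le> ennreal D" by metis
    have Fb: "norm (F k \<xi>) \<le> U * norm (fourier B \<xi>)" for k \<xi>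
    proof -
      have "norm (F k \<xi>) = \<mu> k * (norm (fourier B \<xi>) * norm (fourier u ((y * 2 ^ k) *\<^sub>R (sum_on J \<xi> - \<theta> /\<^sub>R y))))"
        using \<mu>(1)[of k] by (simp add: F_def norm_mult)
      also have "\<dots> \<le> 1 * (norm (fourier B \<xi>) * U)" using \<mu>[of k] by (intro mult_mono U order_refl) (auto intro: less_imp_le)
      finally show ?thesis by (simp add: mult.commute)
    qed
    have [measurable]: "F k \<in> borel_measurable borel" for k unfolding F_def by measurable
    have Fi: "integrable lborel (F k)" for k
      by (rule Bochner_Integration.integrable_bound[of _ "\<lambda>\<xi>. U * norm (fourier B \<xi>)"])
         (use ifB in \<open>auto intro!: AE_I2 order_trans[OF Fb]\<close>)
    define X1 X2 where "X1 = U * (LINT x|lborel. norm (B x))" and "X2 = U * (LINT \<xi>|lborel. norm (fourier B \<xi>))"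
    have F1: "norm (F k \<xi>) \<le> max X1 X2" for k \<xi>
      using order_trans[OF Fb mult_left_mono[OF norm_fourier_le U0]] by (auto simp: X1_def le_max_iff_disj)
    have "(LINT \<xi>|lborel. norm (F k \<xi>)) \<le> (LINT \<xi>|lborel. U * norm (fourier B \<xi>))" for k
      using Fi[of k] ifB Fb by (intro integral_mono) auto
    then have F2: "(LINT \<xi>|lborel. norm (F k \<xi>)) \<le> max X1 X2" for k by (simp add: X2_def le_max_iff_disj)
    from potential_series[where s=s and c=c and F=F, OF r s c0 cs cpos G D Fi F1 F2]
    obtain H where H: "sobolev_potential s (\<lambda>x. \<Sum>k. of_real (c k) * F k x) H" "Lr_pow r H \<le> ennreal ((\<Sum>k. c k) powr r * D)"
      by (elim exE conjE)
    have eq: "\<sigma> (2 powi j *\<^sub>R \<xi>) * fourier \<Psi> \<xi> = (\<Sum>k. of_real (c k) * F k \<xi>)" for \<xi>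
    proof -
      have ab: "summable (\<lambda>k. of_real (c k * \<mu> k) * fourier u (2 ^ k *\<^sub>R (sum_on J (y *\<^sub>R \<xi>) - \<theta>)))"
      proof (rule summable_comparison_test'[OF summable_mult2[OF cs, of U], where N=0])
        fix k
        have "norm (of_real (c k * \<mu> k) * fourier u (2 ^ k *\<^sub>R (sum_on J (y *\<^sub>R \<xi>) - \<theta>))) = (c k * \<mu> k) * norm (fourier u (2 ^ k *\<^sub>R (sum_on J (y *\<^sub>R \<xi>) - \<theta>)))"
          using c0[of k] \<mu>(1)[of k] by (simp add: norm_mult)
        also have "\<dots> \<le> (c k * 1) * U" using c0[of k] \<mu>[of k] by (intro mult_mono mult_left_mono U) (auto intro: less_imp_le)
        finally show "norm (of_real (c k * \<mu> k) * fourier u (2 ^ k *\<^sub>R (sum_on J (y *\<^sub>R \<xi>) - \<theta>))) \<le> c k * U" by simp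
      qed
      \<comment> \<open>Dilation of the symbol by y = 2^j turns scale 2^k and shift \<theta> into
        scale y 2^k and shift \<theta>/y.\<close>
      have arg: "(y * 2 ^ k) *\<^sub>R (sum_on J \<xi> - \<theta> /\<^sub>R y) = 2 ^ k *\<^sub>R (sum_on J (y *\<^sub>R \<xi>) - \<theta>)" for k
        using y(2) by (simp add: sum_on_scaleR scaleR_diff_right mult.commute)
      have "(\<Sum>k. of_real (c k) * F k \<xi>) = (\<Sum>k. fourier B \<xi> * (of_real (c k * \<mu> k) * fourier u (2 ^ k *\<^sub>R (sum_on J (y *\<^sub>R \<xi>) - \<theta>))))"
        unfolding F_def arg by (simp add: mult_ac)
      also have "\<dots> = fourier B \<xi> * (\<Sum>k. of_real (c k * \<mu> k) * fourier u (2 ^ k *\<^sub>R (sum_on J (y *\<^sub>R \<xi>) - \<theta>)))"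
        by (rule suminf_mult[OF ab])
      finally show ?thesis by (simp add: \<sigma>_def B(2) y_def mult_ac)
    qed
    have "sobolev_norm r s (\<lambda>\<xi>. \<sigma> (2 powi j *\<^sub>R \<xi>) * fourier \<Psi> \<xi>) \<le> ennreal (((\<Sum>k. c k) powr r * D) powr (1 / r))"
      unfolding eq using r D by (intro sobolev_norm_le_potential[OF H]) auto
    then show ?thesis by (intro exI[of _ "((\<Sum>k. c k) powr r * D) powr (1 / r)"]) simp
  qed
  then obtain X where X0: "\<And>j. j \<in> {-4..4} \<Longrightarrow> X j \<ge> 0" and X: "\<And>j. j \<in> {-4..4} \<Longrightarrow> sobolev_norm r s (\<lambda>\<xi>. \<sigma> (2 powi j *\<^sub>R \<xi>) * fourier \<Psi> \<xi>) \<le> ennreal (X j)"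
    by metis
  have "sobolev_norm r s (\<lambda>\<xi>. \<sigma> (2 powi j *\<^sub>R \<xi>) * fourier \<Psi> \<xi>) \<le> ennreal (\<Sum>j\<in>{-4..4}. X j)" for j :: int
  proof (cases "j \<in> {-4..4}")
    case True
    have "X j \<le> (\<Sum>j\<in>{-4..4}. X j)" using X0 True by (intro member_le_sum) auto
    then show ?thesis using X[OF True] by (meson ennreal_leI order_trans)
  next
    case False
    have "\<sigma> (2 powi j *\<^sub>R \<xi>) * fourier \<Psi> \<xi> = 0" for \<xi>
    proof (cases "fourier \<Psi> \<xi> = 0")
      case F: False
      then have \<xi>: "1/2 \<le> norm \<xi>" "norm \<xi> \<le> 2" using littlewood_paley_supp[OF \<Psi>, of \<xi>] by linarith+
      have "norm (2 powi j *\<^sub>R \<xi>) < 1/8 \<or> norm (2 powi j *\<^sub>R \<xi>) > 8"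
      proof (cases "j > 4")
        case True
        then have "(2::real) powi 5 \<le> 2 powi j" by (intro power_int_increasing) auto
        then have "32 * (1/2) \<le> 2 powi j * norm \<xi>" using \<xi> by (intro mult_mono) auto
        then show ?thesis by simp
      next
        case F2: False
        then have "(2::real) powi j \<le> 2 powi (-5)" using False by (intro power_int_increasing) auto
        then have "2 powi j * norm \<xi> \<le> (1/32) * 2" using \<xi> by (intro mult_mono) (auto simp: power_int_minus)
        then show ?thesis by simp
      qed
      then show ?thesis by (simp add: \<sigma>_def plateau_zero[OF \<Psi>])
    qed simp
    then have "(\<lambda>\<xi>. \<sigma> (2 powi j *\<^sub>R \<xi>) * fourier \<Psi> \<xi>) = (\<lambda>_. 0)" by (intro ext)
    then show ?thesis using order_trans[OF sobolev_norm_zero[of r s] zero_le] r by (simp only:) simp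
  qed
  then have "hormander_norm r s \<Psi> \<sigma> \<le> ennreal (\<Sum>j\<in>{-4..4}. X j)" unfolding hormander_norm_def by (intro SUP_least)
  also have "\<dots> < \<infinity>" by simp
  finally show ?thesis unfolding \<sigma>_def \<mu>_def e_def .
qed

section \<open>Test functions on dyadic shells\<close>

definition lattice_wave :: "(real^'n) set \<Rightarrow> (real^'n \<Rightarrow> real) \<Rightarrow> (real^'n \<Rightarrow> real) \<Rightarrow> real^'n \<Rightarrow> real^'n \<Rightarrow> complex" where
  "lattice_wave Z c \<psi> e x = cis (2 * pi * (x \<bullet> e)) * of_real (\<Sum>z\<in>Z. c z * \<psi> (x - z))"

text \<open>The common modulation is redistributed: each summand becomes a translate of one fixed
  wave times a coefficient of modulus |c z|. Spectrum and maximal function can then be taken from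
  that wave.\<close>

lemma lattice_wave_eq:
  "lattice_wave Z c \<psi> e x = (\<Sum>z\<in>Z. (of_real (c z) * cis (2 * pi * (z \<bullet> e))) * (cis (2 * pi * ((x - z) \<bullet> e)) * of_real (\<psi> (x - z))))"
proof -
  have "cis (2 * pi * (x \<bullet> e)) = cis (2 * pi * (z \<bullet> e)) * cis (2 * pi * ((x - z) \<bullet> e))" for z
    unfolding cis_mult by (rule arg_cong[where f=cis]) (simp add: inner_diff_left algebra_simps)
  then have "cis (2 * pi * (x \<bullet> e)) * of_real (c z * \<psi> (x - z)) =
     (of_real (c z) * cis (2 * pi * (z \<bullet> e))) * (cis (2 * pi * ((x - z) \<bullet> e)) * of_real (\<psi> (x - z)))" for z
    by (simp only: of_real_mult mult_ac)
  then show ?thesis unfolding lattice_wave_def of_real_sum sum_distrib_left by (intro sum.cong refl)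
qed

lemma schwartz_wave: "schwartz (\<lambda>x. complex_of_real (\<psi> x)) \<Longrightarrow> schwartz (\<lambda>x. cis (2 * pi * (x \<bullet> e)) * of_real (\<psi> x))"
  by (rule schwartz_moderate_mult[OF moderate_cis])

lemma schwartz_lattice_wave:
  assumes s: "schwartz (\<lambda>x. complex_of_real (\<psi> x))" and Z: "lattice_set Z" "Z \<noteq> {}"
  shows "schwartz (lattice_wave Z c \<psi> e)"
proof -
  have "schwartz (\<lambda>x. (\<lambda>y. cis (2 * pi * (y \<bullet> e)) * of_real (\<psi> y)) (- z + x))" for z
    by (rule schwartz_translate[OF schwartz_wave[OF s]])
  then have t: "schwartz (\<lambda>x. cis (2 * pi * ((x - z) \<bullet> e)) * of_real (\<psi> (x - z)))" for z by simp
  have "schwartz (\<lambda>x. \<Sum>z\<in>Z. (of_real (c z) * cis (2 * pi * (z \<bullet> e))) * (cis (2 * pi * ((x - z) \<bullet> e)) * of_real (\<psi> (x - z))))"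
    using Z by (intro schwartz_sum schwartz_cmult t) (auto simp: lattice_set_def)
  then show ?thesis unfolding lattice_wave_eq[symmetric] by (simp add: eta_contract_eq)
qed

lemma fourier_lattice_wave_zero:
  assumes s: "schwartz (\<lambda>x. complex_of_real (\<psi> x))" and Z: "lattice_set Z"
    and z: "fourier (\<lambda>x. cis (2 * pi * (x \<bullet> e)) * of_real (\<psi> x)) \<omega> = 0"
  shows "fourier (lattice_wave Z c \<psi> e) \<omega> = 0"
proof -
  define f0 where "f0 = (\<lambda>x. cis (2 * pi * (x \<bullet> e)) * complex_of_real (\<psi> x))"
  have i: "integrable lborel f0" unfolding f0_def by (intro rapid_integrable schwartz_rapid schwartz_wave s)
  have m: "f0 \<in> borel_measurable borel" using i by auto
  have it: "integrable lborel (\<lambda>x. f0 (x - z))" for z using integrable_lborel_affine[OF i, of 1 "- z"] by simp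
  have e: "lattice_wave Z c \<psi> e = (\<lambda>x. \<Sum>z\<in>Z. (of_real (c z) * cis (2 * pi * (z \<bullet> e))) * f0 (x - z))"
    by (rule ext) (simp add: lattice_wave_eq f0_def)
  have "fourier (lattice_wave Z c \<psi> e) \<omega> = (\<Sum>z\<in>Z. fourier (\<lambda>x. (of_real (c z) * cis (2 * pi * (z \<bullet> e))) * f0 (x - z)) \<omega>)"
    unfolding e using Z it by (intro fourier_sum integrable_mult_right) (auto simp: lattice_set_def)
  also have "\<dots> = 0" unfolding fourier_cmult fourier_translate[OF m] using z by (simp add: f0_def)
  finally show ?thesis .
qed

text \<open>Convolution commutes with translation, so the maximal function of the sum is at most the
  lattice sum of the decaying bound for one wave, and \<open>lattice_Lp_bound\<close> applies. K is
  independent of Z and c.\<close>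

lemma Hp_norm_lattice_wave:
  fixes \<phi> :: "real^'n \<Rightarrow> complex"
  assumes \<phi>: "schwartz \<phi>" and s: "schwartz (\<lambda>x. complex_of_real (\<psi> x))"
    and ann: "annular a (\<lambda>x. cis (2 * pi * (x \<bullet> e)) * complex_of_real (\<psi> x))" and a: "a > 0" and p: "p > 0"
  shows "\<exists>K>0. \<forall>Z c. lattice_set Z \<longrightarrow> (\<forall>z. c z \<ge> 0) \<longrightarrow>
    (if p = \<infinity> then (\<forall>b\<ge>0. (\<forall>z\<in>Z. c z \<le> b) \<longrightarrow> Hp_norm \<phi> p (lattice_wave Z c \<psi> e) \<le> ennreal (K * b))
     else Hp_norm \<phi> p (lattice_wave Z c \<psi> e) \<le> ennreal (K * (\<Sum>z\<in>Z. c z powr enn2real p) powr (1 / enn2real p)))"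
proof -
  define f0 where "f0 = (\<lambda>x. cis (2 * pi * (x \<bullet> e)) * complex_of_real (\<psi> x))"
  have i0: "integrable lborel f0" unfolding f0_def by (intro rapid_integrable schwartz_rapid schwartz_wave s)
  have [measurable]: "f0 \<in> borel_measurable borel" using i0 by auto
  have it: "integrable lborel (\<lambda>x. f0 (x - z))" for z using integrable_lborel_affine[OF i0, of 1 "- z"] by simp
  from lattice_Lp_bound[OF p] obtain M K where K: "K > 0" and LB: "\<forall>Z c (g::real^'n \<Rightarrow> ennreal). lattice_set Z \<longrightarrow> (\<forall>z. c z \<ge> 0) \<longrightarrow> g \<in> borel_measurable borel \<longrightarrow>
     (\<forall>x. g x \<le> ennreal (\<Sum>z\<in>Z. c z / (1 + norm (x - z)) ^ M)) \<longrightarrow>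
     (if p = \<infinity> then (\<forall>b\<ge>0. (\<forall>z\<in>Z. c z \<le> b) \<longrightarrow> Lp_norm_nonneg p g \<le> ennreal (K * b))
      else Lp_norm_nonneg p g \<le> ennreal (K * (\<Sum>z\<in>Z. c z powr enn2real p) powr (1 / enn2real p)))"
    by (elim exE conjE)
  obtain C0 where C0: "C0 \<ge> 0" "\<And>j x. norm (convolve (dyadic_dilate \<phi> j) f0 x) \<le> C0 / (1 + norm x) ^ M"
    using maximal_function_decay[OF \<phi> ann a, of M] unfolding f0_def by blast
  \<comment> \<open>Enlarged by 1 to be positive, so that the final constant K C is
    positive.\<close>
  define C where "C = C0 + 1"
  have C: "C > 0" using C0 by (simp add: C_def)
  have "(if p = \<infinity> then (\<forall>b\<ge>0. (\<forall>z\<in>Z. c z \<le> b) \<longrightarrow> Hp_norm \<phi> p (lattice_wave Z c \<psi> e) \<le> ennreal (K * C * b))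
     else Hp_norm \<phi> p (lattice_wave Z c \<psi> e) \<le> ennreal (K * C * (\<Sum>z\<in>Z. c z powr enn2real p) powr (1 / enn2real p)))"
    if Z: "lattice_set Z" and c: "\<forall>z. c z \<ge> 0" for Z c
  proof -
    define f where "f = lattice_wave Z c \<psi> e"
    have fe: "f x = (\<Sum>z\<in>Z. (of_real (c z) * cis (2 * pi * (z \<bullet> e))) * f0 (x - z))" for x
      by (simp add: f_def lattice_wave_eq f0_def)
    have [measurable]: "f \<in> borel_measurable borel" unfolding fe[abs_def] by measurable
    have rD: "rapid (dyadic_dilate \<phi> j)" for j unfolding dyadic_dilate_eq by (intro rapid_L1_dilate schwartz_rapid \<phi>) simp
    have [measurable]: "dyadic_dilate \<phi> j \<in> borel_measurable borel" for j by (rule rapid_measurable[OF rD])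
    define g where "g = (\<lambda>x. SUP j::int. ennreal (norm (convolve (dyadic_dilate \<phi> j) f x)))"
    have gm: "g \<in> borel_measurable borel"
      unfolding g_def convolve_def by (intro borel_measurable_SUP) (auto, measurable)
    have cb: "norm (convolve (dyadic_dilate \<phi> j) f x) \<le> (\<Sum>z\<in>Z. (C * c z) / (1 + norm (x - z)) ^ M)" for j x
    proof -
      define D where "D = dyadic_dilate \<phi> j"
      have [measurable]: "D \<in> borel_measurable borel" by (simp add: D_def)
      obtain BD where BD: "\<And>x. norm (D x) \<le> BD" using rapid_bounded[OF rD] unfolding D_def by blast
      have iz: "integrable lborel (\<lambda>y. D (x - y) * f0 (y - z))" for z
      proof (rule Bochner_Integration.integrable_bound)
        show "integrable lborel (\<lambda>y. BD * norm (f0 (y - z)))" using it[of z] by simp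
        show "AE y in lborel. norm (D (x - y) * f0 (y - z)) \<le> norm (BD * norm (f0 (y - z)))"
        proof (rule AE_I2)
          fix y
          have "norm (D (x - y)) * norm (f0 (y - z)) \<le> BD * norm (f0 (y - z))" by (intro mult_right_mono BD norm_ge_zero)
          then show "norm (D (x - y) * f0 (y - z)) \<le> norm (BD * norm (f0 (y - z)))"
            unfolding norm_mult[of "D (x - y)"] by simp
        qed
      qed measurable
      have "convolve D f x = (LINT y|lborel. (\<Sum>z\<in>Z. (of_real (c z) * cis (2 * pi * (z \<bullet> e))) * (D (x - y) * f0 (y - z))))"
        unfolding convolve_def fe sum_distrib_left by (intro Bochner_Integration.integral_cong refl sum.cong) (simp only: mult_ac)
      also have "\<dots> = (\<Sum>z\<in>Z. LINT y|lborel. (of_real (c z) * cis (2 * pi * (z \<bullet> e))) * (D (x - y) * f0 (y - z)))"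
        by (intro Bochner_Integration.integral_sum integrable_mult_right iz)
      also have "\<dots> = (\<Sum>z\<in>Z. (of_real (c z) * cis (2 * pi * (z \<bullet> e))) * convolve D f0 (x - z))"
      proof (rule sum.cong[OF refl])
        fix z
        have "(LINT y|lborel. D (x - y) * f0 (y - z)) = (LINT y|lborel. D (x - (z + y)) * f0 ((z + y) - z))"
          by (rule integral_lborel_translate[symmetric]) measurable
        also have "\<dots> = convolve D f0 (x - z)" by (simp add: convolve_def diff_diff_eq)
        finally show "(LINT y|lborel. (of_real (c z) * cis (2 * pi * (z \<bullet> e))) * (D (x - y) * f0 (y - z))) = (of_real (c z) * cis (2 * pi * (z \<bullet> e))) * convolve D f0 (x - z)"
          by (simp only: integral_mult_right_zero)
      qed
      finally have "norm (convolve D f x) \<le> (\<Sum>z\<in>Z. norm ((of_real (c z) * cis (2 * pi * (z \<bullet> e))) * convolve D f0 (x - z)))"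
        by (simp only: norm_sum)
      also have "\<dots> \<le> (\<Sum>z\<in>Z. (C * c z) / (1 + norm (x - z)) ^ M)"
      proof (rule sum_mono)
        fix z
        have "norm (convolve D f0 (x - z)) \<le> C / (1 + norm (x - z)) ^ M"
          unfolding D_def by (rule order_trans[OF C0(2)]) (auto simp: C_def intro!: divide_right_mono)
        then have "c z * norm (convolve D f0 (x - z)) \<le> c z * (C / (1 + norm (x - z)) ^ M)" using c by (intro mult_left_mono) auto
        then show "norm ((of_real (c z) * cis (2 * pi * (z \<bullet> e))) * convolve D f0 (x - z)) \<le> (C * c z) / (1 + norm (x - z)) ^ M"
          using c by (simp add: norm_mult mult.commute)
      qed
      finally show ?thesis by (simp add: D_def)
    qed
    have gb: "\<forall>x. g x \<le> ennreal (\<Sum>z\<in>Z. (C * c z) / (1 + norm (x - z)) ^ M)"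
      unfolding g_def by (intro allI SUP_least ennreal_leI cb)
    have Cc: "\<forall>z. C * c z \<ge> 0" using C c by auto
    have H: "Hp_norm \<phi> p f = Lp_norm_nonneg p g" by (simp add: Hp_norm_def g_def)
    note L = LB[rule_format, OF Z Cc[rule_format] gm gb[rule_format]]
    show ?thesis
    proof (cases "p = \<infinity>")
      case True
      have "Hp_norm \<phi> p f \<le> ennreal (K * C * b)" if b: "b \<ge> 0" "\<forall>z\<in>Z. c z \<le> b" for b
        using L True b C unfolding H by (auto simp: mult.assoc mult_left_mono)
      then show ?thesis using True by (auto simp: f_def)
    next
      case False
      have P: "enn2real p > 0" using p False by (simp add: enn2real_positive_iff less_top)
      have "(\<Sum>z\<in>Z. (C * c z) powr enn2real p) = C powr enn2real p * (\<Sum>z\<in>Z. c z powr enn2real p)"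
        using C c by (simp add: powr_mult sum_distrib_left)
      then have "(\<Sum>z\<in>Z. (C * c z) powr enn2real p) powr (1 / enn2real p) = C * (\<Sum>z\<in>Z. c z powr enn2real p) powr (1 / enn2real p)"
        using C P by (simp add: powr_mult powr_powr sum_nonneg)
      then show ?thesis using L False unfolding H[symmetric] f_def by (simp add: mult.assoc)
    qed
  qed
  then show ?thesis using K C by (intro exI[of _ "K * C"]) auto
qed

text \<open>The shells are cubes in the positive orthant: (2^k, 2^(k+1)]^n contains exactly 2^(kn)
  integer points. The half-open interval makes the shells disjoint and contains the ceiling of every
  real number in its interior.\<close>

definition dyadic_lattice :: "nat \<Rightarrow> (real^'n) set" where
  "dyadic_lattice k = {z. \<forall>i. \<exists>j::int. z $ i = of_int j \<and> 2 ^ k < j \<and> j \<le> 2 ^ Suc k}"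

lemma dyadic_lattice_card:
  "finite (dyadic_lattice k :: (real^'n) set)" "card (dyadic_lattice k :: (real^'n) set) = (2 ^ k) ^ CARD('n)"
proof -
  define I where "I = {2 ^ k <.. 2 ^ Suc k :: int}"
  have e: "(dyadic_lattice k :: (real^'n) set) = (\<lambda>g. \<chi> i. of_int (g i)) ` (UNIV \<rightarrow>\<^sub>E I)"
  proof (intro equalityI subsetI)
    fix z :: "real^'n" assume "z \<in> dyadic_lattice k"
    then have "\<forall>i. \<exists>j::int. z $ i = of_int j \<and> j \<in> I" by (auto simp: dyadic_lattice_def I_def)
    then obtain g where "\<And>i. z $ i = of_int (g i) \<and> g i \<in> I" by metis
    then show "z \<in> (\<lambda>g. \<chi> i. of_int (g i)) ` (UNIV \<rightarrow>\<^sub>E I)"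
      by (intro image_eqI[of _ _ g]) (auto simp: vec_eq_iff)
  qed (auto simp: dyadic_lattice_def I_def)
  have inj: "inj_on (\<lambda>g::'n \<Rightarrow> int. \<chi> i. real_of_int (g i)) (UNIV \<rightarrow>\<^sub>E I)"
    by (rule inj_onI) (auto simp: vec_eq_iff)
  have "card I = 2 ^ k" by (simp add: I_def)
  then show "card (dyadic_lattice k :: (real^'n) set) = (2 ^ k) ^ CARD('n)"
    unfolding e card_image[OF inj] by (simp add: card_PiE)
  show "finite (dyadic_lattice k :: (real^'n) set)" unfolding e by (intro finite_imageI finite_PiE) (auto simp: I_def)
qed

lemma dyadic_lattice_disjoint: "z \<in> dyadic_lattice k \<Longrightarrow> z \<in> dyadic_lattice k' \<Longrightarrow> k = k'"
proof (rule ccontr)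
  have *: False if z: "z \<in> dyadic_lattice k" "z \<in> dyadic_lattice k'" and "k < k'" for k k'
  proof -
    obtain j j' :: int where j: "z $ undefined = of_int j" "j \<le> 2 ^ Suc k" "z $ undefined = of_int j'" "2 ^ k' < j'"
      using z unfolding dyadic_lattice_def by blast
    have "(2::int) ^ Suc k \<le> 2 ^ k'" using \<open>k < k'\<close> by (intro power_increasing) auto
    then show False using j by simp
  qed
  assume "z \<in> dyadic_lattice k" "z \<in> dyadic_lattice k'" "k \<noteq> k'"
  then show False using *[of k k'] *[of k' k] by (meson linorder_neqE_nat)
qed

text \<open>With \<alpha> = 1/p the 2^(kn) points of a shell contribute exactly 1 to the sum of p-th
  powers, hence the total N in \<open>dyadic_weight_power_sum\<close>. For p = \<infinity> one has
  \<alpha> = 0 and all weights are 1.\<close>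

definition dyadic_weight :: "nat \<Rightarrow> real \<Rightarrow> real^'n \<Rightarrow> real" where
  "dyadic_weight N \<alpha> z = (\<Sum>k<N. if z \<in> dyadic_lattice k then (2 ^ k) powr (- (real CARD('n) * \<alpha>)) else 0)"

lemma dyadic_weight_eq:
  assumes "k < N" "z \<in> dyadic_lattice k"
  shows "dyadic_weight N \<alpha> (z::real^'n) = (2 ^ k) powr (- (real CARD('n) * \<alpha>))"
proof -
  have "dyadic_weight N \<alpha> z = (\<Sum>j<N. if j = k then (2 ^ k) powr (- (real CARD('n) * \<alpha>)) else 0)"
    unfolding dyadic_weight_def using assms(2) dyadic_lattice_disjoint by (intro sum.cong refl) auto
  then show ?thesis using assms(1) by simp
qed

lemma dyadic_weight_nonneg: "dyadic_weight N \<alpha> z \<ge> 0"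
  unfolding dyadic_weight_def by (intro sum_nonneg) auto

lemma dyadic_weight_le_1: "z \<in> (\<Union>k<N. dyadic_lattice k) \<Longrightarrow> dyadic_weight N 0 z \<le> 1"
  using dyadic_weight_eq[of _ N z 0] by auto

lemma dyadic_weight_power_sum:
  assumes P: "\<alpha> * P = 1"
  shows "(\<Sum>z\<in>(\<Union>k<N. dyadic_lattice k :: (real^'n) set). dyadic_weight N \<alpha> z powr P) = real N"
proof -
  have "(\<Sum>z\<in>(\<Union>k<N. dyadic_lattice k :: (real^'n) set). dyadic_weight N \<alpha> z powr P)
    = (\<Sum>k<N. \<Sum>z\<in>(dyadic_lattice k :: (real^'n) set). dyadic_weight N \<alpha> z powr P)"
    by (intro sum.UNION_disjoint) (auto simp: dyadic_lattice_card dest: dyadic_lattice_disjoint)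
  also have "\<dots> = (\<Sum>k<N. 1)"
  proof (rule sum.cong[OF refl])
    fix k assume k: "k \<in> {..<N}"
    have "(\<Sum>z\<in>(dyadic_lattice k :: (real^'n) set). dyadic_weight N \<alpha> z powr P) = (\<Sum>z\<in>(dyadic_lattice k :: (real^'n) set). ((2 ^ k) powr (- (real CARD('n) * \<alpha>))) powr P)"
      using k by (intro sum.cong refl) (simp add: dyadic_weight_eq)
    also have "\<dots> = real ((2 ^ k) ^ CARD('n)) * (2 ^ k) powr (- (real CARD('n) * (\<alpha> * P)))"
      by (simp add: dyadic_lattice_card powr_powr mult.assoc)
    also have "(2 ^ k) powr (- (real CARD('n) * (\<alpha> * P))) = 1 / ((2::real) ^ k) ^ CARD('n)"
      unfolding P using powr_realpow[of "2 ^ k" "CARD('n)"] by (simp add: powr_minus_divide)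
    finally show "(\<Sum>z\<in>(dyadic_lattice k :: (real^'n) set). dyadic_weight N \<alpha> z powr P) = 1" by simp
  qed
  finally show ?thesis by simp
qed

lemma dyadic_lattice_Ints: "z \<in> dyadic_lattice k \<Longrightarrow> z $ i \<in> \<int>"
proof -
  assume "z \<in> dyadic_lattice k"
  then obtain j :: int where "z $ i = of_int j" unfolding dyadic_lattice_def by blast
  then show ?thesis by simp
qed

lemma lattice_set_dyadic: "lattice_set (\<Union>k<N. dyadic_lattice k :: (real^'n) set)"
  unfolding lattice_set_def by (auto simp: dyadic_lattice_card intro: dyadic_lattice_Ints)

definition dyadic_box :: "nat \<Rightarrow> (real^'n) set" where
  "dyadic_box k = box (\<chi> i. 2 ^ k) (\<chi> i. 2 ^ Suc k)"

lemma dyadic_box_emeasure: "emeasure lborel (dyadic_box k :: (real^'n) set) = ennreal ((2 ^ k) ^ CARD('n))"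
proof -
  have one: "((\<chi> i. a) :: real^'n) \<bullet> b = a" if "b \<in> Basis" for a b using that by (auto simp: Basis_vec_def inner_axis)
  show ?thesis unfolding dyadic_box_def by (subst emeasure_lborel_box) (auto simp: one inner_diff_left)
qed

lemma dyadic_box_disjoint: "x \<in> dyadic_box k \<Longrightarrow> x \<in> dyadic_box k' \<Longrightarrow> k = k'"
proof (rule ccontr)
  have *: False if x: "x \<in> dyadic_box k" "x \<in> dyadic_box k'" and "k < k'" for k k'
  proof -
    have "x $ undefined < 2 ^ Suc k" "2 ^ k' < x $ undefined" using x by (auto simp: dyadic_box_def mem_box_cart)
    moreover have "(2::real) ^ Suc k \<le> 2 ^ k'" using \<open>k < k'\<close> by (intro power_increasing) auto
    ultimately show False by linarith
  qed
  assume "x \<in> dyadic_box k" "x \<in> dyadic_box k'" "k \<noteq> k'"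
  then show False using *[of k k'] *[of k' k] by (meson linorder_neqE_nat)
qed

text \<open>Rounding every coordinate up moves x by at most 1 in each of the n coordinates and stays
  in the half-open shell.\<close>

lemma dyadic_box_near_lattice:
  fixes x :: "real^'n"
  assumes "x \<in> dyadic_box k" shows "\<exists>z\<in>dyadic_lattice k. norm (x - z) \<le> real CARD('n)"
proof
  define z :: "real^'n" where "z = (\<chi> i. of_int \<lceil>x $ i\<rceil>)"
  have x: "2 ^ k < x $ i" "x $ i < 2 ^ Suc k" for i using assms by (auto simp: dyadic_box_def mem_box_cart)
  have "2 ^ k < \<lceil>x $ i\<rceil>" "\<lceil>x $ i\<rceil> \<le> 2 ^ Suc k" for i
    using x[of i] by (auto simp: less_ceiling_iff ceiling_le_iff)
  then show "z \<in> dyadic_lattice k" unfolding dyadic_lattice_def z_def by auto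
  have "norm (x - z) \<le> (\<Sum>i\<in>UNIV. \<bar>(x - z) $ i\<bar>)" by (rule norm_le_l1_cart)
  also have "\<dots> \<le> (\<Sum>i\<in>(UNIV::'n set). 1)"
  proof (rule sum_mono)
    fix i show "\<bar>(x - z) $ i\<bar> \<le> 1" unfolding z_def using ceiling_correct[of "x $ i"] by (auto simp: abs_le_iff)
  qed
  finally show "norm (x - z) \<le> real CARD('n)" by simp
qed

lemma dyadic_box_norm:
  fixes x :: "real^'n"
  assumes "x \<in> dyadic_box k" shows "norm x \<le> 2 * real CARD('n) * 2 ^ k"
proof -
  have x: "2 ^ k < x $ i" "x $ i < 2 ^ Suc k" for i using assms by (auto simp: dyadic_box_def mem_box_cart)
  have "norm x \<le> (\<Sum>i\<in>UNIV. \<bar>x $ i\<bar>)" by (rule norm_le_l1_cart)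
  also have "\<dots> \<le> (\<Sum>i\<in>(UNIV::'n set). 2 * 2 ^ k)"
  proof (rule sum_mono)
    fix i
    have "0 < x $ i" using x(1)[of i] by (meson less_trans zero_less_numeral zero_less_power)
    then show "\<bar>x $ i\<bar> \<le> 2 * 2 ^ k" using x(2)[of i] by simp
  qed
  finally show ?thesis by simp
qed

text \<open>The boxes are disjoint and the k-th has volume 2^(kn), so each of the N boxes
  contributes at least a^q to the integral of |T|^q.\<close>

lemma Lp_norm_ge_dyadic:
  fixes T :: "real^'n \<Rightarrow> complex"
  assumes q: "q > 0" and a: "a \<ge> 0" and T: "\<And>k x. k < N \<Longrightarrow> x \<in> dyadic_box k \<Longrightarrow> a * (2 ^ k) powr (- (real CARD('n) / q)) \<le> norm (T x)"
  shows "ennreal (a * real N powr (1 / q)) \<le> Lp_norm (ennreal q) T"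
proof -
  have [measurable]: "dyadic_box k \<in> sets borel" for k by (simp add: dyadic_box_def)
  have "ennreal (a powr q * real N) = (\<Sum>k<N. ennreal (a powr q / (2 ^ k) ^ CARD('n)) * emeasure lborel (dyadic_box k :: (real^'n) set))"
  proof -
    have "(\<Sum>k<N. ennreal (a powr q / (2 ^ k) ^ CARD('n)) * emeasure lborel (dyadic_box k :: (real^'n) set)) = (\<Sum>k<N. ennreal (a powr q))"
      unfolding dyadic_box_emeasure by (intro sum.cong refl) (simp add: ennreal_mult[symmetric])
    also have "\<dots> = ennreal (\<Sum>k<N. a powr q)" by (rule sum_ennreal) simp
    finally show ?thesis by (simp add: mult.commute)
  qed
  also have "\<dots> = (\<Sum>k<N. \<integral>\<^sup>+x. ennreal (a powr q / (2 ^ k) ^ CARD('n)) * indicator (dyadic_box k) (x::real^'n) \<partial>lborel)"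
    by (simp add: nn_integral_cmult_indicator)
  also have "\<dots> = (\<integral>\<^sup>+x. (\<Sum>k<N. ennreal (a powr q / (2 ^ k) ^ CARD('n)) * indicator (dyadic_box k) (x::real^'n)) \<partial>lborel)"
    by (rule nn_integral_sum[symmetric]) measurable
  also have "\<dots> \<le> (\<integral>\<^sup>+x. ennreal (norm (T x) powr q) \<partial>lborel)"
  proof (rule nn_integral_mono)
    fix x :: "real^'n"
    show "(\<Sum>k<N. ennreal (a powr q / (2 ^ k) ^ CARD('n)) * indicator (dyadic_box k) x) \<le> ennreal (norm (T x) powr q)"
    proof (cases "\<exists>k<N. x \<in> dyadic_box k")
      case True
      then obtain k where k: "k < N" "x \<in> dyadic_box k" by blast
      have "(\<Sum>j<N. ennreal (a powr q / (2 ^ j) ^ CARD('n)) * indicator (dyadic_box j) x) = (\<Sum>j<N. if j = k then ennreal (a powr q / (2 ^ k) ^ CARD('n)) else 0)"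
        using k(2) dyadic_box_disjoint[of x] by (intro sum.cong refl) (auto simp: indicator_def)
      also have "\<dots> = ennreal (a powr q / (2 ^ k) ^ CARD('n))" using k(1) by simp
      also have "a powr q / (2 ^ k) ^ CARD('n) = (a * (2 ^ k) powr (- (real CARD('n) / q))) powr q"
      proof -
        have "((2::real) ^ k) ^ CARD('n) = (2 ^ k) powr real CARD('n)" using powr_realpow[of "2 ^ k" "CARD('n)"] by simp
        moreover have "(a * (2 ^ k) powr (- (real CARD('n) / q))) powr q = a powr q * (2 ^ k) powr (- real CARD('n))"
          using a q by (simp only: powr_mult powr_powr) simp
        ultimately show ?thesis unfolding powr_minus divide_inverse by simp
      qed
      also have "ennreal \<dots> \<le> ennreal (norm (T x) powr q)"
        using a q T[OF k] by (intro ennreal_leI powr_mono2) auto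
      finally show ?thesis .
    next
      case False
      then have "(\<Sum>k<N. ennreal (a powr q / (2 ^ k) ^ CARD('n)) * indicator (dyadic_box k) x) = 0" by (intro sum.neutral) auto
      then show ?thesis by simp
    qed
  qed
  finally have "ennreal (a powr q * real N) \<le> Lr_pow q T" by (simp add: Lr_pow_def)
  then have "ennreal_powr (ennreal (a powr q * real N)) (1 / q) \<le> Lp_norm (ennreal q) T"
    unfolding Lp_norm_Lr_pow[OF q] using q by (intro ennreal_powr_mono) auto
  moreover have "ennreal_powr (ennreal (a powr q * real N)) (1 / q) = ennreal (a * real N powr (1 / q))"
    using a q by (subst ennreal_powr_ennreal) (auto simp: powr_mult powr_powr)
  ultimately show ?thesis by simp
qed

text \<open>All but a ball of \<nu> of radius 2^(-k) around x / 2^k is discarded; its volume is the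
  source of the factor 2^(-kn). There |x - 2^k \<nu>| \<le> 1 and |\<nu>| \<le> 2n + 1, because x in
  the k-th box has norm at most 2n 2^k. Hence the radius 2n + 1 on which \<psi> \<ge> \<kappa> is
  required.\<close>

lemma block_integral_ge:
  fixes \<psi> :: "real^'n \<Rightarrow> real"
  assumes s: "schwartz (\<lambda>x. complex_of_real (\<psi> x))" and \<psi>0: "\<And>x. \<psi> x \<ge> 0" and \<kappa>: "\<kappa> \<ge> 0"
    and lb: "\<And>x. norm x \<le> 2 * real CARD('n) + 1 \<Longrightarrow> \<kappa> \<le> \<psi> x" and x: "x \<in> dyadic_box k"
  shows "\<kappa> ^ Suc l * unit_ball_vol (real CARD('n)) / (2 ^ k) ^ CARD('n) \<le> (LINT \<nu>|lborel. \<psi> \<nu> * \<psi> (x - 2 ^ k *\<^sub>R \<nu>) ^ l)"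
    "integrable lborel (\<lambda>\<nu>. \<psi> \<nu> * \<psi> (x - 2 ^ k *\<^sub>R \<nu>) ^ l)"
proof -
  have r: "rapid (\<lambda>x. complex_of_real (\<psi> x))" by (rule schwartz_rapid[OF s])
  have i: "integrable lborel \<psi>" using rapid_integrable[OF r] by (simp only: complex_of_real_integrable_eq)
  have [measurable]: "\<psi> \<in> borel_measurable borel" using i by auto
  obtain B where B: "\<And>x. norm (complex_of_real (\<psi> x)) \<le> B" using rapid_bounded[OF r] by blast
  have B': "\<psi> x \<le> B" for x using B[of x] \<psi>0[of x] by simp
  show int: "integrable lborel (\<lambda>\<nu>. \<psi> \<nu> * \<psi> (x - 2 ^ k *\<^sub>R \<nu>) ^ l)"
  proof (rule Bochner_Integration.integrable_bound)
    show "integrable lborel (\<lambda>\<nu>. \<psi> \<nu> * B ^ l)" using i by simp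
    show "AE \<nu> in lborel. norm (\<psi> \<nu> * \<psi> (x - 2 ^ k *\<^sub>R \<nu>) ^ l) \<le> norm (\<psi> \<nu> * B ^ l)"
    proof (rule AE_I2)
      fix \<nu>
      have "\<psi> \<nu> * \<psi> (x - 2 ^ k *\<^sub>R \<nu>) ^ l \<le> \<psi> \<nu> * B ^ l" by (intro mult_left_mono power_mono B' \<psi>0)
      moreover have "0 \<le> \<psi> \<nu> * \<psi> (x - 2 ^ k *\<^sub>R \<nu>) ^ l" by (intro mult_nonneg_nonneg zero_le_power \<psi>0)
      ultimately show "norm (\<psi> \<nu> * \<psi> (x - 2 ^ k *\<^sub>R \<nu>) ^ l) \<le> norm (\<psi> \<nu> * B ^ l)" by simp
    qed
  qed measurable
  define S where "S = cball (x /\<^sub>R 2 ^ k) (1 / 2 ^ k)"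
  have [measurable]: "S \<in> sets borel" by (simp add: S_def)
  have fin: "emeasure lborel S < \<infinity>" unfolding S_def by (rule emeasure_lborel_cball_finite)
  have "\<kappa> ^ Suc l * unit_ball_vol (real CARD('n)) / (2 ^ k) ^ CARD('n) = \<kappa> ^ Suc l * measure lborel S"
    unfolding S_def by (subst content_cball) (simp_all add: power_one_over divide_simps)
  also have "\<dots> = (LINT \<nu>|lborel. \<kappa> ^ Suc l * indicator S \<nu>)" by simp
  also have "\<dots> \<le> (LINT \<nu>|lborel. \<psi> \<nu> * \<psi> (x - 2 ^ k *\<^sub>R \<nu>) ^ l)"
  proof (rule integral_mono[OF _ int])
    show "integrable lborel (\<lambda>\<nu>. \<kappa> ^ Suc l * indicator S \<nu>)" using fin by (intro integrable_mult_right integrable_real_indicator) auto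
    fix \<nu> :: "real^'n"
    show "\<kappa> ^ Suc l * indicator S \<nu> \<le> \<psi> \<nu> * \<psi> (x - 2 ^ k *\<^sub>R \<nu>) ^ l"
    proof (cases "\<nu> \<in> S")
      case True
      have k: "(2::real) ^ k > 0" "(2::real) ^ k \<ge> 1" by auto
      have e: "x - 2 ^ k *\<^sub>R \<nu> = 2 ^ k *\<^sub>R (x /\<^sub>R 2 ^ k - \<nu>)" by (simp add: scaleR_diff_right)
      have d: "norm (x /\<^sub>R 2 ^ k - \<nu>) \<le> 1 / 2 ^ k" using True by (simp add: S_def dist_norm)
      have 1: "norm (x - 2 ^ k *\<^sub>R \<nu>) \<le> 1" using d k unfolding e norm_scaleR by (simp add: field_simps)
      have nx: "norm (x /\<^sub>R 2 ^ k) \<le> 2 * real CARD('n)" using dyadic_box_norm[OF x] k by (simp add: divide_simps)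
      have "norm \<nu> \<le> norm (x /\<^sub>R 2 ^ k) + norm (x /\<^sub>R 2 ^ k - \<nu>)" by (metis norm_triangle_sub add.commute norm_minus_commute)
      also have "\<dots> \<le> 2 * real CARD('n) + 1"
      proof -
        have "1 / 2 ^ k \<le> (1::real)" using k by simp
        then show ?thesis using nx d by linarith
      qed
      finally have "\<kappa> \<le> \<psi> \<nu>" by (rule lb)
      moreover have "\<kappa> \<le> \<psi> (x - 2 ^ k *\<^sub>R \<nu>)" using 1 by (intro lb) linarith
      ultimately show ?thesis using True \<kappa> \<psi>0 by (auto intro!: mult_mono power_mono)
    qed (auto intro!: mult_nonneg_nonneg zero_le_power \<psi>0)
  qed
  finally show "\<kappa> ^ Suc l * unit_ball_vol (real CARD('n)) / (2 ^ k) ^ CARD('n) \<le> (LINT \<nu>|lborel. \<psi> \<nu> * \<psi> (x - 2 ^ k *\<^sub>R \<nu>) ^ l)" .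
qed

section \<open>The test functions: upper bound for the inputs, lower bound for the output\<close>

definition test_wave :: "nat \<Rightarrow> 'm set \<Rightarrow> ('m \<Rightarrow> real) \<Rightarrow> (real^'n \<Rightarrow> real) \<Rightarrow> real^'n \<Rightarrow> 'm \<Rightarrow> real^'n \<Rightarrow> complex" where
  "test_wave N J \<alpha> \<psi> e j = (if j \<in> J then lattice_wave {0} (\<lambda>_. 1) \<psi> e
     else lattice_wave (\<Union>k<N. dyadic_lattice k) (dyadic_weight N (\<alpha> j)) \<psi> e)"

lemma lattice_set_0: "lattice_set {0}"
  by (simp add: lattice_set_def)

lemma dyadic_lattice_nonempty: "(dyadic_lattice k :: (real^'n) set) \<noteq> {}"
proof
  assume "(dyadic_lattice k :: (real^'n) set) = {}"
  then show False using dyadic_lattice_card(2)[of k, where ?'n='n] by simp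
qed

lemma schwartz_test_wave:
  assumes "schwartz (\<lambda>x. complex_of_real (\<psi> x))" "N > 0" shows "schwartz (test_wave N J \<alpha> \<psi> e j)"
proof -
  have "(\<Union>k<N. dyadic_lattice k :: (real^'n) set) \<noteq> {}" using dyadic_lattice_nonempty[of 0] assms(2) by auto
  from schwartz_lattice_wave[OF assms(1) lattice_set_dyadic this] schwartz_lattice_wave[OF assms(1) lattice_set_0]
  show ?thesis by (simp add: test_wave_def)
qed

lemma fourier_test_wave_zero:
  assumes "schwartz (\<lambda>x. complex_of_real (\<psi> x))" "fourier (\<lambda>x. cis (2 * pi * (x \<bullet> e)) * of_real (\<psi> x)) \<omega> = 0"
  shows "fourier (test_wave N J \<alpha> \<psi> e j) \<omega> = 0"
  unfolding test_wave_def using fourier_lattice_wave_zero[OF assms(1) _ assms(2)] lattice_set_0 lattice_set_dyadic by auto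

lemma Hp_norm_test_wave:
  fixes \<phi> :: "real^'n \<Rightarrow> complex"
  assumes \<phi>: "schwartz \<phi>" and s: "schwartz (\<lambda>x. complex_of_real (\<psi> x))"
    and ann: "annular a (\<lambda>x. cis (2 * pi * (x \<bullet> e)) * complex_of_real (\<psi> x))" and a: "a > 0" and p: "p > 0"
    and \<alpha>: "\<alpha> j = enn2real (1 / p)"
  shows "\<exists>K>0. \<forall>N>0. Hp_norm \<phi> p (test_wave N J \<alpha> \<psi> e j) \<le> ennreal (K * real N powr (if j \<in> J then 0 else \<alpha> j))"
proof -
  from Hp_norm_lattice_wave[OF \<phi> s ann a p] obtain K where K: "K > 0" and H: "\<forall>Z c. lattice_set Z \<longrightarrow> (\<forall>z. c z \<ge> 0) \<longrightarrow>
    (if p = \<infinity> then (\<forall>b\<ge>0. (\<forall>z\<in>Z. c z \<le> b) \<longrightarrow> Hp_norm \<phi> p (lattice_wave Z c \<psi> e) \<le> ennreal (K * b))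
     else Hp_norm \<phi> p (lattice_wave Z c \<psi> e) \<le> ennreal (K * (\<Sum>z\<in>Z. c z powr enn2real p) powr (1 / enn2real p)))"
    by (elim exE conjE)
  note H' = H[rule_format, where Z="{0}" and c="\<lambda>_. 1", OF lattice_set_0 zero_le_one]
  have "Hp_norm \<phi> p (test_wave N J \<alpha> \<psi> e j) \<le> ennreal (K * real N powr (if j \<in> J then 0 else \<alpha> j))" if N: "N > 0" for N
  proof -
    note H2 = H[rule_format, where Z="\<Union>k<N. dyadic_lattice k" and c="dyadic_weight N (\<alpha> j)", OF lattice_set_dyadic dyadic_weight_nonneg]
    show ?thesis
    proof (cases "p = \<infinity>")
      case True
      \<comment> \<open>1/\<infinity> is 0, so the weights are 1 and the bound is N^0, which equals
        1 because N > 0.\<close>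
      have \<alpha>0: "\<alpha> j = 0" using True \<alpha> by (simp add: ennreal_divide_top)
      have A: "Hp_norm \<phi> p (lattice_wave {0} (\<lambda>_. 1) \<psi> e) \<le> ennreal (K * 1)"
        by (rule H'[unfolded if_P[OF True], rule_format]) auto
      have B: "Hp_norm \<phi> p (lattice_wave (\<Union>k<N. dyadic_lattice k) (dyadic_weight N (\<alpha> j)) \<psi> e) \<le> ennreal (K * 1)"
      proof -
        have "\<forall>z\<in>(\<Union>k<N. dyadic_lattice k :: (real^'n) set). dyadic_weight N (\<alpha> j) z \<le> 1" unfolding \<alpha>0 using dyadic_weight_le_1 by blast
        then show ?thesis by (intro H2[unfolded if_P[OF True], rule_format]) auto
      qed
      show ?thesis using A B N by (simp add: test_wave_def \<alpha>0)
    next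
      case False
      define P where "P = enn2real p"
      have P: "P > 0" "p = ennreal P" using p False by (auto simp: P_def enn2real_positive_iff less_top)
      have "1 / p = ennreal (1 / P)" using P divide_ennreal[of 1 P] by simp
      then have \<alpha>P: "\<alpha> j = 1 / P" using \<alpha> P by simp
      then have \<alpha>P': "\<alpha> j * P = 1" using P by simp
      have A: "Hp_norm \<phi> p (lattice_wave {0} (\<lambda>_. 1) \<psi> e) \<le> ennreal (K * 1)" using H' False by simp
      have B: "Hp_norm \<phi> p (lattice_wave (\<Union>k<N. dyadic_lattice k) (dyadic_weight N (\<alpha> j)) \<psi> e) \<le> ennreal (K * real N powr \<alpha> j)"
        using H2[unfolded if_not_P[OF False]] P unfolding P_def[symmetric] dyadic_weight_power_sum[OF \<alpha>P'] by (simp only: \<alpha>P)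
      show ?thesis using A B N by (simp add: test_wave_def)
    qed
  qed
  then show ?thesis using K by blast
qed

text \<open>The k-th block is kept. Its inputs from J give the integral of
  \<open>block_integral_ge\<close>, of order 2^(-kn). Each other input is at least a constant times
  its weight 2^(-kn \<alpha> j) on the k-th shell.\<close>

lemma lattice_multiplier_lower:
  fixes \<psi> :: "real^'n \<Rightarrow> real" and J :: "'m::finite set"
  assumes s: "schwartz (\<lambda>x. complex_of_real (\<psi> x))" and \<psi>0: "\<And>x. \<psi> x \<ge> 0" and \<kappa>: "\<kappa> > 0"
    and lb: "\<And>x. norm x \<le> 2 * real CARD('n) + 1 \<Longrightarrow> \<kappa> \<le> \<psi> x"
    and band: "\<And>\<omega>. norm (\<omega> - e) > \<eta> \<Longrightarrow> fourier (\<lambda>x. cis (2 * pi * (x \<bullet> e)) * of_real (\<psi> x)) \<omega> = 0"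
    and d0: "\<And>k. d k \<ge> 0" and ds: "summable d"
    and \<sigma>: "\<And>\<xi>. \<sigma> \<xi> = a \<xi> * (\<Sum>k. of_real (d k) * fourier (\<lambda>x. of_real (\<psi> x)) (2 ^ k *\<^sub>R (sum_on J \<xi> - real (card J) *\<^sub>R e)))"
    and a: "\<And>\<xi>::(real^'n)^'m. (\<And>j. norm (\<xi> $ j - e) \<le> \<eta>) \<Longrightarrow> a \<xi> = 1"
    and k: "k < N" and x: "x \<in> dyadic_box k"
  shows "\<kappa> ^ card (- J) * (\<kappa> ^ Suc (card J) * unit_ball_vol (real CARD('n))) * (d k * (2 ^ k) powr (- (real CARD('n) * (1 + (\<Sum>j\<in>-J. \<alpha> j)))))
    \<le> norm (multiplier_op \<sigma> (test_wave N J \<alpha> \<psi> e) x)"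
proof -
  define f where "f = test_wave N J \<alpha> \<psi> e"
  define g where "g = (\<lambda>j x. if j \<in> J then \<psi> x else (\<Sum>z\<in>(\<Union>k<N. dyadic_lattice k). dyadic_weight N (\<alpha> j) z * \<psi> (x - z)))"
  have N: "N > 0" using k by simp
  have fS: "schwartz (f j)" for j unfolding f_def by (rule schwartz_test_wave[OF s N])
  have fz: "fourier (f j) \<omega> = 0" if "norm (\<omega> - e) > \<eta>" for j \<omega>
    unfolding f_def by (rule fourier_test_wave_zero[OF s band[OF that]])
  have f: "f j x = cis (2 * pi * (x \<bullet> e)) * of_real (g j x)" for j x
    by (simp add: f_def test_wave_def g_def lattice_wave_def)
  have g0: "g j x \<ge> 0" for j x
    unfolding g_def by (auto intro!: sum_nonneg mult_nonneg_nonneg \<psi>0 dyadic_weight_nonneg)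
  have fi: "integrable lborel (f j)" for j by (intro rapid_integrable schwartz_rapid fS)
  have fz': "fourier (f j) \<omega> = 0" if "norm \<omega> > \<bar>\<eta>\<bar> + norm e" for j \<omega>
  proof (rule fz)
    have "norm \<omega> \<le> norm (\<omega> - e) + norm e" by (metis norm_triangle_sub add.commute)
    then show "norm (\<omega> - e) > \<eta>" using that by linarith
  qed
  have ff: "integrable lborel (fourier (f j))" for j by (rule integrable_fourier_band[OF fi fz'])
  have inv: "inv_fourier (fourier (f j)) x = f j x" for j x
    by (rule inv_fourier_fourier_band[OF schwartz_rapid[OF fS] schwartz_continuous[OF fS] fz'])
  have a1: "a \<xi> = 1" if "\<And>j. fourier (f j) (\<xi> $ j) \<noteq> 0" for \<xi>
    by (rule a) (use that fz in \<open>metis linorder_not_le\<close>)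
  have u: "integrable lborel (\<lambda>x. complex_of_real (\<psi> x))" by (intro rapid_integrable schwartz_rapid s)
  have main: "d k * (LINT \<nu>|lborel. \<psi> \<nu> * ((\<Prod>j\<in>J. g j (x - 2 ^ k *\<^sub>R \<nu>)) * (\<Prod>j\<in>-J. g j x))) \<le> norm (multiplier_op \<sigma> f x)"
    by (rule norm_multiplier_op_ge_block[where R="\<lambda>k. 2 ^ k" and e=e and a=a, OF u \<psi>0 f g0 ff inv d0 ds \<sigma> a1])
  have eq: "(LINT \<nu>|lborel. \<psi> \<nu> * ((\<Prod>j\<in>J. g j (x - 2 ^ k *\<^sub>R \<nu>)) * (\<Prod>j\<in>-J. g j x)))
    = (\<Prod>j\<in>-J. g j x) * (LINT \<nu>|lborel. \<psi> \<nu> * \<psi> (x - 2 ^ k *\<^sub>R \<nu>) ^ card J)"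
  proof -
    have "(\<Prod>j\<in>J. g j y) = \<psi> y ^ card J" for y by (simp add: g_def)
    then have "\<psi> \<nu> * ((\<Prod>j\<in>J. g j (x - 2 ^ k *\<^sub>R \<nu>)) * (\<Prod>j\<in>-J. g j x)) = (\<Prod>j\<in>-J. g j x) * (\<psi> \<nu> * \<psi> (x - 2 ^ k *\<^sub>R \<nu>) ^ card J)" for \<nu>
      by (simp only: mult_ac)
    then show ?thesis by (simp only: integral_mult_right_zero)
  qed
  obtain z where z: "z \<in> dyadic_lattice k" "norm (x - z) \<le> real CARD('n)" using dyadic_box_near_lattice[OF x] by blast
  \<comment> \<open>All terms of the lattice sum are nonnegative, so one lattice point z near x is
    enough; |x - z| \<le> n lies within the radius where \<psi> \<ge> \<kappa>.\<close>
  have gl: "(2 ^ k) powr (- (real CARD('n) * \<alpha> j)) * \<kappa> \<le> g j x" if j: "j \<in> - J" for j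
  proof -
    have "(2 ^ k) powr (- (real CARD('n) * \<alpha> j)) * \<kappa> \<le> dyadic_weight N (\<alpha> j) z * \<psi> (x - z)"
      unfolding dyadic_weight_eq[OF k z(1)] using z(2) by (intro mult_left_mono lb) auto
    also have "\<dots> \<le> (\<Sum>z\<in>(\<Union>k<N. dyadic_lattice k). dyadic_weight N (\<alpha> j) z * \<psi> (x - z))"
      using z(1) k by (intro member_le_sum) (auto intro!: mult_nonneg_nonneg \<psi>0 dyadic_weight_nonneg simp: dyadic_lattice_card)
    finally show ?thesis using j by (simp add: g_def)
  qed
  have pl: "(2 ^ k) powr (- (real CARD('n) * (\<Sum>j\<in>-J. \<alpha> j))) * \<kappa> ^ card (- J) \<le> (\<Prod>j\<in>-J. g j x)"
  proof -
    have "(2 ^ k) powr (- (real CARD('n) * (\<Sum>j\<in>-J. \<alpha> j))) * \<kappa> ^ card (- J) = (\<Prod>j\<in>-J. (2 ^ k) powr (- (real CARD('n) * \<alpha> j)) * \<kappa>)"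
      by (simp add: prod.distrib powr_sum[symmetric] sum_distrib_left sum_negf)
    also have "\<dots> \<le> (\<Prod>j\<in>-J. g j x)" using gl \<kappa> by (intro prod_mono) auto
    finally show ?thesis .
  qed
  define V where "V = \<kappa> ^ Suc (card J) * unit_ball_vol (real CARD('n))"
  have V: "V \<ge> 0" using \<kappa> by (auto simp: V_def)
  have il: "V / (2 ^ k) ^ CARD('n) \<le> (LINT \<nu>|lborel. \<psi> \<nu> * \<psi> (x - 2 ^ k *\<^sub>R \<nu>) ^ card J)"
    unfolding V_def by (rule block_integral_ge(1)[OF s \<psi>0 less_imp_le[OF \<kappa>] lb x])
  have "\<kappa> ^ card (- J) * V * (d k * (2 ^ k) powr (- (real CARD('n) * (1 + (\<Sum>j\<in>-J. \<alpha> j)))))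
    = d k * (((2 ^ k) powr (- (real CARD('n) * (\<Sum>j\<in>-J. \<alpha> j))) * \<kappa> ^ card (- J)) * (V / (2 ^ k) ^ CARD('n)))"
  proof -
    have "((2::real) ^ k) ^ CARD('n) = (2 ^ k) powr real CARD('n)" using powr_realpow[of "2 ^ k" "CARD('n)"] by simp
    then have "V / (2 ^ k) ^ CARD('n) = V * (2 ^ k) powr (- real CARD('n))" by (simp only: powr_minus divide_inverse)
    moreover have "((2::real) ^ k) powr (- (real CARD('n) * (1 + (\<Sum>j\<in>-J. \<alpha> j)))) = (2 ^ k) powr (- (real CARD('n) * (\<Sum>j\<in>-J. \<alpha> j))) * (2 ^ k) powr (- real CARD('n))"
      unfolding powr_add[symmetric] by (simp add: algebra_simps)
    ultimately show ?thesis by (simp only: mult_ac)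
  qed
  also have "\<dots> \<le> d k * ((\<Prod>j\<in>-J. g j x) * (LINT \<nu>|lborel. \<psi> \<nu> * \<psi> (x - 2 ^ k *\<^sub>R \<nu>) ^ card J))"
    using V by (intro mult_left_mono[OF _ d0] mult_mono pl il prod_nonneg) (auto simp: g0)
  also have "\<dots> \<le> norm (multiplier_op \<sigma> f x)" using main unfolding eq .
  finally show ?thesis by (simp only: f_def V_def)
qed

section \<open>The counterexample\<close>

text \<open>The point (e, ..., e) has norm 1, and m components that are each off by at most 1/(2m)
  displace it by at most 1/2. The product of the spectra thus lies where \<open>plateau\<close> is
  1.\<close>

lemma norm_near_diagonal:
  fixes \<xi> :: "(real^'n)^'m::finite"
  assumes e: "norm e = 1 / sqrt (real CARD('m))" and \<xi>: "\<And>j. norm (\<xi> $ j - e) \<le> 1 / (2 * real CARD('m))"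
  shows "1 / 2 \<le> norm \<xi>" "norm \<xi> \<le> 2"
proof -
  define E :: "(real^'n)^'m" where "E = (\<chi> j. e)"
  have "norm E = sqrt (\<Sum>j\<in>(UNIV::'m set). (norm e)\<^sup>2)" unfolding norm_vec_def[of E] L2_set_def by (simp add: E_def)
  then have "norm E = 1" unfolding e by (simp add: power_divide)
  moreover have "norm (\<xi> - E) \<le> 1 / 2"
  proof -
    have "norm (\<xi> - E) \<le> (\<Sum>j\<in>UNIV. norm ((\<xi> - E) $ j))" unfolding norm_vec_def[of "\<xi> - E"] by (rule L2_set_le_sum) simp
    also have "\<dots> \<le> (\<Sum>j\<in>(UNIV::'m set). 1 / (2 * real CARD('m)))" by (intro sum_mono) (simp add: E_def \<xi>)
    finally show ?thesis by simp
  qed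
  moreover have "norm E \<le> norm \<xi> + norm (\<xi> - E)" by (metis norm_triangle_sub norm_minus_commute add.commute)
  moreover have "norm \<xi> \<le> norm E + norm (\<xi> - E)" by (metis norm_triangle_sub)
  ultimately show "1 / 2 \<le> norm \<xi>" "norm \<xi> \<le> 2" by linarith+
qed

lemma littlewood_paley_nonzero:
  fixes \<Psi> :: "'a::euclidean_space \<Rightarrow> complex"
  assumes "littlewood_paley \<Psi>" shows "\<exists>c. \<Psi> c \<noteq> 0"
proof (rule ccontr)
  assume "\<not> ?thesis"
  then have z: "fourier \<Psi> \<xi> = 0" for \<xi> by (simp add: fourier_def)
  obtain b :: 'a where "b \<in> Basis" using nonempty_Basis by blast
  then have "b \<noteq> 0" by (rule nonzero_Basis)
  with assms have "((\<lambda>j::int. fourier \<Psi> (b /\<^sub>R 2 powi j)) has_sum 1) UNIV" unfolding littlewood_paley_def by blast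
  then have "((\<lambda>j::int. 0::complex) has_sum 1) UNIV" by (simp only: z)
  from has_sum_unique[OF this has_sum_0] show False by simp
qed

lemma enn2real_inverse_sum:
  fixes p :: "'m::finite \<Rightarrow> ennreal"
  assumes "\<And>i. 0 < p i" "q > 0" "(\<Sum>i\<in>UNIV. 1 / p i) = 1 / ennreal q"
  shows "(\<Sum>i\<in>UNIV. enn2real (1 / p i)) = 1 / q"
proof -
  have "1 / p i < top" for i using assms(1)[of i] by (simp add: less_top[symmetric] ennreal_divide_eq_top_iff)
  then have "(\<Sum>i\<in>UNIV. enn2real (1 / p i)) = enn2real (\<Sum>i\<in>UNIV. 1 / p i)" by (subst enn2real_sum) (auto simp: comp_def)
  also have "\<dots> = 1 / q" unfolding assms(3) using assms(2) divide_ennreal[of 1 q] by simp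
  finally show ?thesis .
qed

text \<open>The final contradiction: the quotient of output and inputs is bounded below by a
  positive constant times N^\<delta>.\<close>

lemma powr_unbounded:
  assumes "\<delta> > 0" shows "\<exists>N::nat. N > 0 \<and> real N powr \<delta> > B"
proof -
  obtain N :: nat where N: "max 1 B powr (1 / \<delta>) < real N" using reals_Archimedean2 by blast
  have "max 1 B = (max 1 B powr (1 / \<delta>)) powr \<delta>" using assms by (simp add: powr_powr)
  also have "\<dots> < real N powr \<delta>" using N assms by (intro powr_less_mono2) auto
  finally have "B < real N powr \<delta>" by simp
  moreover have "N > 0" using N by (rule contrapos_pp) (simp add: not_less)
  ultimately show ?thesis by blast
qed

lemma lacunary_symbol_bounded:
  fixes \<Psi> :: "(real ^ 'n) ^ 'm::finite \<Rightarrow> complex" and u :: "real ^ 'n \<Rightarrow> complex" and J :: "'m set" and \<theta> :: "real ^ 'n"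
  assumes \<Psi>: "littlewood_paley \<Psi>" and u: "integrable lborel u" and d0: "\<And>k. d k \<ge> 0" and ds: "summable d"
  defines "\<sigma> \<equiv> \<lambda>\<xi>. plateau \<Psi> \<xi> * (\<Sum>k. of_real (d k) * fourier u (2 ^ k *\<^sub>R (sum_on J \<xi> - \<theta>)))"
  shows "\<sigma> \<in> borel_measurable borel" "bounded (range \<sigma>)"
proof -
  have [measurable]: "fourier u \<in> borel_measurable borel" using u by (rule fourier_measurable)
  have [measurable]: "(sum_on J :: (real^'n)^'m \<Rightarrow> real^'n) \<in> borel_measurable borel"
    unfolding sum_on_def[abs_def] by (intro borel_measurable_continuous_onI continuous_intros)
  note [measurable] = plateau_measurable_bounded(1)[OF \<Psi>]
  show "\<sigma> \<in> borel_measurable borel" unfolding \<sigma>_def by measurable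
  define U where "U = (LINT x|lborel. norm (u x))"
  have U: "norm (fourier u \<omega>) \<le> U" for \<omega> unfolding U_def by (rule norm_fourier_le)
  obtain C where C: "\<forall>\<xi>. norm (plateau \<Psi> \<xi>) \<le> C" using plateau_measurable_bounded(2)[OF \<Psi>] by blast
  have "norm (\<sigma> \<xi>) \<le> C * (\<Sum>k. d k * U)" for \<xi>
  proof -
    have b: "norm (of_real (d k) * fourier u (2 ^ k *\<^sub>R (sum_on J \<xi> - \<theta>))) \<le> d k * U" for k
      using d0[of k] U by (simp add: norm_mult mult_left_mono)
    have s1: "summable (\<lambda>k. d k * U)" using ds by (rule summable_mult2)
    have s2: "summable (\<lambda>k. norm (of_real (d k) * fourier u (2 ^ k *\<^sub>R (sum_on J \<xi> - \<theta>))))"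
      by (rule summable_comparison_test'[OF s1, of 0]) (use b in simp)
    have "norm (\<Sum>k. of_real (d k) * fourier u (2 ^ k *\<^sub>R (sum_on J \<xi> - \<theta>))) \<le> (\<Sum>k. d k * U)"
      by (rule order_trans[OF summable_norm[OF s2] suminf_le[OF b s2 s1]])
    moreover have "C \<ge> 0" using C by (meson norm_ge_zero order_trans)
    ultimately show ?thesis unfolding \<sigma>_def norm_mult using C by (intro mult_mono) auto
  qed
  then show "bounded (range \<sigma>)" unfolding bounded_iff by blast
qed

lemma ennreal_prod_mono:
  fixes f g :: "'i \<Rightarrow> ennreal"
  assumes "\<And>i. i \<in> I \<Longrightarrow> f i \<le> g i" shows "prod f I \<le> prod g I"
  using assms by (induction I rule: infinite_finite_induct) (auto intro!: mult_mono)

theorem proposition1p3: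
  fixes r r' q :: real
    and p :: "'m::finite \<Rightarrow> ennreal"
    and s :: "'m \<Rightarrow> real"
    and idx :: "nat \<Rightarrow> 'm"
    and l :: nat
    and \<phi> :: "real ^ 'n \<Rightarrow> complex"
    and \<Psi> :: "(real ^ 'n) ^ 'm \<Rightarrow> complex"
  assumes "CARD('m) \<ge> 2"
    and "bij_betw idx {1..CARD('m)} UNIV"
    and "schwartz \<phi>" and "fourier \<phi> 0 = 1"
    and "littlewood_paley \<Psi>"
    and "1 < r" and "r' = r / (r - 1)"
    and "\<And>i. 0 < p i" and "0 < q"
    and "(\<Sum>i\<in>UNIV. 1 / p i) = 1 / ennreal q"
    and "1 \<le> l" and "l \<le> CARD('m)"
    and "\<And>i. s i > real CARD('n) / r"
    and "(\<Sum>k=1..l. s (idx k) / real CARD('n) - enn2real (1 / p (idx k))) \<le> - 1 / r'"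
  shows "\<exists>\<sigma> :: (real ^ 'n) ^ 'm \<Rightarrow> complex.
    \<sigma> \<in> borel_measurable borel \<and> bounded (range \<sigma>) \<and>
    hormander_norm r s \<Psi> \<sigma> < \<infinity> \<and>
    \<not> multiplier_bounded \<phi> p (ennreal q) \<sigma>"
proof -
  note \<Psi> = assms(5) and r = assms(6) and p0 = assms(8) and q = assms(9) and sn = assms(13)
  define n where "n = real CARD('n)"
  define mm where "mm = real CARD('m)"
  have n: "n \<ge> 1" unfolding n_def by (simp add: Suc_leI)
  have mm: "mm \<ge> 2" unfolding mm_def using assms(1) by simp
  define J where "J = idx ` {1..l}"
  define \<alpha> where "\<alpha> = (\<lambda>i. enn2real (1 / p i))"
  define E where "E = (\<Sum>i\<in>J. s i)"
  define \<beta> where "\<beta> = (\<Sum>i\<in>J. \<alpha> i)"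
  have inj: "inj_on idx {1..l}" using assms(2,12) by (auto simp: bij_betw_def intro: inj_on_subset)
  have J0: "idx 1 \<in> J" unfolding J_def using assms(11) by auto
  have \<alpha>0: "\<alpha> i \<ge> 0" for i by (simp add: \<alpha>_def)
  have \<alpha>sum: "\<beta> + (\<Sum>i\<in>-J. \<alpha> i) = 1 / q"
  proof -
    have "\<beta> + (\<Sum>i\<in>-J. \<alpha> i) = (\<Sum>i\<in>UNIV. \<alpha> i)" unfolding \<beta>_def by (subst sum.union_disjoint[symmetric]) auto
    then show ?thesis unfolding \<alpha>_def using enn2real_inverse_sum[OF p0 q assms(10)] by simp
  qed
  \<comment> \<open>The hypothesis multiplied by n, with 1/r' = 1 - 1/r. It is the balance of powers
    of 2^k on the k-th shell.\<close>
  have hyp: "n / r - E - n \<ge> - n * \<beta>"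
  proof -
    have "(\<Sum>k=1..l. s (idx k) / n - \<alpha> (idx k)) = (\<Sum>i\<in>J. s i / n - \<alpha> i)"
      unfolding J_def by (simp only: sum.reindex[OF inj] comp_def)
    also have "\<dots> = E / n - \<beta>" by (simp add: sum_subtractf sum_divide_distrib E_def \<beta>_def)
    finally have "E / n - \<beta> \<le> - 1 / r'" using assms(14) unfolding n_def \<alpha>_def by simp
    moreover have "- 1 / r' = 1 / r - 1" unfolding assms(7) using r by (simp add: field_simps)
    ultimately have "E / n \<le> \<beta> + 1 / r - 1" by linarith
    then have "n * (E / n) \<le> n * (\<beta> + 1 / r - 1)" using n by (intro mult_left_mono) auto
    then show ?thesis using n by (simp add: algebra_simps)
  qed
  have s0: "s i > 0" for i using sn[of i] n r unfolding n_def by (meson divide_nonneg_pos less_le_trans not_le order_less_trans zero_less_one of_nat_0_le_iff order_trans le_less_trans)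
  have Er: "n / r < E"
  proof -
    have "n / r < s (idx 1)" using sn unfolding n_def .
    also have "\<dots> \<le> E" unfolding E_def using J0 s0 by (intro member_le_sum) (auto intro: less_imp_le)
    finally show ?thesis .
  qed
  \<comment> \<open>The balance \<open>hyp\<close> says n \<beta> \<ge> n + (E - n/r), and E exceeds
    n/r because J contains an index with s > n/r.\<close>
  have \<beta>1: "\<beta> > 1"
  proof -
    have "n * 1 < n * \<beta>" using hyp Er by linarith
    then show ?thesis using n by simp
  qed
  \<comment> \<open>Half of the surplus \<beta> - 1 makes the coefficients c k summable, and the
    other half remains as the growth N^\<delta>.\<close>
  define \<delta> where "\<delta> = (\<beta> - 1) / 2"
  have \<delta>: "\<delta> > 0" "\<beta> - 1 - \<delta> = \<delta>" using \<beta>1 by (auto simp: \<delta>_def field_simps)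
  define c where "c = (\<lambda>k. real (Suc k) powr - (1 + \<delta>))"
  have c0: "c k > 0" for k by (simp add: c_def)
  have cs: "summable c"
  proof -
    have "summable (\<lambda>k. real k powr - (1 + \<delta>))" using \<delta> by (simp add: summable_real_powr_iff)
    then show ?thesis unfolding c_def by (subst summable_Suc_iff)
  qed
  define d where "d = (\<lambda>k. c k * (2 ^ k) powr (n / r - E))"
  have d0: "d k \<ge> 0" for k using c0[of k] by (simp add: d_def)
  have dc: "d k \<le> c k" for k
  proof -
    have "((2::real) ^ k) powr (n / r - E) \<le> (2 ^ k) powr 0" using Er by (intro powr_mono) auto
    then show ?thesis using c0[of k] by (simp add: d_def mult_left_le)
  qed
  have ds: "summable d" by (rule summable_comparison_test'[OF cs, of 0]) (use d0 dc in simp)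
  obtain c1 where c1: "\<Psi> c1 \<noteq> 0" using littlewood_paley_nonzero[OF \<Psi>] by blast
  \<comment> \<open>The radius allowed by \<open>norm_near_diagonal\<close>; it also leaves a gap
    around 0, since |e| \<ge> 1/m = 2 \<eta>.\<close>
  define \<eta> where "\<eta> = 1 / (2 * mm)"
  have \<eta>: "\<eta> > 0" using mm by (simp add: \<eta>_def)
  have band: "fourier \<Psi> \<xi> = 0" if "norm \<xi> > 2" for \<xi> using littlewood_paley_supp[OF \<Psi>] that by blast
  have \<rho>: "2 * n + 1 > 0" using n by simp
  have "\<exists>(\<psi>::real^'n \<Rightarrow> real) \<kappa>. \<kappa> > 0 \<and> schwartz (\<lambda>x. of_real (\<psi> x)) \<and> (\<forall>x. \<psi> x \<ge> 0) \<and> (\<forall>x. norm x \<le> 2 * n + 1 \<longrightarrow> \<kappa> \<le> \<psi> x) \<and>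
    (\<forall>e \<omega>. norm (\<omega> - e) > \<eta> \<longrightarrow> fourier (\<lambda>x. cis (2 * pi * (x \<bullet> e)) * of_real (\<psi> x)) \<omega> = 0)"
    by (rule nonneg_band_bump[OF littlewood_paley_schwartz[OF \<Psi>] _ c1 \<rho> \<eta>]) (rule band)
  then obtain \<psi> :: "real^'n \<Rightarrow> real" and \<kappa>
    where \<kappa>: "\<kappa> > 0" and \<psi>s: "schwartz (\<lambda>x. complex_of_real (\<psi> x))" and \<psi>0: "\<forall>x. \<psi> x \<ge> 0" and \<psi>l: "\<forall>x. norm x \<le> 2 * n + 1 \<longrightarrow> \<kappa> \<le> \<psi> x"
    and \<psi>b: "\<forall>e \<omega>. norm (\<omega> - e) > \<eta> \<longrightarrow> fourier (\<lambda>x. cis (2 * pi * (x \<bullet> e)) * of_real (\<psi> x)) \<omega> = 0"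
    by (elim exE conjE)
  \<comment> \<open>Length 1 / sqrt m, so that (e, ..., e) has norm 1; the direction is
    arbitrary.\<close>
  define e :: "real^'n" where "e = (1 / sqrt mm) *\<^sub>R axis undefined 1"
  have ne: "norm e = 1 / sqrt mm" unfolding e_def using mm by simp
  have sq: "sqrt mm \<le> mm" "sqrt mm \<ge> 1" using mm by (auto simp: real_le_lsqrt power2_eq_square)
  \<comment> \<open>The spectrum of the wave lies within \<eta> of e, where 2 \<eta> \<le> |e| \<le>
    1 and \<eta> \<le> 1, hence between the radii \<eta> and 2.\<close>
  have ann: "annular \<eta> (\<lambda>x. cis (2 * pi * (x \<bullet> e)) * complex_of_real (\<psi> x))"
  proof -
    have "fourier (\<lambda>x. cis (2 * pi * (x \<bullet> e)) * complex_of_real (\<psi> x)) \<xi> = 0" if \<xi>: "norm \<xi> < \<eta> \<or> norm \<xi> > 2" for \<xi>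
    proof -
      have "1 / mm \<le> norm e" "norm e \<le> 1" "1 / mm = 2 * \<eta>" "\<eta> \<le> 1" using ne sq mm by (auto simp: \<eta>_def intro!: divide_left_mono mult_pos_pos)
      moreover have "norm e \<le> norm \<xi> + norm (\<xi> - e)" by (metis norm_triangle_sub norm_minus_commute add.commute)
      moreover have "norm \<xi> \<le> norm e + norm (\<xi> - e)" by (rule norm_triangle_sub)
      ultimately have "norm (\<xi> - e) > \<eta>" using \<xi> by linarith
      then show ?thesis using \<psi>b by blast
    qed
    then show ?thesis unfolding annular_def using schwartz_wave[OF \<psi>s] schwartz_rapid schwartz_continuous by blast
  qed
  define \<theta> where "\<theta> = real (card J) *\<^sub>R e"
  define u where "u = (\<lambda>x. complex_of_real (\<psi> x))"
  define \<sigma> :: "(real ^ 'n) ^ 'm \<Rightarrow> complex" where "\<sigma> = (\<lambda>\<xi>. plateau \<Psi> \<xi> * (\<Sum>k. of_real (d k) * fourier u (2 ^ k *\<^sub>R (sum_on J \<xi> - \<theta>))))"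
  have ui: "integrable lborel u" unfolding u_def by (intro rapid_integrable schwartz_rapid \<psi>s)
  have \<sigma>1: "\<sigma> \<in> borel_measurable borel" "bounded (range \<sigma>)"
    unfolding \<sigma>_def by (rule lacunary_symbol_bounded[OF \<Psi> ui d0 ds])+
  have \<sigma>2: "hormander_norm r s \<Psi> \<sigma> < \<infinity>"
    unfolding \<sigma>_def d_def n_def E_def u_def
  proof (rule hormander_norm_lacunary[OF \<Psi> \<psi>s _ s0 J0])
    show "1 \<le> r" using r by simp
    show "real CARD('n) / r \<le> sum s J" using Er unfolding n_def E_def by simp
    show "0 \<le> c k" for k using c0[of k] by simp
    show "summable c" by (rule cs)
    show "0 < suminf c" using cs c0 by (intro suminf_pos) auto
  qed
  define V where "V = \<kappa> ^ card (- J) * (\<kappa> ^ Suc (card J) * unit_ball_vol n)"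
  have V: "V > 0" using \<kappa> n by (simp add: V_def)
  define f where "f = (\<lambda>N. test_wave N J \<alpha> \<psi> e)"
  have lower: "ennreal ((V * real N powr - (1 + \<delta>)) * real N powr (1 / q)) \<le> Lp_norm (ennreal q) (multiplier_op \<sigma> (f N))" for N
  proof (rule Lp_norm_ge_dyadic[OF q])
    show "0 \<le> V * real N powr - (1 + \<delta>)" using V by simp
    fix k and x :: "real^'n" assume k: "k < N" and x: "x \<in> dyadic_box k"
    have a1: "plateau \<Psi> \<xi> = 1" if "\<And>j. norm (\<xi> $ j - e) \<le> \<eta>" for \<xi>
      using norm_near_diagonal[OF ne[unfolded mm_def], of \<xi>] that unfolding \<eta>_def mm_def by (intro plateau_eq_1[OF \<Psi>]) auto
    have L: "V * (d k * (2 ^ k) powr (- (n * (1 + (\<Sum>j\<in>-J. \<alpha> j))))) \<le> norm (multiplier_op \<sigma> (f N) x)"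
      unfolding V_def f_def n_def
    proof (rule lattice_multiplier_lower[where \<eta>=\<eta> and a="plateau \<Psi>" and d=d, OF \<psi>s _ \<kappa> _ _ d0 ds _ a1 k x])
      show "\<psi> x \<ge> 0" for x using \<psi>0 by blast
      show "\<kappa> \<le> \<psi> x" if "norm x \<le> 2 * real CARD('n) + 1" for x using \<psi>l that unfolding n_def by blast
      show "fourier (\<lambda>x. cis (2 * pi * (x \<bullet> e)) * of_real (\<psi> x)) \<omega> = 0" if "norm (\<omega> - e) > \<eta>" for \<omega> using \<psi>b that by blast
    qed (simp_all add: \<sigma>_def u_def \<theta>_def)
    \<comment> \<open>c is decreasing, and k < N means k + 1 \<le> N, so every scale in use has a
      coefficient at least N^(-1-\<delta>).\<close>
    have "real N powr - (1 + \<delta>) \<le> c k" unfolding c_def using k \<delta> by (intro powr_mono2') auto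
    moreover have "((2::real) ^ k) powr (- (n / q)) \<le> (2 ^ k) powr (n / r - E) * (2 ^ k) powr (- (n * (1 + (\<Sum>j\<in>-J. \<alpha> j))))"
    proof -
      have "- (n / q) = - n * (\<beta> + (\<Sum>i\<in>-J. \<alpha> i))" unfolding \<alpha>sum by simp
      also have "\<dots> \<le> (n / r - E) + (- (n * (1 + (\<Sum>j\<in>-J. \<alpha> j))))" using hyp by (simp add: algebra_simps)
      finally show ?thesis unfolding powr_add[symmetric] by (intro powr_mono) auto
    qed
    ultimately have "real N powr - (1 + \<delta>) * (2 ^ k) powr (- (n / q)) \<le> c k * ((2 ^ k) powr (n / r - E) * (2 ^ k) powr (- (n * (1 + (\<Sum>j\<in>-J. \<alpha> j)))))"
      using c0[of k] by (intro mult_mono) auto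
    then have "V * (real N powr - (1 + \<delta>) * (2 ^ k) powr (- (n / q))) \<le> V * (c k * ((2 ^ k) powr (n / r - E) * (2 ^ k) powr (- (n * (1 + (\<Sum>j\<in>-J. \<alpha> j))))))"
      using V by (intro mult_left_mono) auto
    also have "\<dots> = V * (d k * (2 ^ k) powr (- (n * (1 + (\<Sum>j\<in>-J. \<alpha> j)))))" unfolding d_def by (simp only: mult.assoc)
    finally show "V * real N powr - (1 + \<delta>) * (2 ^ k) powr (- (real CARD('n) / q)) \<le> norm (multiplier_op \<sigma> (f N) x)"
      using L unfolding n_def[symmetric] mult.assoc by (rule order_trans)
  qed
  define \<gamma> where "\<gamma> = (\<lambda>j. if j \<in> J then 0 else \<alpha> j)"
  have "\<forall>j. \<exists>K>0. \<forall>N>0. Hp_norm \<phi> (p j) (f N j) \<le> ennreal (K * real N powr \<gamma> j)"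
    unfolding f_def \<gamma>_def by (intro allI Hp_norm_test_wave[OF assms(3) \<psi>s ann \<eta> p0]) (simp add: \<alpha>_def)
  from choice[OF this] obtain K where K: "\<forall>j. K j > 0 \<and> (\<forall>N>0. Hp_norm \<phi> (p j) (f N j) \<le> ennreal (K j * real N powr \<gamma> j))" by (elim exE)
  define K' where "K' = (\<Prod>j\<in>UNIV. K j)"
  have K': "K' > 0" unfolding K'_def using K by (intro prod_pos) auto
  have upper: "(\<Prod>j\<in>UNIV. Hp_norm \<phi> (p j) (f N j)) \<le> ennreal (K' * real N powr (1 / q - \<beta>))" if N: "N > 0" for N
  proof -
    have "(\<Prod>j\<in>UNIV. Hp_norm \<phi> (p j) (f N j)) \<le> (\<Prod>j\<in>UNIV. ennreal (K j * real N powr \<gamma> j))"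
      using K N by (intro ennreal_prod_mono) auto
    also have "\<dots> = ennreal (\<Prod>j\<in>UNIV. K j * real N powr \<gamma> j)" using K by (intro prod_ennreal mult_nonneg_nonneg powr_ge_zero) (auto intro: less_imp_le)
    also have "(\<Prod>j\<in>UNIV. K j * real N powr \<gamma> j) = K' * real N powr (\<Sum>j\<in>UNIV. \<gamma> j)"
      using N by (simp add: prod.distrib K'_def powr_sum)
    \<comment> \<open>Only inputs outside J grow with N. If J is everything, this sum is empty, 1/q
      = \<beta>, and the input norms stay bounded.\<close>
    also have "(\<Sum>j\<in>UNIV. \<gamma> j) = (\<Sum>j\<in>-J. \<alpha> j)" unfolding \<gamma>_def by (rule sum.mono_neutral_cong_right) auto
    also have "\<dots> = 1 / q - \<beta>" using \<alpha>sum by simp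
    finally show ?thesis .
  qed
  have "\<not> multiplier_bounded \<phi> p (ennreal q) \<sigma>"
  proof
    assume "multiplier_bounded \<phi> p (ennreal q) \<sigma>"
    then obtain C where C: "\<And>g. (\<forall>i. schwartz (g i) \<and> Hp_norm \<phi> (p i) (g i) < \<infinity>) \<Longrightarrow>
        Lp_norm (ennreal q) (multiplier_op \<sigma> g) \<le> ennreal C * (\<Prod>i\<in>UNIV. Hp_norm \<phi> (p i) (g i))"
      unfolding multiplier_bounded_def by (elim exE) blast
    \<comment> \<open>The constant of boundedness is an arbitrary real; a negative one is read as 0
      in the extended nonnegative reals.\<close>
    define C' where "C' = max 0 C"
    have C': "C' \<ge> 0" "ennreal C = ennreal C'" by (auto simp: C'_def max_def ennreal_neg)
    obtain N :: nat where N: "N > 0" "real N powr \<delta> > C' * K' / V" using powr_unbounded[OF \<delta>(1)] by blast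
    have fN: "schwartz (f N i) \<and> Hp_norm \<phi> (p i) (f N i) < \<infinity>" for i
    proof
      show "schwartz (f N i)" unfolding f_def by (rule schwartz_test_wave[OF \<psi>s N(1)])
      have "Hp_norm \<phi> (p i) (f N i) \<le> ennreal (K i * real N powr \<gamma> i)" using K N(1) by blast
      then show "Hp_norm \<phi> (p i) (f N i) < \<infinity>" by (simp add: le_less_trans)
    qed
    have "ennreal ((V * real N powr - (1 + \<delta>)) * real N powr (1 / q)) \<le> ennreal C * (\<Prod>i\<in>UNIV. Hp_norm \<phi> (p i) (f N i))"
      by (rule order_trans[OF lower C]) (use fN in blast)
    also have "\<dots> \<le> ennreal C' * ennreal (K' * real N powr (1 / q - \<beta>))" unfolding C'(2) by (intro mult_left_mono upper N(1)) simp
    also have "\<dots> = ennreal (C' * (K' * real N powr (1 / q - \<beta>)))" using C' K' by (intro ennreal_mult[symmetric]) auto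
    finally have le: "(V * real N powr - (1 + \<delta>)) * real N powr (1 / q) \<le> C' * (K' * real N powr (1 / q - \<beta>))"
      using C' K' by (subst (asm) ennreal_le_iff) auto
    \<comment> \<open>The exponents agree because 1/q - 1 - \<delta> = \<delta> + (1/q - \<beta>),
      which is the choice of \<delta>.\<close>
    have "real N powr - (1 + \<delta>) * real N powr (1 / q) = real N powr \<delta> * real N powr (1 / q - \<beta>)"
      unfolding powr_add[symmetric] using \<delta>(2) by (intro arg_cong2[where f="(powr)"] refl) linarith
    then have "(V * real N powr \<delta>) * real N powr (1 / q - \<beta>) \<le> (C' * K') * real N powr (1 / q - \<beta>)"
      using le by (simp only: mult.assoc)
    then have "V * real N powr \<delta> \<le> C' * K'" using N(1) by (simp add: mult_le_cancel_right)
    then show False using N(2) V by (simp add: field_simps)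
  qed
  then show ?thesis using \<sigma>1 \<sigma>2 by blast
qed

end
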